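(* Let $u, B \in C^\infty(\mathbb{R}^3;\mathbb{R}^3)$ and $P \in C^\infty(\mathbb{R}^3)$ be a smooth solution of the stationary MHD system \[ -\Delta u + (u\cdot\nabla)u = -\nabla P + (B\cdot\nabla)B,\qquad -\Delta B + (u\cdot\nabla)B = (B\cdot\nabla)u,\qquad \operatorname{div} u = \operatorname{div} B = 0 \quad\text{in } \mathbb{R}^3 . \] Assume there exist $\Phi, \Psi \in C^\infty(\mathbb{R}^3;\mathbb{R}^{3\times 3})$ with $\nabla\cdot\Phi = u$, $\nabla\cdot\Psi = B$, and a number $s$ with $3 < s \le 6$ and a constant $C>0$ such that \[ \Big(\frac{1}{|B(r)|}\int_{B(r)} |\Phi - \Phi_{B(r)}|^s\,dx\Big)^{1/s} + \Big(\frac{1}{|B(r)|}\int_{B(r)} |\Psi - \Psi_{B(r)}|^s\,dx\Big)^{1/s} \le C\, r^{\frac13 - \frac1s} \qquad \text{for all } r>1. \] Then $u \equiv B \equiv 0$.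
   Context: $B(r)$ denotes the open ball of radius $r$ centered at the origin in $\mathbb{R}^3$, $|B(r)|$ its volume, and $f_{E} = \frac{1}{|E|}\int_E f\,dx$ the mean value of $f$ over a measurable set $E$. For a matrix field $\Phi=(\Phi_{ij})$, $\nabla\cdot\Phi$ denotes the vector field obtained by taking the divergence row-wise, $(\nabla\cdot\Phi)_i = \sum_j \partial_j \Phi_{ij}$. *)

theory Defs
  imports "HOL-Analysis.Analysis"
begin

definition partial :: "'n::finite \<Rightarrow> (real^'n \<Rightarrow> 'b::real_normed_vector) \<Rightarrow> real^'n \<Rightarrow> 'b" where
  "partial j f x = frechet_derivative f (at x) (axis j 1)"

fun pderivs :: "'n::finite list \<Rightarrow> (real^'n \<Rightarrow> 'b::real_normed_vector) \<Rightarrow> real^'n \<Rightarrow> 'b" where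
  "pderivs [] f = f"
| "pderivs (j # js) f = partial j (pderivs js f)"

definition smooth :: "(real^'n::finite \<Rightarrow> 'b::real_normed_vector) \<Rightarrow> bool" where
  "smooth f \<longleftrightarrow> (\<forall>js x. pderivs js f differentiable (at x))"

definition grad :: "(real^'n::finite \<Rightarrow> real) \<Rightarrow> real^'n \<Rightarrow> real^'n" where
  "grad p x = (\<chi> i. partial i p x)"

definition laplacian :: "(real^'n::finite \<Rightarrow> 'b::real_normed_vector) \<Rightarrow> real^'n \<Rightarrow> 'b" where
  "laplacian f x = (\<Sum>j\<in>UNIV. partial j (partial j f) x)"

definition advect :: "(real^'n::finite \<Rightarrow> real^'n) \<Rightarrow> (real^'n \<Rightarrow> 'b::real_normed_vector) \<Rightarrow> real^'n \<Rightarrow> 'b" where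
  "advect v w x = (\<Sum>j\<in>UNIV. (v x $ j) *\<^sub>R partial j w x)"

definition div_vec :: "(real^'n::finite \<Rightarrow> real^'n) \<Rightarrow> real^'n \<Rightarrow> real" where
  "div_vec v x = (\<Sum>j\<in>UNIV. partial j (\<lambda>y. v y $ j) x)"

definition div_mat :: "(real^'n::finite \<Rightarrow> real^'n^'m::finite) \<Rightarrow> real^'n \<Rightarrow> real^'m" where
  "div_mat F x = (\<chi> i. \<Sum>j\<in>UNIV. partial j (\<lambda>y. F y $ i $ j) x)"

definition mean_val :: "(real^'n::finite) set \<Rightarrow> (real^'n \<Rightarrow> 'b::euclidean_space) \<Rightarrow> 'b" where
  "mean_val E f = (1 / measure lebesgue E) *\<^sub>R integral E f"

text \<open>(|B(r)|^{-1} int_{B(r)} |F - F_{B(r)}|^s)^{1/s}; the norm on real^3^3 is the Frobenius norm.\<close>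
definition osc_avg :: "real \<Rightarrow> real \<Rightarrow> (real^'n::finite \<Rightarrow> 'b::euclidean_space) \<Rightarrow> real" where
  "osc_avg s r F = ((1 / measure lebesgue (ball (0::real^'n) r)) *
      integral (ball 0 r) (\<lambda>x. norm (F x - mean_val (ball 0 r) F) powr s)) powr (1 / s)"

end

theory Submission
  imports Defs
begin

text \<open>Rescale a ball of radius \<open>R\<close> so that the potentials become small in \<open>L\<^sup>s\<close>. Writing each velocity component as a
  divergence and integrating by parts, Hoelder and Sobolev bound the rescaled cubic integral of the fields by a power
  \<open>2/3 + 1/s < 1\<close> of the Dirichlet integral. The local energy inequality, in which the pressure is removed by testing
  with a truncated Newtonian potential and a Calderon-Zygmund estimate in \<open>L\<^sup>3\<close>, bounds the Dirichlet integral of a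
  smaller ball by the cubic integral of a larger one. As the resulting power is sublinear, iterating over radii gives
  a global bound for the Dirichlet integral. With the energy thus concentrated in a fixed ball up to \<open>\<epsilon>\<close>, the
  interpolation applied inside and outside of it shows that the rescaled cubic integral tends to 0; hence so does the
  Dirichlet integral, the fields are constant, and the constant is 0.\<close>

subsection \<open>Continuous functions with bounded support\<close>

text \<open>No growth of the pressure is assumed, so \<open>p\<close> may only be integrated against
  test functions and its size must never enter an estimate. A compactly supported test function is
  therefore built whose pairing with \<open>p\<close> can be exchanged, through the equations, for a
  viscous term and terms quadratic in the fields. The latter lie in L^(3/2) when the fields lie in
  L^3, so second derivatives of the potential are wanted in L^3. The exponents come from one Hoelder
  inequality: \<open>1 / s\<close> on the potential, \<open>2/3 - 2 / s\<close> on the cubic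
  integral, \<open>1 / s - 1/6\<close> on the sixth power supplied by Sobolev, 1/2 on the gradient.
  They add up to 1; \<open>s \<le> 6\<close> makes the third nonnegative, and \<open>3 < s\<close>
  makes the second positive and the total power \<open>2/3 + 1 / s\<close> sublinear. For
  oscillations growing like the power \<open>1/3 - 1 / s\<close> of the radius, the powers of the
  rescaled viscosity in this product cancel, which is why the constants do not depend on the
  scale.\<close>

definition supp_in :: "real \<Rightarrow> (real^'n::finite \<Rightarrow> real) \<Rightarrow> bool" where
  "supp_in r f \<longleftrightarrow> (\<forall>x. r < norm x \<longrightarrow> f x = 0)"

definition cc :: "(real^'n::finite \<Rightarrow> real) \<Rightarrow> bool" where
  "cc f \<longleftrightarrow> continuous_on UNIV f \<and> (\<exists>r. supp_in r f)"

lemma supp_in_mono: "supp_in r f \<Longrightarrow> r \<le> r' \<Longrightarrow> supp_in r' f"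
  by (auto simp: supp_in_def)

lemma ccI: "continuous_on UNIV f \<Longrightarrow> supp_in r f \<Longrightarrow> cc f"
  by (auto simp: cc_def)

lemma cc_continuous [continuous_intros]: "cc f \<Longrightarrow> continuous_on UNIV f"
  by (simp add: cc_def)

lemma cc_measurable: "cc f \<Longrightarrow> f \<in> borel_measurable borel"
  by (intro borel_measurable_continuous_onI cc_continuous)

lemma cc_supp_pos:
  assumes "cc f" obtains r where "r > 0" "supp_in r f"
proof -
  from assms obtain r where "supp_in r f" by (auto simp: cc_def)
  then have "supp_in (max r 1) f" "max r 1 > 0" by (auto simp: supp_in_def)
  then show thesis using that by blast
qed

lemma cc_integrable:
  assumes "cc f" shows "integrable lborel f"
proof -
  obtain r where r: "supp_in r f" using assms by (auto simp: cc_def)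
  have "integrable lborel (\<lambda>x. indicator (cball 0 r) x *\<^sub>R f x)"
    using assms continuous_on_subset[OF cc_continuous] by (intro borel_integrable_compact) auto
  also have "(\<lambda>x. indicator (cball 0 r) x *\<^sub>R f x) = f"
    using r by (auto simp: supp_in_def indicator_def fun_eq_iff)
  finally show ?thesis .
qed

lemma cc_comp:
  assumes "cc f" "continuous_on UNIV q" "q 0 = 0" shows "cc (\<lambda>x. q (f x))"
proof -
  obtain r where r: "supp_in r f" using assms by (auto simp: cc_def)
  have "supp_in r (\<lambda>x. q (f x))" using r assms(3) by (auto simp: supp_in_def)
  moreover have "continuous_on UNIV (\<lambda>x. q (f x))"
    using continuous_on_compose2[OF assms(2) cc_continuous[OF assms(1)]] by auto
  ultimately show ?thesis using r by (intro ccI[of _ r])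
qed

lemma cc_comp2:
  assumes "cc f" "cc g" "continuous_on UNIV (\<lambda>(a, b). q a b)" "q 0 0 = 0"
  shows "cc (\<lambda>x. q (f x) (g x))"
proof -
  obtain r r' where r: "supp_in r f" "supp_in r' g" using assms by (auto simp: cc_def)
  have "continuous_on UNIV (\<lambda>x. (f x, g x))" using assms by (intro continuous_intros)
  then have "continuous_on UNIV (\<lambda>x. (\<lambda>(a, b). q a b) (f x, g x))"
    by (rule continuous_on_compose2[OF assms(3)]) auto
  moreover have "supp_in (max r r') (\<lambda>x. q (f x) (g x))"
    using r assms by (auto simp: supp_in_def)
  ultimately show ?thesis by (auto simp: cc_def)
qed

lemma cc_add: "cc f \<Longrightarrow> cc g \<Longrightarrow> cc (\<lambda>x. f x + g x)"
  by (rule cc_comp2[where q = "(+)"]) (auto intro!: continuous_intros simp: case_prod_beta)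

lemma cc_diff: "cc f \<Longrightarrow> cc g \<Longrightarrow> cc (\<lambda>x. f x - g x)"
  by (rule cc_comp2[where q = "(-)"]) (auto intro!: continuous_intros simp: case_prod_beta)

lemma cc_mult_left: "continuous_on UNIV g \<Longrightarrow> cc f \<Longrightarrow> cc (\<lambda>x. g x * f x)"
  unfolding cc_def supp_in_def by (intro conjI continuous_on_mult) auto

lemma cc_mult_right: "cc f \<Longrightarrow> continuous_on UNIV g \<Longrightarrow> cc (\<lambda>x. f x * g x)"
  unfolding cc_def supp_in_def by (intro conjI continuous_on_mult) auto

lemma cc_cmult: "cc f \<Longrightarrow> cc (\<lambda>x. c * f x)"
  by (rule cc_mult_left) auto

lemma cc_divide: "cc f \<Longrightarrow> cc (\<lambda>x. f x / c)"
  using cc_cmult[of f "1 / c"] by simp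

lemma cc_uminus: "cc f \<Longrightarrow> cc (\<lambda>x. - f x)"
  using cc_cmult[of f "-1"] by simp

lemma cc_abs: "cc f \<Longrightarrow> cc (\<lambda>x. \<bar>f x\<bar>)"
  by (rule cc_comp[where q = abs]) (auto intro!: continuous_intros)

lemma cc_power: "cc f \<Longrightarrow> 0 < n \<Longrightarrow> cc (\<lambda>x. f x ^ n)"
  by (rule cc_comp[where q = "\<lambda>a. a ^ n"]) (auto intro!: continuous_intros)

lemma cc_zero: "cc (\<lambda>x. 0)"
  by (auto simp: cc_def supp_in_def)

lemma cc_sum: "(\<And>i. i \<in> I \<Longrightarrow> cc (f i)) \<Longrightarrow> cc (\<lambda>x. \<Sum>i\<in>I. f i x)"
  by (induction I rule: infinite_finite_induct) (auto intro: cc_add cc_zero)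

lemma cc_translate:
  fixes f :: "real^'n::finite \<Rightarrow> real"
  assumes "cc f" shows "cc (\<lambda>x. f (x + e))"
proof -
  obtain r where r: "supp_in r f" using assms by (auto simp: cc_def)
  have "supp_in (r + norm e) (\<lambda>x. f (x + e))"
    unfolding supp_in_def
  proof (intro allI impI)
    fix x :: "real^'n" assume "r + norm e < norm x"
    then have "r < norm (x + e)" using norm_triangle_ineq4[of "x + e" e] by simp
    then show "f (x + e) = 0" using r by (auto simp: supp_in_def)
  qed
  moreover have "continuous_on UNIV (\<lambda>x. f (x + e))"
    by (rule continuous_on_compose2[OF cc_continuous[OF assms]]) (auto intro!: continuous_intros)
  ultimately show ?thesis by (auto simp: cc_def)
qed

lemma cc_translate_minus: "cc f \<Longrightarrow> cc (\<lambda>x. f (x - e))"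
  using cc_translate[of f "-e"] by simp

lemma cc_bounded:
  assumes "cc f" obtains B where "B > 0" "\<And>x. \<bar>f x\<bar> \<le> B"
proof -
  obtain r where r: "supp_in r f" using assms by (auto simp: cc_def)
  have "compact (f ` cball 0 r)"
    by (intro compact_continuous_image continuous_on_subset[OF cc_continuous[OF assms]]) auto
  then obtain B where B: "B > 0" "\<And>y. y \<in> f ` cball 0 r \<Longrightarrow> norm y \<le> B"
    using compact_imp_bounded bounded_pos by metis
  have "\<bar>f x\<bar> \<le> B" for x
    using B r by (cases "norm x \<le> r") (auto simp: supp_in_def)
  then show thesis using that B by blast
qed

text \<open>Heine's theorem on the ball of radius \<open>r + 1\<close>; if two points at distance
  less than 1 are not both in it, both lie outside the support.\<close>

lemma cc_uniformly_continuous: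
  fixes f :: "real^'n::finite \<Rightarrow> real"
  assumes "cc f" shows "uniformly_continuous_on UNIV f"
proof -
  obtain r where r: "supp_in r f" using assms by (auto simp: cc_def)
  have u: "uniformly_continuous_on (cball 0 (r + 1)) f"
    by (intro compact_uniformly_continuous continuous_on_subset[OF cc_continuous[OF assms]]) auto
  show ?thesis unfolding uniformly_continuous_on_def
  proof (intro allI impI)
    fix e :: real assume "e > 0"
    then obtain d where d: "d > 0"
      "\<And>x x'. x \<in> cball 0 (r+1) \<Longrightarrow> x' \<in> cball 0 (r+1) \<Longrightarrow> dist x' x < d \<Longrightarrow> dist (f x') (f x) < e"
      using u unfolding uniformly_continuous_on_def by metis
    show "\<exists>d>0. \<forall>x\<in>UNIV. \<forall>x'\<in>UNIV. dist x' x < d \<longrightarrow> dist (f x') (f x) < e"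
    proof (intro exI[of _ "min d 1"] conjI ballI impI)
      fix x x' :: "real^'n" assume *: "dist x' x < min d 1"
      show "dist (f x') (f x) < e"
      proof (cases "norm x \<le> r + 1 \<and> norm x' \<le> r + 1")
        case True then show ?thesis using d(2)[of x x'] * by auto
      next
        case False
        have "norm (x' - x) < 1" using * by (simp add: dist_norm)
        then have "norm x > r" "norm x' > r"
          using False norm_triangle_ineq2[of x x'] norm_triangle_ineq2[of x' x]
          by (auto simp: norm_minus_commute)
        then show ?thesis using r \<open>e > 0\<close> by (auto simp: supp_in_def)
      qed
    qed (use d in auto)
  qed
qed

lemma integral_translate:
  fixes f :: "real^'n::finite \<Rightarrow> real"
  assumes "f \<in> borel_measurable borel"
  shows "(\<integral>x. f (x + e) \<partial>lborel) = (\<integral>x. f x \<partial>lborel)"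
proof -
  have "(\<integral>x. f x \<partial>lborel) = (\<integral>x. f x \<partial>(distr lborel borel ((+) e)))"
    by (simp add: lborel_distr_plus)
  also have "\<dots> = (\<integral>x. f (e + x) \<partial>lborel)"
    using assms by (subst integral_distr) auto
  finally show ?thesis by (simp add: add.commute)
qed

lemma integral_translate_reflect:
  fixes f :: "real^'n::finite \<Rightarrow> real"
  assumes "f \<in> borel_measurable borel"
  shows "(\<integral>x. f (e - x) \<partial>lborel) = (\<integral>x. f x \<partial>lborel)"
proof -
  have "(\<integral>x. f x \<partial>lborel) = (\<integral>x. f x \<partial>(density (distr lborel borel (\<lambda>x. e + (-1) *\<^sub>R x)) (\<lambda>_. \<bar>-1::real\<bar> ^ DIM(real^'n))))"
    by (subst lborel_affine[of "-1" e]) auto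
  also have "\<dots> = (\<integral>x. f x \<partial>(distr lborel borel (\<lambda>x. e - x)))"
    by (simp add: density_1)
  also have "\<dots> = (\<integral>x. f (e - x) \<partial>lborel)"
    using assms by (subst integral_distr) auto
  finally show ?thesis by simp
qed

subsection \<open>Continuously differentiable functions and integration by parts\<close>

text \<open>One class for all integrations by parts: continuity of the partials gives bounds on
  compact sets and dominated convergence. Second derivatives are handled by asking \<open>C1\<close>
  of each \<open>partial j f\<close> again.\<close>

definition C1 :: "(real^'n::finite \<Rightarrow> real) \<Rightarrow> bool" where
  "C1 f \<longleftrightarrow> (\<forall>x. f differentiable (at x)) \<and> (\<forall>j. continuous_on UNIV (partial j f))"

lemma partial_eq: "(f has_derivative D) (at x) \<Longrightarrow> partial j f x = D (axis j 1)"
  by (simp add: partial_def frechet_derivative_at[symmetric])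

lemma has_derivative_partial:
  fixes f :: "real^'n::finite \<Rightarrow> 'b::real_normed_vector"
  assumes "f differentiable (at x)"
  shows "(f has_derivative (\<lambda>v. \<Sum>j\<in>UNIV. (v $ j) *\<^sub>R partial j f x)) (at x)"
proof -
  let ?D = "frechet_derivative f (at x)"
  have D: "(f has_derivative ?D) (at x)" using assms by (simp add: frechet_derivative_works)
  then interpret linear ?D by (rule has_derivative_linear)
  have "?D v = (\<Sum>j\<in>UNIV. (v $ j) *\<^sub>R partial j f x)" for v
  proof -
    have "?D v = ?D (\<Sum>j\<in>UNIV. (v $ j) *\<^sub>R axis j 1)"
      by (simp add: basis_expansion[of v, unfolded scalar_mult_eq_scaleR])
    then show ?thesis by (simp add: sum scaleR partial_def)
  qed
  then have "?D = (\<lambda>v. \<Sum>j\<in>UNIV. (v $ j) *\<^sub>R partial j f x)" by auto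
  with D show ?thesis by simp
qed

lemma C1_has_derivative:
  assumes "C1 f" shows "(f has_derivative (\<lambda>v. \<Sum>j\<in>UNIV. v $ j * partial j f x)) (at x)"
  using has_derivative_partial[of f x] assms by (simp add: C1_def)

lemma sum_axis: "(\<Sum>i\<in>UNIV. axis j 1 $ i * (d i :: real)) = d j"
  by (simp add: axis_def if_distrib [of "\<lambda>a. a * _"] cong: if_cong)

text \<open>The closure properties below go through this rule: a single Frechet derivative in
  coordinate form yields both membership in the class and the formula for the partials, since
  evaluating it at \<open>axis j 1\<close> isolates \<open>d j\<close>.\<close>

lemma C1I_partial:
  assumes "\<And>x. (f has_derivative (\<lambda>v. \<Sum>j\<in>UNIV. v $ j * d j x)) (at x)"
    "\<And>j. continuous_on UNIV (d j)"
  shows "C1 f" "partial j f = d j"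
proof -
  have p: "partial j f = d j" for j
    by (rule ext) (simp add: partial_eq[OF assms(1)] sum_axis)
  show "partial j f = d j" by (rule p)
  show "C1 f" using assms by (auto simp: C1_def p differentiable_def)
qed

lemma C1_continuous: "C1 f \<Longrightarrow> continuous_on UNIV f"
  by (auto simp: C1_def continuous_at_imp_continuous_on differentiable_imp_continuous_within)

lemma C1_partial_continuous: "C1 f \<Longrightarrow> continuous_on UNIV (partial j f)"
  by (auto simp: C1_def)

lemma C1_line:
  assumes "C1 f"
  shows "((\<lambda>t. f (x + t *\<^sub>R e)) has_real_derivative (\<Sum>j\<in>UNIV. e $ j * partial j f (x + t *\<^sub>R e))) (at t)"
proof -
  have "((\<lambda>t. f (x + t *\<^sub>R e)) has_derivative
      (\<lambda>s. \<Sum>j\<in>UNIV. (s *\<^sub>R e) $ j * partial j f (x + t *\<^sub>R e))) (at t)"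
    by (rule has_derivative_compose[OF _ C1_has_derivative[OF assms], of "\<lambda>t. x + t *\<^sub>R e"])
       (auto intro!: derivative_eq_intros)
  then show ?thesis
    unfolding has_field_derivative_def sum_distrib_right
    by (simp add: mult_ac)
qed

lemma C1_line_axis:
  assumes "C1 f"
  shows "((\<lambda>t. f (x + t *\<^sub>R axis j 1)) has_real_derivative partial j f (x + t *\<^sub>R axis j 1)) (at t)"
  using C1_line[OF assms, of x "axis j 1" t] by (simp add: sum_axis)

lemma C1_mult:
  assumes "C1 f" "C1 g"
  shows "C1 (\<lambda>x. f x * g x)" "partial j (\<lambda>x. f x * g x) x = f x * partial j g x + partial j f x * g x"
proof -
  have *: "((\<lambda>x. f x * g x) has_derivative (\<lambda>v. \<Sum>j\<in>UNIV. v $ j * (f x * partial j g x + partial j f x * g x))) (at x)" for x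
    using has_derivative_mult[OF C1_has_derivative[OF assms(1), of x] C1_has_derivative[OF assms(2), of x]]
    by (simp add: sum_distrib_left sum_distrib_right sum.distrib algebra_simps)
  have c: "continuous_on UNIV (\<lambda>x. f x * partial j g x + partial j f x * g x)" for j
    using assms by (intro continuous_intros C1_continuous C1_partial_continuous)
  show "C1 (\<lambda>x. f x * g x)" by (rule C1I_partial(1)[OF * c])
  show "partial j (\<lambda>x. f x * g x) x = f x * partial j g x + partial j f x * g x"
    by (simp add: C1I_partial(2)[OF * c])
qed

lemma C1_add:
  assumes "C1 f" "C1 g"
  shows "C1 (\<lambda>x. f x + g x)" "partial j (\<lambda>x. f x + g x) x = partial j f x + partial j g x"
proof -
  have *: "((\<lambda>x. f x + g x) has_derivative (\<lambda>v. \<Sum>j\<in>UNIV. v $ j * (partial j f x + partial j g x))) (at x)" for x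
    using has_derivative_add[OF C1_has_derivative[OF assms(1), of x] C1_has_derivative[OF assms(2), of x]]
    by (simp add: sum.distrib algebra_simps)
  have c: "continuous_on UNIV (\<lambda>x. partial j f x + partial j g x)" for j
    using assms by (intro continuous_intros C1_partial_continuous)
  show "C1 (\<lambda>x. f x + g x)" by (rule C1I_partial(1)[OF * c])
  show "partial j (\<lambda>x. f x + g x) x = partial j f x + partial j g x"
    by (simp add: C1I_partial(2)[OF * c])
qed

lemma C1_const:
  fixes c :: real and j :: "'n::finite"
  shows "C1 (\<lambda>x::real^'n. c)" "partial j (\<lambda>x. c) x = 0"
proof -
  have *: "((\<lambda>x. c) has_derivative (\<lambda>v. \<Sum>j\<in>UNIV. v $ j * 0)) (at x)" for x :: "real^'n"
    by simp
  show "C1 (\<lambda>x::real^'n. c)" by (rule C1I_partial(1)[OF *]) simp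
  show "partial j (\<lambda>x. c) x = 0"
    using partial_eq[OF *] by simp
qed

lemma C1_cmult:
  fixes f :: "real^'n::finite \<Rightarrow> real"
  assumes "C1 f"
  shows "C1 (\<lambda>x. c * f x)" "partial j (\<lambda>x. c * f x) x = c * partial j f x"
  using C1_mult[OF C1_const(1)[where c = c] assms] by (simp_all add: C1_const)

lemma C1_diff:
  assumes "C1 f" "C1 g"
  shows "C1 (\<lambda>x. f x - g x)" "partial j (\<lambda>x. f x - g x) x = partial j f x - partial j g x"
  using C1_add[OF assms(1) C1_cmult(1)[OF assms(2), of "-1"]] C1_cmult(2)[OF assms(2), of _ "-1"]
  by simp_all

lemma C1_sum:
  assumes "\<And>i. i \<in> I \<Longrightarrow> C1 (f i)"
  shows "C1 (\<lambda>x. \<Sum>i\<in>I. f i x) \<and> partial j (\<lambda>x. \<Sum>i\<in>I. f i x) x = (\<Sum>i\<in>I. partial j (f i) x)"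
  using assms
  by (induction I rule: infinite_finite_induct) (auto simp: C1_const C1_add)

lemma C1_chain:
  assumes "C1 f" "\<And>t. (q has_real_derivative q' t) (at t)" "continuous_on UNIV q'"
  shows "C1 (\<lambda>x. q (f x))" "partial j (\<lambda>x. q (f x)) x = q' (f x) * partial j f x"
proof -
  have *: "((\<lambda>x. q (f x)) has_derivative (\<lambda>v. \<Sum>j\<in>UNIV. v $ j * (q' (f x) * partial j f x))) (at x)" for x
  proof -
    have "((\<lambda>x. q (f x)) has_derivative (\<lambda>v. q' (f x) * (\<Sum>j\<in>UNIV. v $ j * partial j f x))) (at x)"
      using has_derivative_compose[OF C1_has_derivative[OF assms(1)] assms(2)[unfolded has_field_derivative_def]]
      by simp
    then show ?thesis by (simp add: sum_distrib_left algebra_simps)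
  qed
  have c: "continuous_on UNIV (\<lambda>x. q' (f x) * partial j f x)" for j
    using assms by (intro continuous_intros C1_partial_continuous continuous_on_compose2[OF assms(3)] C1_continuous) auto
  show "C1 (\<lambda>x. q (f x))" by (rule C1I_partial(1)[OF * c])
  show "partial j (\<lambda>x. q (f x)) x = q' (f x) * partial j f x"
    by (simp add: C1I_partial(2)[OF * c])
qed

lemma C1_component:
  fixes i j :: "'n::finite"
  shows "C1 (\<lambda>x::real^'n. x $ i)" "partial j (\<lambda>x. x $ i) x = (if i = j then 1 else 0)"
proof -
  have *: "((\<lambda>x. x $ i) has_derivative (\<lambda>v. \<Sum>j\<in>UNIV. v $ j * (if i = j then 1 else 0))) (at x)" for x :: "real^'n"
    by (simp add: bounded_linear_imp_has_derivative bounded_linear_vec_nth if_distrib cong: if_cong)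
  show "C1 (\<lambda>x::real^'n. x $ i)" by (rule C1I_partial(1)[OF *]) simp
  show "partial j (\<lambda>x. x $ i) x = (if i = j then 1 else 0)"
    using C1I_partial(2)[OF *, of j] by (simp add: fun_eq_iff)
qed

lemma supp_in_partial:
  fixes f :: "real^'n::finite \<Rightarrow> real"
  assumes "supp_in r f" shows "supp_in r (partial j f)"
  unfolding supp_in_def
proof (intro allI impI)
  fix x :: "real^'n" assume x: "r < norm x"
  have "open {x :: real^'n. r < norm x}" by (intro open_Collect_less continuous_intros)
  then have "(f has_derivative (\<lambda>v. 0)) (at x)"
    by (rule has_derivative_transform_within_open[OF has_derivative_const[of 0]])
       (use x assms in \<open>auto simp: supp_in_def\<close>)
  then show "partial j f x = 0" by (simp add: partial_eq)
qed

lemma cc_modulus: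
  fixes f :: "real^'n::finite \<Rightarrow> real"
  assumes "cc f" "e > 0"
  obtains d where "d > 0" "\<And>x x'. dist x' x < d \<Longrightarrow> \<bar>f x' - f x\<bar> < e"
  using uniformly_continuous_onE[OF cc_uniformly_continuous[OF assms(1)] assms(2)]
  by (metis UNIV_I dist_real_def)

lemma cc_partial:
  fixes f :: "real^'n::finite \<Rightarrow> real"
  assumes "C1 f" "cc f" shows "cc (partial j f)"
  using assms supp_in_partial by (auto simp: cc_def C1_partial_continuous)

text \<open>Difference quotients in direction \<open>j\<close> have integral zero by translation
  invariance, and they converge to the partial derivative, dominated through the mean value
  theorem.\<close>

lemma integral_partial_eq_0:
  fixes f :: "real^'n::finite \<Rightarrow> real"
  assumes "C1 f" "cc f"
  shows "(\<integral>x. partial j f x \<partial>lborel) = 0"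
proof -
  let ?e = "axis j 1 :: real^'n"
  obtain r where r: "r > 0" "supp_in r f" using cc_supp_pos[OF assms(2)] by blast
  obtain B where B: "B > 0" "\<And>x. \<bar>partial j f x\<bar> \<le> B"
    using cc_bounded[OF cc_partial[OF assms]] by blast
  define s where "s n x = (f (x + inverse (Suc n) *\<^sub>R ?e) - f x) * Suc n" for n :: nat and x
  have "integral\<^sup>L lborel (s n) = 0" for n
    unfolding s_def
    using integral_translate[OF cc_measurable[OF assms(2)], of "inverse (Suc n) *\<^sub>R ?e"]
    by (simp add: cc_integrable cc_translate assms)
  \<comment> \<open>Step lengths are at most 1, so every quotient vanishes outside the ball of
    radius \<open>r + 1\<close>.\<close>
  moreover have "(\<lambda>n. integral\<^sup>L lborel (s n)) \<longlonglongrightarrow> integral\<^sup>L lborel (partial j f)"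
  proof (rule integral_dominated_convergence[where w = "\<lambda>x. B * indicator (cball 0 (r + 1)) x"])
    show "partial j f \<in> borel_measurable lborel" "s n \<in> borel_measurable lborel" for n
      unfolding s_def using assms
      by (auto simp del: of_nat_Suc intro!: borel_measurable_times borel_measurable_diff cc_measurable cc_translate cc_partial cc_mult_right cc_diff)
    show "integrable lborel (\<lambda>x. B * indicator (cball 0 (r + 1)) x :: real)"
      by (intro integrable_mult_right integrable_real_indicator) (auto intro!: emeasure_bounded_finite[unfolded infinity_ennreal_def])
    show "AE x in lborel. (\<lambda>n. s n x) \<longlonglongrightarrow> partial j f x"
    proof (rule AE_I2)
      fix x
      have "((\<lambda>t. (f (x + t *\<^sub>R ?e) - f x) / t) \<longlongrightarrow> partial j f x) (at 0)"
        using C1_line_axis[OF assms(1), of x j 0] by (simp add: has_field_derivative_iff)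
      moreover have "filterlim (\<lambda>n. inverse (real (Suc n))) (at 0) sequentially"
        by (intro filterlim_atI LIMSEQ_inverse_real_of_nat) auto
      ultimately have "(\<lambda>n. (f (x + inverse (real (Suc n)) *\<^sub>R ?e) - f x) / inverse (real (Suc n))) \<longlonglongrightarrow> partial j f x"
        by (rule filterlim_compose)
      then show "(\<lambda>n. s n x) \<longlonglongrightarrow> partial j f x" by (simp add: s_def field_simps)
    qed
    show "AE x in lborel. norm (s n x) \<le> B * indicator (cball 0 (r + 1)) x" for n
    proof (rule AE_I2)
      fix x :: "real^'n"
      define t where "t = inverse (real (Suc n))"
      have t: "0 < t" "t \<le> 1" "t * real (Suc n) = 1" by (auto simp: t_def field_simps)
      have m: "\<bar>f (x + t *\<^sub>R ?e) - f x\<bar> \<le> B * t"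
      proof -
        obtain c where "f (x + t *\<^sub>R ?e) - f (x + 0 *\<^sub>R ?e) = (t - 0) * partial j f (x + c *\<^sub>R ?e)"
          using MVT2[of 0 t "\<lambda>t. f (x + t *\<^sub>R ?e)" "\<lambda>t. partial j f (x + t *\<^sub>R ?e)"]
            C1_line_axis[OF assms(1)] t by auto
        then show ?thesis using B(2)[of "x + c *\<^sub>R ?e"] t by (simp add: abs_mult)
      qed
      show "norm (s n x) \<le> B * indicator (cball 0 (r + 1)) x"
      proof (cases "norm x \<le> r + 1")
        case True
        have "\<bar>s n x\<bar> = \<bar>f (x + t *\<^sub>R ?e) - f x\<bar> * real (Suc n)" by (simp add: s_def t_def abs_mult)
        also have "\<dots> \<le> B * t * real (Suc n)" using m by (intro mult_right_mono) auto
        finally show ?thesis using True t by (simp add: mult.assoc)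
      next
        case False
        have "norm (x + t *\<^sub>R ?e) \<ge> norm x - norm (t *\<^sub>R ?e)"
          using norm_diff_ineq[of x "t *\<^sub>R ?e"] by simp
        then have "norm (x + t *\<^sub>R ?e) > r" "norm x > r" using False t by (auto simp: norm_axis_1)
        then show ?thesis using r False by (simp add: s_def t_def supp_in_def)
      qed
    qed
  qed
  ultimately show ?thesis by (simp add: LIMSEQ_const_iff)
qed

text \<open>Bounded support of one factor carries over to the product, while the other factor may
  grow: this is what allows the fields, the pressure and the potentials to be integrated against
  cutoffs.\<close>

lemma integral_by_parts:
  fixes f g :: "real^'n::finite \<Rightarrow> real"
  assumes "C1 f" "C1 g" "cc f \<or> cc g"
  shows "(\<integral>x. f x * partial j g x \<partial>lborel) = - (\<integral>x. partial j f x * g x \<partial>lborel)"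
proof -
  have cc: "cc (\<lambda>x. f x * g x)" "cc (\<lambda>x. f x * partial j g x)" "cc (\<lambda>x. partial j f x * g x)"
    using assms by (auto intro: cc_mult_left cc_mult_right cc_partial C1_continuous C1_partial_continuous)
  have "(\<integral>x. f x * partial j g x + partial j f x * g x \<partial>lborel) = 0"
    using integral_partial_eq_0[OF C1_mult(1)[OF assms(1,2)] cc(1), of j]
    by (simp add: C1_mult(2)[OF assms(1,2)])
  then show ?thesis by (simp add: cc_integrable cc)
qed

subsection \<open>Convolution\<close>

definition conv :: "(real^'n::finite \<Rightarrow> real) \<Rightarrow> (real^'n \<Rightarrow> real) \<Rightarrow> real^'n \<Rightarrow> real" where
  "conv k g x = (\<integral>y. k (x - y) * g y \<partial>lborel)"

lemma conv_integrand_cc: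
  fixes k g :: "real^'n::finite \<Rightarrow> real"
  assumes "continuous_on UNIV k" "cc g" shows "cc (\<lambda>y. k (x - y) * g y)"
  by (intro cc_mult_left assms continuous_on_compose2[OF assms(1)] continuous_intros) auto

lemma conv_commute_form:
  fixes k g :: "real^'n::finite \<Rightarrow> real"
  assumes "cc k" "cc g" shows "conv k g x = (\<integral>y. k y * g (x - y) \<partial>lborel)"
proof -
  have "(\<lambda>y. k (x - y) * g y) \<in> borel_measurable borel"
    using assms by (intro cc_measurable conv_integrand_cc cc_continuous)
  from integral_translate_reflect[OF this, of x] show ?thesis by (simp add: conv_def)
qed

lemma supp_in_conv:
  fixes k g :: "real^'n::finite \<Rightarrow> real"
  assumes "supp_in r k" "supp_in r' g" shows "supp_in (r + r') (conv k g)"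
  unfolding supp_in_def
proof (intro allI impI)
  fix x :: "real^'n" assume x: "r + r' < norm x"
  have "k (x - y) * g y = 0" for y
    using assms x norm_triangle_ineq[of "x - y" y] by (cases "r' < norm y") (auto simp: supp_in_def)
  then have "(\<lambda>y. k (x - y) * g y) = (\<lambda>y. 0)" by blast
  then show "conv k g x = 0" by (simp add: conv_def del: mult_eq_0_iff)
qed

lemma abs_integral_le:
  fixes f g :: "real^'n::finite \<Rightarrow> real"
  assumes "integrable lborel f" "integrable lborel g" "\<And>x. \<bar>f x\<bar> \<le> g x"
  shows "\<bar>\<integral>x. f x \<partial>lborel\<bar> \<le> (\<integral>x. g x \<partial>lborel)"
proof -
  have "\<bar>\<integral>x. f x \<partial>lborel\<bar> \<le> (\<integral>x. \<bar>f x\<bar> \<partial>lborel)"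
    by (rule integral_abs_bound)
  also have "\<dots> \<le> (\<integral>x. g x \<partial>lborel)"
    using assms by (intro integral_mono) auto
  finally show ?thesis .
qed

lemma cc_conv:
  fixes k g :: "real^'n::finite \<Rightarrow> real"
  assumes "cc k" "cc g" shows "cc (conv k g)"
proof -
  obtain r r' where r: "supp_in r k" "supp_in r' g" using assms by (auto simp: cc_def)
  define I where "I = (\<integral>y. \<bar>g y\<bar> \<partial>lborel)"
  have I: "I \<ge> 0" by (simp add: I_def)
  have "uniformly_continuous_on UNIV (conv k g)"
    unfolding uniformly_continuous_on_def
  proof (intro allI impI)
    fix e :: real assume "e > 0"
    then have "e / (I + 1) > 0" using I by simp
    then obtain d where d: "d > 0" "\<And>x x'. dist x' x < d \<Longrightarrow> \<bar>k x' - k x\<bar> < e / (I + 1)"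
      using cc_modulus[OF assms(1)] by blast
    have "dist (conv k g x') (conv k g x) < e" if *: "dist x' x < d" for x x'
    proof -
      have "\<bar>conv k g x' - conv k g x\<bar> = \<bar>\<integral>y. (k (x' - y) - k (x - y)) * g y \<partial>lborel\<bar>"
        unfolding conv_def using assms
        by (subst Bochner_Integration.integral_diff[symmetric])
           (auto simp: left_diff_distrib intro!: cc_integrable conv_integrand_cc cc_continuous)
      also have "\<dots> \<le> (\<integral>y. e / (I + 1) * \<bar>g y\<bar> \<partial>lborel)"
      proof (rule abs_integral_le)
        show "integrable lborel (\<lambda>y. (k (x' - y) - k (x - y)) * g y)"
          unfolding left_diff_distrib using assms
          by (intro Bochner_Integration.integrable_diff cc_integrable conv_integrand_cc cc_continuous)
        show "integrable lborel (\<lambda>y. e / (I + 1) * \<bar>g y\<bar>)"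
          using assms by (intro cc_integrable cc_cmult cc_abs)
        show "\<bar>(k (x' - y) - k (x - y)) * g y\<bar> \<le> e / (I + 1) * \<bar>g y\<bar>" for y
          unfolding abs_mult using d(2)[of "x' - y" "x - y"] *
          by (intro mult_right_mono) (auto simp: dist_norm)
      qed
      also have "\<dots> = e / (I + 1) * I" by (simp add: I_def)
      also have "\<dots> < e" using I \<open>e > 0\<close> by (simp add: field_simps)
      finally show ?thesis by (simp add: dist_norm)
    qed
    then show "\<exists>d>0. \<forall>x\<in>UNIV. \<forall>x'\<in>UNIV. dist x' x < d \<longrightarrow> dist (conv k g x') (conv k g x) < e"
      using d by blast
  qed
  then show ?thesis using supp_in_conv[OF r] by (intro ccI uniformly_continuous_imp_continuous)
qed

text \<open>The mean value theorem along the segment reduces the remainder to differences of the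
  partials, and these are uniformly continuous by compact support. Uniformity in \<open>z\<close> is
  what permits integrating the expansion against a density.\<close>

lemma C1_uniform_diff:
  fixes k :: "real^'n::finite \<Rightarrow> real"
  assumes "C1 k" "cc k" "e > 0"
  shows "\<exists>d>0. \<forall>z v. norm v < d \<longrightarrow>
    \<bar>k (z + v) - k z - (\<Sum>j\<in>UNIV. v $ j * partial j k z)\<bar> \<le> e * norm v"
proof -
  define N where "N = real CARD('n)"
  have N: "N > 0" by (simp add: N_def)
  have "\<exists>d>0. \<forall>z z'. dist z' z < d \<longrightarrow> dist (partial j k z') (partial j k z) < e / N" for j
    using cc_modulus[OF cc_partial[OF assms(1,2)], of "e / N" j] N assms(3)
    unfolding dist_real_def by (metis divide_pos_pos)
  then obtain d where d: "\<And>j. d j > 0"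
     "\<And>j z z'. dist z' z < d j \<Longrightarrow> dist (partial j k z') (partial j k z) < e / N" by metis
  define D where "D = Min (range d)"
  have D: "D > 0" "\<And>j. D \<le> d j" using d by (auto simp: D_def)
  show ?thesis
  proof (intro exI[of _ D] conjI D allI impI)
    fix z v :: "real^'n" assume v: "norm v < D"
    obtain t where t: "0 < t" "t < 1"
      "k (z + 1 *\<^sub>R v) - k (z + 0 *\<^sub>R v) = (1 - 0) * (\<Sum>j\<in>UNIV. v $ j * partial j k (z + t *\<^sub>R v))"
      using MVT2[of 0 1 "\<lambda>t. k (z + t *\<^sub>R v)" "\<lambda>t. \<Sum>j\<in>UNIV. v $ j * partial j k (z + t *\<^sub>R v)"]
        C1_line[OF assms(1), of z v] by auto
    have "k (z + v) - k z - (\<Sum>j\<in>UNIV. v $ j * partial j k z)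
        = (\<Sum>j\<in>UNIV. v $ j * (partial j k (z + t *\<^sub>R v) - partial j k z))"
      using t(3) by (simp add: right_diff_distrib sum_subtractf)
    also have "\<bar>\<dots>\<bar> \<le> (\<Sum>j\<in>UNIV. \<bar>v $ j * (partial j k (z + t *\<^sub>R v) - partial j k z)\<bar>)"
      by (rule sum_abs)
    also have "\<dots> \<le> (\<Sum>j\<in>(UNIV::'n set). norm v * (e / N))"
    proof (rule sum_mono)
      fix j :: 'n
      have "norm (t *\<^sub>R v) \<le> norm v" using t by (simp add: mult_left_le_one_le)
      then have "dist (z + t *\<^sub>R v) z < d j" using v D(2)[of j] by (simp add: dist_norm)
      from d(2)[OF this] show "\<bar>v $ j * (partial j k (z + t *\<^sub>R v) - partial j k z)\<bar> \<le> norm v * (e / N)"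
        unfolding abs_mult dist_norm by (intro mult_mono component_le_norm_cart) auto
    qed
    also have "\<dots> = e * norm v" using N by (simp add: N_def)
    finally show "\<bar>k (z + v) - k z - (\<Sum>j\<in>UNIV. v $ j * partial j k z)\<bar> \<le> e * norm v" .
  qed
qed

text \<open>The uniform first-order expansion of the kernel is integrated against \<open>g\<close>,
  so every derivative falls on \<open>k\<close>. Division by \<open>I + 1\<close> instead of
  \<open>I\<close> covers \<open>g = 0\<close>.\<close>

lemma C1_conv:
  fixes k g :: "real^'n::finite \<Rightarrow> real"
  assumes "C1 k" "cc k" "cc g"
  shows "C1 (conv k g)" "partial j (conv k g) = conv (partial j k) g"
proof -
  define I where "I = (\<integral>y. \<bar>g y\<bar> \<partial>lborel)"
  have I: "I \<ge> 0" by (simp add: I_def)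
  have "(conv k g has_derivative (\<lambda>v. \<Sum>j\<in>UNIV. v $ j * conv (partial j k) g x)) (at x)" for x
    unfolding has_derivative_at_alt
  proof (intro conjI allI impI)
    show "bounded_linear (\<lambda>v. \<Sum>j\<in>UNIV. v $ j * conv (partial j k) g x)"
      by (intro bounded_linear_sum bounded_linear_mult_left[THEN bounded_linear_compose] bounded_linear_vec_nth)
    fix e :: real assume e: "e > 0"
    then have pos: "e / (I + 1) > 0" using I by simp
    obtain d where d: "d > 0" "\<And>z v. norm v < d \<Longrightarrow>
        \<bar>k (z + v) - k z - (\<Sum>j\<in>UNIV. v $ j * partial j k z)\<bar> \<le> e / (I + 1) * norm v"
      using C1_uniform_diff[OF assms(1,2) pos] by blast
    have "norm (conv k g y - conv k g x - (\<Sum>j\<in>UNIV. (y - x) $ j * conv (partial j k) g x)) \<le> e * norm (y - x)"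
      if y: "norm (y - x) < d" for y
    proof -
      have int: "integrable lborel (\<lambda>z. k (y - z) * g z)" "integrable lborel (\<lambda>z. k (x - z) * g z)"
        "integrable lborel (\<lambda>z. (y - x) $ j * (partial j k (x - z) * g z))" for j
        using assms by (auto intro!: cc_integrable cc_cmult conv_integrand_cc cc_continuous C1_partial_continuous simp: cc_partial)
      define F where "F z = (k (y - z) - k (x - z) - (\<Sum>j\<in>UNIV. (y - x) $ j * partial j k (x - z))) * g z" for z
      have F: "F = (\<lambda>z. k (y - z) * g z - k (x - z) * g z - (\<Sum>j\<in>UNIV. (y - x) $ j * (partial j k (x - z) * g z)))"
        by (simp add: F_def fun_eq_iff left_diff_distrib sum_distrib_right mult.assoc)
      have "conv k g y - conv k g x - (\<Sum>j\<in>UNIV. (y - x) $ j * conv (partial j k) g x) = (\<integral>z. F z \<partial>lborel)"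
        unfolding F conv_def using int by simp
      also have "\<bar>\<dots>\<bar> \<le> (\<integral>z. e / (I + 1) * norm (y - x) * \<bar>g z\<bar> \<partial>lborel)"
      proof (rule abs_integral_le)
        show "integrable lborel F" unfolding F using int by auto
        show "integrable lborel (\<lambda>z. e / (I + 1) * norm (y - x) * \<bar>g z\<bar>)"
          using assms by (intro cc_integrable cc_cmult cc_abs)
        fix z
        have "x - z + (y - x) = y - z" by simp
        with d(2)[OF y, of "x - z"] show "\<bar>F z\<bar> \<le> e / (I + 1) * norm (y - x) * \<bar>g z\<bar>"
          unfolding F_def abs_mult by (intro mult_right_mono) auto
      qed
      also have "\<dots> = e * norm (y - x) * (I / (I + 1))" by (simp add: I_def)
      also have "\<dots> \<le> e * norm (y - x)" using I e by (intro mult_left_le) auto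
      finally show ?thesis by simp
    qed
    then show "\<exists>d>0. \<forall>y. norm (y - x) < d \<longrightarrow>
        norm (conv k g y - conv k g x - (\<Sum>j\<in>UNIV. (y - x) $ j * conv (partial j k) g x)) \<le> e * norm (y - x)"
      using d by blast
  qed
  note * = this
  have c: "continuous_on UNIV (conv (partial j k) g)" for j
    using assms by (intro cc_continuous cc_conv cc_partial)
  show "C1 (conv k g)" by (rule C1I_partial(1)[OF * c])
  show "partial j (conv k g) = conv (partial j k) g" by (rule C1I_partial(2)[OF * c])
qed

lemma C1_reflect_translate:
  fixes k :: "real^'n::finite \<Rightarrow> real"
  assumes "C1 k"
  shows "C1 (\<lambda>y. k (x - y))" "partial j (\<lambda>y. k (x - y)) y = - partial j k (x - y)"
proof -
  have *: "((\<lambda>y. k (x - y)) has_derivative (\<lambda>v. \<Sum>j\<in>UNIV. v $ j * - partial j k (x - y))) (at y)" for y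
  proof -
    have "((\<lambda>y. k (x - y)) has_derivative (\<lambda>v. \<Sum>j\<in>UNIV. (- v) $ j * partial j k (x - y))) (at y)"
      by (rule has_derivative_compose[OF _ C1_has_derivative[OF assms], of "\<lambda>y. x - y"])
         (auto intro!: derivative_eq_intros)
    then show ?thesis by simp
  qed
  have c: "continuous_on UNIV (\<lambda>y. - partial j k (x - y))" for j
    by (intro continuous_intros continuous_on_compose2[OF C1_partial_continuous[OF assms]]) auto
  show "C1 (\<lambda>y. k (x - y))" by (rule C1I_partial(1)[OF * c])
  show "partial j (\<lambda>y. k (x - y)) y = - partial j k (x - y)"
    by (simp add: C1I_partial(2)[OF * c])
qed

text \<open>The sign from differentiating \<open>k (x - y)\<close> in \<open>y\<close> cancels the
  sign of the integration by parts. It serves to compute the divergence of a convolved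
  field.\<close>

lemma conv_partial_swap:
  fixes k f :: "real^'n::finite \<Rightarrow> real"
  assumes "C1 k" "C1 f" "cc f"
  shows "conv (partial j k) f x = conv k (partial j f) x"
  using integral_by_parts[OF C1_reflect_translate(1)[OF assms(1)] assms(2), of x j] assms
  by (simp add: conv_def C1_reflect_translate(2))

text \<open>Integrate the tangent line of the cube at the weighted mean \<open>m\<close> of
  \<open>f\<close>. The weight is not normalised, which produces the square of its mass.\<close>

lemma jensen_cube:
  fixes w f :: "'a \<Rightarrow> real"
  assumes "integrable M w" "integrable M (\<lambda>x. w x * f x)" "integrable M (\<lambda>x. w x * f x ^ 3)"
    and nn: "\<And>x. 0 \<le> w x" "\<And>x. 0 \<le> f x"
  shows "(\<integral>x. w x * f x \<partial>M) ^ 3 \<le> (\<integral>x. w x \<partial>M)\<^sup>2 * (\<integral>x. w x * f x ^ 3 \<partial>M)"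
proof (cases "(\<integral>x. w x \<partial>M) = 0")
  case True
  then have "AE x in M. w x = 0"
    using integral_nonneg_eq_0_iff_AE[OF assms(1)] nn by auto
  then have "AE x in M. w x * f x = 0" by eventually_elim simp
  then have "(\<integral>x. w x * f x \<partial>M) = 0" by (simp add: integral_eq_zero_AE)
  then show ?thesis using True by simp
next
  case False
  define W where "W = (\<integral>x. w x \<partial>M)"
  define m where "m = (\<integral>x. w x * f x \<partial>M) / W"
  have W: "W > 0" using False nn by (simp add: W_def integral_nonneg_AE less_le)
  have m: "m \<ge> 0" using W nn by (simp add: m_def integral_nonneg_AE)
  have key: "3 * m\<^sup>2 * (w x * f x) - 2 * m ^ 3 * w x \<le> w x * f x ^ 3" for x
  proof -
    \<comment> \<open>The gap between the cube and its tangent at \<open>m\<close> has a double root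
      at \<open>m\<close> and a second factor that is nonnegative for nonnegative arguments.\<close>
    have "0 \<le> (f x - m)\<^sup>2 * (f x + 2 * m)" using m nn by simp
    also have "\<dots> = f x ^ 3 - (3 * m\<^sup>2 * f x - 2 * m ^ 3)" by algebra
    finally have "w x * (3 * m\<^sup>2 * f x - 2 * m ^ 3) \<le> w x * f x ^ 3" using nn by (intro mult_left_mono) auto
    then show ?thesis by (simp add: algebra_simps)
  qed
  have "(\<integral>x. 3 * m\<^sup>2 * (w x * f x) - 2 * m ^ 3 * w x \<partial>M) \<le> (\<integral>x. w x * f x ^ 3 \<partial>M)"
    using assms key by (intro integral_mono) auto
  then have "3 * m\<^sup>2 * (m * W) - 2 * m ^ 3 * W \<le> (\<integral>x. w x * f x ^ 3 \<partial>M)"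
    using assms W by (simp add: m_def W_def)
  then have "m ^ 3 * W \<le> (\<integral>x. w x * f x ^ 3 \<partial>M)" by (simp add: power2_eq_square power3_eq_cube algebra_simps)
  then have "W\<^sup>2 * (m ^ 3 * W) \<le> W\<^sup>2 * (\<integral>x. w x * f x ^ 3 \<partial>M)" by (intro mult_left_mono) auto
  moreover have "W\<^sup>2 * (m ^ 3 * W) = (m * W) ^ 3" by algebra
  moreover have "m * W = (\<integral>x. w x * f x \<partial>M)" using W by (simp add: m_def)
  ultimately show ?thesis by (simp add: W_def)
qed

lemma conv_integral:
  fixes k g :: "real^'n::finite \<Rightarrow> real"
  assumes "cc k" "cc g"
  shows "(\<integral>x. conv k g x \<partial>lborel) = (\<integral>x. k x \<partial>lborel) * (\<integral>x. g x \<partial>lborel)"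
proof -
  obtain r r' where r: "supp_in r k" "supp_in r' g" using assms by (auto simp: cc_def)
  define S where "S = cball (0 :: real^'n) (r + r') \<times> cball (0 :: real^'n) r'"
  have z: "k (x - y) * g y = 0" if "(x, y) \<notin> S" for x y
    using r that norm_triangle_ineq[of "x - y" y] by (cases "r' < norm y") (auto simp: S_def supp_in_def)
  have cont: "continuous_on UNIV (\<lambda>(x, y). k (x - y) * g y)"
    unfolding case_prod_beta
    by (intro continuous_intros continuous_on_compose2[OF cc_continuous[OF assms(1)]]
        continuous_on_compose2[OF cc_continuous[OF assms(2)]]) auto
  have "integrable lborel (\<lambda>z. indicator S z *\<^sub>R (case z of (x, y) \<Rightarrow> k (x - y) * g y))"
    by (intro borel_integrable_compact continuous_on_subset[OF cont]) (auto simp: S_def intro: compact_Times)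
  also have "(\<lambda>z. indicator S z *\<^sub>R (case z of (x, y) \<Rightarrow> k (x - y) * g y)) = (\<lambda>(x, y). k (x - y) * g y)"
    using z by (auto simp: fun_eq_iff indicator_def)
  finally have int: "integrable (lborel \<Otimes>\<^sub>M lborel) (\<lambda>(x, y). k (x - y) * g y)"
    by (simp add: lborel_prod)
  have "(\<integral>x. conv k g x \<partial>lborel) = (\<integral>y. (\<integral>x. k (x - y) * g y \<partial>lborel) \<partial>lborel)"
    unfolding conv_def using lborel_pair.Fubini_integral[OF int] by simp
  also have "\<dots> = (\<integral>y. (\<integral>x. k x \<partial>lborel) * g y \<partial>lborel)"
    using integral_translate[OF cc_measurable[OF assms(1)], of "- _"] by simp
  finally show ?thesis by simp
qed

text \<open>Young's inequality for an integrable kernel acting on L^3: Jensen pointwise with weight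
  \<open>k (x - y)\<close> costs two powers of the mass, and the integral of the remaining
  convolution costs the third.\<close>

lemma conv_cube_le:
  fixes k g :: "real^'n::finite \<Rightarrow> real"
  assumes "cc k" "cc g" "\<And>x. 0 \<le> k x"
  shows "(\<integral>x. \<bar>conv k g x\<bar> ^ 3 \<partial>lborel) \<le> (\<integral>x. k x \<partial>lborel) ^ 3 * (\<integral>x. \<bar>g x\<bar> ^ 3 \<partial>lborel)"
proof -
  let ?I = "\<integral>x. k x \<partial>lborel"
  have "(\<integral>x. \<bar>conv k g x\<bar> ^ 3 \<partial>lborel) \<le> (\<integral>x. ?I\<^sup>2 * conv k (\<lambda>y. \<bar>g y\<bar> ^ 3) x \<partial>lborel)"
  proof (rule integral_mono)
    show "integrable lborel (\<lambda>x. \<bar>conv k g x\<bar> ^ 3)"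
      using assms by (intro cc_integrable cc_power cc_abs cc_conv) auto
    show "integrable lborel (\<lambda>x. ?I\<^sup>2 * conv k (\<lambda>y. \<bar>g y\<bar> ^ 3) x)"
      using assms by (intro cc_integrable cc_cmult cc_power cc_abs cc_conv) auto
    fix x
    have i: "cc (\<lambda>y. k (x - y) * \<bar>g y\<bar>)" "cc (\<lambda>y. k (x - y) * \<bar>g y\<bar> ^ 3)"
      using assms by (auto intro!: conv_integrand_cc cc_continuous cc_power cc_abs)
    have kk: "integrable lborel (\<lambda>y. k (x - y))" "(\<integral>y. k (x - y) \<partial>lborel) = ?I"
    proof -
      have "cc (\<lambda>y. k (x - y))"
      proof -
        obtain r where r: "supp_in r k" using assms by (auto simp: cc_def)
        have "supp_in (r + norm x) (\<lambda>y. k (x - y))"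
          unfolding supp_in_def using r norm_triangle_ineq2[of _ x]
          by (metis add_less_cancel_right diff_add_cancel norm_minus_commute norm_triangle_sub order_less_le_trans supp_in_def)
        moreover have "continuous_on UNIV (\<lambda>y. k (x - y))"
          by (intro continuous_on_compose2[OF cc_continuous[OF assms(1)]] continuous_intros) auto
        ultimately show ?thesis by (auto simp: cc_def)
      qed
      then show "integrable lborel (\<lambda>y. k (x - y))" by (rule cc_integrable)
      show "(\<integral>y. k (x - y) \<partial>lborel) = ?I" by (rule integral_translate_reflect[OF cc_measurable[OF assms(1)]])
    qed
    have "\<bar>conv k g x\<bar> \<le> (\<integral>y. k (x - y) * \<bar>g y\<bar> \<partial>lborel)"
      unfolding conv_def using assms i
      by (intro abs_integral_le cc_integrable conv_integrand_cc cc_continuous) (auto simp: abs_mult intro: cc_abs)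
    then have "\<bar>conv k g x\<bar> ^ 3 \<le> (\<integral>y. k (x - y) * \<bar>g y\<bar> \<partial>lborel) ^ 3"
      by (intro power_mono) auto
    also have "\<dots> \<le> (\<integral>y. k (x - y) \<partial>lborel)\<^sup>2 * (\<integral>y. k (x - y) * \<bar>g y\<bar> ^ 3 \<partial>lborel)"
      using assms i kk by (intro jensen_cube) (auto intro: cc_integrable)
    finally show "\<bar>conv k g x\<bar> ^ 3 \<le> ?I\<^sup>2 * conv k (\<lambda>y. \<bar>g y\<bar> ^ 3) x"
      by (simp add: kk conv_def)
  qed
  also have "\<dots> = ?I\<^sup>2 * (?I * (\<integral>x. \<bar>g x\<bar> ^ 3 \<partial>lborel))"
    using assms by (subst integral_mult_right_zero, subst conv_integral) (auto intro!: cc_power cc_abs)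
  finally show ?thesis by (simp add: power2_eq_square power3_eq_cube mult.assoc)
qed

subsection \<open>A Calderon-Zygmund inequality\<close>

text \<open>A Bellman function for the \<open>L\<^sup>3\<close> bound of second derivatives by the Laplacian: averaging over two
  translates lowers \<open>\<integral> bell g f\<close> by at least a multiple of the product of the differences of \<open>g\<close> and \<open>f\<close>.\<close>

definition bell :: "real \<Rightarrow> real \<Rightarrow> real" where
  "bell a b = (a\<^sup>2 + b) * sqrt (a\<^sup>2 + b)"

text \<open>The right-hand side is the second derivative of \<open>bell\<close> along a line in
  direction \<open>(a, b)\<close>, at a point with first coordinate \<open>x\<close> where the
  square root equals \<open>y\<close>. If \<open>b\<close> dominates \<open>y * a\<close>, the
  squared term suffices because \<open>2 * a * x\<close> cancels at most half of \<open>b\<close>;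
  otherwise \<open>3 * y * a\<^sup>2\<close> suffices.\<close>

lemma bell_second_derivative_ge:
  fixes a b x y :: real
  assumes "y > 0" "\<bar>x\<bar> \<le> y"
  shows "3/4 * \<bar>a\<bar> * \<bar>b\<bar> \<le> 3/4 * (2 * a * x + b)\<^sup>2 / y + 3 * y * a\<^sup>2"
proof (cases "4 * y * \<bar>a\<bar> \<le> \<bar>b\<bar>")
  case True
  have "2 * \<bar>a\<bar> * \<bar>x\<bar> \<le> 2 * \<bar>a\<bar> * y" using assms by (intro mult_left_mono) auto
  then have "\<bar>2 * a * x\<bar> \<le> \<bar>b\<bar> / 2" using True by (simp add: abs_mult mult.assoc mult.commute[of y])
  then have "\<bar>b\<bar> / 2 \<le> \<bar>2 * a * x + b\<bar>" by linarith
  then have "(\<bar>b\<bar> / 2)\<^sup>2 \<le> \<bar>2 * a * x + b\<bar>\<^sup>2" by (intro power_mono) auto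
  then have 1: "b\<^sup>2 / 4 \<le> (2 * a * x + b)\<^sup>2" by (simp add: power_divide)
  have "\<bar>a\<bar> * \<bar>b\<bar> * y = (\<bar>a\<bar> * y) * \<bar>b\<bar>" by simp
  also have "\<dots> \<le> (\<bar>b\<bar> / 4) * \<bar>b\<bar>" using True by (intro mult_right_mono) (auto simp: mult_ac)
  also have "\<dots> = b\<^sup>2 / 4" by (simp add: power2_eq_square)
  finally have "\<bar>a\<bar> * \<bar>b\<bar> \<le> (2 * a * x + b)\<^sup>2 / y" using 1 assms by (simp add: field_simps)
  moreover have "0 \<le> 3 * y * a\<^sup>2" using assms by simp
  ultimately show ?thesis by simp
next
  case False
  have "\<bar>a\<bar> * \<bar>b\<bar> \<le> \<bar>a\<bar> * (4 * y * \<bar>a\<bar>)" using False by (intro mult_left_mono) auto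
  also have "\<dots> = 4 * y * a\<^sup>2" by (simp add: power2_eq_square)
  finally have "3/4 * \<bar>a\<bar> * \<bar>b\<bar> \<le> 3 * y * a\<^sup>2" by simp
  moreover have "0 \<le> 3/4 * (2 * a * x + b)\<^sup>2 / y" using assms by simp
  ultimately show ?thesis by simp
qed

text \<open>Second-order Taylor expansion at the midpoint in both directions: the linear terms
  cancel, and each remainder is at least half the lower bound for the second derivative. The strict
  inequality keeps the radicand positive on the whole segment, where the square root is
  differentiable.\<close>

lemma bell_midpoint_strict:
  fixes p q a b :: real
  assumes "\<bar>b\<bar> < q"
  shows "bell p q + 3/8 * \<bar>a\<bar> * \<bar>b\<bar> \<le> (bell (p + a) (q + b) + bell (p - a) (q - b)) / 2"
proof -
  define S where "S t = (p + t * a)\<^sup>2 + (q + t * b)" for t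
  \<comment> \<open>The function and its first two derivatives along the segment, packed into one
    family as Taylor's theorem expects.\<close>
  define D where "D m t = (if m = (0::nat) then S t * sqrt (S t)
      else if m = 1 then 3/2 * sqrt (S t) * (2 * a * (p + t * a) + b)
      else 3/4 * (2 * a * (p + t * a) + b)\<^sup>2 / sqrt (S t) + 3 * sqrt (S t) * a\<^sup>2)" for m t
  have S: "S t > 0" if "-1 \<le> t" "t \<le> 1" for t
  proof -
    have "\<bar>t * b\<bar> \<le> \<bar>b\<bar>" using that by (auto simp: abs_mult intro!: mult_left_le_one_le)
    then have "q + t * b > 0" using assms by linarith
    then show ?thesis unfolding S_def using zero_le_power2[of "p + t * a"] by linarith
  qed
  have dS: "(S has_real_derivative (2 * a * (p + t * a) + b)) (at t)" for t
    unfolding S_def by (auto intro!: derivative_eq_intros simp: algebra_simps power2_eq_square)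
  have dq: "((\<lambda>t. sqrt (S t)) has_real_derivative ((2 * a * (p + t * a) + b) / (2 * sqrt (S t)))) (at t)"
    if "-1 \<le> t" "t \<le> 1" for t
    using DERIV_chain2[OF DERIV_real_sqrt[OF S[OF that]] dS] by (simp add: field_simps)
  have d: "((D m) has_real_derivative D (Suc m) t) (at t)" if m: "m < 2" and that: "-1 \<le> t" "t \<le> 1" for m t
  proof -
    have sq: "sqrt (S t) > 0" "S t = sqrt (S t) * sqrt (S t)" using S[OF that] by auto
    have dq: "((\<lambda>t. sqrt (S t)) has_real_derivative ((2 * a * (p + t * a) + b) / (2 * sqrt (S t)))) (at t)"
      by (rule dq[OF that])
    consider "m = 0" | "m = 1" using m by linarith
    then show ?thesis
    proof cases
      case 1
      have "((\<lambda>t. S t * sqrt (S t)) has_real_derivative (2 * a * (p + t * a) + b) * sqrt (S t)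
           + (2 * a * (p + t * a) + b) / (2 * sqrt (S t)) * S t) (at t)"
        by (rule DERIV_mult[OF dS dq])
      moreover have "(2 * a * (p + t * a) + b) * sqrt (S t) + (2 * a * (p + t * a) + b) / (2 * sqrt (S t)) * S t
         = 3/2 * sqrt (S t) * (2 * a * (p + t * a) + b)"
        using sq(1) by (subst (2) sq(2)) (simp add: field_simps del: real_sqrt_mult_self)
      ultimately have "((\<lambda>t. S t * sqrt (S t)) has_real_derivative
          3/2 * sqrt (S t) * (2 * a * (p + t * a) + b)) (at t)" by (rule DERIV_cong)
      then show ?thesis using 1 by (simp add: D_def[abs_def])
    next
      case 2
      have "((\<lambda>t. 3/2 * sqrt (S t) * (2 * a * (p + t * a) + b)) has_real_derivative
          3/2 * ((2 * a * (p + t * a) + b) / (2 * sqrt (S t))) * (2 * a * (p + t * a) + b)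
          + 2 * a * a * (3/2 * sqrt (S t))) (at t)"
        by (rule DERIV_mult[OF DERIV_cmult[OF dq]]) (auto intro!: derivative_eq_intros)
      then show ?thesis using 2 by (simp add: D_def[abs_def] power2_eq_square field_simps)
    qed
  qed
  have lo: "3/4 * \<bar>a\<bar> * \<bar>b\<bar> \<le> D 2 t" if "-1 \<le> t" "t \<le> 1" for t
  proof -
    have "q + t * b > 0"
    proof -
      have "\<bar>t * b\<bar> \<le> \<bar>b\<bar>" using that by (auto simp: abs_mult intro!: mult_left_le_one_le)
      then show ?thesis using assms by linarith
    qed
    then have "\<bar>p + t * a\<bar> \<le> sqrt (S t)" by (intro real_le_rsqrt) (simp add: S_def)
    then show ?thesis using bell_second_derivative_ge[of "sqrt (S t)" "p + t * a" a b] S[OF that]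
      by (simp add: D_def)
  qed
  obtain t1 where t1: "0 < t1" "t1 < 1" "D 0 1 = (\<Sum>m<2. D m 0 / fact m * (1 - 0) ^ m) + D 2 t1 / fact 2 * (1 - 0) ^ 2"
    using Taylor_up[of 2 D "D 0" "-1" 1 0] d by auto
  obtain t2 where t2: "-1 < t2" "t2 < 0" "D 0 (-1) = (\<Sum>m<2. D m 0 / fact m * (-1 - 0) ^ m) + D 2 t2 / fact 2 * (-1 - 0) ^ 2"
    using Taylor_down[of 2 D "D 0" "-1" 1 0] d by auto
  have "D 0 1 = D 0 0 + D 1 0 + D 2 t1 / 2" "D 0 (-1) = D 0 0 - D 1 0 + D 2 t2 / 2"
    using t1(3) t2(3) by (simp_all add: numeral_2_eq_2)
  then have "D 0 1 + D 0 (-1) \<ge> 2 * D 0 0 + 3/4 * \<bar>a\<bar> * \<bar>b\<bar>"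
    using lo[of t1] lo[of t2] t1 t2 by simp
  moreover have "D 0 1 = bell (p + a) (q + b)" "D 0 (-1) = bell (p - a) (q - b)" "D 0 0 = bell p q"
    by (simp_all add: D_def S_def bell_def)
  ultimately show ?thesis by simp
qed

lemma continuous_on_bell: "continuous_on UNIV (\<lambda>(a, b). bell a b)"
  unfolding bell_def case_prod_beta by (intro continuous_intros)

text \<open>Pairs with \<open>\<bar>b\<bar> = q\<close>, where the radicand may vanish, are reached
  by continuity from \<open>q + d\<close> as \<open>d\<close> decreases to 0. They do occur:
  \<open>f\<close> may be zero at one of the two translates.\<close>

lemma bell_midpoint:
  fixes p q a b :: real
  assumes "\<bar>b\<bar> \<le> q"
  shows "bell p q + 3/8 * \<bar>a\<bar> * \<bar>b\<bar> \<le> (bell (p + a) (q + b) + bell (p - a) (q - b)) / 2"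
proof -
  have l: "((\<lambda>d. bell s (t + d)) \<longlongrightarrow> bell s (t + 0)) (at_right 0)" for s t
    unfolding bell_def by (intro tendsto_intros)
  have "((\<lambda>d. (bell (p + a) (q + b + d) + bell (p - a) (q - b + d)) / 2 - (bell p (q + d) + 3/8 * \<bar>a\<bar> * \<bar>b\<bar>))
     \<longlongrightarrow> (bell (p + a) (q + b + 0) + bell (p - a) (q - b + 0)) / 2 - (bell p (q + 0) + 3/8 * \<bar>a\<bar> * \<bar>b\<bar>)) (at_right 0)"
    by (intro tendsto_intros l) auto
  moreover have "\<forall>\<^sub>F d in at_right 0. 0 \<le> (bell (p + a) (q + b + d) + bell (p - a) (q - b + d)) / 2 - (bell p (q + d) + 3/8 * \<bar>a\<bar> * \<bar>b\<bar>)"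
    using eventually_at_right_less[of 0]
  proof eventually_elim
    case (elim d)
    then show ?case using bell_midpoint_strict[of b "q + d" p a] assms by (simp add: algebra_simps)
  qed
  ultimately have "0 \<le> (bell (p + a) (q + b + 0) + bell (p - a) (q - b + 0)) / 2 - (bell p (q + 0) + 3/8 * \<bar>a\<bar> * \<bar>b\<bar>)"
    by (rule tendsto_lowerbound) simp
  then show ?thesis by simp
qed

text \<open>With a square as second argument \<open>bell\<close> is homogeneous of degree 3 and is
  compared with the cube of the larger entry; the factor 3 is 2 times the bound 3/2 for the square
  root of 2.\<close>

lemma bell_le:
  assumes "0 \<le> b" shows "0 \<le> bell a b" "bell a (b\<^sup>2) \<le> 3 * (\<bar>a\<bar> ^ 3 + b ^ 3)"
proof -
  show "0 \<le> bell a b" using assms by (simp add: bell_def)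
  define m where "m = max \<bar>a\<bar> b"
  have m: "m \<ge> 0" "\<bar>a\<bar> \<le> m" "b \<le> m" by (auto simp: m_def)
  have "\<bar>a\<bar>\<^sup>2 \<le> m\<^sup>2" by (rule power_mono) (use m in auto)
  moreover have "b\<^sup>2 \<le> m\<^sup>2" by (rule power_mono) (use m assms in auto)
  ultimately have "a\<^sup>2 + b\<^sup>2 \<le> 2 * m\<^sup>2" by simp
  moreover have "sqrt (a\<^sup>2 + b\<^sup>2) \<le> 3/2 * m"
  proof (rule real_le_lsqrt)
    have "(3/2 * m)\<^sup>2 = 9/4 * m\<^sup>2" by (simp add: power_mult_distrib power2_eq_square)
    then show "a\<^sup>2 + b\<^sup>2 \<le> (3/2 * m)\<^sup>2" using \<open>a\<^sup>2 + b\<^sup>2 \<le> 2 * m\<^sup>2\<close> zero_le_power2[of m] by linarith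
  qed (use m in auto)
  ultimately have "bell a (b\<^sup>2) \<le> 2 * m\<^sup>2 * (3/2 * m)"
    unfolding bell_def using m by (intro mult_mono) auto
  also have "\<dots> = 3 * m ^ 3" by (simp add: power2_eq_square power3_eq_cube)
  also have "m ^ 3 \<le> \<bar>a\<bar> ^ 3 + b ^ 3" using assms by (auto simp: m_def max_def)
  finally show "bell a (b\<^sup>2) \<le> 3 * (\<bar>a\<bar> ^ 3 + b ^ 3)" by simp
qed

section \<open>Averages and half differences over two translates\<close>

definition avg :: "real^'n::finite \<Rightarrow> (real^'n \<Rightarrow> real) \<Rightarrow> real^'n \<Rightarrow> real" where
  "avg e f x = (f (x + e) + f (x - e)) / 2"

text \<open>Halved so that \<open>avg\<close> plus and minus \<open>dif\<close> are exactly the two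
  translates, the form in which the midpoint inequality for \<open>bell\<close> applies.\<close>

definition dif :: "real^'n::finite \<Rightarrow> (real^'n \<Rightarrow> real) \<Rightarrow> real^'n \<Rightarrow> real" where
  "dif e f x = (f (x + e) - f (x - e)) / 2"

lemma cc_avg: "cc f \<Longrightarrow> cc (avg e f)" and cc_dif: "cc f \<Longrightarrow> cc (dif e f)"
  unfolding avg_def[abs_def] dif_def[abs_def]
  by (intro cc_divide cc_add cc_diff cc_translate cc_translate_minus; simp)+

text \<open>\<open>dif_dif\<close> writes a second difference as the squared average minus the
  identity: it is the increment of a discrete evolution.\<close>

lemma avg_commute: "avg e (avg e' f) = avg e' (avg e f)"
  and avg_dif_commute: "avg e (dif e' f) = dif e' (avg e f)"
  and dif_dif: "dif e (dif e f) = (\<lambda>x. avg e (avg e f) x - f x)"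
  by (simp_all add: avg_def dif_def fun_eq_iff algebra_simps, simp_all add: field_simps)

lemma avg_linear: "avg e (\<lambda>x. f x - g x) = (\<lambda>x. avg e f x - avg e g x)"
  "avg e (\<lambda>x. f x + g x) = (\<lambda>x. avg e f x + avg e g x)"
  "avg e (\<lambda>x. f x / c) = (\<lambda>x. avg e f x / c)"
  by (simp_all add: avg_def fun_eq_iff add_divide_distrib diff_divide_distrib)

lemma dif_linear: "dif e (\<lambda>x. f x - g x) = (\<lambda>x. dif e f x - dif e g x)"
  "dif e (\<lambda>x. f x / c) = (\<lambda>x. dif e f x / c)"
  by (simp_all add: dif_def fun_eq_iff add_divide_distrib diff_divide_distrib)

lemma integral_translate_mult:
  fixes f g :: "real^'n::finite \<Rightarrow> real"
  assumes "cc f" "cc g"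
  shows "(\<integral>x. f x * g (x + e) \<partial>lborel) = (\<integral>x. f (x - e) * g x \<partial>lborel)"
proof -
  have "cc (\<lambda>x. f (x - e) * g x)" using assms by (intro cc_mult_left cc_continuous cc_translate_minus)
  from integral_translate[OF cc_measurable[OF this], of e] show ?thesis by simp
qed

lemma avg_selfadjoint:
  assumes "cc f" "cc g"
  shows "(\<integral>x. f x * avg e g x \<partial>lborel) = (\<integral>x. avg e f x * g x \<partial>lborel)"
    and dif_antiadjoint: "(\<integral>x. f x * dif e g x \<partial>lborel) = - (\<integral>x. dif e f x * g x \<partial>lborel)"
proof -
  have cc: "cc (\<lambda>x. f x * g (x + e))" "cc (\<lambda>x. f x * g (x - e))" "cc (\<lambda>x. f (x - e) * g x)" "cc (\<lambda>x. f (x + e) * g x)" for e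
    using assms by (auto intro!: cc_mult_left cc_mult_right cc_continuous cc_translate_minus cc_translate)
  have 1: "(\<integral>x. f x * g (x + e) \<partial>lborel) = (\<integral>x. f (x - e) * g x \<partial>lborel)"
    "(\<integral>x. f x * g (x - e) \<partial>lborel) = (\<integral>x. f (x + e) * g x \<partial>lborel)"
    using integral_translate_mult[OF assms, of e] integral_translate_mult[OF assms, of "-e"] by auto
  show "(\<integral>x. f x * avg e g x \<partial>lborel) = (\<integral>x. avg e f x * g x \<partial>lborel)"
    unfolding avg_def by (simp add: distrib_left distrib_right cc_integrable cc 1)
  show "(\<integral>x. f x * dif e g x \<partial>lborel) = - (\<integral>x. dif e f x * g x \<partial>lborel)"
    unfolding dif_def by (simp add: left_diff_distrib right_diff_distrib cc_integrable cc 1 minus_divide_left)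
qed

lemma integral_avg:
  assumes "cc f" shows "(\<integral>x. avg e f x \<partial>lborel) = (\<integral>x. f x \<partial>lborel)"
  using integral_translate[OF cc_measurable[OF assms], of e] integral_translate[OF cc_measurable[OF assms], of "-e"]
  unfolding avg_def by (simp add: cc_integrable assms cc_translate cc_translate_minus)

text \<open>Parallelogram identity: averaging loses exactly the square of the half difference, hence
  along an iteration these losses are summable.\<close>

lemma integral_avg_square:
  assumes "cc f"
  shows "(\<integral>x. (avg e f x)\<^sup>2 \<partial>lborel) = (\<integral>x. (f x)\<^sup>2 \<partial>lborel) - (\<integral>x. (dif e f x)\<^sup>2 \<partial>lborel)"
proof -
  have cc: "cc (\<lambda>x. (avg e f x)\<^sup>2)" "cc (\<lambda>x. (f x)\<^sup>2)" "cc (\<lambda>x. (dif e f x)\<^sup>2)"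
    using assms by (auto intro!: cc_power cc_avg cc_dif)
  have "(\<integral>x. (f x)\<^sup>2 \<partial>lborel) = (\<integral>x. avg e (\<lambda>x. (f x)\<^sup>2) x \<partial>lborel)"
    by (rule integral_avg[OF cc(2), symmetric])
  also have "\<dots> = (\<integral>x. (avg e f x)\<^sup>2 + (dif e f x)\<^sup>2 \<partial>lborel)"
    by (rule Bochner_Integration.integral_cong) (auto simp: avg_def dif_def power2_eq_square field_simps)
  also have "\<dots> = (\<integral>x. (avg e f x)\<^sup>2 \<partial>lborel) + (\<integral>x. (dif e f x)\<^sup>2 \<partial>lborel)"
    using cc by (simp add: cc_integrable)
  finally show ?thesis by simp
qed

lemma cc_bell: "cc f \<Longrightarrow> cc g \<Longrightarrow> cc (\<lambda>x. bell (g x) (f x))"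
  by (rule cc_comp2[OF _ _ continuous_on_bell]) (auto simp: bell_def)

text \<open>Nonnegativity of \<open>f\<close> gives
  \<open>\<bar>dif e f x\<bar> \<le> avg e f x\<close>, the condition of the pointwise midpoint
  inequality; averaging preserves the integral on the right.\<close>

lemma integral_bell_avg:
  assumes "cc f" "cc g" "\<And>x. 0 \<le> f x"
  shows "(\<integral>x. bell (avg e g x) (avg e f x) \<partial>lborel) + 3/8 * (\<integral>x. \<bar>dif e g x\<bar> * \<bar>dif e f x\<bar> \<partial>lborel)
     \<le> (\<integral>x. bell (g x) (f x) \<partial>lborel)"
proof -
  have cc: "cc (\<lambda>x. bell (avg e g x) (avg e f x))" "cc (\<lambda>x. bell (g x) (f x))"
    "cc (\<lambda>x. \<bar>dif e g x\<bar> * \<bar>dif e f x\<bar>)"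
    using assms by (auto intro!: cc_bell cc_avg cc_mult_left cc_abs cc_dif cc_continuous)
  have "(\<integral>x. bell (avg e g x) (avg e f x) + 3/8 * (\<bar>dif e g x\<bar> * \<bar>dif e f x\<bar>) \<partial>lborel)
     \<le> (\<integral>x. avg e (\<lambda>x. bell (g x) (f x)) x \<partial>lborel)"
  proof (intro integral_mono cc_integrable cc_add cc cc_cmult cc_avg)
    fix x
    have s: "avg e g x + dif e g x = g (x + e)" "avg e g x - dif e g x = g (x - e)"
      "avg e f x + dif e f x = f (x + e)" "avg e f x - dif e f x = f (x - e)"
      by (simp_all add: avg_def dif_def field_simps)
    have "\<bar>dif e f x\<bar> \<le> avg e f x"
      using assms(3)[of "x + e"] assms(3)[of "x - e"] by (simp add: avg_def dif_def)
    from bell_midpoint[OF this, of "avg e g x" "dif e g x"]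
    show "bell (avg e g x) (avg e f x) + 3/8 * (\<bar>dif e g x\<bar> * \<bar>dif e f x\<bar>) \<le> avg e (\<lambda>x. bell (g x) (f x)) x"
      unfolding s by (simp add: avg_def mult.assoc)
  qed
  then show ?thesis using cc by (simp add: integral_avg cc_integrable)
qed

fun avgs :: "(real^'n::finite) list \<Rightarrow> (real^'n \<Rightarrow> real) \<Rightarrow> real^'n \<Rightarrow> real" where
  "avgs [] f = f"
| "avgs (e # es) f = avgs es (avg e f)"

lemma cc_avgs: "cc f \<Longrightarrow> cc (avgs es f)"
  by (induction es arbitrary: f) (auto intro: cc_avg)

lemma avgs_nonneg: "(\<And>x. 0 \<le> f x) \<Longrightarrow> 0 \<le> avgs es f x"
  by (induction es arbitrary: f) (auto simp: avg_def)

lemma avgs_avg: "avgs es (avg e f) = avg e (avgs es f)"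
proof (induction es arbitrary: f)
  case (Cons a es) then show ?case by (simp add: avg_commute[of a e])
qed simp

lemma avgs_dif: "avgs es (dif e f) = dif e (avgs es f)"
proof (induction es arbitrary: f)
  case (Cons a es) then show ?case by (simp add: avg_dif_commute)
qed simp

lemma avgs_linear: "avgs es (\<lambda>x. f x - g x) = (\<lambda>x. avgs es f x - avgs es g x)"
  "avgs es (\<lambda>x. f x + g x) = (\<lambda>x. avgs es f x + avgs es g x)"
  "avgs es (\<lambda>x. f x / c) = (\<lambda>x. avgs es f x / c)"
  by (induction es arbitrary: f g) (auto simp: avg_linear)

lemma avgs_selfadjoint:
  "cc f \<Longrightarrow> cc g \<Longrightarrow> (\<integral>x. f x * avgs es g x \<partial>lborel) = (\<integral>x. avgs es f x * g x \<partial>lborel)"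
proof (induction es arbitrary: f g)
  case (Cons e es)
  have "(\<integral>x. f x * avgs es (avg e g) x \<partial>lborel) = (\<integral>x. avgs es f x * avg e g x \<partial>lborel)"
    using Cons by (simp add: cc_avg)
  also have "\<dots> = (\<integral>x. avg e (avgs es f) x * g x \<partial>lborel)"
    using Cons.prems by (intro avg_selfadjoint) (auto intro: cc_avgs)
  finally show ?case by (simp add: avgs_avg)
qed simp

lemma integral_avgs_square_le:
  "cc f \<Longrightarrow> (\<integral>x. (avgs es f x)\<^sup>2 \<partial>lborel) \<le> (\<integral>x. (f x)\<^sup>2 \<partial>lborel)"
proof (induction es arbitrary: f)
  case (Cons e es)
  have "(\<integral>x. (avgs es (avg e f) x)\<^sup>2 \<partial>lborel) \<le> (\<integral>x. (avg e f x)\<^sup>2 \<partial>lborel)"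
    using Cons by (simp add: cc_avg)
  also have "\<dots> \<le> (\<integral>x. (f x)\<^sup>2 \<partial>lborel)"
    using integral_avg_square[OF Cons.prems, of e] by simp
  finally show ?case by simp
qed simp

lemma integral_bell_avgs:
  "cc f \<Longrightarrow> cc g \<Longrightarrow> (\<And>x. 0 \<le> f x) \<Longrightarrow>
   (\<integral>x. bell (avgs es g x) (avgs es f x) \<partial>lborel) \<le> (\<integral>x. bell (g x) (f x) \<partial>lborel)"
proof (induction es arbitrary: f g)
  case (Cons e es)
  have "(\<integral>x. bell (avgs es (avg e g) x) (avgs es (avg e f) x) \<partial>lborel) \<le> (\<integral>x. bell (avg e g x) (avg e f x) \<partial>lborel)"
    using Cons.prems by (intro Cons.IH cc_avg) (auto simp: avg_def)
  also have "\<dots> \<le> (\<integral>x. bell (g x) (f x) \<partial>lborel)"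
  proof -
    have "0 \<le> (\<integral>x. \<bar>dif e g x\<bar> * \<bar>dif e f x\<bar> \<partial>lborel)" by (intro integral_nonneg_AE) auto
    then show ?thesis using integral_bell_avg[OF Cons.prems, of e] by linarith
  qed
  finally show ?case by simp
qed simp

text \<open>\<open>P\<close> plays the role of a heat semigroup: iterating it moves \<open>f\<close> and \<open>g = (P\<^sup>2 - 1) h\<close> to 0, the left-hand
  side telescopes into the products controlled by \<open>bell\<close>, and no singular integral is needed.\<close>

lemma discrete_second_difference_bound:
  fixes e :: "real^'n::finite" and es :: "(real^'n) list" and f h :: "real^'n::finite \<Rightarrow> real"
  assumes f: "cc f" "\<And>x. 0 \<le> f x" and h: "cc h"
  defines "P \<equiv> avgs (e # es)"
  shows "\<bar>\<integral>x. f x * dif e (dif e h) x \<partial>lborel\<bar> \<le> 8/3 * (\<integral>x. bell (P (P h) x - h x) (f x) \<partial>lborel)"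
proof -
  define g where "g = (\<lambda>x. P (P h) x - h x)"
  define fn where "fn n = (P ^^ n) f" for n
  define hn where "hn n = (P ^^ n) h" for n
  define gn where "gn n = (P ^^ n) g" for n
  have ccP: "cc u \<Longrightarrow> cc ((P ^^ n) u)" for n u
    by (induction n) (auto simp: P_def intro!: cc_avgs cc_avg)
  have g: "cc g" unfolding g_def P_def using h by (intro cc_diff cc_avgs)
  have cc: "cc (fn n)" "cc (hn n)" "cc (gn n)" for n
    using ccP f g h by (auto simp: fn_def hn_def gn_def)
  have fnn: "0 \<le> fn n x" for n x
    unfolding fn_def P_def by (induction n arbitrary: x) (auto simp: f simp del: avgs.simps intro!: avgs_nonneg)
  have gn: "gn n = (\<lambda>x. P (P (hn n)) x - hn n x)" for n
  proof (induction n)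
    case (Suc n)
    have "gn (Suc n) = P (gn n)" by (simp add: gn_def)
    then show ?case using Suc by (simp add: P_def avgs_linear avg_linear hn_def)
  qed (simp add: gn_def hn_def g_def)
  define E where "E n = (\<integral>x. bell (gn n x) (fn n x) \<partial>lborel)" for n
  define T where "T n = (\<integral>x. fn n x * dif e (dif e (hn n)) x \<partial>lborel)" for n
  \<comment> \<open>Self-adjointness moves \<open>P\<close> from \<open>fn n\<close> to the other
    factor, where it commutes with \<open>dif\<close>; so the increment of \<open>T\<close> contains
    \<open>gn n\<close>. Shifting one difference onto \<open>fn n\<close> gives the product that the
    decrease of \<open>E\<close> pays for.\<close>
  have step: "\<bar>T n - T (Suc n)\<bar> \<le> 8/3 * (E n - E (Suc n))" for n
  proof -
    have "T (Suc n) = (\<integral>x. P (fn n) x * dif e (dif e (P (hn n))) x \<partial>lborel)"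
      by (simp add: T_def fn_def hn_def)
    also have "\<dots> = (\<integral>x. fn n x * P (dif e (dif e (P (hn n)))) x \<partial>lborel)"
      unfolding P_def using cc by (intro avgs_selfadjoint[symmetric] cc_dif cc_avgs)
    also have "P (dif e (dif e (P (hn n)))) = dif e (dif e (P (P (hn n))))"
      unfolding P_def avgs_dif ..
    finally have "T (Suc n) - T n = (\<integral>x. fn n x * dif e (dif e (P (P (hn n)))) x - fn n x * dif e (dif e (hn n)) x \<partial>lborel)"
      unfolding T_def P_def using cc
      by (subst Bochner_Integration.integral_diff) (auto intro!: cc_integrable cc_mult_left cc_dif cc_avgs cc_avg cc_continuous)
    also have "\<dots> = (\<integral>x. fn n x * dif e (dif e (gn n)) x \<partial>lborel)"
      unfolding gn dif_linear by (simp add: right_diff_distrib)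
    also have "\<dots> = - (\<integral>x. dif e (fn n) x * dif e (gn n) x \<partial>lborel)"
      using cc by (intro dif_antiadjoint cc_dif)
    finally have "\<bar>T n - T (Suc n)\<bar> = \<bar>\<integral>x. dif e (fn n) x * dif e (gn n) x \<partial>lborel\<bar>" by simp
    also have "\<dots> \<le> (\<integral>x. \<bar>dif e (gn n) x\<bar> * \<bar>dif e (fn n) x\<bar> \<partial>lborel)"
      using cc by (intro abs_integral_le cc_integrable cc_mult_left cc_dif cc_abs cc_continuous)
        (auto simp: abs_mult mult.commute)
    also have "\<dots> \<le> 8/3 * (E n - E (Suc n))"
    proof -
      have "E (Suc n) = (\<integral>x. bell (avgs es (avg e (gn n)) x) (avgs es (avg e (fn n)) x) \<partial>lborel)"
        by (simp add: E_def gn_def fn_def P_def)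
      also have "\<dots> \<le> (\<integral>x. bell (avg e (gn n) x) (avg e (fn n) x) \<partial>lborel)"
        using cc fnn by (intro integral_bell_avgs cc_avg) (auto simp: avg_def)
      finally show ?thesis
        using integral_bell_avg[OF cc(1)[of n] cc(3)[of n] fnn[of n], of e] by (simp add: E_def)
    qed
    finally show ?thesis .
  qed
  have bound: "\<bar>T 0\<bar> \<le> 8/3 * (E 0 - E n) + \<bar>T n\<bar>" for n
  proof (induction n)
    case (Suc n)
    have "\<bar>T n\<bar> \<le> \<bar>T n - T (Suc n)\<bar> + \<bar>T (Suc n)\<bar>" by linarith
    moreover have "8/3 * (E 0 - E (Suc n)) = 8/3 * (E 0 - E n) + 8/3 * (E n - E (Suc n))"
      by (simp add: right_diff_distrib)
    ultimately show ?case using step[of n] Suc by linarith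
  qed simp
  have En: "0 \<le> E n" for n
    unfolding E_def by (intro integral_nonneg_AE AE_I2 bell_le fnn)
  \<comment> \<open>Squared norms decrease along the iteration and each drop dominates the squared
    half difference. So the half differences of \<open>fn n\<close> and \<open>hn n\<close> tend to
    0 in the mean square, and with them \<open>T n\<close>.\<close>
  have lim: "(\<lambda>n. (\<integral>x. (dif e ((P ^^ n) u) x)\<^sup>2 \<partial>lborel)) \<longlonglongrightarrow> 0" if u: "cc u" for u
  proof -
    define A where "A n = (\<integral>x. ((P ^^ n) u x)\<^sup>2 \<partial>lborel)" for n
    have le: "(\<integral>x. (dif e ((P ^^ n) u) x)\<^sup>2 \<partial>lborel) \<le> A n - A (Suc n)" for n
    proof -
      have "A (Suc n) \<le> (\<integral>x. (avg e ((P ^^ n) u) x)\<^sup>2 \<partial>lborel)"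
        using integral_avgs_square_le[OF cc_avg[OF ccP[OF u]]] by (simp add: A_def P_def)
      then show ?thesis using integral_avg_square[OF ccP[OF u, of n], of e] by (simp add: A_def)
    qed
    have nn: "0 \<le> (\<integral>x. (dif e ((P ^^ n) u) x)\<^sup>2 \<partial>lborel)" for n
      by (intro integral_nonneg_AE) auto
    have "decseq A" by (rule decseq_SucI) (use le nn in \<open>metis diff_ge_0_iff_ge order_trans\<close>)
    moreover have "0 \<le> A n" for n by (simp add: A_def integral_nonneg_AE)
    ultimately obtain L where "A \<longlonglongrightarrow> L" by (metis decseq_convergent)
    then have "(\<lambda>n. A n - A (Suc n)) \<longlonglongrightarrow> L - L" by (intro tendsto_diff LIMSEQ_Suc)
    then have "(\<lambda>n. A n - A (Suc n)) \<longlonglongrightarrow> 0" by simp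
    from tendsto_sandwich[OF _ _ tendsto_const this] show ?thesis
      using le nn by (auto intro!: always_eventually)
  qed
  have Tle: "\<bar>T n\<bar> \<le> ((\<integral>x. (dif e (fn n) x)\<^sup>2 \<partial>lborel) + (\<integral>x. (dif e (hn n) x)\<^sup>2 \<partial>lborel)) / 2" for n
  proof -
    have "T n = - (\<integral>x. dif e (fn n) x * dif e (hn n) x \<partial>lborel)"
      unfolding T_def using cc by (intro dif_antiadjoint cc_dif)
    then have "\<bar>T n\<bar> = \<bar>\<integral>x. dif e (fn n) x * dif e (hn n) x \<partial>lborel\<bar>" by simp
    also have "\<dots> \<le> (\<integral>x. ((dif e (fn n) x)\<^sup>2 + (dif e (hn n) x)\<^sup>2) / 2 \<partial>lborel)"
    proof (rule abs_integral_le)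
      fix x
      show "\<bar>dif e (fn n) x * dif e (hn n) x\<bar> \<le> ((dif e (fn n) x)\<^sup>2 + (dif e (hn n) x)\<^sup>2) / 2"
        using sum_squares_bound[of "\<bar>dif e (fn n) x\<bar>" "\<bar>dif e (hn n) x\<bar>"] by (simp add: abs_mult)
    qed (use cc in \<open>auto intro!: cc_integrable cc_mult_left cc_divide cc_add cc_power cc_dif cc_continuous\<close>)
    also have "\<dots> = ((\<integral>x. (dif e (fn n) x)\<^sup>2 \<partial>lborel) + (\<integral>x. (dif e (hn n) x)\<^sup>2 \<partial>lborel)) / 2"
      using cc by (simp add: cc_integrable cc_power cc_dif)
    finally show ?thesis .
  qed
  have "(\<lambda>n. 8/3 * E 0 + ((\<integral>x. (dif e (fn n) x)\<^sup>2 \<partial>lborel) + (\<integral>x. (dif e (hn n) x)\<^sup>2 \<partial>lborel)) / 2) \<longlonglongrightarrow> 8/3 * E 0 + (0 + 0) / 2"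
    unfolding fn_def hn_def by (intro tendsto_intros lim f h) auto
  then have "\<bar>T 0\<bar> \<le> 8/3 * E 0 + (0 + 0) / 2"
  proof (rule tendsto_lowerbound)
    show "\<forall>\<^sub>F n in sequentially. \<bar>T 0\<bar> \<le> 8/3 * E 0 + ((\<integral>x. (dif e (fn n) x)\<^sup>2 \<partial>lborel) + (\<integral>x. (dif e (hn n) x)\<^sup>2 \<partial>lborel)) / 2"
    proof (intro always_eventually allI)
      fix n
      have "8/3 * (E 0 - E n) \<le> 8/3 * E 0" using En[of n] by simp
      then show "\<bar>T 0\<bar> \<le> 8/3 * E 0 + ((\<integral>x. (dif e (fn n) x)\<^sup>2 \<partial>lborel) + (\<integral>x. (dif e (hn n) x)\<^sup>2 \<partial>lborel)) / 2"
        using bound[of n] Tle[of n] by linarith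
    qed
  qed simp
  then show ?thesis by (simp add: T_def E_def fn_def hn_def gn_def g_def)
qed


section \<open>From second differences to second derivatives\<close>

lemma uniform_limit_avg:
  fixes u :: "real^'n::finite \<Rightarrow> real"
  assumes lim: "uniform_limit UNIV U u sequentially" and u: "cc u" and e: "\<epsilon> \<longlonglongrightarrow> (0::real)"
  shows "uniform_limit UNIV (\<lambda>n. avg (\<epsilon> n *\<^sub>R e) (U n)) u sequentially"
proof (rule uniform_limitI)
  fix d :: real assume d: "d > 0"
  then have d2: "d / 2 > 0" by simp
  obtain r where r: "r > 0" "\<And>x x'. dist x' x < r \<Longrightarrow> \<bar>u x' - u x\<bar> < d / 2"
    using cc_modulus[OF u d2] by blast
  have "(\<lambda>n. norm (\<epsilon> n *\<^sub>R e)) \<longlonglongrightarrow> norm (0 *\<^sub>R e)" by (intro tendsto_intros e)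
  then have "(\<lambda>n. norm (\<epsilon> n *\<^sub>R e)) \<longlonglongrightarrow> 0" by simp
  from order_tendstoD(2)[OF this r(1)] uniform_limitD[OF lim d2]
  show "\<forall>\<^sub>F n in sequentially. \<forall>x\<in>UNIV. dist (avg (\<epsilon> n *\<^sub>R e) (U n) x) (u x) < d"
  proof eventually_elim
    case (elim n)
    show ?case
    proof
      fix x
      let ?v = "\<epsilon> n *\<^sub>R e"
      have "\<bar>U n (x + ?v) - u (x + ?v)\<bar> < d / 2" "\<bar>U n (x - ?v) - u (x - ?v)\<bar> < d / 2"
        using elim(2) by (auto simp: dist_real_def)
      moreover have "\<bar>u (x + ?v) - u x\<bar> < d / 2" "\<bar>u (x - ?v) - u x\<bar> < d / 2"
        using elim(1) r(2)[of "x + ?v" x] r(2)[of "x - ?v" x] by (simp_all add: dist_norm)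
      ultimately show "dist (avg ?v (U n) x) (u x) < d"
        by (simp add: avg_def dist_real_def abs_if field_simps split: if_splits)
    qed
  qed
qed

lemma uniform_limit_avgs:
  fixes u :: "real^'n::finite \<Rightarrow> real"
  assumes "cc u" "\<epsilon> \<longlonglongrightarrow> (0::real)"
  shows "uniform_limit UNIV U u sequentially \<Longrightarrow>
    uniform_limit UNIV (\<lambda>n. avgs (map (\<lambda>e. \<epsilon> n *\<^sub>R e) es) (U n)) u sequentially"
proof (induction es arbitrary: U)
  case (Cons e es)
  show ?case using Cons.IH[OF uniform_limit_avg[OF Cons.prems assms]] by simp
qed simp

lemma supp_in_avg: "supp_in r f \<Longrightarrow> supp_in (r + norm e) (avg e f)"
  unfolding supp_in_def
proof (intro allI impI)
  fix x :: "real^'a" assume *: "\<forall>x. r < norm x \<longrightarrow> f x = 0" "r + norm e < norm x"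
  have "norm x - norm e \<le> norm (x + e)" "norm x - norm e \<le> norm (x - e)"
    using norm_diff_ineq[of x e] norm_triangle_ineq2[of x e] by auto
  then have "r < norm (x + e)" "r < norm (x - e)" using *(2) by linarith+
  then show "avg e f x = 0" using *(1) by (simp add: avg_def)
qed

lemma supp_in_avgs: "supp_in r f \<Longrightarrow> supp_in (r + (\<Sum>e\<leftarrow>es. norm e)) (avgs es f)"
proof (induction es arbitrary: r f)
  case (Cons e es)
  from Cons.IH[OF supp_in_avg[OF Cons.prems, of e]] show ?case by (simp add: add.assoc)
qed simp

text \<open>Applying \<open>dif\<close> twice reaches \<open>2 * \<epsilon> n\<close> to both sides
  with weight 1/4, so the factor 4 of the squared step cancels against the weight. Uniformity comes
  from the modulus of continuity of \<open>H\<close>.\<close>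

lemma second_difference_uniform_limit:
  fixes h :: "real^'n::finite \<Rightarrow> real"
  assumes d1: "\<And>x t. ((\<lambda>t. h (x + t *\<^sub>R e)) has_real_derivative h1 (x + t *\<^sub>R e)) (at t)"
    and d2: "\<And>x t. ((\<lambda>t. h1 (x + t *\<^sub>R e)) has_real_derivative H (x + t *\<^sub>R e)) (at t)"
    and H: "cc H" and e: "\<epsilon> \<longlonglongrightarrow> (0::real)" "\<And>n. \<epsilon> n > 0"
  shows "uniform_limit UNIV (\<lambda>n x. dif (\<epsilon> n *\<^sub>R e) (dif (\<epsilon> n *\<^sub>R e) h) x / (\<epsilon> n)\<^sup>2) H sequentially"
proof (rule uniform_limitI)
  fix d :: real assume d: "d > 0"
  obtain r where r: "r > 0" "\<And>x x'. dist x' x < r \<Longrightarrow> \<bar>H x' - H x\<bar> < d"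
    using cc_modulus[OF H d] by blast
  have "(\<lambda>n. 2 * \<epsilon> n * norm e) \<longlonglongrightarrow> 2 * 0 * norm e" by (intro tendsto_intros e)
  then have "(\<lambda>n. 2 * \<epsilon> n * norm e) \<longlonglongrightarrow> 0" by simp
  from order_tendstoD(2)[OF this r(1)]
  show "\<forall>\<^sub>F n in sequentially. \<forall>x\<in>UNIV. dist (dif (\<epsilon> n *\<^sub>R e) (dif (\<epsilon> n *\<^sub>R e) h) x / (\<epsilon> n)\<^sup>2) (H x) < d"
  proof eventually_elim
    case (elim n)
    show ?case
    proof
      fix x
      let ?t = "2 * \<epsilon> n"
      define D where "D m t = (if m = (0::nat) then h (x + t *\<^sub>R e) else if m = 1 then h1 (x + t *\<^sub>R e) else H (x + t *\<^sub>R e))" for m t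
      have dD: "((D m) has_real_derivative D (Suc m) t) (at t)" if "m < 2" for m t
      proof -
        have "m = 0 \<or> m = 1" using that by linarith
        then show ?thesis using d1 d2 by (auto simp: D_def[abs_def])
      qed
      have t: "?t > 0" using e(2) by simp
      obtain t1 where t1: "0 < t1" "t1 < ?t" "D 0 ?t = (\<Sum>m<2. D m 0 / fact m * (?t - 0) ^ m) + D 2 t1 / fact 2 * (?t - 0) ^ 2"
        using Taylor_up[of 2 D "D 0" 0 ?t 0] dD t by auto
      obtain t2 where t2: "-?t < t2" "t2 < 0" "D 0 (-?t) = (\<Sum>m<2. D m 0 / fact m * (-?t - 0) ^ m) + D 2 t2 / fact 2 * (-?t - 0) ^ 2"
        using Taylor_down[of 2 D "D 0" "-?t" 0 0] dD t by auto
      have "D 0 ?t = D 0 0 + D 1 0 * ?t + D 2 t1 / 2 * ?t ^ 2" "D 0 (-?t) = D 0 0 - D 1 0 * ?t + D 2 t2 / 2 * ?t ^ 2"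
        using t1(3) t2(3) by (simp_all add: numeral_2_eq_2)
      then have "D 0 ?t + D 0 (-?t) - 2 * D 0 0 = 2 * (D 2 t1 + D 2 t2) * (\<epsilon> n)\<^sup>2"
        by (simp add: power2_eq_square algebra_simps)
      moreover have "dif (\<epsilon> n *\<^sub>R e) (dif (\<epsilon> n *\<^sub>R e) h) x = (D 0 ?t + D 0 (-?t) - 2 * D 0 0) / 4"
        by (simp add: dif_def D_def scaleR_2 add.assoc algebra_simps flip: scaleR_scaleR) (simp add: field_simps)
      ultimately have eq: "dif (\<epsilon> n *\<^sub>R e) (dif (\<epsilon> n *\<^sub>R e) h) x / (\<epsilon> n)\<^sup>2 = (D 2 t1 + D 2 t2) / 2"
        using e(2)[of n] by (simp add: field_simps)
      have "\<bar>D 2 s - H x\<bar> < d" if "\<bar>s\<bar> < ?t" for s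
      proof -
        have "\<bar>s\<bar> * norm e \<le> ?t * norm e" using that by (intro mult_right_mono) auto
        then have "dist (x + s *\<^sub>R e) x < r" using elim by (simp add: dist_norm)
        from r(2)[OF this] show ?thesis by (simp add: D_def)
      qed
      from this[of t1] this[of t2] t1 t2 have "\<bar>D 2 t1 - H x\<bar> < d" "\<bar>D 2 t2 - H x\<bar> < d" by auto
      then show "dist (dif (\<epsilon> n *\<^sub>R e) (dif (\<epsilon> n *\<^sub>R e) h) x / (\<epsilon> n)\<^sup>2) (H x) < d"
        unfolding eq dist_real_def by (simp add: abs_if field_simps split: if_splits)
    qed
  qed
qed

text \<open>The squared averages minus the identity telescope over the directions: by
  \<open>dif_dif\<close> each direction contributes its second difference, smoothed by the averages
  in the remaining directions, and the smoothing disappears in the limit.\<close>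

lemma second_difference_avgs_uniform_limit:
  fixes h :: "real^'n::finite \<Rightarrow> real"
  assumes "\<epsilon> \<longlonglongrightarrow> (0::real)"
    and "\<And>e. e \<in> set es \<Longrightarrow> cc (H e) \<and>
      uniform_limit UNIV (\<lambda>n x. dif (\<epsilon> n *\<^sub>R e) (dif (\<epsilon> n *\<^sub>R e) h) x / (\<epsilon> n)\<^sup>2) (H e) sequentially"
  shows "uniform_limit UNIV (\<lambda>n x. (avgs (map (\<lambda>e. \<epsilon> n *\<^sub>R e) es) (avgs (map (\<lambda>e. \<epsilon> n *\<^sub>R e) es) h) x - h x) / (\<epsilon> n)\<^sup>2)
     (\<lambda>x. \<Sum>e\<leftarrow>es. H e x) sequentially"
  using assms(2)
proof (induction es)
  case Nil
  then show ?case by (simp add: uniform_limit_const)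
next
  case (Cons e es)
  let ?P = "\<lambda>n. avgs (map (\<lambda>e. \<epsilon> n *\<^sub>R e) es)"
  let ?q = "\<lambda>n x. dif (\<epsilon> n *\<^sub>R e) (dif (\<epsilon> n *\<^sub>R e) h) x / (\<epsilon> n)\<^sup>2"
  have 1: "uniform_limit UNIV (\<lambda>n. ?P n (?P n (?q n))) (H e) sequentially"
    using Cons.prems[of e] assms(1) by (intro uniform_limit_avgs) auto
  have "uniform_limit UNIV (\<lambda>n x. ?P n (?P n (?q n)) x + (?P n (?P n h) x - h x) / (\<epsilon> n)\<^sup>2)
     (\<lambda>x. H e x + (\<Sum>e\<leftarrow>es. H e x)) sequentially"
    using Cons by (intro uniform_limit_add 1) auto
  moreover have "?P n (?P n (?q n)) x + (?P n (?P n h) x - h x) / (\<epsilon> n)\<^sup>2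
     = (avgs (map (\<lambda>e. \<epsilon> n *\<^sub>R e) (e # es)) (avgs (map (\<lambda>e. \<epsilon> n *\<^sub>R e) (e # es)) h) x - h x) / (\<epsilon> n)\<^sup>2" for n x
  proof -
    have "avg (\<epsilon> n *\<^sub>R e) (avg (\<epsilon> n *\<^sub>R e) h) = (\<lambda>x. dif (\<epsilon> n *\<^sub>R e) (dif (\<epsilon> n *\<^sub>R e) h) x + h x)"
      by (simp add: dif_dif)
    then have "?P n (?P n (avg (\<epsilon> n *\<^sub>R e) (avg (\<epsilon> n *\<^sub>R e) h)))
        = (\<lambda>x. ?P n (?P n (dif (\<epsilon> n *\<^sub>R e) (dif (\<epsilon> n *\<^sub>R e) h))) x + ?P n (?P n h) x)"
      by (simp add: avgs_linear)
    then show ?thesis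
      by (simp add: avgs_avg avgs_linear add_divide_distrib diff_divide_distrib)
  qed
  ultimately show ?case by simp
qed


theorem second_derivative_test_bound:
  fixes f h :: "real^'n::finite \<Rightarrow> real" and H :: "real^'n \<Rightarrow> real^'n \<Rightarrow> real"
  assumes f: "cc f" "\<And>x. 0 \<le> f x" and h: "cc h"
    and d1: "\<And>e x t. e \<in> set (e0 # es) \<Longrightarrow> ((\<lambda>t. h (x + t *\<^sub>R e)) has_real_derivative h1 e (x + t *\<^sub>R e)) (at t)"
    and d2: "\<And>e x t. e \<in> set (e0 # es) \<Longrightarrow> ((\<lambda>t. h1 e (x + t *\<^sub>R e)) has_real_derivative H e (x + t *\<^sub>R e)) (at t)"
    and H: "\<And>e. e \<in> set (e0 # es) \<Longrightarrow> cc (H e)"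
  shows "\<bar>\<integral>x. f x * H e0 x \<partial>lborel\<bar> \<le> 8/3 * (\<integral>x. bell (\<Sum>e\<leftarrow>e0 # es. H e x) (f x) \<partial>lborel)"
proof -
  define \<epsilon> where "\<epsilon> n = inverse (real (Suc n))" for n
  have e: "\<epsilon> \<longlonglongrightarrow> 0" "\<And>n. \<epsilon> n > 0" "\<And>n. \<epsilon> n \<le> 1"
    unfolding \<epsilon>_def by (rule LIMSEQ_inverse_real_of_nat) (auto simp: field_simps)
  define D where "D x = (\<Sum>e\<leftarrow>e0 # es. H e x)" for x
  define P where "P n = avgs (map (\<lambda>e. \<epsilon> n *\<^sub>R e) (e0 # es))" for n
  define q where "q n x = (P n (P n h) x - h x) / (\<epsilon> n)\<^sup>2" for n x
  define p where "p n x = dif (\<epsilon> n *\<^sub>R e0) (dif (\<epsilon> n *\<^sub>R e0) h) x / (\<epsilon> n)\<^sup>2" for n x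
  have ul: "uniform_limit UNIV (\<lambda>n x. dif (\<epsilon> n *\<^sub>R e) (dif (\<epsilon> n *\<^sub>R e) h) x / (\<epsilon> n)\<^sup>2) (H e) sequentially"
    if "e \<in> set (e0 # es)" for e
    using second_difference_uniform_limit[OF d1[OF that] d2[OF that] H[OF that] e(1,2)] .
  have pl: "uniform_limit UNIV p (H e0) sequentially"
    unfolding p_def[abs_def] by (rule ul) simp
  have ql: "uniform_limit UNIV q D sequentially"
    unfolding q_def[abs_def] D_def[abs_def] P_def
    by (rule second_difference_avgs_uniform_limit[OF e(1)]) (use ul H in blast)
  have ccD: "cc D"
  proof -
    have "(\<And>e. e \<in> set xs \<Longrightarrow> cc (H e)) \<Longrightarrow> cc (\<lambda>x. \<Sum>e\<leftarrow>xs. H e x)" for xs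
      by (induction xs) (auto intro: cc_zero cc_add)
    then show ?thesis using H unfolding D_def[abs_def] by blast
  qed
  have ccp: "cc (p n)" and ccq: "cc (q n)" for n
    unfolding p_def[abs_def] q_def[abs_def] P_def by (intro cc_divide cc_diff cc_dif cc_avgs h)+
  have bound: "\<bar>\<integral>x. f x * p n x \<partial>lborel\<bar> \<le> 8/3 * (\<integral>x. bell (q n x) (f x) \<partial>lborel)" for n
  proof -
    have "cc (\<lambda>x. h x / (\<epsilon> n)\<^sup>2)" by (intro cc_divide h)
    from discrete_second_difference_bound[OF f this, of "\<epsilon> n *\<^sub>R e0" "map (\<lambda>e. \<epsilon> n *\<^sub>R e) es"]
    show ?thesis
      unfolding p_def q_def P_def avgs_linear dif_linear by (simp add: diff_divide_distrib)
  qed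
  obtain r where r: "supp_in r h" using h by (auto simp: cc_def)
  obtain r2 where r2: "supp_in r2 f" using f by (auto simp: cc_def)
  define N where "N = (\<Sum>e\<leftarrow>e0 # es. norm e)"
  define S where "S = max (r + 2 * N) r2"
  have N0: "0 \<le> N" unfolding N_def by (intro sum_list_nonneg) auto
  \<comment> \<open>Steps are at most 1, so the supports of all \<open>q n\<close> stay in one ball,
    as dominated convergence requires.\<close>
  have qS: "q n x = 0" if "S < norm x" for n x
  proof -
    have eq: "(\<Sum>e\<leftarrow>map (\<lambda>e. \<epsilon> n *\<^sub>R e) xs. norm e) = \<epsilon> n * (\<Sum>e\<leftarrow>xs. norm e)" for xs :: "(real^'n) list"
      using e(2)[of n] by (induction xs) (auto simp: algebra_simps)
    have "\<epsilon> n * N \<le> N" using e(2,3)[of n] N0 by (simp add: mult_left_le_one_le)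
    moreover have "supp_in (r + \<epsilon> n * N + \<epsilon> n * N) (P n (P n h))"
      using supp_in_avgs[OF supp_in_avgs[OF r], of "map (\<lambda>e. \<epsilon> n *\<^sub>R e) (e0 # es)" "map (\<lambda>e. \<epsilon> n *\<^sub>R e) (e0 # es)"]
      unfolding eq P_def N_def .
    moreover have "r + 2 * N < norm x" using that by (simp add: S_def)
    moreover have "r < norm x" using \<open>r + 2 * N < norm x\<close> N0 by linarith
    ultimately have "P n (P n h) x = 0" "h x = 0"
      using r unfolding supp_in_def by (smt (verit))+
    then show ?thesis by (simp add: q_def)
  qed
  obtain BD Bf where B: "BD > 0" "\<And>x. \<bar>D x\<bar> \<le> BD" "Bf > 0" "\<And>x. \<bar>f x\<bar> \<le> Bf"
    using cc_bounded[OF ccD] cc_bounded[OF f(1)] by metis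
  \<comment> \<open>Discarding the first \<open>n0\<close> terms makes \<open>q\<close> uniformly
    bounded by \<open>BD + 1\<close>.\<close>
  obtain n0 where n0: "\<And>n x. n \<ge> n0 \<Longrightarrow> \<bar>q n x - D x\<bar> < 1"
    using uniform_limitD[OF ql, of 1] by (auto simp: eventually_sequentially dist_real_def)
  have "(\<lambda>n. \<integral>x. bell (q (n + n0) x) (f x) \<partial>lborel) \<longlonglongrightarrow> (\<integral>x. bell (D x) (f x) \<partial>lborel)"
  proof (rule integral_dominated_convergence[where w = "\<lambda>x. bell (BD + 1) Bf * indicator (cball 0 S) x"])
    show "(\<lambda>x. bell (D x) (f x)) \<in> borel_measurable lborel" "(\<lambda>x. bell (q (n + n0) x) (f x)) \<in> borel_measurable lborel" for n
      using f ccD ccq by (auto intro!: cc_measurable cc_bell)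
    show "integrable lborel (\<lambda>x. bell (BD + 1) Bf * indicator (cball (0::real^'n) S) x :: real)"
      by (intro integrable_mult_right integrable_real_indicator) (auto intro!: emeasure_bounded_finite[unfolded infinity_ennreal_def])
    show "AE x in lborel. (\<lambda>n. bell (q (n + n0) x) (f x)) \<longlonglongrightarrow> bell (D x) (f x)"
    proof (rule AE_I2)
      fix x
      have "(\<lambda>n. q n x) \<longlonglongrightarrow> D x" using tendsto_uniform_limitI[OF ql] by simp
      then have "(\<lambda>n. q (n + n0) x) \<longlonglongrightarrow> D x" by (rule LIMSEQ_ignore_initial_segment)
      then show "(\<lambda>n. bell (q (n + n0) x) (f x)) \<longlonglongrightarrow> bell (D x) (f x)"
        unfolding bell_def by (intro tendsto_intros)
    qed
    show "AE x in lborel. norm (bell (q (n + n0) x) (f x)) \<le> bell (BD + 1) Bf * indicator (cball 0 S) x" for n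
    proof (rule AE_I2)
      fix x
      show "norm (bell (q (n + n0) x) (f x)) \<le> bell (BD + 1) Bf * indicator (cball 0 S) x"
      proof (cases "norm x \<le> S")
        case True
        have "\<bar>q (n + n0) x\<bar> \<le> BD + 1" using n0[of "n + n0" x] B(2)[of x] by linarith
        then have "(q (n + n0) x)\<^sup>2 \<le> (BD + 1)\<^sup>2" using abs_le_square_iff[of "q (n + n0) x" "BD + 1"] by linarith
        moreover have "f x \<le> Bf" using B(4)[of x] by simp
        ultimately have "(q (n + n0) x)\<^sup>2 + f x \<le> (BD + 1)\<^sup>2 + Bf" by simp
        then have "bell (q (n + n0) x) (f x) \<le> bell (BD + 1) Bf"
          unfolding bell_def using f(2)[of x] B(3) by (intro mult_mono) (auto intro!: add_nonneg_nonneg)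
        then show ?thesis using True bell_le(1)[OF f(2)[of x], of "q (n + n0) x"] by simp
      next
        case False
        then have "q (n + n0) x = 0" by (intro qS) simp
        moreover have "f x = 0" using False r2 by (auto simp: S_def supp_in_def)
        ultimately show ?thesis using False by (simp add: bell_def)
      qed
    qed
  qed
  then have lim1: "(\<lambda>n. 8/3 * (\<integral>x. bell (q (n + n0) x) (f x) \<partial>lborel)) \<longlonglongrightarrow> 8/3 * (\<integral>x. bell (D x) (f x) \<partial>lborel)"
    by (intro tendsto_intros)
  have lim2: "(\<lambda>n. \<bar>\<integral>x. f x * p (n + n0) x \<partial>lborel\<bar>) \<longlonglongrightarrow> \<bar>\<integral>x. f x * H e0 x \<partial>lborel\<bar>"
  proof (intro tendsto_intros)
    have "(\<lambda>n. \<integral>x. f x * p n x \<partial>lborel) \<longlonglongrightarrow> (\<integral>x. f x * H e0 x \<partial>lborel)"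
    proof (rule LIMSEQ_I)
      fix d :: real assume d: "d > 0"
      define I where "I = (\<integral>x. \<bar>f x\<bar> \<partial>lborel)"
      have I: "I \<ge> 0" by (simp add: I_def)
      then have d1: "d / (I + 1) > 0" using d by simp
      obtain n1 where n1: "\<And>n x. n \<ge> n1 \<Longrightarrow> \<bar>p n x - H e0 x\<bar> < d / (I + 1)"
        using uniform_limitD[OF pl d1] by (auto simp: eventually_sequentially dist_real_def)
      have "norm ((\<integral>x. f x * p n x \<partial>lborel) - (\<integral>x. f x * H e0 x \<partial>lborel)) < d" if n: "n \<ge> n1" for n
      proof -
        have cH: "cc (H e0)" using H by simp
        have "\<bar>(\<integral>x. f x * p n x \<partial>lborel) - (\<integral>x. f x * H e0 x \<partial>lborel)\<bar> = \<bar>\<integral>x. f x * (p n x - H e0 x) \<partial>lborel\<bar>"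
          using f ccp cH unfolding right_diff_distrib
          by (subst Bochner_Integration.integral_diff) (auto intro!: cc_integrable cc_mult_left cc_continuous)
        also have "\<dots> \<le> (\<integral>x. d / (I + 1) * \<bar>f x\<bar> \<partial>lborel)"
        proof (rule abs_integral_le)
          fix x
          show "\<bar>f x * (p n x - H e0 x)\<bar> \<le> d / (I + 1) * \<bar>f x\<bar>"
            unfolding abs_mult mult.commute[of "\<bar>f x\<bar>"] using n1[OF n, of x] by (intro mult_right_mono) auto
        qed (use f ccp cH in \<open>auto intro!: cc_integrable cc_mult_left cc_cmult cc_abs cc_diff cc_continuous cc_divide\<close>)
        also have "\<dots> = d * (I / (I + 1))" by (simp add: I_def)
        also have "\<dots> < d" using I d by (simp add: field_simps)
        finally show ?thesis by simp
      qed
      then show "\<exists>no. \<forall>n\<ge>no. norm ((\<integral>x. f x * p n x \<partial>lborel) - (\<integral>x. f x * H e0 x \<partial>lborel)) < d" by blast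
    qed
    then show "(\<lambda>n. \<integral>x. f x * p (n + n0) x \<partial>lborel) \<longlonglongrightarrow> (\<integral>x. f x * H e0 x \<partial>lborel)"
      by (rule LIMSEQ_ignore_initial_segment)
  qed
  show ?thesis
    using LIMSEQ_le[OF lim2 lim1] bound by (auto simp: D_def)
qed


text \<open>Test with \<open>(F / 16)\<^sup>2\<close>, where \<open>F\<close> is the positive part
  of the derivative. The left side becomes 1/256 of the cube to be bounded, while
  \<open>bell\<close> returns the same cube with coefficient 1/512, which is absorbed.\<close>

lemma second_derivative_cube_pos_part:
  fixes h :: "real^'n::finite \<Rightarrow> real" and H :: "real^'n \<Rightarrow> real^'n \<Rightarrow> real"
  assumes h: "cc h"
    and d1: "\<And>e x t. e \<in> set (e0 # es) \<Longrightarrow> ((\<lambda>t. h (x + t *\<^sub>R e)) has_real_derivative h1 e (x + t *\<^sub>R e)) (at t)"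
    and d2: "\<And>e x t. e \<in> set (e0 # es) \<Longrightarrow> ((\<lambda>t. h1 e (x + t *\<^sub>R e)) has_real_derivative H e (x + t *\<^sub>R e)) (at t)"
    and H: "\<And>e. e \<in> set (e0 # es) \<Longrightarrow> cc (H e)"
  shows "(\<integral>x. (max 0 (H e0 x)) ^ 3 \<partial>lborel) \<le> 4096 * (\<integral>x. \<bar>\<Sum>e\<leftarrow>e0 # es. H e x\<bar> ^ 3 \<partial>lborel)"
proof -
  define D where "D x = (\<Sum>e\<leftarrow>e0 # es. H e x)" for x
  have ccD: "cc D"
  proof -
    have "(\<And>e. e \<in> set xs \<Longrightarrow> cc (H e)) \<Longrightarrow> cc (\<lambda>x. \<Sum>e\<leftarrow>xs. H e x)" for xs
      by (induction xs) (auto intro: cc_zero cc_add)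
    then show ?thesis using H unfolding D_def[abs_def] by blast
  qed
  define F where "F x = max 0 (H e0 x)" for x
  have F: "cc F" "\<And>x. 0 \<le> F x"
    unfolding F_def[abs_def] using H
    by (auto intro!: cc_comp[where q = "max 0"] continuous_intros)
  have F3: "cc (\<lambda>x. F x ^ 3)" "cc (\<lambda>x. \<bar>D x\<bar> ^ 3)" using F ccD by (auto intro!: cc_power cc_abs)
  define f where "f x = (F x / 16)\<^sup>2" for x
  have f: "cc f" "\<And>x. 0 \<le> f x" unfolding f_def[abs_def] using F by (auto intro!: cc_power cc_divide)
  have "(\<integral>x. f x * H e0 x \<partial>lborel) = (\<integral>x. F x ^ 3 / 256 \<partial>lborel)"
    by (rule Bochner_Integration.integral_cong)
       (auto simp: f_def F_def max_def power2_eq_square power3_eq_cube)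
  moreover have "(\<integral>x. bell (D x) (f x) \<partial>lborel) \<le> (\<integral>x. 3 * (\<bar>D x\<bar> ^ 3 + F x ^ 3 / 4096) \<partial>lborel)"
  proof (intro integral_mono cc_integrable cc_bell f ccD cc_cmult cc_add cc_divide F3)
    fix x
    show "bell (D x) (f x) \<le> 3 * (\<bar>D x\<bar> ^ 3 + F x ^ 3 / 4096)"
      using bell_le(2)[of "F x / 16" "D x"] F(2)[of x] by (simp add: f_def power_divide)
  qed
  moreover have "\<bar>\<integral>x. f x * H e0 x \<partial>lborel\<bar> \<le> 8/3 * (\<integral>x. bell (D x) (f x) \<partial>lborel)"
    unfolding D_def using second_derivative_test_bound[where ?h1.0 = h1, OF f h d1 d2 H] by blast
  moreover have "(\<integral>x. 3 * (\<bar>D x\<bar> ^ 3 + F x ^ 3 / 4096) \<partial>lborel)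
      = 3 * (\<integral>x. \<bar>D x\<bar> ^ 3 \<partial>lborel) + 3/4096 * (\<integral>x. F x ^ 3 \<partial>lborel)"
    using F3 by (simp add: cc_integrable cc_divide)
  moreover have "(\<integral>x. F x ^ 3 / 256 \<partial>lborel) = (\<integral>x. F x ^ 3 \<partial>lborel) / 256" by simp
  ultimately have "(\<integral>x. F x ^ 3 \<partial>lborel) \<le> 4096 * (\<integral>x. \<bar>D x\<bar> ^ 3 \<partial>lborel)" by linarith
  then show ?thesis by (simp add: F_def D_def)
qed

theorem second_derivative_cube_le:
  fixes h :: "real^'n::finite \<Rightarrow> real" and H :: "real^'n \<Rightarrow> real^'n \<Rightarrow> real"
  assumes h: "cc h"
    and d1: "\<And>e x t. e \<in> set (e0 # es) \<Longrightarrow> ((\<lambda>t. h (x + t *\<^sub>R e)) has_real_derivative h1 e (x + t *\<^sub>R e)) (at t)"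
    and d2: "\<And>e x t. e \<in> set (e0 # es) \<Longrightarrow> ((\<lambda>t. h1 e (x + t *\<^sub>R e)) has_real_derivative H e (x + t *\<^sub>R e)) (at t)"
    and H: "\<And>e. e \<in> set (e0 # es) \<Longrightarrow> cc (H e)"
  shows "(\<integral>x. \<bar>H e0 x\<bar> ^ 3 \<partial>lborel) \<le> 8192 * (\<integral>x. \<bar>\<Sum>e\<leftarrow>e0 # es. H e x\<bar> ^ 3 \<partial>lborel)"
proof -
  have 1: "(\<integral>x. (max 0 (H e0 x)) ^ 3 \<partial>lborel) \<le> 4096 * (\<integral>x. \<bar>\<Sum>e\<leftarrow>e0 # es. H e x\<bar> ^ 3 \<partial>lborel)"
    using second_derivative_cube_pos_part[where ?h1.0 = h1, OF h d1 d2 H] by blast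
  have 2: "(\<integral>x. (max 0 (- H e0 x)) ^ 3 \<partial>lborel) \<le> 4096 * (\<integral>x. \<bar>\<Sum>e\<leftarrow>e0 # es. - H e x\<bar> ^ 3 \<partial>lborel)"
    using second_derivative_cube_pos_part[where ?h1.0 = "\<lambda>e x. - h1 e x" and H = "\<lambda>e x. - H e x",
        OF cc_uminus[OF h] DERIV_minus[OF d1] DERIV_minus[OF d2] cc_uminus[OF H]] by blast
  have cc: "cc (\<lambda>x. (max 0 (H e0 x)) ^ 3)" "cc (\<lambda>x. (max 0 (- H e0 x)) ^ 3)"
    using H by (auto intro!: cc_power cc_comp[where q = "max 0"] cc_comp[where q = "\<lambda>t. max 0 (- t)"] continuous_intros)
  have "(\<integral>x. \<bar>H e0 x\<bar> ^ 3 \<partial>lborel) = (\<integral>x. (max 0 (H e0 x)) ^ 3 + (max 0 (- H e0 x)) ^ 3 \<partial>lborel)"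
    by (rule Bochner_Integration.integral_cong) (auto simp: max_def abs_if)
  also have "\<dots> = (\<integral>x. (max 0 (H e0 x)) ^ 3 \<partial>lborel) + (\<integral>x. (max 0 (- H e0 x)) ^ 3 \<partial>lborel)"
    using cc by (simp add: cc_integrable)
  moreover have "\<bar>\<Sum>e\<leftarrow>xs. - H e x\<bar> = \<bar>\<Sum>e\<leftarrow>xs. H e x\<bar>" for xs x
  proof -
    have "(\<Sum>e\<leftarrow>xs. - H e x) = - (\<Sum>e\<leftarrow>xs. H e x)" by (induction xs) auto
    then show ?thesis by simp
  qed
  ultimately show ?thesis using 1 2 unfolding \<open>\<And>xs x. \<bar>\<Sum>e\<leftarrow>xs. - H e x\<bar> = \<bar>\<Sum>e\<leftarrow>xs. H e x\<bar>\<close> by linarith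
qed

lemma C1_directional:
  fixes h :: "real^'n::finite \<Rightarrow> real"
  assumes "C1 h" "\<And>j. C1 (partial j h)"
  defines "h1 \<equiv> \<lambda>e x. \<Sum>j\<in>UNIV. e $ j * partial j h x"
    and "H \<equiv> \<lambda>e x. \<Sum>j\<in>UNIV. \<Sum>i\<in>UNIV. e $ j * (e $ i * partial i (partial j h) x)"
  shows "((\<lambda>t. h (x + t *\<^sub>R e)) has_real_derivative h1 e (x + t *\<^sub>R e)) (at t)"
    "((\<lambda>t. h1 e (x + t *\<^sub>R e)) has_real_derivative H e (x + t *\<^sub>R e)) (at t)"
proof -
  show "((\<lambda>t. h (x + t *\<^sub>R e)) has_real_derivative h1 e (x + t *\<^sub>R e)) (at t)"
    unfolding h1_def by (rule C1_line[OF assms(1)])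
  have "((\<lambda>t. \<Sum>j\<in>UNIV. e $ j * partial j h (x + t *\<^sub>R e)) has_real_derivative
      (\<Sum>j\<in>UNIV. e $ j * (\<Sum>i\<in>UNIV. e $ i * partial i (partial j h) (x + t *\<^sub>R e)))) (at t)"
    by (intro DERIV_sum DERIV_cmult C1_line[OF assms(2)])
  then show "((\<lambda>t. h1 e (x + t *\<^sub>R e)) has_real_derivative H e (x + t *\<^sub>R e)) (at t)"
    by (simp add: h1_def H_def sum_distrib_left)
qed

lemma sum_axis_pair:
  fixes f :: "'n::finite \<Rightarrow> 'n \<Rightarrow> real" and i j :: 'n
  assumes "i \<noteq> j" "c = 1 \<or> c = - 1"
  shows "(\<Sum>k\<in>UNIV. \<Sum>l\<in>UNIV. (axis i 1 + c *\<^sub>R axis j 1) $ k * ((axis i 1 + c *\<^sub>R axis j 1) $ l * f l k))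
    = f i i + f j j + c * (f i j + f j i)"
proof -
  have 1: "(\<Sum>l\<in>UNIV. (axis i 1 + c *\<^sub>R axis j 1) $ l * g l) = g i + c * g j" for g :: "'n \<Rightarrow> real"
    by (simp add: distrib_right sum.distrib sum_axis mult.assoc flip: sum_distrib_left)
  show ?thesis
    unfolding sum_distrib_left[symmetric] 1 using assms(2) by (auto simp: algebra_simps)
qed

text \<open>Polarisation: half the difference of the second derivatives along the two diagonals of
  the \<open>i\<close>, \<open>j\<close> plane is the symmetrised mixed derivative.\<close>

theorem mixed_second_derivative_cube_le:
  fixes h :: "real^'n::finite \<Rightarrow> real"
  assumes h: "C1 h" "\<And>j. C1 (partial j h)" "cc h"
  shows "(\<integral>x. \<bar>partial i (partial j h) x + partial j (partial i h) x\<bar> ^ 3 \<partial>lborel)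
    \<le> 65536 * (\<integral>x. \<bar>\<Sum>l\<in>UNIV. partial l (partial l h) x\<bar> ^ 3 \<partial>lborel)"
proof -
  define L where "L x = (\<Sum>l\<in>UNIV. partial l (partial l h) x)" for x
  define h1 where "h1 = (\<lambda>e x. \<Sum>j\<in>UNIV. e $ j * partial j h x)"
  define H where "H = (\<lambda>e x. \<Sum>j\<in>UNIV. \<Sum>i\<in>UNIV. e $ j * (e $ i * partial i (partial j h) x))"
  note d = C1_directional[OF h(1,2), folded h1_def H_def]
  have cc2: "cc (partial i (partial j h))" for i j
    using h by (intro cc_partial)
  have ccH: "cc (H e)" for e
    unfolding H_def by (intro cc_sum cc_cmult cc2)
  have main: "(\<integral>x. \<bar>H e0 x\<bar> ^ 3 \<partial>lborel) \<le> 8192 * (\<integral>x. \<bar>\<Sum>e\<leftarrow>e0 # es. H e x\<bar> ^ 3 \<partial>lborel)" for e0 es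
    using second_derivative_cube_le[where ?h1.0 = h1 and H = H and h = h] h(3) d ccH
    unfolding h1_def H_def by blast
  have Hax: "H (axis l 1) x = partial l (partial l h) x" for l x
    unfolding H_def sum_distrib_left[symmetric] sum_axis ..
  have sumax: "(\<Sum>e\<leftarrow>map (\<lambda>l. axis l 1) xs. H e x) = (\<Sum>l\<in>set xs. partial l (partial l h) x)"
    if "distinct xs" for xs x
    using that by (simp add: Hax o_def sum_list_distinct_conv_sum_set)
  have L3: "cc (\<lambda>x. \<bar>L x\<bar> ^ 3)" unfolding L_def[abs_def] by (intro cc_power cc_abs cc_sum cc2) auto
  show ?thesis
  proof (cases "i = j")
    case True
    obtain xs where xs: "set xs = UNIV - {i}" "distinct xs"
      using finite_distinct_list[of "UNIV - {i}"] by auto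
    have "(\<Sum>e\<leftarrow>axis i 1 # map (\<lambda>l. axis l 1) xs. H e x) = L x" for x
    proof -
      have "L x = partial i (partial i h) x + (\<Sum>l\<in>UNIV - {i}. partial l (partial l h) x)"
        unfolding L_def by (subst sum.remove[of UNIV i]) auto
      then show ?thesis using sumax[OF xs(2), of x] by (simp add: xs Hax)
    qed
    then have "(\<integral>x. \<bar>partial i (partial i h) x\<bar> ^ 3 \<partial>lborel) \<le> 8192 * (\<integral>x. \<bar>L x\<bar> ^ 3 \<partial>lborel)"
      using main[of "axis i 1" "map (\<lambda>l. axis l 1) xs"] by (simp add: Hax)
    then show ?thesis using True by (simp add: L_def power_mult_distrib abs_mult flip: mult_2)
  next
    case False
    obtain xs where xs: "set xs = UNIV - {i, j}" "distinct xs"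
      using finite_distinct_list[of "UNIV - {i, j}"] by auto
    define v :: "real \<Rightarrow> real^'n" where "v c = axis i 1 + c *\<^sub>R axis j 1" for c
    have Hv: "H (v c) x = partial i (partial i h) x + partial j (partial j h) x
        + c * (partial i (partial j h) x + partial j (partial i h) x)" if "c = 1 \<or> c = -1" for c x
      unfolding H_def v_def by (rule sum_axis_pair[OF False that])
    have Lx: "L x = partial i (partial i h) x + partial j (partial j h) x + (\<Sum>l\<in>UNIV - {i, j}. partial l (partial l h) x)" for x
    proof -
      have "L x = partial i (partial i h) x + (\<Sum>l\<in>UNIV - {i}. partial l (partial l h) x)"
        unfolding L_def by (subst sum.remove[of UNIV i]) auto
      also have "(\<Sum>l\<in>UNIV - {i}. partial l (partial l h) x) = partial j (partial j h) x + (\<Sum>l\<in>UNIV - {i} - {j}. partial l (partial l h) x)"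
        using False by (subst sum.remove[of "UNIV - {i}" j]) auto
      also have "UNIV - {i} - {j} = UNIV - {i, j}" by auto
      finally show ?thesis by simp
    qed
    \<comment> \<open>The two diagonals together contribute twice the pure derivatives in
      \<open>i\<close> and \<open>j\<close>; listing the other axes twice completes the sum to twice
      the Laplacian, whence the extra factor 8.\<close>
    have b: "(\<integral>x. \<bar>H (v c) x\<bar> ^ 3 \<partial>lborel) \<le> 65536 * (\<integral>x. \<bar>L x\<bar> ^ 3 \<partial>lborel)" if c: "c = 1 \<or> c = -1" for c
    proof -
      have c': "- c = 1 \<or> - c = -1" using c by auto
      have "(\<Sum>e\<leftarrow>v c # (v (- c) # (map (\<lambda>l. axis l 1) xs @ map (\<lambda>l. axis l 1) xs)). H e x) = 2 * L x" for x
        using sumax[OF xs(2), of x] by (simp add: xs Hv[OF c] Hv[OF c'] Lx)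
      then show ?thesis
        using main[of "v c" "v (- c) # (map (\<lambda>l. axis l 1) xs @ map (\<lambda>l. axis l 1) xs)"]
        by (simp add: abs_mult power_mult_distrib)
    qed
    have "(\<integral>x. \<bar>partial i (partial j h) x + partial j (partial i h) x\<bar> ^ 3 \<partial>lborel)
      \<le> (\<integral>x. (\<bar>H (v 1) x\<bar> ^ 3 + \<bar>H (v (-1)) x\<bar> ^ 3) / 2 \<partial>lborel)"
    proof (intro integral_mono cc_integrable cc_power cc_abs cc_add cc2 cc_divide ccH)
      fix x
      let ?a = "H (v 1) x" and ?b = "H (v (-1)) x"
      have eq: "partial i (partial j h) x + partial j (partial i h) x = (?a - ?b) / 2"
        by (simp add: Hv)
      have "\<bar>?a - ?b\<bar> ^ 3 \<le> (\<bar>?a\<bar> + \<bar>?b\<bar>) ^ 3" by (intro power_mono) auto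
      also have "\<dots> \<le> 4 * (\<bar>?a\<bar> ^ 3 + \<bar>?b\<bar> ^ 3)"
      proof -
        have "0 \<le> 3 * (\<bar>?a\<bar> + \<bar>?b\<bar>) * (\<bar>?a\<bar> - \<bar>?b\<bar>)\<^sup>2" by simp
        also have "\<dots> = 4 * (\<bar>?a\<bar> ^ 3 + \<bar>?b\<bar> ^ 3) - (\<bar>?a\<bar> + \<bar>?b\<bar>) ^ 3" by algebra
        finally show ?thesis by simp
      qed
      finally show "\<bar>partial i (partial j h) x + partial j (partial i h) x\<bar> ^ 3 \<le> (\<bar>?a\<bar> ^ 3 + \<bar>?b\<bar> ^ 3) / 2"
        unfolding eq by (simp add: power_divide)
    qed auto
    also have "\<dots> = ((\<integral>x. \<bar>H (v 1) x\<bar> ^ 3 \<partial>lborel) + (\<integral>x. \<bar>H (v (-1)) x\<bar> ^ 3 \<partial>lborel)) / 2"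
      by (simp add: cc_integrable cc_power cc_abs ccH)
    finally show ?thesis using b[of 1] b[of "-1"] by (simp add: L_def)
  qed
qed

subsection \<open>Hoelder and Sobolev inequalities\<close>

text \<open>Weighted sum of \<open>ln t \<le> t - 1\<close> at \<open>t = x / M\<close> with
  \<open>M\<close> the geometric mean: the logarithms add up to zero.\<close>

lemma amgm4:
  fixes x1 x2 x3 x4 a1 a2 a3 a4 :: real
  assumes a: "0 \<le> a1" "0 \<le> a2" "0 \<le> a3" "0 \<le> a4" "a1 + a2 + a3 + a4 = 1"
    and x: "0 \<le> x1" "0 \<le> x2" "0 \<le> x3" "0 \<le> x4"
  shows "x1 powr a1 * x2 powr a2 * x3 powr a3 * x4 powr a4 \<le> a1 * x1 + a2 * x2 + a3 * x3 + a4 * x4"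
proof (cases "x1 = 0 \<or> x2 = 0 \<or> x3 = 0 \<or> x4 = 0")
  case True
  then have "x1 powr a1 * x2 powr a2 * x3 powr a3 * x4 powr a4 = 0" by auto
  moreover have "0 \<le> a1 * x1 + a2 * x2 + a3 * x3 + a4 * x4"
    using a x by (intro add_nonneg_nonneg mult_nonneg_nonneg)
  ultimately show ?thesis by linarith
next
  case False
  then have pos: "0 < x1" "0 < x2" "0 < x3" "0 < x4" using x by auto
  define M where "M = x1 powr a1 * x2 powr a2 * x3 powr a3 * x4 powr a4"
  have M: "M > 0" using pos by (simp add: M_def)
  have lnM: "ln M = a1 * ln x1 + a2 * ln x2 + a3 * ln x3 + a4 * ln x4"
    using pos by (simp add: M_def ln_mult ln_powr)
  have l: "a * (1 + ln t - ln M) \<le> a * (t / M)" if "a \<ge> 0" "t > 0" for a t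
    using ln_le_minus_one[of "t / M"] that M by (intro mult_left_mono) (auto simp: ln_div)
  have "a1 * (1 + ln x1 - ln M) + a2 * (1 + ln x2 - ln M) + a3 * (1 + ln x3 - ln M) + a4 * (1 + ln x4 - ln M)
      \<le> a1 * (x1 / M) + a2 * (x2 / M) + a3 * (x3 / M) + a4 * (x4 / M)"
    using l[OF a(1) pos(1)] l[OF a(2) pos(2)] l[OF a(3) pos(3)] l[OF a(4) pos(4)] by linarith
  also have "\<dots> = (a1 * x1 + a2 * x2 + a3 * x3 + a4 * x4) / M" by (simp add: add_divide_distrib)
  also have "a1 * (1 + ln x1 - ln M) + a2 * (1 + ln x2 - ln M) + a3 * (1 + ln x3 - ln M) + a4 * (1 + ln x4 - ln M)
     = (a1 + a2 + a3 + a4) * (1 - ln M) + ln M"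
    unfolding lnM by (simp add: algebra_simps)
  finally have "1 \<le> (a1 * x1 + a2 * x2 + a3 * x3 + a4 * x4) / M" using a(5) by simp
  then show ?thesis unfolding M_def[symmetric] using M by (simp add: field_simps)
qed

text \<open>Arithmetic-geometric mean after division by the constants \<open>J1\<close> to
  \<open>J4\<close>. These are positive upper bounds rather than the integrals themselves, which
  excludes division by zero.\<close>

lemma holder4:
  fixes f1 f2 f3 f4 :: "'a \<Rightarrow> real"
  assumes a: "0 \<le> a1" "0 \<le> a2" "0 \<le> a3" "0 \<le> a4" "a1 + a2 + a3 + a4 = 1"
    and f: "\<And>x. 0 \<le> f1 x" "\<And>x. 0 \<le> f2 x" "\<And>x. 0 \<le> f3 x" "\<And>x. 0 \<le> f4 x"
    and int: "integrable M f1" "integrable M f2" "integrable M f3" "integrable M f4"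
    and J: "0 < J1" "0 < J2" "0 < J3" "0 < J4"
    and le: "integral\<^sup>L M f1 \<le> J1" "integral\<^sup>L M f2 \<le> J2" "integral\<^sup>L M f3 \<le> J3" "integral\<^sup>L M f4 \<le> J4"
  shows "(\<integral>x. f1 x powr a1 * f2 x powr a2 * f3 x powr a3 * f4 x powr a4 \<partial>M)
     \<le> J1 powr a1 * J2 powr a2 * J3 powr a3 * J4 powr a4"
proof (cases "integrable M (\<lambda>x. f1 x powr a1 * f2 x powr a2 * f3 x powr a3 * f4 x powr a4)")
  case True
  let ?K = "J1 powr a1 * J2 powr a2 * J3 powr a3 * J4 powr a4"
  have "f1 x powr a1 * f2 x powr a2 * f3 x powr a3 * f4 x powr a4
     \<le> ?K * (a1 * (f1 x / J1) + a2 * (f2 x / J2) + a3 * (f3 x / J3) + a4 * (f4 x / J4))" for x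
  proof -
    have "f1 x powr a1 * f2 x powr a2 * f3 x powr a3 * f4 x powr a4
       = ?K * ((f1 x / J1) powr a1 * (f2 x / J2) powr a2 * (f3 x / J3) powr a3 * (f4 x / J4) powr a4)"
      using J f by (simp add: powr_divide)
    also have "\<dots> \<le> ?K * (a1 * (f1 x / J1) + a2 * (f2 x / J2) + a3 * (f3 x / J3) + a4 * (f4 x / J4))"
      using J f by (intro mult_left_mono amgm4 a) auto
    finally show ?thesis .
  qed
  then have "(\<integral>x. f1 x powr a1 * f2 x powr a2 * f3 x powr a3 * f4 x powr a4 \<partial>M)
    \<le> (\<integral>x. ?K * (a1 * (f1 x / J1) + a2 * (f2 x / J2) + a3 * (f3 x / J3) + a4 * (f4 x / J4)) \<partial>M)"
    using True int by (intro integral_mono) auto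
  also have "\<dots> = ?K * (a1 * (integral\<^sup>L M f1 / J1) + a2 * (integral\<^sup>L M f2 / J2) + a3 * (integral\<^sup>L M f3 / J3) + a4 * (integral\<^sup>L M f4 / J4))"
    using int by simp
  also have "\<dots> \<le> ?K * (a1 * 1 + a2 * 1 + a3 * 1 + a4 * 1)"
    using J le by (intro mult_left_mono add_mono a) (auto simp: divide_le_eq_1)
  finally show ?thesis using a(5) by simp
next
  \<comment> \<open>The Bochner integral of a non-integrable function is 0, and the bound is
    nonnegative.\<close>
  case False
  then show ?thesis using J by (simp add: not_integrable_integral_eq)
qed

text \<open>A nonnegative quadratic polynomial in \<open>t\<close>, evaluated at
  \<open>A / G\<close>; for \<open>G = 0\<close> a large \<open>t\<close> forces
  \<open>A = 0\<close>. If the product is not integrable, the left side is 0 by convention.\<close>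

lemma cauchy_schwarz_integral:
  fixes f g :: "'a \<Rightarrow> real"
  assumes "integrable M (\<lambda>x. (f x)\<^sup>2)" "integrable M (\<lambda>x. (g x)\<^sup>2)"
  shows "(\<integral>x. \<bar>f x * g x\<bar> \<partial>M)\<^sup>2 \<le> (\<integral>x. (f x)\<^sup>2 \<partial>M) * (\<integral>x. (g x)\<^sup>2 \<partial>M)"
proof (cases "integrable M (\<lambda>x. \<bar>f x * g x\<bar>)")
  case True
  define A where "A = (\<integral>x. \<bar>f x * g x\<bar> \<partial>M)"
  define F where "F = (\<integral>x. (f x)\<^sup>2 \<partial>M)"
  define G where "G = (\<integral>x. (g x)\<^sup>2 \<partial>M)"
  have A: "A \<ge> 0" and G: "G \<ge> 0" by (simp_all add: A_def G_def)
  have q: "0 \<le> F - 2 * t * A + t\<^sup>2 * G" for t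
  proof -
    have "0 \<le> (\<integral>x. (\<bar>f x\<bar> - t * \<bar>g x\<bar>)\<^sup>2 \<partial>M)" by simp
    also have "\<dots> = (\<integral>x. (f x)\<^sup>2 - 2 * t * \<bar>f x * g x\<bar> + t\<^sup>2 * (g x)\<^sup>2 \<partial>M)"
      by (rule Bochner_Integration.integral_cong) (auto simp: power2_diff power_mult_distrib abs_mult mult_ac)
    also have "\<dots> = F - 2 * t * A + t\<^sup>2 * G"
      using assms True by (simp add: A_def F_def G_def)
    finally show ?thesis .
  qed
  have "A\<^sup>2 \<le> F * G"
  proof (cases "G = 0")
    case True
    have "A = 0"
    proof (rule ccontr)
      assume "A \<noteq> 0"
      define t where "t = (F + 1) / A"
      have "t * A = F + 1" using \<open>A \<noteq> 0\<close> by (simp add: t_def)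
      moreover have "0 \<le> F - 2 * (t * A)" using q[of t] True by (simp add: mult.assoc)
      moreover have "F \<ge> 0" by (simp add: F_def)
      ultimately show False by simp
    qed
    then show ?thesis using True by simp
  next
    case False
    have "0 \<le> F - 2 * (A / G) * A + (A / G)\<^sup>2 * G" by (rule q)
    also have "\<dots> = F - A\<^sup>2 / G" using False by (simp add: power2_eq_square field_simps)
    finally show ?thesis using False G by (simp add: field_simps)
  qed
  then show ?thesis by (simp add: A_def F_def G_def)
next
  case False
  then show ?thesis by (simp add: not_integrable_integral_eq)
qed

lemma nn_integral_geometric_mean:
  fixes V p q :: "'a \<Rightarrow> ennreal"
  assumes [measurable]: "V \<in> borel_measurable M" "p \<in> borel_measurable M" "q \<in> borel_measurable M"
    and le: "\<And>x. (V x)\<^sup>2 \<le> p x * q x"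
  shows "(\<integral>\<^sup>+x. V x \<partial>M)\<^sup>2 \<le> (\<integral>\<^sup>+x. p x \<partial>M) * (\<integral>\<^sup>+x. q x \<partial>M)"
proof -
  define P where "P = (\<integral>\<^sup>+x. p x \<partial>M)"
  define Q where "Q = (\<integral>\<^sup>+x. q x \<partial>M)"
  have zero: "(\<integral>\<^sup>+x. V x \<partial>M) = 0" if "P = 0 \<or> Q = 0"
  proof -
    from that have "AE x in M. p x * q x = 0"
    proof
      assume "P = 0"
      then have "AE x in M. p x = 0" unfolding P_def by (subst (asm) nn_integral_0_iff_AE) auto
      then show ?thesis by eventually_elim simp
    next
      assume "Q = 0"
      then have "AE x in M. q x = 0" unfolding Q_def by (subst (asm) nn_integral_0_iff_AE) auto
      then show ?thesis by eventually_elim simp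
    qed
    then have "AE x in M. V x = 0"
    proof eventually_elim
      case (elim x)
      have "(V x)\<^sup>2 = 0" using le[of x] unfolding elim by simp
      then show ?case by simp
    qed
    then show ?thesis by (subst nn_integral_0_iff_AE) auto
  qed
  show ?thesis
  proof (cases "P = 0 \<or> Q = 0")
    case True
    then show ?thesis using zero by simp
  next
    case False
    show ?thesis
    proof (cases "P = top \<or> Q = top")
      case True
      then show ?thesis using False by (auto simp: P_def[symmetric] Q_def[symmetric] ennreal_mult_eq_top_iff top_unique)
    next
      case fin: False
      obtain a b where ab: "P = ennreal a" "Q = ennreal b" "a \<ge> 0" "b \<ge> 0"
        using fin by (metis ennreal_cases)
      then have pos: "a > 0" "b > 0" using False by (auto simp: less_le)
      define l where "l = sqrt (b / a)"
      have l: "l > 0" using pos by (simp add: l_def)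
      have "2 * V x \<le> ennreal l * p x + ennreal (1 / l) * q x" for x
      proof (cases "p x = top \<or> q x = top")
        case True
        then have *: "ennreal l * p x + ennreal (1 / l) * q x = top"
          using l by (auto simp: ennreal_mult_eq_top_iff)
        show ?thesis unfolding * by simp
      next
        case f: False
        then obtain r s where rs: "p x = ennreal r" "q x = ennreal s" "r \<ge> 0" "s \<ge> 0"
          by (metis ennreal_cases)
        have "(V x)\<^sup>2 \<noteq> top" using le[of x] f by (auto simp: rs top_unique simp flip: ennreal_mult)
        then obtain v where v: "V x = ennreal v" "v \<ge> 0" by (cases "V x") (auto simp: power2_eq_square ennreal_mult_eq_top_iff)
        have "v\<^sup>2 \<le> r * s" using le[of x] rs v by (simp add: ennreal_power flip: ennreal_mult)
        have "(2 * v)\<^sup>2 \<le> 4 * (r * s)" using \<open>v\<^sup>2 \<le> r * s\<close> by (simp add: power_mult_distrib)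
        also have "\<dots> \<le> (l * r + 1 / l * s)\<^sup>2"
        proof -
          have "0 \<le> (l * r - 1 / l * s)\<^sup>2" by simp
          also have "\<dots> = (l * r + 1 / l * s)\<^sup>2 - 4 * (r * s)" using l by (simp add: power2_eq_square field_simps)
          finally show ?thesis by simp
        qed
        finally have "2 * v \<le> l * r + 1 / l * s"
          using l rs by (intro power2_le_imp_le[of "2 * v"]) auto
        moreover have "2 * V x = ennreal (2 * v)" using v by (simp add: ennreal_mult)
        moreover have "ennreal l * p x + ennreal (1 / l) * q x = ennreal (l * r + 1 / l * s)"
        proof -
          have "ennreal (l * r + 1 / l * s) = ennreal (l * r) + ennreal (1 / l * s)"
            using rs l by (intro ennreal_plus) auto
          also have "ennreal (l * r) = ennreal l * ennreal r" using rs l by (intro ennreal_mult) auto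
          also have "ennreal (1 / l * s) = ennreal (1 / l) * ennreal s" using rs l by (intro ennreal_mult) auto
          finally show ?thesis by (simp only: rs)
        qed
        ultimately show ?thesis by (simp add: ennreal_leI)
      qed
      then have "(\<integral>\<^sup>+x. 2 * V x \<partial>M) \<le> (\<integral>\<^sup>+x. ennreal l * p x + ennreal (1 / l) * q x \<partial>M)"
        by (intro nn_integral_mono)
      then have "2 * (\<integral>\<^sup>+x. V x \<partial>M) \<le> ennreal l * P + ennreal (1 / l) * Q"
        by (simp add: nn_integral_cmult nn_integral_add P_def Q_def)
      also have "\<dots> = ennreal (l * a + 1 / l * b)"
      proof -
        have "ennreal (l * a + 1 / l * b) = ennreal (l * a) + ennreal (1 / l * b)"
          using ab l by (intro ennreal_plus) auto
        also have "ennreal (l * a) = ennreal l * ennreal a" using ab l by (intro ennreal_mult) auto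
        also have "ennreal (1 / l * b) = ennreal (1 / l) * ennreal b" using ab l by (intro ennreal_mult) auto
        finally show ?thesis by (simp only: ab)
      qed
      also have "l * a + 1 / l * b = 2 * sqrt (a * b)"
        using pos by (simp add: l_def real_sqrt_divide real_sqrt_mult field_simps)
      finally have "2 * (\<integral>\<^sup>+x. V x \<partial>M) \<le> ennreal (2 * sqrt (a * b))" .
      then have "2 * (\<integral>\<^sup>+x. V x \<partial>M) \<le> 2 * ennreal (sqrt (a * b))"
        using ab by (simp add: ennreal_mult)
      then have "(\<integral>\<^sup>+x. V x \<partial>M) \<le> ennreal (sqrt (a * b))"
        by (subst (asm) ennreal_mult_le_mult_iff) auto
      then have "(\<integral>\<^sup>+x. V x \<partial>M)\<^sup>2 \<le> (ennreal (sqrt (a * b)))\<^sup>2" by (intro power_mono) auto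
      also have "\<dots> = P * Q" using ab by (simp add: ennreal_power ennreal_mult)
      finally show ?thesis by (simp add: P_def Q_def)
    qed
  qed
qed

section \<open>Coordinates on R^3, Loomis-Whitney and Sobolev inequalities\<close>

definition vec3 :: "real \<Rightarrow> real \<Rightarrow> real \<Rightarrow> real^3" where
  "vec3 x y z = x *\<^sub>R axis 1 1 + y *\<^sub>R axis 2 1 + z *\<^sub>R axis 3 1"

lemma vec3_nth [simp]: "vec3 x y z $ 1 = x" "vec3 x y z $ 2 = y" "vec3 x y z $ 3 = z"
  by (simp_all add: vec3_def axis_def)

lemma vec3_measurable [measurable (raw)]:
  assumes "f \<in> borel_measurable M" "g \<in> borel_measurable M" "h \<in> borel_measurable M"
  shows "(\<lambda>w. vec3 (f w) (g w) (h w)) \<in> borel_measurable M"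
  unfolding vec3_def using assms by measurable

lemma emeasure_lborel_Times:
  fixes A :: "'a::euclidean_space set" and B :: "'b::euclidean_space set"
  assumes "A \<in> sets borel" "B \<in> sets borel"
  shows "emeasure lborel (A \<times> B) = emeasure lborel A * emeasure lborel B"
  using assms by (subst lborel_prod[symmetric], subst lborel.emeasure_pair_measure_Times) auto

lemma nn_integral_lborel_prod:
  fixes f :: "'a::euclidean_space \<times> 'b::euclidean_space \<Rightarrow> ennreal"
  assumes "f \<in> borel_measurable borel"
  shows "(\<integral>\<^sup>+w. f w \<partial>lborel) = (\<integral>\<^sup>+x. \<integral>\<^sup>+y. f (x, y) \<partial>lborel \<partial>lborel)"
proof -
  have "f \<in> borel_measurable (lborel \<Otimes>\<^sub>M lborel)" using assms by (simp add: lborel_prod)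
  from lborel.nn_integral_fst[OF this] show ?thesis by (simp add: lborel_prod)
qed

text \<open>Both measures agree on boxes, which determines \<open>lborel\<close>; integrals over
  \<open>real^3\<close> thereby become iterated integrals.\<close>

lemma lborel_vec3: "lborel = distr (lborel \<Otimes>\<^sub>M (lborel \<Otimes>\<^sub>M lborel)) borel (\<lambda>(x, y, z). vec3 x y z)"
proof (rule lborel_eqI)
  fix l u :: "real^3" assume le: "\<And>b. b \<in> Basis \<Longrightarrow> l \<bullet> b \<le> u \<bullet> b"
  have le': "l $ i \<le> u $ i" for i
    using le[of "axis i 1"] by (simp add: inner_axis)
  have B: "(Basis :: (real^3) set) = (\<lambda>i. axis i 1) ` UNIV" by (auto simp: Basis_vec_def)
  have inj: "inj (\<lambda>i::3. axis i (1::real))" by (auto simp: inj_on_def axis_eq_axis)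
  have pr: "(\<Prod>b\<in>Basis. (u - l) \<bullet> b) = (u $ 1 - l $ 1) * ((u $ 2 - l $ 2) * (u $ 3 - l $ 3))"
  proof -
    have i: "(u - l) \<bullet> axis i 1 = u $ i - l $ i" for i by (simp add: inner_axis)
    have "(\<Prod>b\<in>Basis. (u - l) \<bullet> b) = (\<Prod>i\<in>UNIV. u $ i - l $ i)"
      unfolding B prod.reindex[OF inj] o_def i ..
    also have "\<dots> = (u $ 1 - l $ 1) * ((u $ 2 - l $ 2) * (u $ 3 - l $ 3))"
      unfolding UNIV_3 by simp
    finally show ?thesis .
  qed
  have vi: "(\<lambda>(x, y, z). vec3 x y z) -` box l u = {l $ 1<..<u $ 1} \<times> ({l $ 2<..<u $ 2} \<times> {l $ 3<..<u $ 3})"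
    by (auto simp: mem_box_cart forall_3)
  have "emeasure (distr (lborel \<Otimes>\<^sub>M (lborel \<Otimes>\<^sub>M lborel)) borel (\<lambda>(x, y, z). vec3 x y z)) (box l u)
     = emeasure (lborel \<Otimes>\<^sub>M (lborel \<Otimes>\<^sub>M lborel)) ({l $ 1<..<u $ 1} \<times> ({l $ 2<..<u $ 2} \<times> {l $ 3<..<u $ 3}))"
    by (subst emeasure_distr) (auto simp: vi space_pair_measure)
  also have "\<dots> = emeasure lborel {l $ 1<..<u $ 1} * (emeasure lborel {l $ 2<..<u $ 2} * emeasure lborel {l $ 3<..<u $ 3})"
    unfolding lborel_prod
    by (simp add: emeasure_lborel_Times borel_open open_Times del: emeasure_lborel_Ioo)
  also have "\<dots> = (\<Prod>b\<in>Basis. (u - l) \<bullet> b)"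
    unfolding pr using le' by (simp add: ennreal_mult)
  finally show "emeasure (distr (lborel \<Otimes>\<^sub>M (lborel \<Otimes>\<^sub>M lborel)) borel (\<lambda>(x, y, z). vec3 x y z)) (box l u)
     = (\<Prod>b\<in>Basis. (u - l) \<bullet> b)" .
qed simp

lemma nn_integral_vec3:
  fixes f :: "real^3 \<Rightarrow> ennreal"
  assumes [measurable]: "f \<in> borel_measurable borel"
  shows "(\<integral>\<^sup>+p. f p \<partial>lborel) = (\<integral>\<^sup>+x. \<integral>\<^sup>+y. \<integral>\<^sup>+z. f (vec3 x y z) \<partial>lborel \<partial>lborel \<partial>lborel)"
proof -
  have "(\<integral>\<^sup>+p. f p \<partial>lborel) = (\<integral>\<^sup>+w. f (case w of (x, y, z) \<Rightarrow> vec3 x y z) \<partial>(lborel \<Otimes>\<^sub>M (lborel \<Otimes>\<^sub>M lborel)))"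
    by (subst lborel_vec3, subst nn_integral_distr) auto
  also have "\<dots> = (\<integral>\<^sup>+w. f (case w of (x, y, z) \<Rightarrow> vec3 x y z) \<partial>lborel)"
    by (simp add: lborel_prod)
  also have "\<dots> = (\<integral>\<^sup>+x. \<integral>\<^sup>+w. f (case w of (y, z) \<Rightarrow> vec3 x y z) \<partial>lborel \<partial>lborel)"
    by (subst nn_integral_lborel_prod) (auto simp flip: borel_prod)
  also have "\<dots> = (\<integral>\<^sup>+x. \<integral>\<^sup>+y. \<integral>\<^sup>+z. f (vec3 x y z) \<partial>lborel \<partial>lborel \<partial>lborel)"
    by (intro nn_integral_cong, subst nn_integral_lborel_prod) (auto simp flip: borel_prod)
  finally show ?thesis .
qed

text \<open>Fundamental theorem of calculus from a point \<open>a\<close> so far out that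
  \<open>f\<close> vanishes there and beyond.\<close>

lemma C1_abs_le_line_integral:
  fixes f :: "real^'n::finite \<Rightarrow> real"
  assumes "C1 f" "cc f"
  shows "ennreal \<bar>f (p + x *\<^sub>R axis j 1)\<bar> \<le> (\<integral>\<^sup>+t. ennreal \<bar>partial j f (p + t *\<^sub>R axis j 1)\<bar> \<partial>lborel)"
proof -
  obtain r where r: "r > 0" "supp_in r f" using cc_supp_pos[OF assms(2)] by blast
  define a where "a = - (r + norm p + 1)"
  have z: "f (p + t *\<^sub>R axis j 1) = 0" if "t \<le> a" for t
  proof -
    have "norm (t *\<^sub>R axis j (1::real)) = \<bar>t\<bar>" by (simp add: norm_axis_1)
    moreover have "\<bar>t\<bar> \<ge> r + norm p + 1" using that r by (simp add: a_def)
    ultimately have "r < norm (p + t *\<^sub>R axis j 1)"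
      using norm_diff_ineq[of "t *\<^sub>R axis j 1" p] by (simp add: add.commute)
    then show ?thesis using r by (simp add: supp_in_def)
  qed
  show ?thesis
  proof (cases "x \<le> a")
    case True then show ?thesis using z by simp
  next
    case False
    let ?g = "\<lambda>t. partial j f (p + t *\<^sub>R axis j 1)"
    have cont: "continuous_on UNIV ?g"
      by (intro continuous_on_compose2[OF C1_partial_continuous[OF assms(1)]] continuous_intros) auto
    have eq: "(\<integral>t. ?g t * indicator {a..x} t \<partial>lborel) = f (p + x *\<^sub>R axis j 1) - f (p + a *\<^sub>R axis j 1)"
      using False C1_line_axis[OF assms(1)] cont
      by (intro integral_FTC_Icc_real) (auto simp: continuous_on_eq_continuous_at)
    have int: "integrable lborel (\<lambda>t. ?g t * indicator {a..x} t)"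
      using borel_integrable_compact[of "{a..x}" ?g] continuous_on_subset[OF cont] by (simp add: mult.commute)
    have "ennreal \<bar>f (p + x *\<^sub>R axis j 1)\<bar> = ennreal (norm (\<integral>t. ?g t * indicator {a..x} t \<partial>lborel))"
      unfolding eq using z[of a] by simp
    also have "\<dots> \<le> (\<integral>\<^sup>+t. ennreal (norm (?g t * indicator {a..x} t)) \<partial>lborel)"
      by (rule integral_norm_bound_ennreal[OF int])
    also have "\<dots> \<le> (\<integral>\<^sup>+t. ennreal \<bar>?g t\<bar> \<partial>lborel)"
      by (intro nn_integral_mono) (auto simp: indicator_def abs_mult)
    finally show ?thesis .
  qed
qed


text \<open>Integrate out \<open>z\<close>, \<open>y\<close>, \<open>x\<close> in turn. In each
  variable one of the three factors is constant and comes out, and the other two are separated by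
  the geometric-mean inequality.\<close>

lemma loomis_whitney:
  fixes V g1 g2 g3 :: "real^3 \<Rightarrow> ennreal"
  assumes [measurable]: "V \<in> borel_measurable borel" "g1 \<in> borel_measurable borel"
      "g2 \<in> borel_measurable borel" "g3 \<in> borel_measurable borel"
    and le: "\<And>x y z. (V (vec3 x y z))\<^sup>2 \<le> (\<integral>\<^sup>+t. g1 (vec3 t y z) \<partial>lborel) * (\<integral>\<^sup>+t. g2 (vec3 x t z) \<partial>lborel) * (\<integral>\<^sup>+t. g3 (vec3 x y t) \<partial>lborel)"
  shows "(\<integral>\<^sup>+p. V p \<partial>lborel)\<^sup>2 \<le> (\<integral>\<^sup>+p. g1 p \<partial>lborel) * (\<integral>\<^sup>+p. g2 p \<partial>lborel) * (\<integral>\<^sup>+p. g3 p \<partial>lborel)"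
proof -
  define F1 where "F1 y z = (\<integral>\<^sup>+t. g1 (vec3 t y z) \<partial>lborel)" for y z
  define F2 where "F2 x z = (\<integral>\<^sup>+t. g2 (vec3 x t z) \<partial>lborel)" for x z
  define F3 where "F3 x y = (\<integral>\<^sup>+t. g3 (vec3 x y t) \<partial>lborel)" for x y
  have [measurable]: "(\<lambda>w. F1 (fst w) (snd w)) \<in> borel_measurable (borel \<Otimes>\<^sub>M borel)"
    "(\<lambda>w. F2 (fst w) (snd w)) \<in> borel_measurable (borel \<Otimes>\<^sub>M borel)"
    "(\<lambda>w. F3 (fst w) (snd w)) \<in> borel_measurable (borel \<Otimes>\<^sub>M borel)"
    unfolding F1_def F2_def F3_def by measurable
  have m1 [measurable (raw)]: "(\<lambda>w. F1 (f w) (g w)) \<in> borel_measurable M"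
    and m2 [measurable (raw)]: "(\<lambda>w. F2 (f w) (g w)) \<in> borel_measurable M"
    and m3 [measurable (raw)]: "(\<lambda>w. F3 (f w) (g w)) \<in> borel_measurable M"
    if [measurable]: "f \<in> borel_measurable M" "g \<in> borel_measurable M" for f g and M :: "'z measure"
  proof -
    have [measurable]: "(\<lambda>w. (f w, g w)) \<in> measurable M (borel \<Otimes>\<^sub>M borel)" by measurable
    show "(\<lambda>w. F1 (f w) (g w)) \<in> borel_measurable M" "(\<lambda>w. F2 (f w) (g w)) \<in> borel_measurable M"
      "(\<lambda>w. F3 (f w) (g w)) \<in> borel_measurable M"
      using measurable_compose[of "\<lambda>w. (f w, g w)" M "borel \<Otimes>\<^sub>M borel" "\<lambda>w. F1 (fst w) (snd w)" borel]
        measurable_compose[of "\<lambda>w. (f w, g w)" M "borel \<Otimes>\<^sub>M borel" "\<lambda>w. F2 (fst w) (snd w)" borel]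
        measurable_compose[of "\<lambda>w. (f w, g w)" M "borel \<Otimes>\<^sub>M borel" "\<lambda>w. F3 (fst w) (snd w)" borel]
      by simp_all
  qed
  define A where "A y = (\<integral>\<^sup>+z. F1 y z \<partial>lborel)" for y
  define B where "B x = (\<integral>\<^sup>+z. F2 x z \<partial>lborel)" for x
  define C where "C x = (\<integral>\<^sup>+y. F3 x y \<partial>lborel)" for x
  have [measurable]: "A \<in> borel_measurable borel" "B \<in> borel_measurable borel" "C \<in> borel_measurable borel"
    unfolding A_def[abs_def] B_def[abs_def] C_def[abs_def] by measurable
  have s1: "(\<integral>\<^sup>+z. V (vec3 x y z) \<partial>lborel)\<^sup>2 \<le> (F3 x y * B x) * A y" for x y
  proof -
    have "(\<integral>\<^sup>+z. V (vec3 x y z) \<partial>lborel)\<^sup>2 \<le> (\<integral>\<^sup>+z. F3 x y * F2 x z \<partial>lborel) * (\<integral>\<^sup>+z. F1 y z \<partial>lborel)"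
      using le by (intro nn_integral_geometric_mean) (auto simp: F1_def F2_def F3_def mult_ac)
    then show ?thesis by (simp add: nn_integral_cmult A_def B_def)
  qed
  have s2: "(\<integral>\<^sup>+y. \<integral>\<^sup>+z. V (vec3 x y z) \<partial>lborel \<partial>lborel)\<^sup>2 \<le> (C x * B x) * (\<integral>\<^sup>+y. A y \<partial>lborel)" for x
  proof -
    have "(\<integral>\<^sup>+y. \<integral>\<^sup>+z. V (vec3 x y z) \<partial>lborel \<partial>lborel)\<^sup>2 \<le> (\<integral>\<^sup>+y. F3 x y * B x \<partial>lborel) * (\<integral>\<^sup>+y. A y \<partial>lborel)"
      by (intro nn_integral_geometric_mean s1) measurable
    then show ?thesis by (simp add: nn_integral_multc C_def)
  qed
  have s3: "(\<integral>\<^sup>+x. \<integral>\<^sup>+y. \<integral>\<^sup>+z. V (vec3 x y z) \<partial>lborel \<partial>lborel \<partial>lborel)\<^sup>2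
     \<le> (\<integral>\<^sup>+x. C x \<partial>lborel) * (\<integral>\<^sup>+x. B x * (\<integral>\<^sup>+y. A y \<partial>lborel) \<partial>lborel)"
    using s2 by (intro nn_integral_geometric_mean) (auto simp: mult_ac)
  have "(\<integral>\<^sup>+y. A y \<partial>lborel) = (\<integral>\<^sup>+p. g1 p \<partial>lborel)"
  proof -
    have "(\<integral>\<^sup>+p. g1 p \<partial>lborel) = (\<integral>\<^sup>+x. \<integral>\<^sup>+y. \<integral>\<^sup>+z. g1 (vec3 x y z) \<partial>lborel \<partial>lborel \<partial>lborel)"
      by (rule nn_integral_vec3) measurable
    also have "\<dots> = (\<integral>\<^sup>+y. \<integral>\<^sup>+x. \<integral>\<^sup>+z. g1 (vec3 x y z) \<partial>lborel \<partial>lborel \<partial>lborel)"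
      by (subst lborel_pair.Fubini') auto
    also have "\<dots> = (\<integral>\<^sup>+y. \<integral>\<^sup>+z. \<integral>\<^sup>+x. g1 (vec3 x y z) \<partial>lborel \<partial>lborel \<partial>lborel)"
      by (rule nn_integral_cong, subst lborel_pair.Fubini') auto
    finally show ?thesis by (simp add: A_def F1_def)
  qed
  moreover have "(\<integral>\<^sup>+y. B y \<partial>lborel) = (\<integral>\<^sup>+p. g2 p \<partial>lborel)"
  proof -
    have "(\<integral>\<^sup>+p. g2 p \<partial>lborel) = (\<integral>\<^sup>+x. \<integral>\<^sup>+y. \<integral>\<^sup>+z. g2 (vec3 x y z) \<partial>lborel \<partial>lborel \<partial>lborel)"
      by (rule nn_integral_vec3) measurable
    also have "\<dots> = (\<integral>\<^sup>+x. \<integral>\<^sup>+z. \<integral>\<^sup>+y. g2 (vec3 x y z) \<partial>lborel \<partial>lborel \<partial>lborel)"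
      by (rule nn_integral_cong, subst lborel_pair.Fubini') auto
    finally show ?thesis by (simp add: B_def F2_def)
  qed
  moreover have "(\<integral>\<^sup>+y. C y \<partial>lborel) = (\<integral>\<^sup>+p. g3 p \<partial>lborel)"
    by (subst nn_integral_vec3) (auto simp: C_def[abs_def] F3_def[abs_def])
  ultimately show ?thesis
    using s3 by (simp add: nn_integral_vec3[of V] nn_integral_multc mult_ac)
qed

lemma C1_power4:
  assumes "C1 w" shows "C1 (\<lambda>x. w x ^ 4)" "partial j (\<lambda>x. w x ^ 4) x = 4 * w x ^ 3 * partial j w x"
proof -
  have d: "((\<lambda>t. t ^ 4) has_real_derivative 4 * t ^ 3) (at t)" for t :: real
    by (auto intro!: derivative_eq_intros)
  have c: "continuous_on UNIV (\<lambda>t::real. 4 * t ^ 3)" by (intro continuous_intros)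
  show "C1 (\<lambda>x. w x ^ 4)" "partial j (\<lambda>x. w x ^ 4) x = 4 * w x ^ 3 * partial j w x"
    using C1_chain[OF assms d c] by auto
qed

text \<open>Gagliardo-Nirenberg: \<open>w ^ 4\<close> is bounded by line integrals in all three
  directions, so Loomis-Whitney controls the integral of \<open>\<bar>w\<bar> ^ 6\<close>.
  Cauchy-Schwarz on \<open>w ^ 3\<close> times a partial puts the same integral on the right with a
  lower power; dividing it out leaves 4096 = \<open>16 ^ 3\<close>.\<close>

theorem sobolev6:
  fixes w :: "real^3 \<Rightarrow> real"
  assumes w: "C1 w" "cc w"
  shows "(\<integral>x. \<bar>w x\<bar> ^ 6 \<partial>lborel) \<le> 4096 * ((\<integral>x. (partial 1 w x)\<^sup>2 \<partial>lborel) * (\<integral>x. (partial 2 w x)\<^sup>2 \<partial>lborel) * (\<integral>x. (partial 3 w x)\<^sup>2 \<partial>lborel))"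
proof -
  define g where "g j x = \<bar>4 * w x ^ 3 * partial j w x\<bar>" for j x
  have ccp: "cc (partial j w)" for j using w by (intro cc_partial)
  have ccg: "cc (g j)" for j
    unfolding g_def[abs_def] using w by (intro cc_abs cc_mult_left ccp continuous_intros cc_continuous)
  define I where "I = (\<integral>x. \<bar>w x\<bar> ^ 6 \<partial>lborel)"
  define D where "D j = (\<integral>x. (partial j w x)\<^sup>2 \<partial>lborel)" for j
  define K where "K j = (\<integral>x. g j x \<partial>lborel)" for j
  have I0: "0 \<le> I" and D0: "0 \<le> D j" and K0: "0 \<le> K j" for j by (simp_all add: I_def D_def K_def g_def)
  have nI: "(\<integral>\<^sup>+x. ennreal (\<bar>w x\<bar> ^ 6) \<partial>lborel) = ennreal I"
    unfolding I_def using w by (intro nn_integral_eq_integral cc_integrable cc_power cc_abs) auto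
  have nK: "(\<integral>\<^sup>+x. ennreal (g j x) \<partial>lborel) = ennreal (K j)" for j
    unfolding K_def by (intro nn_integral_eq_integral cc_integrable ccg) (simp add: g_def)
  have lin: "ennreal (\<bar>w (p + s *\<^sub>R axis j 1)\<bar> ^ 4) \<le> (\<integral>\<^sup>+t. ennreal (g j (p + t *\<^sub>R axis j 1)) \<partial>lborel)" for p s j
    using C1_abs_le_line_integral[OF C1_power4(1)[OF w(1)], of p s j] cc_power[OF w(2), of 4]
    by (simp add: C1_power4(2)[OF w(1)] g_def power_abs)
  have "(\<integral>\<^sup>+x. ennreal (\<bar>w x\<bar> ^ 6) \<partial>lborel)\<^sup>2 \<le> (\<integral>\<^sup>+x. ennreal (g 1 x) \<partial>lborel) * (\<integral>\<^sup>+x. ennreal (g 2 x) \<partial>lborel) * (\<integral>\<^sup>+x. ennreal (g 3 x) \<partial>lborel)"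
  proof (rule loomis_whitney)
    fix x y z
    have "(ennreal (\<bar>w (vec3 x y z)\<bar> ^ 6))\<^sup>2 = ennreal (\<bar>w (vec3 x y z)\<bar> ^ 4) * ennreal (\<bar>w (vec3 x y z)\<bar> ^ 4) * ennreal (\<bar>w (vec3 x y z)\<bar> ^ 4)"
      by (simp add: ennreal_power flip: ennreal_mult power_mult power_add)
    also have "\<dots> \<le> (\<integral>\<^sup>+t. ennreal (g 1 (vec3 t y z)) \<partial>lborel) * (\<integral>\<^sup>+t. ennreal (g 2 (vec3 x t z)) \<partial>lborel) * (\<integral>\<^sup>+t. ennreal (g 3 (vec3 x y t)) \<partial>lborel)"
      using lin[of "vec3 0 y z" x 1] lin[of "vec3 x 0 z" y 2] lin[of "vec3 x y 0" z 3]
      by (intro mult_mono) (auto simp: vec3_def add_ac)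
    finally show "(ennreal (\<bar>w (vec3 x y z)\<bar> ^ 6))\<^sup>2 \<le> (\<integral>\<^sup>+t. ennreal (g 1 (vec3 t y z)) \<partial>lborel) * (\<integral>\<^sup>+t. ennreal (g 2 (vec3 x t z)) \<partial>lborel) * (\<integral>\<^sup>+t. ennreal (g 3 (vec3 x y t)) \<partial>lborel)" .
  qed (use cc_measurable[OF w(2)] cc_measurable[OF ccg] in measurable)
  then have "ennreal (I\<^sup>2) \<le> ennreal (K 1 * K 2 * K 3)"
    unfolding nI nK using I0 K0 by (simp add: ennreal_power ennreal_mult)
  then have IK: "I\<^sup>2 \<le> K 1 * K 2 * K 3"
    using K0 by (subst (asm) ennreal_le_iff) auto
  have KK: "(K j)\<^sup>2 \<le> 16 * (I * D j)" for j
  proof -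
    have "(\<integral>x. \<bar>w x ^ 3 * partial j w x\<bar> \<partial>lborel)\<^sup>2 \<le> (\<integral>x. (w x ^ 3)\<^sup>2 \<partial>lborel) * (\<integral>x. (partial j w x)\<^sup>2 \<partial>lborel)"
      using w by (intro cauchy_schwarz_integral cc_integrable cc_power ccp) auto
    moreover have "K j = 4 * (\<integral>x. \<bar>w x ^ 3 * partial j w x\<bar> \<partial>lborel)"
      unfolding K_def g_def by (simp add: abs_mult mult.assoc)
    moreover have "(\<lambda>x. (w x ^ 3)\<^sup>2) = (\<lambda>x. \<bar>w x\<bar> ^ 6)" by (simp add: power_even_abs flip: power_mult)
    ultimately show ?thesis by (simp add: I_def D_def power_mult_distrib)
  qed
  have "(I\<^sup>2)\<^sup>2 \<le> (K 1 * K 2 * K 3)\<^sup>2" using IK by (intro power_mono) auto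
  also have "\<dots> = (K 1)\<^sup>2 * (K 2)\<^sup>2 * (K 3)\<^sup>2" by (simp add: power_mult_distrib)
  also have "\<dots> \<le> (16 * (I * D 1)) * (16 * (I * D 2)) * (16 * (I * D 3))"
    using I0 D0 by (intro mult_mono KK) auto
  also have "\<dots> = I ^ 3 * (4096 * (D 1 * D 2 * D 3))" by (simp add: power3_eq_cube)
  finally have "I ^ 3 * I \<le> I ^ 3 * (4096 * (D 1 * D 2 * D 3))" by (simp add: power2_eq_square power3_eq_cube mult_ac)
  then have "I \<le> 4096 * (D 1 * D 2 * D 3)"
  proof (cases "I = 0")
    case True then show ?thesis using D0 by simp
  next
    case False
    then have "I ^ 3 > 0" using I0 by simp
    with \<open>I ^ 3 * I \<le> _\<close> show ?thesis by (simp del: power_mult_distrib)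
  qed
  then show ?thesis by (simp add: I_def D_def)
qed

subsection \<open>A truncated, regularised Newtonian kernel\<close>

lemma DERIV_mult_abs: "((\<lambda>s::real. s * \<bar>s\<bar>) has_real_derivative 2 * \<bar>s\<bar>) (at s)"
proof -
  consider "s > 0" | "s < 0" | "s = 0" by linarith
  then show ?thesis
  proof cases
    case 1
    have "((\<lambda>s. s * s) has_real_derivative 2 * s) (at s)" by (auto intro!: derivative_eq_intros)
    then have "((\<lambda>s. s * \<bar>s\<bar>) has_real_derivative 2 * s) (at s)"
      by (rule has_field_derivative_transform_within_open[of _ _ _ "{0<..}"]) (use 1 in auto)
    then show ?thesis using 1 by simp
  next
    case 2
    have "((\<lambda>s. - (s * s)) has_real_derivative - (2 * s)) (at s)" by (auto intro!: derivative_eq_intros)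
    then have "((\<lambda>s. s * \<bar>s\<bar>) has_real_derivative - (2 * s)) (at s)"
      by (rule has_field_derivative_transform_within_open[of _ _ _ "{..<0}"]) (use 2 in auto)
    then show ?thesis using 2 by simp
  next
    case 3
    have "((\<lambda>h::real. \<bar>h\<bar>) \<longlongrightarrow> \<bar>0\<bar>) (at 0)" by (intro tendsto_intros)
    then have "((\<lambda>h::real. (h * \<bar>h\<bar>) / h) \<longlongrightarrow> \<bar>0\<bar>) (at 0)"
      by (rule Lim_transform_eventually) (auto simp: eventually_at intro!: exI[of _ 1])
    then show ?thesis using 3 by (simp add: has_field_derivative_iff)
  qed
qed

text \<open>Powers of the positive part serve as cutoffs of finite smoothness; the kink is reduced
  to the derivative of \<open>s * \<bar>s\<bar>\<close>.\<close>

lemma DERIV_pos_part_power2: "((\<lambda>s::real. (max 0 s) ^ 2) has_real_derivative 2 * max 0 s) (at s)"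
proof -
  have eq: "(max 0 s) ^ 2 = (s * s + s * \<bar>s\<bar>) / 2" for s :: real
    by (auto simp: max_def power2_eq_square)
  have "((\<lambda>s. (s * s + s * \<bar>s\<bar>) / 2) has_real_derivative (s + s + 2 * \<bar>s\<bar>) / 2) (at s)"
    by (intro DERIV_cdivide DERIV_add DERIV_mult_abs) (auto intro!: derivative_eq_intros)
  then show ?thesis unfolding eq by (rule DERIV_cong) (auto simp: max_def)
qed

lemma DERIV_pos_part_power3: "((\<lambda>s::real. (max 0 s) ^ 3) has_real_derivative 3 * (max 0 s) ^ 2) (at s)"
proof -
  have eq: "(max 0 s) ^ 3 = s * (max 0 s) ^ 2" for s :: real
    by (auto simp: max_def power2_eq_square power3_eq_cube)
  have "((\<lambda>s. s * (max 0 s) ^ 2) has_real_derivative 1 * (max 0 s) ^ 2 + 2 * max 0 s * s) (at s)"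
    by (intro DERIV_mult DERIV_pos_part_power2) (auto intro!: derivative_eq_intros)
  then show ?thesis unfolding eq by (rule DERIV_cong) (auto simp: max_def power2_eq_square)
qed

lemma DERIV_pos_part_power4: "((\<lambda>s::real. (max 0 s) ^ 4) has_real_derivative 4 * (max 0 s) ^ 3) (at s)"
proof -
  have eq: "(max 0 s) ^ 4 = s * (max 0 s) ^ 3" for s :: real
    by (auto simp: max_def power3_eq_cube power4_eq_xxxx)
  have "((\<lambda>s. s * (max 0 s) ^ 3) has_real_derivative 1 * (max 0 s) ^ 3 + 3 * (max 0 s) ^ 2 * s) (at s)"
    by (intro DERIV_mult DERIV_pos_part_power3) (auto intro!: derivative_eq_intros)
  then show ?thesis unfolding eq by (rule DERIV_cong) (auto simp: max_def power2_eq_square power3_eq_cube)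
qed

text \<open>In the variable \<open>x \<bullet> x\<close> a radial function is a composition with a
  polynomial map, so the origin is no exceptional point.\<close>

lemma C1_radial:
  fixes Q Q' :: "real \<Rightarrow> real"
  assumes "\<And>t. 0 \<le> t \<Longrightarrow> (Q has_real_derivative Q' t) (at t)" "continuous_on {0..} Q'"
  shows "C1 (\<lambda>x::real^'n::finite. Q (x \<bullet> x))" "partial j (\<lambda>x::real^'n. Q (x \<bullet> x)) x = 2 * x $ j * Q' (x \<bullet> x)"
proof -
  have *: "((\<lambda>x. Q (x \<bullet> x)) has_derivative (\<lambda>v. \<Sum>j\<in>UNIV. v $ j * (2 * x $ j * Q' (x \<bullet> x)))) (at x)" for x :: "real^'n"
  proof -
    have "((\<lambda>x. x \<bullet> x) has_derivative (\<lambda>v. 2 * (x \<bullet> v))) (at x)"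
      by (auto intro!: derivative_eq_intros simp: inner_commute)
    then have "((\<lambda>x. Q (x \<bullet> x)) has_derivative (\<lambda>v. Q' (x \<bullet> x) * (2 * (x \<bullet> v)))) (at x)"
      by (rule has_derivative_compose) (use assms(1)[of "x \<bullet> x"] in \<open>simp add: has_field_derivative_def\<close>)
    then show ?thesis
      by (simp add: inner_vec_def sum_distrib_left mult_ac)
  qed
  have c: "continuous_on UNIV (\<lambda>x. 2 * x $ j * Q' (x \<bullet> x))" for j :: 'n
    by (intro continuous_intros continuous_on_compose2[OF assms(2)]) auto
  show "C1 (\<lambda>x::real^'n. Q (x \<bullet> x))" by (rule C1I_partial(1)[OF * c])
  show "partial j (\<lambda>x::real^'n. Q (x \<bullet> x)) x = 2 * x $ j * Q' (x \<bullet> x)"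
    by (simp add: C1I_partial(2)[OF * c])
qed

text \<open>Profiles are functions of \<open>t = |x|\<^sup>2\<close>. The Laplacian of \<open>k\<close> is \<open>L - E\<close>, where \<open>E\<close> concentrates at the origin as \<open>a\<close>
  tends to 0; the cutoff \<open>yy\<close> is constant to fourth order in \<open>|x|\<close> there, which keeps \<open>L\<close> bounded uniformly in \<open>a\<close>.\<close>

locale kernel =
  fixes c a :: real
  assumes c: "1 \<le> c" and a: "0 < a"
begin

text \<open>\<open>nn\<close> is the Newtonian profile regularised at scale \<open>a\<close>. The
  cutoff \<open>yy\<close> will enter as a fourth power: two derivatives for the Laplacian and a
  third for the gradient of \<open>L\<close> still leave a factor \<open>yy\<close>, hence
  continuity at the edge of the support.\<close>

definition "yy t = max 0 (1 - c * t\<^sup>2)"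
definition "nn t = 1 / sqrt (t + a\<^sup>2)"
definition "K0 t = yy t ^ 4 * nn t"
text \<open>\<open>K1\<close> and \<open>K2\<close> are the first two derivatives of
  \<open>K0\<close> in \<open>t\<close>, and \<open>L1\<close> is the derivative of
  \<open>L0\<close>. \<open>E0\<close> is the part of the Laplacian, up to sign, in which no
  derivative falls on the cutoff: \<open>3 * a\<^sup>2 * nn t ^ 5\<close> is minus the Laplacian of
  the regularised profile. \<open>L0\<close> collects the other terms.\<close>

definition "K1 t = - 8 * c * t * yy t ^ 3 * nn t - 1/2 * yy t ^ 4 * nn t ^ 3"
definition "K2 t = - 8 * c * yy t ^ 3 * nn t + 48 * c\<^sup>2 * t\<^sup>2 * yy t ^ 2 * nn t + 8 * c * t * yy t ^ 3 * nn t ^ 3 + 3/4 * yy t ^ 4 * nn t ^ 5"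
definition "E0 t = 3 * a\<^sup>2 * yy t ^ 4 * nn t ^ 5"
definition "L0 t = - 80 * c * t * yy t ^ 3 * nn t + 192 * c\<^sup>2 * t ^ 3 * yy t ^ 2 * nn t + 32 * c * t\<^sup>2 * yy t ^ 3 * nn t ^ 3"
definition "L1 t = - 80 * c * (yy t ^ 3 * nn t - 6 * c * t\<^sup>2 * yy t ^ 2 * nn t - 1/2 * t * yy t ^ 3 * nn t ^ 3)
   + 192 * c\<^sup>2 * (3 * t\<^sup>2 * yy t ^ 2 * nn t - 4 * c * t ^ 4 * yy t * nn t - 1/2 * t ^ 3 * yy t ^ 2 * nn t ^ 3)
   + 32 * c * (2 * t * yy t ^ 3 * nn t ^ 3 - 6 * c * t ^ 3 * yy t ^ 2 * nn t ^ 3 - 3/2 * t\<^sup>2 * yy t ^ 3 * nn t ^ 5)"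

lemma pos: "0 \<le> t \<Longrightarrow> 0 < t + a\<^sup>2"
  using a by (simp add: add_nonneg_pos)

lemma nn_pos: "0 \<le> t \<Longrightarrow> 0 < nn t"
  using pos by (simp add: nn_def)

lemma nn_sq: "0 \<le> t \<Longrightarrow> nn t ^ 2 * (t + a\<^sup>2) = 1"
  using pos[of t] by (simp add: nn_def power_divide)

lemma yy: "0 \<le> yy t" "yy t \<le> 1"
  using c by (auto simp: yy_def)

lemma dnn: "0 \<le> t \<Longrightarrow> (nn has_real_derivative (- 1/2 * nn t ^ 3)) (at t)"
proof -
  assume t: "0 \<le> t"
  have sq: "0 < sqrt (t + a\<^sup>2)" "sqrt (t + a\<^sup>2) ^ 2 = t + a\<^sup>2" using pos[OF t] by auto
  have "((\<lambda>t. sqrt (t + a\<^sup>2)) has_real_derivative (1 / (2 * sqrt (t + a\<^sup>2)))) (at t)"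
    using pos[OF t] by (auto intro!: derivative_eq_intros simp: field_simps)
  then have "((\<lambda>t. inverse (sqrt (t + a\<^sup>2))) has_real_derivative
      - (inverse (sqrt (t + a\<^sup>2)) * (1 / (2 * sqrt (t + a\<^sup>2))) * inverse (sqrt (t + a\<^sup>2)))) (at t)"
    by (rule DERIV_inverse') (use sq in simp)
  then show "(nn has_real_derivative (- 1/2 * nn t ^ 3)) (at t)"
    unfolding nn_def[abs_def] by (simp add: inverse_eq_divide power3_eq_cube mult_ac)
qed

lemma dyy:
  "((\<lambda>t. yy t ^ 2) has_real_derivative (2 * yy t * (- 2 * c * t))) (at t)"
  "((\<lambda>t. yy t ^ 3) has_real_derivative (3 * yy t ^ 2 * (- 2 * c * t))) (at t)"
  "((\<lambda>t. yy t ^ 4) has_real_derivative (4 * yy t ^ 3 * (- 2 * c * t))) (at t)"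
proof -
  have i: "((\<lambda>t. 1 - c * t\<^sup>2) has_real_derivative (- 2 * c * t)) (at t)"
    by (auto intro!: derivative_eq_intros)
  show "((\<lambda>t. yy t ^ 2) has_real_derivative (2 * yy t * (- 2 * c * t))) (at t)"
    "((\<lambda>t. yy t ^ 3) has_real_derivative (3 * yy t ^ 2 * (- 2 * c * t))) (at t)"
    "((\<lambda>t. yy t ^ 4) has_real_derivative (4 * yy t ^ 3 * (- 2 * c * t))) (at t)"
    unfolding yy_def
    by (rule DERIV_chain2[OF DERIV_pos_part_power2 i] DERIV_chain2[OF DERIV_pos_part_power3 i] DERIV_chain2[OF DERIV_pos_part_power4 i])+
qed

lemma dnn3: "0 \<le> t \<Longrightarrow> ((\<lambda>t. nn t ^ 3) has_real_derivative (- 3/2 * nn t ^ 5)) (at t)"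
  using DERIV_power[OF dnn, of t 3] by (auto simp: eval_nat_numeral mult_ac)

lemma dK0: assumes t: "0 \<le> t" shows "(K0 has_real_derivative K1 t) (at t)"
  using DERIV_mult[OF dyy(3) dnn[OF t]] unfolding K0_def[abs_def] K1_def
  by (rule DERIV_cong) (simp add: algebra_simps)

lemma dK1: assumes t: "0 \<le> t" shows "(K1 has_real_derivative K2 t) (at t)"
proof -
  have "((\<lambda>t. t * yy t ^ 3) has_real_derivative 1 * yy t ^ 3 + 3 * yy t ^ 2 * (- 2 * c * t) * t) (at t)"
    by (intro DERIV_mult dyy) (auto intro!: derivative_eq_intros)
  from DERIV_diff[OF DERIV_cmult[OF DERIV_mult[OF this dnn[OF t]], of "- 8 * c"]
      DERIV_cmult[OF DERIV_mult[OF dyy(3) dnn3[OF t]], of "1/2"]]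
  show ?thesis unfolding K1_def[abs_def] K2_def mult.assoc
    by (rule DERIV_cong) (simp add: algebra_simps power2_eq_square power3_eq_cube power4_eq_xxxx)
qed

lemma dL0: assumes t: "0 \<le> t" shows "(L0 has_real_derivative L1 t) (at t)"
proof -
  have 1: "((\<lambda>t. t * yy t ^ 3) has_real_derivative 1 * yy t ^ 3 + 3 * yy t ^ 2 * (- 2 * c * t) * t) (at t)"
    by (intro DERIV_mult dyy) (auto intro!: derivative_eq_intros)
  have 2: "((\<lambda>t. t ^ 3 * yy t ^ 2) has_real_derivative (3 * t ^ 2) * yy t ^ 2 + 2 * yy t * (- 2 * c * t) * t ^ 3) (at t)"
    by (intro DERIV_mult dyy) (auto intro!: derivative_eq_intros)
  have 3: "((\<lambda>t. t ^ 2 * yy t ^ 3) has_real_derivative (2 * t) * yy t ^ 3 + 3 * yy t ^ 2 * (- 2 * c * t) * t ^ 2) (at t)"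
    by (intro DERIV_mult dyy) (auto intro!: derivative_eq_intros)
  from DERIV_add[OF DERIV_add[OF DERIV_cmult[OF DERIV_mult[OF 1 dnn[OF t]], of "- 80 * c"]
      DERIV_cmult[OF DERIV_mult[OF 2 dnn[OF t]], of "192 * c\<^sup>2"]] DERIV_cmult[OF DERIV_mult[OF 3 dnn3[OF t]], of "32 * c"]]
  show ?thesis unfolding L0_def[abs_def] L1_def mult.assoc
    by (rule DERIV_cong) (simp add: algebra_simps power2_eq_square power3_eq_cube power4_eq_xxxx)
qed

text \<open>For a profile in \<open>t = \<bar>x\<bar>\<^sup>2\<close> the Laplacian in dimension 3
  is 4 t times the second derivative plus 6 times the first. The terms without derivatives of the
  cutoff combine through \<open>nn t ^ 2 * (t + a\<^sup>2) = 1\<close>.\<close>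

lemma laplace_identity: assumes t: "0 \<le> t" shows "4 * t * K2 t + 6 * K1 t = L0 t - E0 t"
proof -
  have "3 * t * yy t ^ 4 * nn t ^ 5 - 3 * yy t ^ 4 * nn t ^ 3 = - 3 * a\<^sup>2 * yy t ^ 4 * nn t ^ 5"
  proof -
    have "3 * yy t ^ 4 * nn t ^ 3 = 3 * yy t ^ 4 * nn t ^ 3 * (nn t ^ 2 * (t + a\<^sup>2))"
      using nn_sq[OF t] by simp
    also have "\<dots> = 3 * yy t ^ 4 * nn t ^ 5 * (t + a\<^sup>2)" by (simp add: eval_nat_numeral)
    finally show ?thesis by (simp add: algebra_simps)
  qed
  then show ?thesis
    by (simp add: K1_def K2_def L0_def E0_def algebra_simps power2_eq_square power3_eq_cube)
qed

lemma cont_yy: "continuous_on S yy"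
  unfolding yy_def by (intro continuous_intros)

lemma cont_nn: "continuous_on {0..} nn"
  unfolding nn_def using pos by (intro continuous_intros) (auto simp: less_imp_neq[symmetric])

lemma cont: "continuous_on {0..} K1" "continuous_on {0..} K2" "continuous_on {0..} L1"
  "continuous_on {0..} E0"
  unfolding K1_def[abs_def] K2_def[abs_def] L1_def[abs_def] E0_def[abs_def]
  by (intro continuous_intros cont_yy cont_nn)+

text \<open>Where the cutoff is positive, both \<open>\<bar>x\<bar>\<close> and
  \<open>\<bar>x\<bar>\<close> times the regularised profile are at most 1, whatever
  \<open>a\<close> is. The bounds on \<open>L\<close> are reduced to products of these two
  quantities.\<close>

lemma mono_bounds:
  assumes t: "0 \<le> t" "yy t > 0"
  shows "t \<le> 1" "0 \<le> sqrt t * nn t" "sqrt t * nn t \<le> 1"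
proof -
  have "c * t\<^sup>2 < 1" using t(2) by (simp add: yy_def)
  moreover have "1 * t\<^sup>2 \<le> c * t\<^sup>2" using c by (intro mult_right_mono) auto
  ultimately have "t\<^sup>2 \<le> 1" by linarith
  then show "t \<le> 1" using t by (simp add: power_le_one_iff abs_le_square_iff[of t 1, simplified])
  have n: "nn t > 0" using nn_pos[OF t(1)] .
  show "0 \<le> sqrt t * nn t" using n t by simp
  have "sqrt t \<le> sqrt (t + a\<^sup>2)" by simp
  then show "sqrt t * nn t \<le> 1" using pos[OF t(1)] by (simp add: nn_def)
qed

text \<open>Every \<open>nn\<close> is accompanied by enough powers of \<open>\<bar>x\<bar>\<close>
  to be absorbed into \<open>w\<close>; the constant is the sum 80 + 192 + 32 of the
  coefficients.\<close>

lemma L0_bound: assumes t: "0 \<le> t" shows "\<bar>L0 t\<bar> \<le> 304 * c\<^sup>2"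
proof (cases "yy t = 0")
  case True then show ?thesis by (simp add: L0_def)
next
  case False
  then have "yy t > 0" using yy[of t] by simp
  note b = mono_bounds[OF t this]
  define T where "T = sqrt t"
  define w where "w = T * nn t"
  define y where "y = yy t"
  have T: "0 \<le> T" "T \<le> 1" "t = T\<^sup>2" and w: "0 \<le> w" "w \<le> 1" and y: "0 \<le> y" "y \<le> 1"
    using b t yy[of t] by (auto simp: T_def w_def y_def)
  have m: "0 \<le> T * w * y ^ 3" "T * w * y ^ 3 \<le> 1" "0 \<le> T ^ 5 * w * y\<^sup>2" "T ^ 5 * w * y\<^sup>2 \<le> 1"
    "0 \<le> T * w ^ 3 * y ^ 3" "T * w ^ 3 * y ^ 3 \<le> 1"
    using T(1,2) w y by (auto intro!: mult_le_one power_le_one mult_nonneg_nonneg)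
  have "L0 t = - 80 * c * (T * w * y ^ 3) + 192 * c\<^sup>2 * (T ^ 5 * w * y\<^sup>2) + 32 * c * (T * w ^ 3 * y ^ 3)"
    by (simp add: L0_def T(3) w_def y_def eval_nat_numeral mult_ac)
  moreover have "0 \<le> c * (T * w * y ^ 3)" "c * (T * w * y ^ 3) \<le> c"
      "0 \<le> c\<^sup>2 * (T ^ 5 * w * y\<^sup>2)" "c\<^sup>2 * (T ^ 5 * w * y\<^sup>2) \<le> c\<^sup>2"
      "0 \<le> c * (T * w ^ 3 * y ^ 3)" "c * (T * w ^ 3 * y ^ 3) \<le> c"
    using m c by (auto intro!: mult_left_le mult_nonneg_nonneg)
  moreover have "c \<le> c\<^sup>2" using c by (simp add: self_le_power)
  ultimately have "L0 t \<le> 304 * c\<^sup>2" "- (304 * c\<^sup>2) \<le> L0 t" by (simp_all only: mult.assoc)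
  then show ?thesis by (simp add: abs_le_iff)
qed

text \<open>The factor \<open>sqrt t\<close> comes from the gradient
  \<open>2 * x $ j * L1 (x \<bullet> x)\<close>. Without it the first term would contain an unpaired
  \<open>nn\<close>, of size \<open>1 / a\<close> at the origin. The constant 2344 is the sum of the
  absolute values of the six coefficients.\<close>

lemma L1_bound: assumes t: "0 \<le> t" shows "sqrt t * \<bar>L1 t\<bar> \<le> 2344 * c ^ 3"
proof (cases "yy t = 0")
  case True then show ?thesis using c by (simp add: L1_def)
next
  case False
  then have "yy t > 0" using yy[of t] by simp
  note b = mono_bounds[OF t this]
  define T where "T = sqrt t"
  define w where "w = T * nn t"
  define y where "y = yy t"
  have T: "0 \<le> T" "T \<le> 1" "t = T\<^sup>2" and w: "0 \<le> w" "w \<le> 1" and y: "0 \<le> y" "y \<le> 1"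
    using b t yy[of t] by (auto simp: T_def w_def y_def)
  have m: "\<bar>y ^ 3 * w\<bar> \<le> 1" "\<bar>T ^ 4 * y\<^sup>2 * w\<bar> \<le> 1" "\<bar>y ^ 3 * w ^ 3\<bar> \<le> 1" "\<bar>T ^ 8 * y * w\<bar> \<le> 1"
    "\<bar>T ^ 4 * y\<^sup>2 * w ^ 3\<bar> \<le> 1" "\<bar>y ^ 3 * w ^ 5\<bar> \<le> 1"
    using T(1,2) w y by (auto simp: abs_mult intro!: mult_le_one power_le_one mult_nonneg_nonneg)
  define p1 where "p1 = c * (y ^ 3 * w)"
  define p2 where "p2 = c\<^sup>2 * (T ^ 4 * y\<^sup>2 * w)"
  define p3 where "p3 = c * (y ^ 3 * w ^ 3)"
  define p4 where "p4 = c ^ 3 * (T ^ 8 * y * w)"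
  define p5 where "p5 = c\<^sup>2 * (T ^ 4 * y\<^sup>2 * w ^ 3)"
  define p6 where "p6 = c * (y ^ 3 * w ^ 5)"
  have eq: "T * L1 t = - 80 * p1 + 1056 * p2 + 104 * p3 - 768 * p4 - 288 * p5 - 48 * p6"
    unfolding p1_def p2_def p3_def p4_def p5_def p6_def
    by (simp add: L1_def T(3) w_def y_def eval_nat_numeral algebra_simps)
  have h: "- k \<le> k * m" "k * m \<le> k" if "\<bar>m\<bar> \<le> 1" "0 \<le> k" for k m :: real
  proof -
    have "\<bar>k * m\<bar> \<le> k" using mult_left_mono[OF that] that by (simp add: abs_mult)
    then show "- k \<le> k * m" "k * m \<le> k" by (simp_all add: abs_le_iff)
  qed
  have c0: "0 \<le> c" "0 \<le> c\<^sup>2" "0 \<le> c ^ 3" using c by auto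
  note p = h[OF m(1) c0(1), folded p1_def] h[OF m(2) c0(2), folded p2_def] h[OF m(3) c0(1), folded p3_def]
    h[OF m(4) c0(3), folded p4_def] h[OF m(5) c0(2), folded p5_def] h[OF m(6) c0(1), folded p6_def]
  have cc: "c \<le> c\<^sup>2" "c\<^sup>2 \<le> c ^ 3" using c by (auto simp: self_le_power intro!: power_increasing)
  have "T * L1 t \<le> 2344 * c ^ 3" "- (2344 * c ^ 3) \<le> T * L1 t"
    unfolding eq using p cc by linarith+
  then have "\<bar>T * L1 t\<bar> \<le> 2344 * c ^ 3" by (simp add: abs_le_iff)
  then show ?thesis unfolding T_def[symmetric] using T(1) by (simp add: abs_mult)
qed

definition "k x = K0 (x \<bullet> x)" for x :: "real^3"
definition "L x = L0 (x \<bullet> x)" for x :: "real^3"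
definition "E x = E0 (x \<bullet> x)" for x :: "real^3"

lemma C1_k: "C1 k" "partial j k = (\<lambda>x. 2 * x $ j * K1 (x \<bullet> x))"
  unfolding k_def[abs_def] using C1_radial[OF dK0 cont(1)] by (auto simp: fun_eq_iff)

lemma C1_partial_k: "C1 (partial j k)"
  "partial i (partial j k) x = 4 * x $ i * x $ j * K2 (x \<bullet> x) + (if i = j then 2 * K1 (x \<bullet> x) else 0)"
proof -
  note r = C1_radial[OF dK1 cont(2), where 'n = 3]
  have 1: "C1 (\<lambda>x::real^3. 2 * x $ j)" "partial i (\<lambda>x::real^3. 2 * x $ j) x = (if i = j then 2 else 0)"
    using C1_cmult[OF C1_component(1)[of j], where c = 2] by (auto simp: C1_component(2))
  show "C1 (partial j k)" unfolding C1_k(2) by (rule C1_mult(1)[OF 1(1) r(1)])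
  show "partial i (partial j k) x = 4 * x $ i * x $ j * K2 (x \<bullet> x) + (if i = j then 2 * K1 (x \<bullet> x) else 0)"
    by (simp only: C1_k(2), subst C1_mult(2)[OF 1(1) r(1)]) (auto simp: 1(2) r(2))
qed

lemma laplace_k: "(\<Sum>j\<in>UNIV. partial j (partial j k) x) = L x - E x"
proof -
  have "(\<Sum>j\<in>UNIV. partial j (partial j k) x) = 4 * (x \<bullet> x) * K2 (x \<bullet> x) + 6 * K1 (x \<bullet> x)"
    by (simp add: C1_partial_k(2) sum_3 inner_vec_def algebra_simps)
  then show ?thesis using laplace_identity[of "x \<bullet> x"] by (simp add: L_def E_def)
qed

lemma C1_L: "C1 L" "partial j L = (\<lambda>x. 2 * x $ j * L1 (x \<bullet> x))"
  unfolding L_def[abs_def] using C1_radial[OF dL0 cont(3)] by (auto simp: fun_eq_iff)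

lemma L_bound: "\<bar>L x\<bar> \<le> 304 * c\<^sup>2" "\<bar>partial j L x\<bar> \<le> 4688 * c ^ 3"
proof -
  show "\<bar>L x\<bar> \<le> 304 * c\<^sup>2" unfolding L_def by (rule L0_bound) simp
  have "\<bar>partial j L x\<bar> = 2 * (\<bar>x $ j\<bar> * \<bar>L1 (x \<bullet> x)\<bar>)" by (simp add: C1_L(2) abs_mult)
  also have "\<bar>x $ j\<bar> * \<bar>L1 (x \<bullet> x)\<bar> \<le> sqrt (x \<bullet> x) * \<bar>L1 (x \<bullet> x)\<bar>"
    using component_le_norm_cart[of x j] by (intro mult_right_mono) (auto simp: norm_eq_sqrt_inner)
  also have "\<dots> \<le> 2344 * c ^ 3" by (rule L1_bound) simp
  finally show "\<bar>partial j L x\<bar> \<le> 4688 * c ^ 3" by simp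
qed

lemma E_nonneg: "0 \<le> E x"
  using yy[of "x \<bullet> x"] nn_pos[of "x \<bullet> x"] by (simp add: E_def E0_def)

text \<open>At a fixed distance from the origin \<open>E\<close> is of order
  \<open>a\<^sup>2\<close>: this is the concentration.\<close>

lemma E_le: assumes "0 < d" "d \<le> norm x" shows "E x \<le> 3 * a\<^sup>2 / d ^ 5"
proof -
  have n: "0 \<le> nn (x \<bullet> x)" using nn_pos[of "x \<bullet> x"] by simp
  have "norm x \<le> sqrt (x \<bullet> x + a\<^sup>2)" unfolding norm_eq_sqrt_inner by simp
  then have "d \<le> sqrt (x \<bullet> x + a\<^sup>2)" using assms by linarith
  then have "nn (x \<bullet> x) \<le> 1 / d" unfolding nn_def using assms pos[of "x \<bullet> x"] by (intro divide_left_mono) auto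
  then have "nn (x \<bullet> x) ^ 5 \<le> (1 / d) ^ 5" using n by (intro power_mono)
  moreover have "yy (x \<bullet> x) ^ 4 \<le> 1" using yy by (intro power_le_one)
  ultimately have "3 * a\<^sup>2 * yy (x \<bullet> x) ^ 4 * nn (x \<bullet> x) ^ 5 \<le> 3 * a\<^sup>2 * 1 * (1 / d) ^ 5"
    using n yy[of "x \<bullet> x"] by (intro mult_mono) auto
  then show ?thesis by (simp add: E_def E0_def power_divide)
qed

lemma support:
  assumes "0 < s" "c * s ^ 4 = 1"
  shows "supp_in s k" "supp_in s L" "supp_in s E"
proof -
  have "yy (x \<bullet> x) = 0" if "s < norm x" for x :: "real^3"
  proof -
    have "s ^ 4 \<le> norm x ^ 4" using that assms by (intro power_mono) auto
    also have "norm x ^ 4 = (x \<bullet> x)\<^sup>2" by (simp add: power2_norm_eq_inner[symmetric] flip: power_mult)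
    finally have "c * s ^ 4 \<le> c * (x \<bullet> x)\<^sup>2" using c by (intro mult_left_mono) auto
    then show ?thesis using assms by (simp add: yy_def)
  qed
  then show "supp_in s k" "supp_in s L" "supp_in s E"
    by (auto simp: supp_in_def k_def L_def E_def K0_def L0_def E0_def)
qed

lemma continuous_E: "continuous_on UNIV E"
  unfolding E_def[abs_def] by (intro continuous_on_compose2[OF cont(4)] continuous_intros) auto

text \<open>On the ball of radius \<open>a\<close> the height is of order \<open>a ^ (-3)\<close>
  and matches the volume, so the mass of \<open>E\<close> has a positive lower bound uniform in
  \<open>a\<close>. The condition on \<open>a\<close> keeps this ball where the cutoff is at least
  15/16.\<close>

lemma E_lower:
  assumes "c * (2 * a) ^ 4 \<le> 1" "norm x \<le> a"
  shows "1 / (4 * a ^ 3) \<le> E x"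
proof -
  have t: "x \<bullet> x \<le> a\<^sup>2" using assms(2) by (simp add: power2_norm_eq_inner[symmetric] power_mono)
  have "(x \<bullet> x)\<^sup>2 \<le> (a\<^sup>2)\<^sup>2" using t by (intro power_mono) auto
  then have "c * (x \<bullet> x)\<^sup>2 \<le> c * (a\<^sup>2)\<^sup>2" using c by (intro mult_left_mono) auto
  also have "\<dots> = c * (2 * a) ^ 4 / 16" by (simp add: power_mult_distrib flip: power_mult)
  also have "\<dots> \<le> 1 / 16" using assms by simp
  finally have "15 / 16 \<le> yy (x \<bullet> x)" by (simp add: yy_def)
  then have "(15 / 16) ^ 4 \<le> yy (x \<bullet> x) ^ 4" by (intro power_mono) auto
  then have y: "1 / 2 \<le> yy (x \<bullet> x) ^ 4" by (simp add: power_divide)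
  have "sqrt (x \<bullet> x + a\<^sup>2) \<le> sqrt (2 * a\<^sup>2)" using t by simp
  also have "\<dots> = sqrt 2 * a" using a by (simp add: real_sqrt_mult)
  finally have "1 / (sqrt 2 * a) \<le> nn (x \<bullet> x)" unfolding nn_def using pos[of "x \<bullet> x"] a by (intro divide_left_mono) auto
  then have "(1 / (sqrt 2 * a)) ^ 5 \<le> nn (x \<bullet> x) ^ 5" using a by (intro power_mono) auto
  moreover have "1 / (6 * a ^ 5) \<le> (1 / (sqrt 2 * a)) ^ 5"
  proof -
    have "sqrt 2 ^ 5 = 4 * sqrt 2" by (simp add: eval_nat_numeral)
    also have "sqrt 2 \<le> 3/2" by (rule real_le_lsqrt) (auto simp: power2_eq_square)
    finally have "sqrt 2 ^ 5 \<le> 6" by simp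
    then have "(sqrt 2 * a) ^ 5 \<le> 6 * a ^ 5" using a by (simp add: power_mult_distrib)
    then show ?thesis using a unfolding power_divide power_one by (intro divide_left_mono) auto
  qed
  ultimately have n: "1 / (6 * a ^ 5) \<le> nn (x \<bullet> x) ^ 5" by linarith
  have "1 / (4 * a ^ 3) = 3 * a\<^sup>2 * (1 / 2) * (1 / (6 * a ^ 5))"
    using a by (simp add: field_simps eval_nat_numeral)
  also have "\<dots> \<le> 3 * a\<^sup>2 * yy (x \<bullet> x) ^ 4 * nn (x \<bullet> x) ^ 5"
    using y n a by (intro mult_mono) auto
  finally show ?thesis by (simp add: E_def E0_def)
qed

end

text \<open>The mixed second difference over a square of side \<open>s\<close> equals
  \<open>s * s\<close> times a mixed derivative at a nearby point, by two mean value theorems taken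
  in either order; let \<open>s\<close> tend to 0.\<close>

lemma C2_partial_commute:
  fixes f :: "real^'n::finite \<Rightarrow> real"
  assumes f: "C1 f" "\<And>j. C1 (partial j f)"
  shows "partial i (partial j f) x = partial j (partial i f) x"
proof -
  let ?ei = "axis i 1 :: real^'n" and ?ej = "axis j 1 :: real^'n"
  define D where "D s = f (x + s *\<^sub>R ?ei + s *\<^sub>R ?ej) - f (x + s *\<^sub>R ?ei) - f (x + s *\<^sub>R ?ej) + f x" for s
  have key: "\<exists>y. norm (y - x) \<le> 2 * s \<and> D s = s * s * partial l (partial k f) y"
    if s: "s > 0" and kl: "(k = i \<and> l = j) \<or> (k = j \<and> l = i)" for s k l
  proof -
    let ?ek = "axis k 1 :: real^'n" and ?el = "axis l 1 :: real^'n"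
    have Dk: "D s = (f (x + s *\<^sub>R ?el + s *\<^sub>R ?ek) - f (x + s *\<^sub>R ?ek)) - (f (x + s *\<^sub>R ?el) - f x)"
      using kl by (auto simp: D_def algebra_simps)
    define \<phi> where "\<phi> t = f (x + s *\<^sub>R ?el + t *\<^sub>R ?ek) - f (x + t *\<^sub>R ?ek)" for t
    have "(\<phi> has_real_derivative partial k f (x + s *\<^sub>R ?el + t *\<^sub>R ?ek) - partial k f (x + t *\<^sub>R ?ek)) (at t)" for t
      unfolding \<phi>_def[abs_def] by (intro DERIV_diff C1_line_axis f)
    from MVT2[OF s this] obtain t where t: "0 < t" "t < s"
      "\<phi> s - \<phi> 0 = (s - 0) * (partial k f (x + s *\<^sub>R ?el + t *\<^sub>R ?ek) - partial k f (x + t *\<^sub>R ?ek))" by auto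
    define \<psi> where "\<psi> r = partial k f ((x + t *\<^sub>R ?ek) + r *\<^sub>R ?el)" for r
    have "(\<psi> has_real_derivative partial l (partial k f) ((x + t *\<^sub>R ?ek) + r *\<^sub>R ?el)) (at r)" for r
      unfolding \<psi>_def[abs_def] by (intro C1_line_axis f)
    from MVT2[OF s this] obtain r where r: "0 < r" "r < s"
      "\<psi> s - \<psi> 0 = (s - 0) * partial l (partial k f) ((x + t *\<^sub>R ?ek) + r *\<^sub>R ?el)" by auto
    have "D s = \<phi> s - \<phi> 0" unfolding Dk \<phi>_def by simp
    also have "\<dots> = s * (\<psi> s - \<psi> 0)" using t(3) by (simp add: \<psi>_def add_ac)
    also have "\<dots> = s * s * partial l (partial k f) ((x + t *\<^sub>R ?ek) + r *\<^sub>R ?el)" using r(3) by simp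
    finally have "D s = s * s * partial l (partial k f) ((x + t *\<^sub>R ?ek) + r *\<^sub>R ?el)" .
    moreover have "norm ((x + t *\<^sub>R ?ek) + r *\<^sub>R ?el - x) \<le> 2 * s"
      using norm_triangle_ineq[of "t *\<^sub>R ?ek" "r *\<^sub>R ?el"] t r by (simp add: norm_axis_1)
    ultimately show ?thesis by blast
  qed
  have lim: "(\<lambda>n. partial l (partial k f) (y n)) \<longlonglongrightarrow> partial l (partial k f) x"
    if "\<And>n. norm (y n - x) \<le> 2 * inverse (real (Suc n))" for y k l
  proof -
    have "(\<lambda>n. 2 * inverse (real (Suc n))) \<longlonglongrightarrow> 2 * 0" by (intro tendsto_intros LIMSEQ_inverse_real_of_nat)
    then have "(\<lambda>n. 2 * inverse (real (Suc n))) \<longlonglongrightarrow> 0" by simp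
    from tendsto_sandwich[OF _ _ tendsto_const this] have "(\<lambda>n. norm (y n - x)) \<longlonglongrightarrow> 0"
      using that by (auto simp del: of_nat_Suc)
    then have "y \<longlonglongrightarrow> x" by (simp add: tendsto_norm_zero_iff LIM_zero_iff)
    then show ?thesis
      using C1_partial_continuous[OF f(2)[of k], of l] by (auto simp: continuous_on_eq_continuous_at isCont_def intro: isCont_tendsto_compose)
  qed
  have p: "inverse (real (Suc n)) > 0" for n by simp
  obtain y where y: "\<And>n. norm (y n - x) \<le> 2 * inverse (real (Suc n))"
    "\<And>n. D (inverse (real (Suc n))) = inverse (real (Suc n)) * inverse (real (Suc n)) * partial i (partial j f) (y n)"
    using key[OF p, of j i] by metis
  obtain z where z: "\<And>n. norm (z n - x) \<le> 2 * inverse (real (Suc n))"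
    "\<And>n. D (inverse (real (Suc n))) = inverse (real (Suc n)) * inverse (real (Suc n)) * partial j (partial i f) (z n)"
    using key[OF p, of i j] by metis
  have "partial i (partial j f) (y n) = partial j (partial i f) (z n)" for n
    using y(2)[of n] z(2)[of n] by (simp del: of_nat_Suc)
  then show ?thesis using lim[OF y(1), of i j] lim[OF z(1), of j i] by (simp add: LIMSEQ_unique)
qed

section \<open>Integrals over closed balls centred at the origin\<close>

definition II :: "real \<Rightarrow> (real^3 \<Rightarrow> real) \<Rightarrow> real" where
  "II r f = (\<integral>x. indicator (cball 0 r) x * f x \<partial>lborel)"

lemma II_integrable:
  fixes f :: "real^3 \<Rightarrow> real"
  assumes "continuous_on UNIV f" shows "integrable lborel (\<lambda>x. indicator (cball 0 r) x * f x)"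
  using borel_integrable_compact[of "cball 0 r" f] continuous_on_subset[OF assms] by simp

lemma II_nonneg: "(\<And>x. 0 \<le> f x) \<Longrightarrow> 0 \<le> II r f"
  unfolding II_def by (intro integral_nonneg_AE) auto

lemma II_mono:
  "continuous_on UNIV f \<Longrightarrow> continuous_on UNIV g \<Longrightarrow> (\<And>x. norm x \<le> r \<Longrightarrow> f x \<le> g x) \<Longrightarrow> II r f \<le> II r g"
  unfolding II_def by (intro integral_mono II_integrable) (auto simp: indicator_def)

lemma II_mono_radius:
  "continuous_on UNIV f \<Longrightarrow> (\<And>x. 0 \<le> f x) \<Longrightarrow> r \<le> r' \<Longrightarrow> II r f \<le> II r' f"
  unfolding II_def by (intro integral_mono II_integrable) (auto simp: indicator_def)

lemma II_add: "continuous_on UNIV f \<Longrightarrow> continuous_on UNIV g \<Longrightarrow> II r (\<lambda>x. f x + g x) = II r f + II r g"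
  unfolding II_def distrib_left by (intro Bochner_Integration.integral_add II_integrable)

lemma II_cmult: "II r (\<lambda>x. c * f x) = c * II r f"
  unfolding II_def by (simp add: mult.left_commute[of _ c])

lemma II_const: "0 \<le> r \<Longrightarrow> II r (\<lambda>x. c) = c * (4/3 * pi * r ^ 3)"
  unfolding II_def by (simp add: content_cball unit_ball_vol_3)

lemma integral_eq_II:
  fixes f :: "real^3 \<Rightarrow> real"
  assumes "supp_in r f" shows "(\<integral>x. f x \<partial>lborel) = II r f"
  unfolding II_def using assms by (intro Bochner_Integration.integral_cong) (auto simp: supp_in_def indicator_def)

lemma integral_le_II:
  assumes "cc f" "supp_in r f" "continuous_on UNIV g" "\<And>x. norm x \<le> r \<Longrightarrow> \<bar>f x\<bar> \<le> g x"
  shows "\<bar>\<integral>x. f x \<partial>lborel\<bar> \<le> II r g"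
proof -
  have "\<bar>\<integral>x. f x \<partial>lborel\<bar> \<le> (\<integral>x. \<bar>f x\<bar> \<partial>lborel)" by (rule integral_abs_bound)
  also have "\<dots> = II r (\<lambda>x. \<bar>f x\<bar>)" using assms by (intro integral_eq_II) (auto simp: supp_in_def)
  also have "\<dots> \<le> II r g" using assms cc_continuous[OF assms(1)] by (intro II_mono continuous_on_rabs) auto
  finally show ?thesis .
qed

lemma pi_le: "pi \<le> 4" by (rule less_imp_le[OF pi_less_4])

context kernel
begin

lemma cc_kernel: "cc k" "cc L" "cc E"
proof -
  define s where "s = root 4 (1 / c)"
  have "s ^ 4 = 1 / c" using c by (simp add: s_def)
  then have s: "c * s ^ 4 = 1" "0 < s" using c by (auto simp: s_def)
  show "cc k" "cc L" "cc E"
    using support[OF s(2,1)] C1_continuous[OF C1_k(1)] C1_continuous[OF C1_L(1)] continuous_E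
    by (auto intro: ccI)
qed

lemma laplace_k_eq: "L = (\<lambda>x. (\<Sum>j\<in>UNIV. partial j (partial j k) x) + E x)"
  using laplace_k by (auto simp: fun_eq_iff)

text \<open>The Laplacian of the compactly supported \<open>k\<close> integrates to zero. The mass
  of \<open>E\<close>, whose height blows up as \<open>a\<close> decreases, is thereby bounded
  through the uniformly bounded \<open>L\<close>.\<close>

lemma integral_E_eq_L: "(\<integral>x. E x \<partial>lborel) = (\<integral>x. L x \<partial>lborel)"
proof -
  have cp: "cc (partial j k)" and cp2: "cc (partial j (partial j k))" for j
    by (intro cc_partial C1_k(1) C1_partial_k(1) cc_kernel)+
  have "(\<integral>x. L x \<partial>lborel) = (\<Sum>j\<in>UNIV. (\<integral>x. partial j (partial j k) x \<partial>lborel)) + (\<integral>x. E x \<partial>lborel)"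
    unfolding laplace_k_eq using cp2 cc_kernel(3) by (simp add: cc_integrable cc_sum)
  then show ?thesis by (simp add: integral_partial_eq_0[OF C1_partial_k(1) cp])
qed

text \<open>The support has radius at most 1; 1622 rounds up 304 times 16/3, the volume of the unit
  ball with \<open>pi\<close> replaced by 4.\<close>

lemma integral_abs_L_le: "(\<integral>x. \<bar>L x\<bar> \<partial>lborel) \<le> 1622 * c\<^sup>2"
proof -
  define s where "s = root 4 (1 / c)"
  have "s ^ 4 = 1 / c" using c by (simp add: s_def)
  then have s: "c * s ^ 4 = 1" "0 < s" using c by (auto simp: s_def)
  have s1: "s \<le> 1" using c by (simp add: s_def)
  have "\<bar>\<integral>x. \<bar>L x\<bar> \<partial>lborel\<bar> \<le> II s (\<lambda>x. 304 * c\<^sup>2)"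
    using support[OF s(2,1)] L_bound cc_kernel by (intro integral_le_II cc_abs) (auto simp: supp_in_def)
  also have "\<dots> = 304 * c\<^sup>2 * (4/3 * pi * s ^ 3)" using s by (simp add: II_const)
  also have "\<dots> \<le> 304 * c\<^sup>2 * (4/3 * 4 * 1)"
    using s s1 pi_le by (intro mult_left_mono mult_mono power_le_one) auto
  also have "\<dots> \<le> 1622 * c\<^sup>2" by simp
  finally show ?thesis by simp
qed

lemma integral_E_le: "(\<integral>x. E x \<partial>lborel) \<le> 1622 * c\<^sup>2"
proof -
  have "(\<integral>x. E x \<partial>lborel) \<le> (\<integral>x. \<bar>L x\<bar> \<partial>lborel)"
    unfolding integral_E_eq_L using cc_kernel by (intro integral_mono cc_integrable cc_abs) auto
  then show ?thesis using integral_abs_L_le by simp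
qed

lemma integral_E_ge:
  assumes "c * (2 * a) ^ 4 \<le> 1" shows "1 \<le> (\<integral>x. E x \<partial>lborel)"
proof -
  have "1 \<le> 1 / (4 * a ^ 3) * (4/3 * pi * a ^ 3)"
    using a pi_gt3 by simp
  also have "\<dots> = II a (\<lambda>x. 1 / (4 * a ^ 3))" using a by (simp only: II_const less_imp_le)
  also have "\<dots> \<le> II a E" using E_lower[OF assms] continuous_E by (intro II_mono) auto
  also have "\<dots> \<le> (\<integral>x. E x \<partial>lborel)"
    unfolding II_def using E_nonneg cc_kernel continuous_E
    by (intro integral_mono II_integrable cc_integrable) (auto simp: indicator_def)
  finally show ?thesis .
qed

text \<open>Near the origin the modulus of continuity of \<open>g\<close> acts against the mass of
  \<open>E\<close>; away from it the smallness of \<open>E\<close> acts against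
  \<open>2 * B\<close>. \<open>E\<close> is not normalised, so the comparison is with a multiple of
  \<open>g\<close>.\<close>

lemma E_approximate_identity:
  assumes g: "cc g" "\<And>x. \<bar>g x\<bar> \<le> B" and d: "0 < d" "\<And>x y. norm (x - y) < d \<Longrightarrow> \<bar>g x - g y\<bar> \<le> e" and e: "0 \<le> e"
  shows "\<bar>conv E g x - (\<integral>x. E x \<partial>lborel) * g x\<bar> \<le> e * (1622 * c\<^sup>2) + 2 * B * (3 * a\<^sup>2 / d ^ 5) * (16/3)"
proof -
  define s where "s = root 4 (1 / c)"
  have "s ^ 4 = 1 / c" using c by (simp add: s_def)
  then have s: "c * s ^ 4 = 1" "0 < s" using c by (auto simp: s_def)
  have s1: "s \<le> 1" using c by (simp add: s_def)
  have B: "0 \<le> B" using g(2)[of 0] by simp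
  have cs: "continuous_on UNIV (\<lambda>y. g (x - y))"
    by (intro continuous_on_compose2[OF cc_continuous[OF g(1)]] continuous_intros) auto
  have ccs: "cc (\<lambda>y. E y * g (x - y))" "cc (\<lambda>y. E y * g x)" "cc (\<lambda>y. E y * (g (x - y) - g x))"
    by (intro cc_mult_right cc_kernel cs continuous_on_diff continuous_on_const)+
  have "conv E g x - (\<integral>x. E x \<partial>lborel) * g x = (\<integral>y. E y * (g (x - y) - g x) \<partial>lborel)"
    unfolding conv_commute_form[OF cc_kernel(3) g(1)] right_diff_distrib
    by (subst Bochner_Integration.integral_diff[OF cc_integrable[OF ccs(1)] cc_integrable[OF ccs(2)]]) simp
  also have "\<bar>\<dots>\<bar> \<le> (\<integral>y. e * E y + 2 * B * (3 * a\<^sup>2 / d ^ 5) * indicator (cball 0 s) y \<partial>lborel)"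
  proof (rule abs_integral_le)
    show "integrable lborel (\<lambda>y. e * E y + 2 * B * (3 * a\<^sup>2 / d ^ 5) * indicator (cball 0 s) y)"
      using cc_kernel by (intro Bochner_Integration.integrable_add integrable_mult_right cc_integrable integrable_real_indicator)
        (auto intro!: emeasure_bounded_finite[unfolded infinity_ennreal_def])
    fix y
    show "\<bar>E y * (g (x - y) - g x)\<bar> \<le> e * E y + 2 * B * (3 * a\<^sup>2 / d ^ 5) * indicator (cball 0 s) y"
    proof (cases "norm y < d")
      case True
      then have "\<bar>g (x - y) - g x\<bar> \<le> e" by (intro d) simp
      then have "E y * \<bar>g (x - y) - g x\<bar> \<le> E y * e" using E_nonneg by (intro mult_left_mono)
      then have "\<bar>E y * (g (x - y) - g x)\<bar> \<le> e * E y" using E_nonneg[of y] by (simp add: abs_mult mult.commute)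
      moreover have "0 \<le> 2 * B * (3 * a\<^sup>2 / d ^ 5) * indicator (cball 0 s) y" using B d by simp
      ultimately show ?thesis by linarith
    next
      case False
      have e0: "0 \<le> e * E y" using e E_nonneg by simp
      show ?thesis
      proof (cases "norm y \<le> s")
        case True
        have "\<bar>g (x - y) - g x\<bar> \<le> 2 * B" using g(2)[of "x - y"] g(2)[of x] by linarith
        then have "E y * \<bar>g (x - y) - g x\<bar> \<le> (3 * a\<^sup>2 / d ^ 5) * (2 * B)"
          using False d E_nonneg[of y] by (intro mult_mono E_le) auto
        then show ?thesis using True e0 E_nonneg[of y] by (simp add: abs_mult mult_ac)
      next
        case False
        then have "E y = 0" using support[OF s(2,1)] by (auto simp: supp_in_def)
        then show ?thesis using False by simp
      qed
    qed
  qed (use ccs in \<open>auto intro: cc_integrable\<close>)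
  also have "\<dots> = e * (\<integral>y. E y \<partial>lborel) + 2 * B * (3 * a\<^sup>2 / d ^ 5) * (4/3 * pi * s ^ 3)"
  proof -
    define M where "M = 2 * B * (3 * a\<^sup>2 / d ^ 5)"
    have i: "integrable lborel (\<lambda>y::real^3. M * indicator (cball 0 s) y)"
      by (intro integrable_mult_right integrable_real_indicator) (auto intro!: emeasure_bounded_finite[unfolded infinity_ennreal_def])
    have j: "integrable lborel (\<lambda>y. e * E y)" using cc_kernel by (intro cc_integrable cc_cmult)
    have "(\<integral>y. e * E y + M * indicator (cball 0 s) y \<partial>lborel) = (\<integral>y. e * E y \<partial>lborel) + (\<integral>y. M * indicator (cball (0::real^3) s) y \<partial>lborel)"
      by (rule Bochner_Integration.integral_add[OF j i])
    then show ?thesis unfolding M_def[symmetric] using s by (simp add: content_cball unit_ball_vol_3)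
  qed
  also have "\<dots> \<le> e * (1622 * c\<^sup>2) + 2 * B * (3 * a\<^sup>2 / d ^ 5) * (4/3 * 4 * 1)"
    using e B d s s1 pi_le integral_E_le by (intro add_mono mult_left_mono mult_mono power_le_one) auto
  finally show ?thesis by simp
qed

end


subsection \<open>The stationary MHD system and its pressure\<close>

text \<open>The viscosity is a parameter because rescaling turns viscosity 1 into a smaller one and
  leaves the system otherwise unchanged. Fields are families of scalar components, to which
  integration by parts applies directly.\<close>

locale mhd =
  fixes \<nu> :: real and v b :: "3 \<Rightarrow> real^3 \<Rightarrow> real" and p :: "real^3 \<Rightarrow> real"
  assumes C1_v: "C1 (v i)" and C2_v: "C1 (partial j (v i))"
    and C1_b: "C1 (b i)" and C2_b: "C1 (partial j (b i))" and C1_p: "C1 p"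
    and div_v: "(\<Sum>i\<in>UNIV. partial i (v i) x) = 0" and div_b: "(\<Sum>i\<in>UNIV. partial i (b i) x) = 0"
    and momentum: "\<nu> * (\<Sum>j\<in>UNIV. partial j (partial j (v i)) x)
       = (\<Sum>j\<in>UNIV. v j x * partial j (v i) x) + partial i p x - (\<Sum>j\<in>UNIV. b j x * partial j (b i) x)"
    and induction: "\<nu> * (\<Sum>j\<in>UNIV. partial j (partial j (b i)) x)
       = (\<Sum>j\<in>UNIV. v j x * partial j (b i) x) - (\<Sum>j\<in>UNIV. b j x * partial j (v i) x)"

text \<open>Vanishing divergence turns the advection of \<open>w\<close> into the divergence of the
  product of \<open>v\<close> and \<open>w\<close>, which is then integrated by parts.\<close>

lemma advection_by_parts:
  fixes v :: "'n::finite \<Rightarrow> real^'n \<Rightarrow> real" and w q :: "real^'n \<Rightarrow> real"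
  assumes v: "\<And>i. C1 (v i)" "\<And>x. (\<Sum>i\<in>UNIV. partial i (v i) x) = 0" and w: "C1 w" and q: "C1 q" "cc q"
  shows "(\<integral>x. (\<Sum>j\<in>UNIV. v j x * partial j w x) * q x \<partial>lborel) = - (\<Sum>j\<in>UNIV. \<integral>x. v j x * w x * partial j q x \<partial>lborel)"
proof -
  note vc = C1_continuous[OF v(1)] C1_partial_continuous[OF v(1)] C1_continuous[OF w] C1_partial_continuous[OF w] C1_partial_continuous[OF q(1)]
  have vw: "C1 (\<lambda>x. v j x * w x)" "partial j (\<lambda>x. v j x * w x) x = v j x * partial j w x + partial j (v j) x * w x" for j x
    using C1_mult[OF v(1) w] by auto
  have cc: "cc (\<lambda>x. partial j (\<lambda>x. v j x * w x) x * q x)" for j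
    by (intro cc_mult_left q C1_partial_continuous vw)
  have "(\<Sum>j\<in>UNIV. v j x * partial j w x) * q x = (\<Sum>j\<in>UNIV. partial j (\<lambda>x. v j x * w x) x * q x)" for x
  proof -
    have "(\<Sum>j\<in>UNIV. partial j (\<lambda>x. v j x * w x) x * q x) = (\<Sum>j\<in>UNIV. v j x * partial j w x) * q x + (\<Sum>j\<in>UNIV. partial j (v j) x) * (w x * q x)"
      unfolding vw(2) by (simp add: sum_distrib_right sum_distrib_left sum.distrib algebra_simps)
    then show ?thesis using v(2) by simp
  qed
  then have "(\<integral>x. (\<Sum>j\<in>UNIV. v j x * partial j w x) * q x \<partial>lborel) = (\<Sum>j\<in>UNIV. \<integral>x. partial j (\<lambda>x. v j x * w x) x * q x \<partial>lborel)"
    using cc by (simp add: cc_integrable)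
  also have "\<dots> = (\<Sum>j\<in>UNIV. - (\<integral>x. v j x * w x * partial j q x \<partial>lborel))"
    using integral_by_parts[OF vw(1) q(1)] q(2) by simp
  finally show ?thesis by (simp add: sum_negf)
qed

lemma laplacian_by_parts:
  fixes w q :: "real^'n::finite \<Rightarrow> real"
  assumes w: "\<And>j. C1 (partial j w)" and q: "C1 q" "cc q"
  shows "(\<integral>x. (\<Sum>j\<in>UNIV. partial j (partial j w) x) * q x \<partial>lborel) = - (\<Sum>j\<in>UNIV. \<integral>x. partial j w x * partial j q x \<partial>lborel)"
proof -
  have cc: "cc (\<lambda>x. partial j (partial j w) x * q x)" for j
    by (intro cc_mult_left q C1_partial_continuous w)
  have "(\<integral>x. (\<Sum>j\<in>UNIV. partial j (partial j w) x) * q x \<partial>lborel) = (\<Sum>j\<in>UNIV. \<integral>x. partial j (partial j w) x * q x \<partial>lborel)"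
    unfolding sum_distrib_right using cc by (simp add: cc_integrable)
  also have "\<dots> = (\<Sum>j\<in>UNIV. - (\<integral>x. partial j w x * partial j q x \<partial>lborel))"
    using integral_by_parts[OF w q(1)] q(2) by simp
  finally show ?thesis by (simp add: sum_negf)
qed

context mhd
begin

lemmas conts = C1_continuous[OF C1_v] C1_continuous[OF C1_b] C1_partial_continuous[OF C1_v] C1_partial_continuous[OF C1_b]
  C1_partial_continuous[OF C2_v] C1_partial_continuous[OF C2_b] C1_continuous[OF C1_p] C1_partial_continuous[OF C1_p]

lemma momentum_weak:
  assumes q: "\<And>i. C1 (q i)" "\<And>i. cc (q i)"
  shows "(\<Sum>i\<in>UNIV. \<integral>x. partial i p x * q i x \<partial>lborel)
     = - \<nu> * (\<Sum>i\<in>UNIV. \<Sum>j\<in>UNIV. \<integral>x. partial j (v i) x * partial j (q i) x \<partial>lborel)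
       + (\<Sum>i\<in>UNIV. \<Sum>j\<in>UNIV. \<integral>x. (v j x * v i x - b j x * b i x) * partial j (q i) x \<partial>lborel)"
proof -
  have "(\<integral>x. partial i p x * q i x \<partial>lborel) = - \<nu> * (\<Sum>j\<in>UNIV. \<integral>x. partial j (v i) x * partial j (q i) x \<partial>lborel)
     + (\<Sum>j\<in>UNIV. \<integral>x. (v j x * v i x - b j x * b i x) * partial j (q i) x \<partial>lborel)" for i
  proof -
    have cc: "cc (\<lambda>x. (\<Sum>j\<in>UNIV. partial j (partial j (v i)) x) * q i x)"
      "cc (\<lambda>x. (\<Sum>j\<in>UNIV. v j x * partial j (v i) x) * q i x)" "cc (\<lambda>x. (\<Sum>j\<in>UNIV. b j x * partial j (b i) x) * q i x)"
      by (intro cc_mult_left q continuous_intros conts)+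
    have cc': "cc (\<lambda>x. v j x * v i x * partial j (q i) x)" "cc (\<lambda>x. b j x * b i x * partial j (q i) x)" for j
      by (intro cc_mult_left cc_partial q continuous_intros conts)+
    have "partial i p x * q i x = \<nu> * ((\<Sum>j\<in>UNIV. partial j (partial j (v i)) x) * q i x)
        - (\<Sum>j\<in>UNIV. v j x * partial j (v i) x) * q i x + (\<Sum>j\<in>UNIV. b j x * partial j (b i) x) * q i x" for x
      using arg_cong[OF momentum[of i x], of "\<lambda>t. t * q i x"] by (simp add: algebra_simps)
    then have "(\<integral>x. partial i p x * q i x \<partial>lborel) = \<nu> * (\<integral>x. (\<Sum>j\<in>UNIV. partial j (partial j (v i)) x) * q i x \<partial>lborel)
        - (\<integral>x. (\<Sum>j\<in>UNIV. v j x * partial j (v i) x) * q i x \<partial>lborel) + (\<integral>x. (\<Sum>j\<in>UNIV. b j x * partial j (b i) x) * q i x \<partial>lborel)"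
      using cc by (simp add: cc_integrable cc_diff cc_cmult)
    then show ?thesis
      unfolding laplacian_by_parts[OF C2_v q] advection_by_parts[OF C1_v div_v C1_v q]
        advection_by_parts[OF C1_b div_b C1_b q]
      using cc' by (simp add: left_diff_distrib cc_integrable sum_subtractf)
  qed
  then show ?thesis by (simp add: sum.distrib sum_distrib_left)
qed

text \<open>Weak form of the pressure equation, obtained by testing the momentum equation with the
  gradient of \<open>h\<close>. The viscous term disappears: after exchanging derivatives it pairs
  the gradient of the divergence of \<open>v\<close> with the gradient of \<open>h\<close>.\<close>

lemma integral_p_laplacian:
  assumes h: "C1 h" "\<And>j. C1 (partial j h)" "cc h"
  shows "(\<integral>x. p x * (\<Sum>i\<in>UNIV. partial i (partial i h) x) \<partial>lborel)
     = - (\<Sum>i\<in>UNIV. \<Sum>j\<in>UNIV. \<integral>x. (v j x * v i x - b j x * b i x) * partial j (partial i h) x \<partial>lborel)"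
proof -
  have cp: "cc (partial i h)" for i by (intro cc_partial h)
  have z: "(\<Sum>i\<in>UNIV. \<Sum>j\<in>UNIV. \<integral>x. partial j (v i) x * partial j (partial i h) x \<partial>lborel) = 0"
  proof -
    have "(\<Sum>i\<in>UNIV. \<Sum>j\<in>UNIV. \<integral>x. partial j (v i) x * partial j (partial i h) x \<partial>lborel)
      = (\<Sum>i\<in>UNIV. \<Sum>j\<in>UNIV. - (\<integral>x. partial j (partial i (v i)) x * partial j h x \<partial>lborel))"
    proof (intro sum.cong refl)
      fix i j
      have "partial j (partial i h) = partial i (partial j h)"
        by (rule ext) (rule C2_partial_commute[OF h(1,2)])
      moreover have "partial i (partial j (v i)) = partial j (partial i (v i))"
        by (rule ext) (rule C2_partial_commute[OF C1_v C2_v])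
      ultimately show "(\<integral>x. partial j (v i) x * partial j (partial i h) x \<partial>lborel)
          = - (\<integral>x. partial j (partial i (v i)) x * partial j h x \<partial>lborel)"
        using integral_by_parts[OF C2_v[of j i] h(2)[of j], of i] cp by simp
    qed
    also have "\<dots> = - (\<Sum>j\<in>UNIV. \<integral>x. (\<Sum>i\<in>UNIV. partial j (partial i (v i)) x) * partial j h x \<partial>lborel)"
    proof -
      have "cc (\<lambda>x. partial j (partial i (v i)) x * partial j h x)" for i j
        by (intro cc_mult_left cp conts)
      then show ?thesis
        unfolding sum_distrib_right by (subst sum.swap) (simp add: cc_integrable sum_negf)
    qed
    also have "\<dots> = 0"
    proof -
      have "(\<Sum>i\<in>UNIV. partial j (partial i (v i)) x) = 0" for j x
      proof -
        have "partial j (\<lambda>x. \<Sum>i\<in>UNIV. partial i (v i) x) x = (\<Sum>i\<in>UNIV. partial j (partial i (v i)) x)"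
          using C1_sum[of UNIV "\<lambda>i. partial i (v i)" j x] C2_v by auto
        then show ?thesis unfolding div_v by (simp add: C1_const)
      qed
      then show ?thesis by simp
    qed
    finally show ?thesis .
  qed
  have "(\<integral>x. p x * (\<Sum>i\<in>UNIV. partial i (partial i h) x) \<partial>lborel) = (\<Sum>i\<in>UNIV. \<integral>x. p x * partial i (partial i h) x \<partial>lborel)"
  proof -
    have "cc (\<lambda>x. p x * partial i (partial i h) x)" for i by (intro cc_mult_left cc_partial cp h conts)
    then show ?thesis by (simp add: sum_distrib_left cc_integrable)
  qed
  also have "\<dots> = (\<Sum>i\<in>UNIV. - (\<integral>x. partial i p x * partial i h x \<partial>lborel))"
    using integral_by_parts[OF C1_p h(2)] cp by simp
  also have "\<dots> = - (\<Sum>i\<in>UNIV. \<integral>x. partial i p x * partial i h x \<partial>lborel)" by (simp add: sum_negf)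
  also have "\<dots> = - (\<Sum>i\<in>UNIV. \<Sum>j\<in>UNIV. \<integral>x. (v j x * v i x - b j x * b i x) * partial j (partial i h) x \<partial>lborel)"
    unfolding momentum_weak[of "\<lambda>i. partial i h", OF h(2) cp] z by simp
  finally show ?thesis .
qed

lemma integral_p_divergence:
  assumes q: "\<And>i. C1 (q i)" "\<And>i. cc (q i)"
  shows "(\<integral>x. p x * (\<Sum>i\<in>UNIV. partial i (q i) x) \<partial>lborel)
     = \<nu> * (\<Sum>i\<in>UNIV. \<Sum>j\<in>UNIV. \<integral>x. partial j (v i) x * partial j (q i) x \<partial>lborel)
       - (\<Sum>i\<in>UNIV. \<Sum>j\<in>UNIV. \<integral>x. (v j x * v i x - b j x * b i x) * partial j (q i) x \<partial>lborel)"
proof -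
  have "cc (\<lambda>x. p x * partial i (q i) x)" for i by (intro cc_mult_left cc_partial q conts)
  then have "(\<integral>x. p x * (\<Sum>i\<in>UNIV. partial i (q i) x) \<partial>lborel) = (\<Sum>i\<in>UNIV. \<integral>x. p x * partial i (q i) x \<partial>lborel)"
    by (simp add: sum_distrib_left cc_integrable)
  also have "\<dots> = (\<Sum>i\<in>UNIV. - (\<integral>x. partial i p x * q i x \<partial>lborel))"
    using integral_by_parts[OF C1_p q(1)] q(2) by simp
  also have "\<dots> = - (\<Sum>i\<in>UNIV. \<integral>x. partial i p x * q i x \<partial>lborel)" by (simp add: sum_negf)
  finally show ?thesis unfolding momentum_weak[OF q] by simp
qed

end

lemma conv_sum_right:
  fixes k :: "real^'n::finite \<Rightarrow> real"
  assumes "continuous_on UNIV k" "\<And>i. i \<in> I \<Longrightarrow> cc (f i)"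
  shows "conv k (\<lambda>x. \<Sum>i\<in>I. f i x) x = (\<Sum>i\<in>I. conv k (f i) x)"
proof -
  have "integrable lborel (\<lambda>y. k (x - y) * f i y)" if "i \<in> I" for i
    using assms that by (intro cc_integrable conv_integrand_cc)
  then show ?thesis unfolding conv_def sum_distrib_left by (intro Bochner_Integration.integral_sum)
qed

lemma conv_diff_left:
  fixes k l :: "real^'n::finite \<Rightarrow> real"
  assumes "continuous_on UNIV k" "continuous_on UNIV l" "cc f"
  shows "conv (\<lambda>x. k x - l x) f x = conv k f x - conv l f x"
  unfolding conv_def left_diff_distrib using assms
  by (intro Bochner_Integration.integral_diff cc_integrable conv_integrand_cc)

lemma conv_sum_left:
  fixes k :: "'i \<Rightarrow> real^'n::finite \<Rightarrow> real"
  assumes "\<And>i. i \<in> I \<Longrightarrow> continuous_on UNIV (k i)" "cc f"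
  shows "conv (\<lambda>x. \<Sum>i\<in>I. k i x) f x = (\<Sum>i\<in>I. conv (k i) f x)"
proof -
  have "integrable lborel (\<lambda>y. k i (x - y) * f y)" if "i \<in> I" for i
    using assms that by (intro cc_integrable conv_integrand_cc)
  then show ?thesis unfolding conv_def sum_distrib_right by (intro Bochner_Integration.integral_sum)
qed

section \<open>Exchanging the pressure for quadratic terms\<close>

locale mhd_kernel = mhd \<nu> v b p + kernel c a for \<nu> v b p c a +
  fixes \<phi> :: "real^3 \<Rightarrow> real"
  assumes C1_\<phi>: "C1 \<phi>" and cc_\<phi>: "cc \<phi>"
begin

text \<open>\<open>g\<close> is the divergence of the field \<open>v\<close> times
  \<open>\<phi>\<close>, the function that the pressure meets in the energy identity, and
  \<open>h\<close> is its potential. The Laplacian of \<open>h\<close> is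
  \<open>conv L g - conv E g\<close>, and \<open>conv L g\<close> is in turn the divergence of
  \<open>V\<close>. So \<open>conv E g\<close> is a divergence minus a Laplacian, and both can be
  tested against \<open>p\<close> through the equations.\<close>

definition "g x = (\<Sum>i\<in>UNIV. v i x * partial i \<phi> x)"
definition "h = conv k g"
definition "V i = conv L (\<lambda>x. v i x * \<phi> x)"

lemma cc_g: "cc g"
  unfolding g_def[abs_def] by (intro cc_sum cc_mult_left cc_partial C1_\<phi> cc_\<phi> conts)

lemma C1_v\<phi>: "C1 (\<lambda>x. v i x * \<phi> x)" and cc_v\<phi>: "cc (\<lambda>x. v i x * \<phi> x)"
  by (intro C1_mult C1_v C1_\<phi> cc_mult_left conts cc_\<phi>)+

lemma h: "C1 h" "C1 (partial j h)" "cc h" "partial i (partial j h) = conv (partial i (partial j k)) g"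
proof -
  have ck: "cc (partial j k)" for j by (intro cc_partial C1_k(1) cc_kernel)
  note 1 = C1_conv[OF C1_k(1) cc_kernel(1) cc_g] and 2 = C1_conv[OF C1_partial_k(1) ck cc_g]
  show "C1 h" "C1 (partial j h)" "partial i (partial j h) = conv (partial i (partial j k)) g"
    unfolding h_def 1(2) by (rule 1(1) 2(1) 2(2))+
  show "cc h" unfolding h_def by (intro cc_conv cc_kernel cc_g)
qed

lemma V: "C1 (V i)" "cc (V i)" "partial j (V i) = conv (partial j L) (\<lambda>x. v i x * \<phi> x)"
  unfolding V_def by (rule C1_conv[OF C1_L(1) cc_kernel(2) cc_v\<phi>] cc_conv[OF cc_kernel(2) cc_v\<phi>])+

lemma laplacian_h: "(\<Sum>i\<in>UNIV. partial i (partial i h) x) = conv L g x - conv E g x"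
proof -
  have "(\<Sum>i\<in>UNIV. partial i (partial i h) x) = conv (\<lambda>x. \<Sum>i\<in>UNIV. partial i (partial i k) x) g x"
    unfolding h(4) by (intro conv_sum_left[symmetric] cc_g C1_partial_continuous C1_partial_k(1))
  also have "\<dots> = conv L g x - conv E g x"
    unfolding laplace_k by (intro conv_diff_left cc_continuous cc_kernel cc_g)
  finally show ?thesis .
qed

lemma divergence_V: "(\<Sum>i\<in>UNIV. partial i (V i) x) = conv L g x"
proof -
  have ccp: "cc (partial i (\<lambda>x. v i x * \<phi> x))" for i by (intro cc_partial C1_v\<phi> cc_v\<phi>)
  have "(\<Sum>i\<in>UNIV. partial i (V i) x) = (\<Sum>i\<in>UNIV. conv L (partial i (\<lambda>x. v i x * \<phi> x)) x)"
    unfolding V(3) by (intro sum.cong refl conv_partial_swap C1_L(1) C1_v\<phi> cc_v\<phi>)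
  also have "\<dots> = conv L (\<lambda>x. \<Sum>i\<in>UNIV. partial i (\<lambda>x. v i x * \<phi> x) x) x"
    by (intro conv_sum_right[symmetric] ccp cc_continuous cc_kernel)
  also have "(\<lambda>x. \<Sum>i\<in>UNIV. partial i (\<lambda>x. v i x * \<phi> x) x) = g"
  proof
    fix x
    have "(\<Sum>i\<in>UNIV. partial i (\<lambda>x. v i x * \<phi> x) x) = g x + (\<Sum>i\<in>UNIV. partial i (v i) x) * \<phi> x"
      unfolding C1_mult(2)[OF C1_v C1_\<phi>] g_def by (simp add: sum.distrib sum_distrib_right)
    then show "(\<Sum>i\<in>UNIV. partial i (\<lambda>x. v i x * \<phi> x) x) = g x" using div_v by simp
  qed
  finally show ?thesis .
qed

text \<open>Difference of the two weak forms for \<open>div V\<close> and for the Laplacian of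
  \<open>h\<close>; nothing on the right contains \<open>p\<close>.\<close>

lemma pressure_identity:
  "(\<integral>x. p x * conv E g x \<partial>lborel)
     = \<nu> * (\<Sum>i\<in>UNIV. \<Sum>j\<in>UNIV. \<integral>x. partial j (v i) x * partial j (V i) x \<partial>lborel)
       - (\<Sum>i\<in>UNIV. \<Sum>j\<in>UNIV. \<integral>x. (v j x * v i x - b j x * b i x) * partial j (V i) x \<partial>lborel)
       + (\<Sum>i\<in>UNIV. \<Sum>j\<in>UNIV. \<integral>x. (v j x * v i x - b j x * b i x) * partial j (partial i h) x \<partial>lborel)"
proof -
  have cc: "cc (\<lambda>x. p x * conv L g x)" "cc (\<lambda>x. p x * conv E g x)"
    by (intro cc_mult_left conts cc_conv cc_kernel cc_g)+
  have "(\<integral>x. p x * (\<Sum>i\<in>UNIV. partial i (partial i h) x) \<partial>lborel) = (\<integral>x. p x * conv L g x \<partial>lborel) - (\<integral>x. p x * conv E g x \<partial>lborel)"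
    unfolding laplacian_h right_diff_distrib using cc by (simp add: cc_integrable)
  then show ?thesis
    using integral_p_laplacian[OF h(1,2,3)] integral_p_divergence[of V, OF V(1,2), unfolded divergence_V] by simp
qed

end

lemma cube_sum3_le:
  fixes x y z :: real
  assumes "0 \<le> x" "0 \<le> y" "0 \<le> z" shows "(x + y + z) ^ 3 \<le> 9 * (x ^ 3 + y ^ 3 + z ^ 3)"
proof -
  have t: "3 * m\<^sup>2 * t - 2 * m ^ 3 \<le> t ^ 3" if "0 \<le> t" "0 \<le> m" for t m :: real
  proof -
    have "0 \<le> (t - m)\<^sup>2 * (t + 2 * m)" using that by simp
    also have "\<dots> = t ^ 3 - (3 * m\<^sup>2 * t - 2 * m ^ 3)" by algebra
    finally show ?thesis by simp
  qed
  define m where "m = (x + y + z) / 3"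
  have m: "0 \<le> m" "x + y + z = 3 * m" using assms by (auto simp: m_def)
  have "3 * m\<^sup>2 * (x + y + z) - 6 * m ^ 3 \<le> x ^ 3 + y ^ 3 + z ^ 3"
    using t[OF assms(1) m(1)] t[OF assms(2) m(1)] t[OF assms(3) m(1)] by (simp add: algebra_simps)
  then show ?thesis unfolding m(2) by (simp add: power2_eq_square power3_eq_cube)
qed

lemma cube_add_le:
  fixes x y :: real shows "\<bar>x - y\<bar> ^ 3 \<le> 4 * (\<bar>x\<bar> ^ 3 + \<bar>y\<bar> ^ 3)"
proof -
  have "\<bar>x - y\<bar> ^ 3 \<le> (\<bar>x\<bar> + \<bar>y\<bar>) ^ 3" by (intro power_mono) auto
  also have "\<dots> \<le> 4 * (\<bar>x\<bar> ^ 3 + \<bar>y\<bar> ^ 3)"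
  proof -
    have "0 \<le> 3 * (\<bar>x\<bar> + \<bar>y\<bar>) * (\<bar>x\<bar> - \<bar>y\<bar>)\<^sup>2" by simp
    also have "\<dots> = 4 * (\<bar>x\<bar> ^ 3 + \<bar>y\<bar> ^ 3) - (\<bar>x\<bar> + \<bar>y\<bar>) ^ 3" by algebra
    finally show ?thesis by simp
  qed
  finally show ?thesis .
qed

lemma prod3_le:
  fixes x y z :: real
  assumes "0 \<le> x" "0 \<le> y" "0 \<le> z" shows "x * y * z \<le> x ^ 3 + y ^ 3 + z ^ 3"
proof -
  define m where "m = max x (max y z)"
  have "x * y * z \<le> m * m * m" using assms by (intro mult_mono) (auto simp: m_def)
  also have "\<dots> = m ^ 3" by (simp add: power3_eq_cube)
  also have "\<dots> \<le> x ^ 3 + y ^ 3 + z ^ 3" using assms by (auto simp: m_def max_def)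
  finally show ?thesis .
qed

lemma abs_prod3_le: "\<bar>x * y * z\<bar> \<le> \<bar>x\<bar> ^ 3 + \<bar>y\<bar> ^ 3 + \<bar>z :: real\<bar> ^ 3"
  using prod3_le[of "\<bar>x\<bar>" "\<bar>y\<bar>" "\<bar>z\<bar>"] by (simp add: abs_mult)

lemma II_one_le: assumes "0 \<le> r" "r \<le> 2" shows "II r (\<lambda>x. 1) \<le> 43"
proof -
  have "II r (\<lambda>x. 1) = 4/3 * pi * r ^ 3" using II_const[OF assms(1), of 1] by simp
  also have "\<dots> \<le> 4/3 * 4 * 2 ^ 3" using assms pi_le by (intro mult_mono power_mono) auto
  finally show ?thesis by simp
qed

lemma II_cauchy_schwarz:
  assumes "continuous_on UNIV f" "continuous_on UNIV g"
  shows "(II r (\<lambda>x. \<bar>f x * g x\<bar>))\<^sup>2 \<le> II r (\<lambda>x. (f x)\<^sup>2) * II r (\<lambda>x. (g x)\<^sup>2)"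
proof -
  let ?i = "\<lambda>x. indicator (cball (0::real^3) r) x :: real"
  have e: "(?i x * f x)\<^sup>2 = ?i x * (f x)\<^sup>2" "(?i x * g x)\<^sup>2 = ?i x * (g x)\<^sup>2"
    "\<bar>(?i x * f x) * (?i x * g x)\<bar> = ?i x * \<bar>f x * g x\<bar>" for x
    by (auto simp: indicator_def)
  have "(\<integral>x. \<bar>(?i x * f x) * (?i x * g x)\<bar> \<partial>lborel)\<^sup>2 \<le> (\<integral>x. (?i x * f x)\<^sup>2 \<partial>lborel) * (\<integral>x. (?i x * g x)\<^sup>2 \<partial>lborel)"
    by (rule cauchy_schwarz_integral) (auto simp: e intro!: II_integrable continuous_on_power assms)
  then show ?thesis unfolding e II_def .
qed

text \<open>Jensen with the indicator of the ball as weight. Balls of radius up to 2 have volume at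
  most 43, and 13 is the least integer whose cube exceeds \<open>43 ^ 2\<close>.\<close>

lemma II_abs_le:
  assumes f: "continuous_on UNIV f" and r: "0 \<le> r" "r \<le> 2"
  shows "II r (\<lambda>x. \<bar>f x\<bar>) \<le> 13 * root 3 (II r (\<lambda>x. \<bar>f x\<bar> ^ 3))"
proof -
  let ?A = "II r (\<lambda>x. \<bar>f x\<bar> ^ 3)"
  have A: "0 \<le> ?A" by (intro II_nonneg) auto
  have "(II r (\<lambda>x. \<bar>f x\<bar>)) ^ 3 \<le> (II r (\<lambda>x. 1))\<^sup>2 * ?A"
    using jensen_cube[of lborel "indicator (cball 0 r)" "\<lambda>x. \<bar>f x\<bar>"] II_integrable[of "\<lambda>x. 1" r]
      II_integrable[of "\<lambda>x. \<bar>f x\<bar>" r] II_integrable[of "\<lambda>x. \<bar>f x\<bar> ^ 3" r] f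
    by (simp add: II_def continuous_intros)
  also have "\<dots> \<le> 43\<^sup>2 * ?A"
    using II_one_le[OF r] A by (intro mult_right_mono power_mono II_nonneg) auto
  also have "\<dots> \<le> 13 ^ 3 * ?A" using A by (intro mult_right_mono) auto
  also have "\<dots> = (13 * root 3 ?A) ^ 3" using A by (simp add: power_mult_distrib real_root_pow_pos2)
  finally show ?thesis using A by (subst (asm) power_mono_iff) (auto intro!: II_nonneg)
qed

text \<open>Cauchy-Schwarz on the square, split into the roots of \<open>\<bar>f\<bar>\<close> and
  of \<open>\<bar>f\<bar> ^ 3\<close>; 13 is enlarged to 16 in order to be a square.\<close>

lemma II_square_le:
  assumes f: "continuous_on UNIV f" and r: "0 \<le> r" "r \<le> 2"
  shows "II r (\<lambda>x. (f x)\<^sup>2) \<le> 4 * (root 3 (II r (\<lambda>x. \<bar>f x\<bar> ^ 3)))\<^sup>2"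
proof -
  let ?A = "II r (\<lambda>x. \<bar>f x\<bar> ^ 3)"
  define t where "t = root 3 ?A"
  have A: "0 \<le> ?A" by (intro II_nonneg) auto
  have t: "0 \<le> t" "t ^ 3 = ?A" using A by (auto simp: t_def real_root_pow_pos2)
  have "(II r (\<lambda>x. \<bar>sqrt \<bar>f x\<bar> * sqrt (\<bar>f x\<bar> ^ 3)\<bar>))\<^sup>2 \<le> II r (\<lambda>x. (sqrt \<bar>f x\<bar>)\<^sup>2) * II r (\<lambda>x. (sqrt (\<bar>f x\<bar> ^ 3))\<^sup>2)"
    by (intro II_cauchy_schwarz continuous_intros f)
  moreover have "\<bar>sqrt \<bar>y\<bar> * sqrt (\<bar>y\<bar> ^ 3)\<bar> = y\<^sup>2" for y :: real
  proof -
    have "\<bar>y\<bar> * \<bar>y\<bar> ^ 3 = (y\<^sup>2)\<^sup>2" by (simp add: power_even_abs flip: power_Suc power_mult)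
    then have "sqrt \<bar>y\<bar> * sqrt (\<bar>y\<bar> ^ 3) = \<bar>y\<^sup>2\<bar>"
      unfolding real_sqrt_mult[symmetric] by (simp only: real_sqrt_abs)
    then show ?thesis by simp
  qed
  ultimately have "(II r (\<lambda>x. (f x)\<^sup>2))\<^sup>2 \<le> II r (\<lambda>x. \<bar>f x\<bar>) * ?A" by simp
  also have "\<dots> \<le> (13 * t) * t ^ 3"
    using II_abs_le[OF f r] t A by (intro mult_mono) (auto simp: t_def)
  also have "\<dots> \<le> 16 * (t * t ^ 3)" using t(1) by simp
  also have "\<dots> = (4 * t\<^sup>2)\<^sup>2" by (simp add: power2_eq_square power3_eq_cube)
  finally show ?thesis unfolding t_def[symmetric] by (rule power2_le_imp_le) simp
qed

text \<open>8192 bounds a single second derivative by the Laplacian, 8 comes from the cube of a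
  difference of two convolutions, \<open>1622 ^ 3\<close> from Young's inequality with kernels of
  mass at most \<open>1622 * c\<^sup>2\<close>, and 576 = 64 * 9 from cubing the bound of
  \<open>g\<close> by 4 times a sum of three components.\<close>

definition hessian_const :: real where "hessian_const = 8192 * 8 * 1622 ^ 3 * 576"
text \<open>60944 = 4688 * 13 bounds the gradient of \<open>V\<close> by the cube root of
  \<open>X\<close>. The outer factors count nine index pairs: 63 = 9 * 7, 36 = 9 * 4, 774 = 9 * 2 *
  43 and 18 = 9 * 2.\<close>

definition pressure_const :: real where "pressure_const = 63 * 60944 + 36 + 774 * 60944 ^ 3 + 18 * hessian_const"

context mhd
begin

text \<open>For the rescaled fields of radius \<open>R = \<nu>\<close> to the power \<open>-3\<close> (see \<open>mhd_global\<close> below), \<open>X\<close> is \<open>1/R\<close> times the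
  cubic integral over the ball of radius \<open>R r\<close> and \<open>G\<close> is exactly the Dirichlet integral over it.\<close>

definition "X r = (\<Sum>i\<in>UNIV. II r (\<lambda>x. \<bar>v i x\<bar> ^ 3) + II r (\<lambda>x. \<bar>b i x\<bar> ^ 3))"
definition "G r = \<nu> * (\<Sum>i\<in>UNIV. \<Sum>j\<in>UNIV. II r (\<lambda>x. (partial j (v i) x)\<^sup>2) + II r (\<lambda>x. (partial j (b i) x)\<^sup>2))"

lemma X_nonneg: "0 \<le> X r"
  unfolding X_def by (intro sum_nonneg add_nonneg_nonneg II_nonneg) auto

lemma II_le_X: "II r (\<lambda>x. \<bar>v i x\<bar> ^ 3) + II r (\<lambda>x. \<bar>b i x\<bar> ^ 3) \<le> X r"
  unfolding X_def by (rule member_le_sum) (auto intro!: add_nonneg_nonneg II_nonneg)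

lemma II_v_le_X: "II r (\<lambda>x. \<bar>v i x\<bar> ^ 3) \<le> X r" and II_b_le_X: "II r (\<lambda>x. \<bar>b i x\<bar> ^ 3) \<le> X r"
proof -
  have "0 \<le> II r (\<lambda>x. \<bar>v i x\<bar> ^ 3)" "0 \<le> II r (\<lambda>x. \<bar>b i x\<bar> ^ 3)" by (auto intro!: II_nonneg)
  then show "II r (\<lambda>x. \<bar>v i x\<bar> ^ 3) \<le> X r" "II r (\<lambda>x. \<bar>b i x\<bar> ^ 3) \<le> X r"
    using II_le_X[of r i] by linarith+
qed

lemma G_nonneg: "0 \<le> \<nu> \<Longrightarrow> 0 \<le> G r"
  unfolding G_def by (intro mult_nonneg_nonneg sum_nonneg add_nonneg_nonneg II_nonneg) auto

lemma II_le_G: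
  assumes "0 \<le> \<nu>"
  shows "\<nu> * II r (\<lambda>x. (partial j (v i) x)\<^sup>2) \<le> G r" "\<nu> * II r (\<lambda>x. (partial j (b i) x)\<^sup>2) \<le> G r"
proof -
  let ?f = "\<lambda>i j. II r (\<lambda>x. (partial j (v i) x)\<^sup>2) + II r (\<lambda>x. (partial j (b i) x)\<^sup>2)"
  have nn: "0 \<le> II r (\<lambda>x. (partial j (v i) x)\<^sup>2)" "0 \<le> II r (\<lambda>x. (partial j (b i) x)\<^sup>2)" for i j
    by (auto intro!: II_nonneg)
  have "?f i j \<le> (\<Sum>j\<in>UNIV. ?f i j)" using nn by (intro member_le_sum) (auto intro!: add_nonneg_nonneg)
  also have "\<dots> \<le> (\<Sum>i\<in>UNIV. \<Sum>j\<in>UNIV. ?f i j)"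
    using nn by (intro member_le_sum[of i UNIV "\<lambda>i. \<Sum>j\<in>UNIV. ?f i j"]) (auto intro!: sum_nonneg add_nonneg_nonneg)
  finally have "\<nu> * ?f i j \<le> G r" unfolding G_def using assms by (intro mult_left_mono)
  moreover have "0 \<le> \<nu> * II r (\<lambda>x. (partial j (v i) x)\<^sup>2)" "0 \<le> \<nu> * II r (\<lambda>x. (partial j (b i) x)\<^sup>2)"
    using nn assms by auto
  ultimately show "\<nu> * II r (\<lambda>x. (partial j (v i) x)\<^sup>2) \<le> G r" "\<nu> * II r (\<lambda>x. (partial j (b i) x)\<^sup>2) \<le> G r"
    by (simp_all add: distrib_left)
qed

text \<open>Cauchy-Schwarz spends one square root of \<open>\<nu>\<close> on the Dirichlet integral,
  and the other is at most 1. This keeps the viscous terms uniform as \<open>\<nu>\<close> tends to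
  0.\<close>

lemma viscous_le:
  assumes nu: "0 < \<nu>" "\<nu> \<le> 1" and r: "0 \<le> r" "r \<le> 2" and w: "continuous_on UNIV w"
    and wG: "\<nu> * II r (\<lambda>x. (w x)\<^sup>2) \<le> G r"
  shows "\<nu> * II r (\<lambda>x. \<bar>w x\<bar>) \<le> 7 * sqrt (G r)"
    "continuous_on UNIV f \<Longrightarrow> II r (\<lambda>x. \<bar>f x\<bar> ^ 3) \<le> X r \<Longrightarrow> \<nu> * II r (\<lambda>x. \<bar>f x * w x\<bar>) \<le> 2 * root 3 (X r) * sqrt (G r)"
proof -
  have G: "0 \<le> G r" using nu by (intro G_nonneg) simp
  have m: "\<nu> * II r (\<lambda>x. \<bar>f x * w x\<bar>) \<le> M * sqrt (G r)"
    if f: "continuous_on UNIV f" and M: "0 \<le> M" "II r (\<lambda>x. (f x)\<^sup>2) \<le> M\<^sup>2" for f M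
  proof (rule power2_le_imp_le)
    have w0: "0 \<le> II r (\<lambda>x. (w x)\<^sup>2)" by (intro II_nonneg) auto
    have "(\<nu> * II r (\<lambda>x. \<bar>f x * w x\<bar>))\<^sup>2 = \<nu>\<^sup>2 * (II r (\<lambda>x. \<bar>f x * w x\<bar>))\<^sup>2" by (simp add: power_mult_distrib)
    also have "\<dots> \<le> \<nu>\<^sup>2 * (II r (\<lambda>x. (f x)\<^sup>2) * II r (\<lambda>x. (w x)\<^sup>2))"
      by (intro mult_left_mono II_cauchy_schwarz f w) auto
    also have "\<dots> \<le> \<nu>\<^sup>2 * (M\<^sup>2 * II r (\<lambda>x. (w x)\<^sup>2))"
      using M w0 by (intro mult_left_mono mult_right_mono) auto
    also have "\<dots> = M\<^sup>2 * \<nu> * (\<nu> * II r (\<lambda>x. (w x)\<^sup>2))" by (simp add: power2_eq_square)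
    also have "\<dots> \<le> M\<^sup>2 * 1 * G r"
      using nu w0 G by (intro mult_mono wG) auto
    finally show "(\<nu> * II r (\<lambda>x. \<bar>f x * w x\<bar>))\<^sup>2 \<le> (M * sqrt (G r))\<^sup>2"
      using G by (simp add: power_mult_distrib)
    show "0 \<le> M * sqrt (G r)" using M G by simp
  qed
  have "II r (\<lambda>x. 1\<^sup>2) \<le> 7\<^sup>2" using II_one_le[OF r] by simp
  from m[of "\<lambda>x. 1", OF _ _ this] show "\<nu> * II r (\<lambda>x. \<bar>w x\<bar>) \<le> 7 * sqrt (G r)" by simp
  assume f: "continuous_on UNIV f" "II r (\<lambda>x. \<bar>f x\<bar> ^ 3) \<le> X r"
  have "II r (\<lambda>x. (f x)\<^sup>2) \<le> 4 * (root 3 (II r (\<lambda>x. \<bar>f x\<bar> ^ 3)))\<^sup>2" by (rule II_square_le[OF f(1) r])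
  also have "\<dots> \<le> 4 * (root 3 (X r))\<^sup>2"
    using f(2) by (intro mult_left_mono power_mono) (auto intro!: II_nonneg real_root_ge_zero)
  also have "\<dots> = (2 * root 3 (X r))\<^sup>2" by (simp add: power_mult_distrib)
  finally show "\<nu> * II r (\<lambda>x. \<bar>f x * w x\<bar>) \<le> 2 * root 3 (X r) * sqrt (G r)"
    using X_nonneg[of r] by (intro m f(1)) auto
qed

lemma continuous_cube: "continuous_on UNIV (\<lambda>x. \<bar>v i x\<bar> ^ 3)" "continuous_on UNIV (\<lambda>x. \<bar>b i x\<bar> ^ 3)"
  by (intro continuous_intros conts)+

text \<open>A product of three functions is at most the sum of their cubes, so a bound of
  \<open>H\<close> in L^3 controls its pairing with the quadratic terms.\<close>

lemma quadratic_term_le: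
  assumes H: "cc H" "supp_in R H" and HB: "II R (\<lambda>x. \<bar>H x\<bar> ^ 3) \<le> B"
  shows "\<bar>\<integral>x. (v j x * v i x - b j x * b i x) * H x \<partial>lborel\<bar> \<le> 2 * X R + 2 * B"
proof -
  have cH: "continuous_on UNIV (\<lambda>x. \<bar>H x\<bar> ^ 3)" using H by (intro continuous_intros cc_continuous)
  have "\<bar>\<integral>x. (v j x * v i x - b j x * b i x) * H x \<partial>lborel\<bar>
    \<le> II R (\<lambda>x. (\<bar>v j x\<bar> ^ 3 + \<bar>b j x\<bar> ^ 3) + ((\<bar>v i x\<bar> ^ 3 + \<bar>b i x\<bar> ^ 3) + 2 * \<bar>H x\<bar> ^ 3))"
  proof (rule integral_le_II)
    show "cc (\<lambda>x. (v j x * v i x - b j x * b i x) * H x)"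
      by (intro cc_mult_left H continuous_intros conts)
    show "supp_in R (\<lambda>x. (v j x * v i x - b j x * b i x) * H x)" using H by (auto simp: supp_in_def)
    fix x
    have "\<bar>(v j x * v i x - b j x * b i x) * H x\<bar> \<le> \<bar>v j x * v i x * H x\<bar> + \<bar>b j x * b i x * H x\<bar>"
      by (simp add: left_diff_distrib abs_triangle_ineq4)
    then show "\<bar>(v j x * v i x - b j x * b i x) * H x\<bar> \<le> (\<bar>v j x\<bar> ^ 3 + \<bar>b j x\<bar> ^ 3) + ((\<bar>v i x\<bar> ^ 3 + \<bar>b i x\<bar> ^ 3) + 2 * \<bar>H x\<bar> ^ 3)"
      using abs_prod3_le[of "v j x" "v i x" "H x"] abs_prod3_le[of "b j x" "b i x" "H x"] by linarith
  qed (intro continuous_intros conts cH)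
  also have "\<dots> = (II R (\<lambda>x. \<bar>v j x\<bar> ^ 3) + II R (\<lambda>x. \<bar>b j x\<bar> ^ 3)) + ((II R (\<lambda>x. \<bar>v i x\<bar> ^ 3) + II R (\<lambda>x. \<bar>b i x\<bar> ^ 3)) + 2 * II R (\<lambda>x. \<bar>H x\<bar> ^ 3))"
    using continuous_cube cH by (simp add: II_add II_cmult continuous_on_add continuous_on_mult_left)
  finally show ?thesis using HB II_le_X[of R j] II_le_X[of R i] by linarith
qed

end

context mhd_kernel
begin

text \<open>The point is independence of the regularisation \<open>a\<close>: the gradient of
  \<open>V\<close> is bounded because that of \<open>L\<close> is, and the second derivatives of
  \<open>h\<close> are controlled in L^3 by its Laplacian, into which \<open>E\<close> enters only
  through its mass. The gap between \<open>r1\<close> and \<open>R\<close> leaves room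
  \<open>s\<close> for the convolutions.\<close>

lemma pressure_bound:
  assumes nu: "0 < \<nu>" "\<nu> \<le> 1" and s: "0 < s" "c * s ^ 4 = 1" and r1: "supp_in r1 \<phi>" and R: "r1 + s \<le> R" "0 \<le> r1" "R \<le> 2"
    and \<phi>: "\<And>x. 0 \<le> \<phi> x" "\<And>x. \<phi> x \<le> 1" "\<And>i x. \<bar>partial i \<phi> x\<bar> \<le> 4"
  shows "\<bar>\<integral>x. p x * conv E g x \<partial>lborel\<bar> \<le> pressure_const * c ^ 9 * (X R + root 3 (X R) * sqrt (G R))"
proof -
  have R0: "0 \<le> R" "r1 \<le> R" using s R by auto
  have X: "0 \<le> X R" and G: "0 \<le> G R" using X_nonneg G_nonneg nu by auto
  define \<xi> where "\<xi> = root 3 (X R)"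
  have \<xi>: "0 \<le> \<xi>" "\<xi> ^ 3 = X R" using X by (auto simp: \<xi>_def real_root_pow_pos2)
  have c0: "0 \<le> c" "1 \<le> c ^ n" for n using c by auto
  have suppg: "supp_in r1 g" using supp_in_partial[OF r1] by (auto simp: supp_in_def g_def)
  have supph: "supp_in R h"
    unfolding h_def by (rule supp_in_mono[OF supp_in_conv[OF support(1)[OF s] suppg]]) (use R in linarith)
  have suppV: "supp_in R (V i)" for i
  proof -
    have "supp_in r1 (\<lambda>x. v i x * \<phi> x)" using r1 by (auto simp: supp_in_def)
    from supp_in_conv[OF support(2)[OF s] this] show ?thesis
      unfolding V_def by (rule supp_in_mono) (use R in linarith)
  qed
  have gX: "(\<integral>x. \<bar>g x\<bar> ^ 3 \<partial>lborel) \<le> 576 * X R"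
  proof -
    have "\<bar>\<integral>x. \<bar>g x\<bar> ^ 3 \<partial>lborel\<bar> \<le> II R (\<lambda>x. 576 * (\<Sum>i\<in>UNIV. \<bar>v i x\<bar> ^ 3))"
    proof (rule integral_le_II)
      show "cc (\<lambda>x. \<bar>g x\<bar> ^ 3)" by (intro cc_power cc_abs cc_g) simp
      show "supp_in R (\<lambda>x. \<bar>g x\<bar> ^ 3)" using supp_in_mono[OF suppg R0(2)] by (auto simp: supp_in_def)
      fix x
      have "\<bar>g x\<bar> \<le> (\<Sum>i\<in>UNIV. \<bar>v i x * partial i \<phi> x\<bar>)" unfolding g_def by (rule sum_abs)
      also have "\<dots> \<le> (\<Sum>i\<in>UNIV. 4 * \<bar>v i x\<bar>)"
        using \<phi>(3) by (intro sum_mono) (auto simp: abs_mult mult.commute[of 4] intro!: mult_left_mono)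
      also have "\<dots> = 4 * (\<bar>v 1 x\<bar> + \<bar>v 2 x\<bar> + \<bar>v 3 x\<bar>)" by (simp add: sum_3)
      finally have "\<bar>g x\<bar> ^ 3 \<le> (4 * (\<bar>v 1 x\<bar> + \<bar>v 2 x\<bar> + \<bar>v 3 x\<bar>)) ^ 3" by (intro power_mono) auto
      also have "\<dots> = 64 * (\<bar>v 1 x\<bar> + \<bar>v 2 x\<bar> + \<bar>v 3 x\<bar>) ^ 3" unfolding power_mult_distrib by simp
      also have "\<dots> \<le> 64 * (9 * (\<bar>v 1 x\<bar> ^ 3 + \<bar>v 2 x\<bar> ^ 3 + \<bar>v 3 x\<bar> ^ 3))"
        by (intro mult_left_mono cube_sum3_le) auto
      finally show "\<bar>\<bar>g x\<bar> ^ 3\<bar> \<le> 576 * (\<Sum>i\<in>UNIV. \<bar>v i x\<bar> ^ 3)" by (simp add: sum_3)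
    qed (intro continuous_intros conts)
    also have "\<dots> = 576 * (\<Sum>i\<in>UNIV. II R (\<lambda>x. \<bar>v i x\<bar> ^ 3))"
      using continuous_cube by (simp add: II_cmult sum_3 II_add continuous_on_add continuous_on_mult_left)
    also have "\<dots> \<le> 576 * X R"
      unfolding X_def by (intro mult_left_mono sum_mono) (auto intro!: II_nonneg)
    finally show ?thesis by simp
  qed
  define \<Lambda> where "\<Lambda> = 1622 * c\<^sup>2"
  have Lg: "(\<integral>x. \<bar>conv L g x\<bar> ^ 3 \<partial>lborel) \<le> \<Lambda> ^ 3 * (576 * X R)"
  proof -
    have aL: "cc (\<lambda>x. \<bar>L x\<bar>)" "cc (\<lambda>x. \<bar>g x\<bar>)" by (intro cc_abs cc_kernel cc_g)+
    have "(\<integral>x. \<bar>conv L g x\<bar> ^ 3 \<partial>lborel) \<le> (\<integral>x. \<bar>conv (\<lambda>x. \<bar>L x\<bar>) (\<lambda>x. \<bar>g x\<bar>) x\<bar> ^ 3 \<partial>lborel)"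
    proof (rule integral_mono)
      fix x
      have "\<bar>conv L g x\<bar> \<le> conv (\<lambda>x. \<bar>L x\<bar>) (\<lambda>x. \<bar>g x\<bar>) x"
        unfolding conv_def using aL cc_kernel cc_g
        by (intro abs_integral_le cc_integrable conv_integrand_cc cc_continuous) (auto simp: abs_mult)
      then show "\<bar>conv L g x\<bar> ^ 3 \<le> \<bar>conv (\<lambda>x. \<bar>L x\<bar>) (\<lambda>x. \<bar>g x\<bar>) x\<bar> ^ 3" by (intro power_mono) auto
    qed (use aL cc_kernel cc_g in \<open>auto intro!: cc_integrable cc_power cc_abs cc_conv\<close>)
    also have "\<dots> \<le> (\<integral>x. \<bar>L x\<bar> \<partial>lborel) ^ 3 * (\<integral>x. \<bar>\<bar>g x\<bar>\<bar> ^ 3 \<partial>lborel)"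
      by (intro conv_cube_le aL) auto
    also have "\<dots> \<le> \<Lambda> ^ 3 * (576 * X R)"
      using gX integral_abs_L_le c by (intro mult_mono power_mono) (auto simp: \<Lambda>_def)
    finally show ?thesis .
  qed
  have Eg: "(\<integral>x. \<bar>conv E g x\<bar> ^ 3 \<partial>lborel) \<le> \<Lambda> ^ 3 * (576 * X R)"
  proof -
    have "(\<integral>x. \<bar>conv E g x\<bar> ^ 3 \<partial>lborel) \<le> (\<integral>x. E x \<partial>lborel) ^ 3 * (\<integral>x. \<bar>g x\<bar> ^ 3 \<partial>lborel)"
      by (intro conv_cube_le cc_kernel cc_g E_nonneg)
    also have "\<dots> \<le> \<Lambda> ^ 3 * (576 * X R)"
      using gX integral_E_le c E_nonneg by (intro mult_mono power_mono) (auto simp: \<Lambda>_def)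
    finally show ?thesis .
  qed
  \<comment> \<open>Second derivatives of \<open>h\<close> commute, so the symmetrised estimate
    applies to twice one of them, which gives back a factor 8.\<close>
  have hX: "II R (\<lambda>x. \<bar>partial j (partial i h) x\<bar> ^ 3) \<le> hessian_const * c ^ 6 * X R" for i j
  proof -
    have cL: "cc (conv L g)" "cc (conv E g)" by (intro cc_conv cc_kernel cc_g)+
    have "(\<integral>x. \<bar>\<Sum>l\<in>UNIV. partial l (partial l h) x\<bar> ^ 3 \<partial>lborel) \<le> (\<integral>x. 4 * (\<bar>conv L g x\<bar> ^ 3 + \<bar>conv E g x\<bar> ^ 3) \<partial>lborel)"
      unfolding laplacian_h using cL
      by (intro integral_mono cc_integrable cc_power cc_abs cc_diff cc_cmult cc_add cube_add_le) auto
    also have "\<dots> = 4 * ((\<integral>x. \<bar>conv L g x\<bar> ^ 3 \<partial>lborel) + (\<integral>x. \<bar>conv E g x\<bar> ^ 3 \<partial>lborel))"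
      using cL by (simp add: cc_integrable cc_power cc_abs)
    also have "\<dots> \<le> 8 * (\<Lambda> ^ 3 * (576 * X R))" using Lg Eg by simp
    finally have lap: "(\<integral>x. \<bar>\<Sum>l\<in>UNIV. partial l (partial l h) x\<bar> ^ 3 \<partial>lborel) \<le> 8 * (\<Lambda> ^ 3 * (576 * X R))" .
    have "partial j (partial i h) x + partial i (partial j h) x = 2 * partial j (partial i h) x" for x
      using C2_partial_commute[OF h(1,2), of i j x] by simp
    then have "8 * (\<integral>x. \<bar>partial j (partial i h) x\<bar> ^ 3 \<partial>lborel) \<le> 65536 * (\<integral>x. \<bar>\<Sum>l\<in>UNIV. partial l (partial l h) x\<bar> ^ 3 \<partial>lborel)"
      using mixed_second_derivative_cube_le[OF h(1,2,3), of j i] by (simp add: abs_mult power_mult_distrib)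
    then have "(\<integral>x. \<bar>partial j (partial i h) x\<bar> ^ 3 \<partial>lborel) \<le> 8192 * (8 * (\<Lambda> ^ 3 * (576 * X R)))"
      using lap by linarith
    also have "\<dots> = hessian_const * c ^ 6 * X R" by (simp add: hessian_const_def \<Lambda>_def power_mult_distrib flip: power_mult)
    also have "(\<integral>x. \<bar>partial j (partial i h) x\<bar> ^ 3 \<partial>lborel) = II R (\<lambda>x. \<bar>partial j (partial i h) x\<bar> ^ 3)"
      using supp_in_partial[OF supp_in_partial[OF supph]] by (intro integral_eq_II) (auto simp: supp_in_def)
    finally show ?thesis .
  qed
  define D where "D = 60944 * c ^ 3"
  have D: "0 \<le> D" using c0 by (simp add: D_def)
  \<comment> \<open>The derivative falls on \<open>L\<close>, whose gradient is bounded by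
    \<open>4688 * c ^ 3\<close>; the remaining integral of \<open>\<bar>v i\<bar>\<close> costs a
    factor 13.\<close>
  have VX: "\<bar>partial j (V i) x\<bar> \<le> D * \<xi>" for i j x
  proof -
    have "\<bar>partial j (V i) x\<bar> \<le> (\<integral>y. 4688 * c ^ 3 * \<bar>v i y * \<phi> y\<bar> \<partial>lborel)"
      unfolding V(3) conv_def
    proof (rule abs_integral_le)
      show "integrable lborel (\<lambda>y. partial j L (x - y) * (v i y * \<phi> y))"
        by (intro cc_integrable conv_integrand_cc C1_partial_continuous C1_L(1) cc_v\<phi>)
      show "integrable lborel (\<lambda>y. 4688 * c ^ 3 * \<bar>v i y * \<phi> y\<bar>)"
        by (intro cc_integrable cc_cmult cc_abs cc_v\<phi>)
      fix y
      show "\<bar>partial j L (x - y) * (v i y * \<phi> y)\<bar> \<le> 4688 * c ^ 3 * \<bar>v i y * \<phi> y\<bar>"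
        unfolding abs_mult[of "partial j L (x - y)"] by (intro mult_right_mono L_bound) auto
    qed
    also have "\<dots> = 4688 * c ^ 3 * (\<integral>y. \<bar>v i y * \<phi> y\<bar> \<partial>lborel)" by simp
    also have "\<dots> \<le> 4688 * c ^ 3 * (13 * \<xi>)"
    proof (intro mult_left_mono)
      have "\<bar>\<integral>y. \<bar>v i y * \<phi> y\<bar> \<partial>lborel\<bar> \<le> II R (\<lambda>x. \<bar>v i x\<bar>)"
        using supp_in_mono[OF r1 R0(2)] \<phi>(1,2)
        by (intro integral_le_II cc_abs cc_v\<phi> continuous_intros conts) (auto simp: supp_in_def abs_mult intro!: mult_left_le)
      also have "\<dots> \<le> 13 * root 3 (II R (\<lambda>x. \<bar>v i x\<bar> ^ 3))" by (intro II_abs_le conts R0 R)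
      also have "\<dots> \<le> 13 * \<xi>" unfolding \<xi>_def using II_v_le_X by simp
      finally show "(\<integral>y. \<bar>v i y * \<phi> y\<bar> \<partial>lborel) \<le> 13 * \<xi>" by simp
    qed (use c in simp)
    finally show ?thesis by (simp add: D_def mult_ac)
  qed
  have V3: "II R (\<lambda>x. \<bar>partial j (V i) x\<bar> ^ 3) \<le> 43 * (D ^ 3 * X R)" for i j
  proof -
    have "II R (\<lambda>x. \<bar>partial j (V i) x\<bar> ^ 3) \<le> II R (\<lambda>x. (D * \<xi>) ^ 3)"
      using VX by (intro II_mono continuous_intros C1_partial_continuous V power_mono) auto
    also have "\<dots> = II R (\<lambda>x. (D * \<xi>) ^ 3 * 1)" by simp
    also have "\<dots> = (D * \<xi>) ^ 3 * II R (\<lambda>x. 1)" by (rule II_cmult)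
    also have "\<dots> \<le> (D * \<xi>) ^ 3 * 43" using II_one_le[OF R0(1) R(3)] D \<xi> by (intro mult_left_mono) auto
    finally show ?thesis by (simp add: power_mult_distrib \<xi>)
  qed
  have T1: "\<bar>\<nu> * (\<integral>x. partial j (v i) x * partial j (V i) x \<partial>lborel)\<bar> \<le> 7 * D * (\<xi> * sqrt (G R))" for i j
  proof -
    have "\<bar>\<integral>x. partial j (v i) x * partial j (V i) x \<partial>lborel\<bar> \<le> II R (\<lambda>x. D * \<xi> * \<bar>partial j (v i) x\<bar>)"
    proof (rule integral_le_II)
      show "cc (\<lambda>x. partial j (v i) x * partial j (V i) x)" by (intro cc_mult_left cc_partial V conts)
      show "supp_in R (\<lambda>x. partial j (v i) x * partial j (V i) x)"
        using supp_in_partial[OF suppV] by (auto simp: supp_in_def)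
      show "\<bar>partial j (v i) x * partial j (V i) x\<bar> \<le> D * \<xi> * \<bar>partial j (v i) x\<bar>" for x
        unfolding abs_mult mult.commute[of "\<bar>partial j (v i) x\<bar>"] by (intro mult_right_mono VX) auto
    qed (intro continuous_intros conts)
    then have "\<nu> * \<bar>\<integral>x. partial j (v i) x * partial j (V i) x \<partial>lborel\<bar> \<le> \<nu> * II R (\<lambda>x. D * \<xi> * \<bar>partial j (v i) x\<bar>)"
      using nu by (intro mult_left_mono) auto
    also have "\<dots> = D * \<xi> * (\<nu> * II R (\<lambda>x. \<bar>partial j (v i) x\<bar>))" by (simp add: II_cmult)
    also have "\<dots> \<le> D * \<xi> * (7 * sqrt (G R))"
      using D \<xi> nu by (intro mult_left_mono viscous_le(1) R0 R conts II_le_G) auto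
    finally show ?thesis using nu by (simp add: abs_mult mult_ac)
  qed
  have T2: "\<bar>\<integral>x. (v j x * v i x - b j x * b i x) * partial j (V i) x \<partial>lborel\<bar> \<le> 2 * X R + 2 * (43 * (D ^ 3 * X R))" for i j
    by (intro quadratic_term_le cc_partial V supp_in_partial suppV V3)
  have T3: "\<bar>\<integral>x. (v j x * v i x - b j x * b i x) * partial j (partial i h) x \<partial>lborel\<bar> \<le> 2 * X R + 2 * (hessian_const * c ^ 6 * X R)" for i j
    by (intro quadratic_term_le cc_partial h supp_in_partial supph hX)
  have S: "\<bar>\<Sum>i\<in>UNIV. \<Sum>j\<in>UNIV. f i j\<bar> \<le> 9 * B" if "\<And>i j. \<bar>f i j\<bar> \<le> B" for f :: "3 \<Rightarrow> 3 \<Rightarrow> real" and B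
  proof -
    have "\<bar>\<Sum>i\<in>UNIV. \<Sum>j\<in>UNIV. f i j\<bar> \<le> (\<Sum>i\<in>(UNIV::3 set). \<Sum>j\<in>(UNIV::3 set). B)"
      by (intro order_trans[OF sum_abs] sum_mono that order_trans[OF sum_abs[of "f _" UNIV]])
    then show ?thesis by simp
  qed
  have "\<bar>\<integral>x. p x * conv E g x \<partial>lborel\<bar> \<le> 9 * (7 * D * (\<xi> * sqrt (G R))) + 9 * (2 * X R + 2 * (43 * (D ^ 3 * X R))) + 9 * (2 * X R + 2 * (hessian_const * c ^ 6 * X R))"
  proof -
    have 1: "\<bar>\<nu> * (\<Sum>i\<in>UNIV. \<Sum>j\<in>UNIV. \<integral>x. partial j (v i) x * partial j (V i) x \<partial>lborel)\<bar> \<le> 9 * (7 * D * (\<xi> * sqrt (G R)))"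
      unfolding sum_distrib_left by (rule S[OF T1])
    have 2: "\<bar>\<Sum>i\<in>UNIV. \<Sum>j\<in>UNIV. \<integral>x. (v j x * v i x - b j x * b i x) * partial j (V i) x \<partial>lborel\<bar> \<le> 9 * (2 * X R + 2 * (43 * (D ^ 3 * X R)))"
      by (rule S, rule T2)
    have 3: "\<bar>\<Sum>i\<in>UNIV. \<Sum>j\<in>UNIV. \<integral>x. (v j x * v i x - b j x * b i x) * partial j (partial i h) x \<partial>lborel\<bar> \<le> 9 * (2 * X R + 2 * (hessian_const * c ^ 6 * X R))"
      by (rule S, rule T3)
    show ?thesis unfolding pressure_identity using 1 2 3 by linarith
  qed
  also have "\<dots> = 63 * D * (\<xi> * sqrt (G R)) + (36 + 774 * D ^ 3 + 18 * (hessian_const * c ^ 6)) * X R"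
    by (simp add: algebra_simps)
  also have "\<dots> \<le> pressure_const * c ^ 9 * (\<xi> * sqrt (G R)) + pressure_const * c ^ 9 * X R"
  proof (intro add_mono mult_right_mono)
    \<comment> \<open>Since \<open>1 \<le> c\<close>, all powers of \<open>c\<close> are raised to
      the largest one, which comes from \<open>D ^ 3\<close>.\<close>
    have cp: "c ^ 3 \<le> c ^ 9" "c ^ 6 \<le> c ^ 9" "1 \<le> c ^ 9" using c by (auto intro!: power_increasing)
    have D3: "D ^ 3 = 60944 ^ 3 * c ^ 9" by (simp add: D_def power_mult_distrib flip: power_mult)
    have K: "0 \<le> hessian_const" by (simp add: hessian_const_def)
    have "hessian_const * c ^ 6 \<le> hessian_const * c ^ 9" using K cp by (intro mult_left_mono)
    moreover have "0 \<le> hessian_const * c ^ 9" using K c0(1) by simp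
    ultimately show "63 * D \<le> pressure_const * c ^ 9" "36 + 774 * D ^ 3 + 18 * (hessian_const * c ^ 6) \<le> pressure_const * c ^ 9"
      using cp unfolding D3 D_def pressure_const_def by (simp_all add: algebra_simps)
  qed (use \<xi> G X in auto)
  finally show ?thesis by (simp add: \<xi>_def algebra_simps)
qed

end


section \<open>Local energy inequality\<close>

context mhd
begin

text \<open>Momentum is tested with \<open>v i * \<phi>\<close> and induction with
  \<open>b i * \<phi>\<close>. Only their sum works: the two coupling terms without derivative of
  \<open>\<phi>\<close> then form a single advected derivative and can be integrated by parts onto
  the cutoff.\<close>

lemma energy_identity:
  assumes \<phi>: "C1 \<phi>" "cc \<phi>"
  shows "\<nu> * (\<Sum>i\<in>UNIV. \<Sum>j\<in>UNIV. \<integral>x. \<phi> x * ((partial j (v i) x)\<^sup>2 + (partial j (b i) x)\<^sup>2) \<partial>lborel)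
    = - \<nu> * (\<Sum>i\<in>UNIV. \<Sum>j\<in>UNIV. \<integral>x. (v i x * partial j (v i) x + b i x * partial j (b i) x) * partial j \<phi> x \<partial>lborel)
      + (\<Sum>i\<in>UNIV. \<Sum>j\<in>UNIV. \<integral>x. (v j x * ((v i x)\<^sup>2 + (b i x)\<^sup>2) / 2 - b j x * b i x * v i x) * partial j \<phi> x \<partial>lborel)
      + (\<integral>x. p x * (\<Sum>i\<in>UNIV. v i x * partial i \<phi> x) \<partial>lborel)"
proof -
  have cp: "cc (partial j \<phi>)" for j by (intro cc_partial \<phi>)
  define q1 where "q1 i x = v i x * \<phi> x" for i x
  define q2 where "q2 i x = b i x * \<phi> x" for i x
  have q1: "C1 (q1 i)" "cc (q1 i)" "partial j (q1 i) x = v i x * partial j \<phi> x + partial j (v i) x * \<phi> x" for i j x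
    unfolding q1_def[abs_def] by (intro C1_mult C1_v \<phi> cc_mult_left conts)+
  have q2: "C1 (q2 i)" "cc (q2 i)" "partial j (q2 i) x = b i x * partial j \<phi> x + partial j (b i) x * \<phi> x" for i j x
    unfolding q2_def[abs_def] by (intro C1_mult C1_b \<phi> cc_mult_left conts)+
  \<comment> \<open>Per component, \<open>w1\<close> is twice the energy density and
    \<open>w2\<close> the cross helicity. Every convective term without a derivative of
    \<open>\<phi>\<close> is \<open>v\<close> acting on half of \<open>w1\<close> or
    \<open>b\<close> acting on \<open>w2\<close>.\<close>
  define w1 where "w1 i x = v i x * v i x + b i x * b i x" for i x
  define w2 where "w2 i x = v i x * b i x" for i x
  have w1: "C1 (w1 i)" "partial j (w1 i) x = 2 * (v i x * partial j (v i) x + b i x * partial j (b i) x)" for i j x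
    unfolding w1_def[abs_def] using C1_mult[OF C1_v[of i] C1_v[of i]] C1_mult[OF C1_b[of i] C1_b[of i]] by (auto simp: C1_add)
  have w2: "C1 (w2 i)" "partial j (w2 i) x = v i x * partial j (b i) x + partial j (v i) x * b i x" for i j x
    unfolding w2_def[abs_def] by (intro C1_mult C1_v C1_b)+
  have g: "(\<Sum>i\<in>UNIV. partial i (q1 i) x) = (\<Sum>i\<in>UNIV. v i x * partial i \<phi> x)" for x
  proof -
    have "(\<Sum>i\<in>UNIV. partial i (q1 i) x) = (\<Sum>i\<in>UNIV. v i x * partial i \<phi> x) + (\<Sum>i\<in>UNIV. partial i (v i) x) * \<phi> x"
      unfolding q1 by (simp add: sum.distrib sum_distrib_right)
    then show ?thesis using div_v by simp
  qed
  have M1: "(\<integral>x. p x * (\<Sum>i\<in>UNIV. v i x * partial i \<phi> x) \<partial>lborel)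
     = \<nu> * (\<Sum>i\<in>UNIV. \<Sum>j\<in>UNIV. \<integral>x. partial j (v i) x * partial j (q1 i) x \<partial>lborel)
       - (\<Sum>i\<in>UNIV. \<Sum>j\<in>UNIV. \<integral>x. (v j x * v i x - b j x * b i x) * partial j (q1 i) x \<partial>lborel)"
    using integral_p_divergence[of q1, OF q1(1,2)] unfolding g .
  have M2: "\<nu> * (\<Sum>i\<in>UNIV. \<Sum>j\<in>UNIV. \<integral>x. partial j (b i) x * partial j (q2 i) x \<partial>lborel)
     = (\<Sum>i\<in>UNIV. \<Sum>j\<in>UNIV. \<integral>x. (v j x * b i x - b j x * v i x) * partial j (q2 i) x \<partial>lborel)"
    unfolding sum_distrib_left[of \<nu> _ UNIV]
  proof (rule sum.cong[OF refl])
    fix i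
    have cc: "cc (\<lambda>x. (\<Sum>j\<in>UNIV. partial j (partial j (b i)) x) * q2 i x)"
      "cc (\<lambda>x. (\<Sum>j\<in>UNIV. v j x * partial j (b i) x) * q2 i x)" "cc (\<lambda>x. (\<Sum>j\<in>UNIV. b j x * partial j (v i) x) * q2 i x)"
      by (intro cc_mult_left q2 continuous_intros conts)+
    have cc': "cc (\<lambda>x. v j x * b i x * partial j (q2 i) x)" "cc (\<lambda>x. b j x * v i x * partial j (q2 i) x)" for j
      by (intro cc_mult_left cc_partial q2 continuous_intros conts)+
    have "\<nu> * ((\<Sum>j\<in>UNIV. partial j (partial j (b i)) x) * q2 i x)
        = (\<Sum>j\<in>UNIV. v j x * partial j (b i) x) * q2 i x - (\<Sum>j\<in>UNIV. b j x * partial j (v i) x) * q2 i x" for x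
      using arg_cong[OF induction[of i x], of "\<lambda>t. t * q2 i x"] by (simp add: algebra_simps)
    then have "(\<integral>x. \<nu> * ((\<Sum>j\<in>UNIV. partial j (partial j (b i)) x) * q2 i x) \<partial>lborel)
        = (\<integral>x. (\<Sum>j\<in>UNIV. v j x * partial j (b i) x) * q2 i x - (\<Sum>j\<in>UNIV. b j x * partial j (v i) x) * q2 i x \<partial>lborel)"
      by (simp only:)
    then have "\<nu> * (\<integral>x. (\<Sum>j\<in>UNIV. partial j (partial j (b i)) x) * q2 i x \<partial>lborel)
        = (\<integral>x. (\<Sum>j\<in>UNIV. v j x * partial j (b i) x) * q2 i x \<partial>lborel) - (\<integral>x. (\<Sum>j\<in>UNIV. b j x * partial j (v i) x) * q2 i x \<partial>lborel)"
      using cc by (simp add: cc_integrable)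
    then show "(\<Sum>j\<in>UNIV. \<nu> * (\<integral>x. partial j (b i) x * partial j (q2 i) x \<partial>lborel))
        = (\<Sum>j\<in>UNIV. \<integral>x. (v j x * b i x - b j x * v i x) * partial j (q2 i) x \<partial>lborel)"
      unfolding laplacian_by_parts[OF C2_b q2(1,2)] advection_by_parts[OF C1_v div_v C1_b q2(1,2)]
        advection_by_parts[OF C1_b div_b C1_v q2(1,2)]
      using cc' by (simp add: left_diff_distrib cc_integrable sum_subtractf sum_distrib_left)
  qed
  have A1: "(\<Sum>j\<in>UNIV. \<integral>x. v j x * partial j (w1 i) x * \<phi> x \<partial>lborel) = - (\<Sum>j\<in>UNIV. \<integral>x. v j x * w1 i x * partial j \<phi> x \<partial>lborel)" for i
  proof -
    have "cc (\<lambda>x. v j x * partial j (w1 i) x * \<phi> x)" for j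
      by (intro cc_mult_left \<phi> continuous_intros conts C1_partial_continuous w1)
    then show ?thesis
      unfolding advection_by_parts[OF C1_v div_v w1(1) \<phi>, symmetric] sum_distrib_right by (simp add: cc_integrable)
  qed
  have A2: "(\<Sum>j\<in>UNIV. \<integral>x. b j x * partial j (w2 i) x * \<phi> x \<partial>lborel) = - (\<Sum>j\<in>UNIV. \<integral>x. b j x * w2 i x * partial j \<phi> x \<partial>lborel)" for i
  proof -
    have "cc (\<lambda>x. b j x * partial j (w2 i) x * \<phi> x)" for j
      by (intro cc_mult_left \<phi> continuous_intros conts C1_partial_continuous w2)
    then show ?thesis
      unfolding advection_by_parts[OF C1_b div_b w2(1) \<phi>, symmetric] sum_distrib_right by (simp add: cc_integrable)
  qed
  have L: "(\<integral>x. partial j (v i) x * partial j (q1 i) x \<partial>lborel) + (\<integral>x. partial j (b i) x * partial j (q2 i) x \<partial>lborel)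
     = (\<integral>x. \<phi> x * ((partial j (v i) x)\<^sup>2 + (partial j (b i) x)\<^sup>2) \<partial>lborel)
       + (\<integral>x. (v i x * partial j (v i) x + b i x * partial j (b i) x) * partial j \<phi> x \<partial>lborel)" for i j
  proof -
    have cc: "cc (\<lambda>x. partial j (v i) x * partial j (q1 i) x)" "cc (\<lambda>x. partial j (b i) x * partial j (q2 i) x)"
      by (intro cc_mult_left cc_partial q1 q2 conts)+
    have cc': "cc (\<lambda>x. \<phi> x * ((partial j (v i) x)\<^sup>2 + (partial j (b i) x)\<^sup>2))"
      "cc (\<lambda>x. (v i x * partial j (v i) x + b i x * partial j (b i) x) * partial j \<phi> x)"
      by (intro cc_mult_left cc_mult_right \<phi> cp continuous_intros conts)+
    show ?thesis
      unfolding Bochner_Integration.integral_add[OF cc_integrable[OF cc(1)] cc_integrable[OF cc(2)], symmetric]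
        Bochner_Integration.integral_add[OF cc_integrable[OF cc'(1)] cc_integrable[OF cc'(2)], symmetric]
      by (intro Bochner_Integration.integral_cong refl) (simp add: q1 q2 algebra_simps power2_eq_square)
  qed
  have Rr: "(\<integral>x. (v j x * v i x - b j x * b i x) * partial j (q1 i) x \<partial>lborel) + (\<integral>x. (v j x * b i x - b j x * v i x) * partial j (q2 i) x \<partial>lborel)
     = (\<integral>x. v j x * w1 i x * partial j \<phi> x \<partial>lborel) - 2 * (\<integral>x. b j x * w2 i x * partial j \<phi> x \<partial>lborel)
       + 1/2 * (\<integral>x. v j x * partial j (w1 i) x * \<phi> x \<partial>lborel) - (\<integral>x. b j x * partial j (w2 i) x * \<phi> x \<partial>lborel)" for i j
  proof -
    have cc: "cc (\<lambda>x. (v j x * v i x - b j x * b i x) * partial j (q1 i) x)" "cc (\<lambda>x. (v j x * b i x - b j x * v i x) * partial j (q2 i) x)"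
      by (intro cc_mult_left cc_partial q1 q2 continuous_intros conts)+
    have cc': "cc (\<lambda>x. v j x * w1 i x * partial j \<phi> x)" "cc (\<lambda>x. b j x * w2 i x * partial j \<phi> x)"
      "cc (\<lambda>x. v j x * partial j (w1 i) x * \<phi> x)" "cc (\<lambda>x. b j x * partial j (w2 i) x * \<phi> x)"
      by (intro cc_mult_left cp \<phi> continuous_intros conts C1_continuous C1_partial_continuous w1 w2)+
    have "(\<integral>x. v j x * w1 i x * partial j \<phi> x \<partial>lborel) - 2 * (\<integral>x. b j x * w2 i x * partial j \<phi> x \<partial>lborel)
       + 1/2 * (\<integral>x. v j x * partial j (w1 i) x * \<phi> x \<partial>lborel) - (\<integral>x. b j x * partial j (w2 i) x * \<phi> x \<partial>lborel)
      = (\<integral>x. v j x * w1 i x * partial j \<phi> x - 2 * (b j x * w2 i x * partial j \<phi> x)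
         + 1/2 * (v j x * partial j (w1 i) x * \<phi> x) - b j x * partial j (w2 i) x * \<phi> x \<partial>lborel)"
      using cc'[THEN cc_integrable] by simp
    then show ?thesis
      unfolding Bochner_Integration.integral_add[OF cc_integrable[OF cc(1)] cc_integrable[OF cc(2)], symmetric]
      by (simp only:) (intro Bochner_Integration.integral_cong refl, simp add: q1 q2 w1 w2, simp add: w1_def w2_def field_simps)
  qed
  have F: "(\<integral>x. (v j x * ((v i x)\<^sup>2 + (b i x)\<^sup>2) / 2 - b j x * b i x * v i x) * partial j \<phi> x \<partial>lborel)
     = 1/2 * (\<integral>x. v j x * w1 i x * partial j \<phi> x \<partial>lborel) - (\<integral>x. b j x * w2 i x * partial j \<phi> x \<partial>lborel)" for i j
  proof -
    have cc': "cc (\<lambda>x. v j x * w1 i x * partial j \<phi> x)" "cc (\<lambda>x. b j x * w2 i x * partial j \<phi> x)"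
      by (intro cc_mult_left cp continuous_intros conts C1_continuous w1 w2)+
    have "1/2 * (\<integral>x. v j x * w1 i x * partial j \<phi> x \<partial>lborel) - (\<integral>x. b j x * w2 i x * partial j \<phi> x \<partial>lborel)
      = (\<integral>x. 1/2 * (v j x * w1 i x * partial j \<phi> x) - b j x * w2 i x * partial j \<phi> x \<partial>lborel)"
      using cc'[THEN cc_integrable] by simp
    also have "\<dots> = (\<integral>x. (v j x * ((v i x)\<^sup>2 + (b i x)\<^sup>2) / 2 - b j x * b i x * v i x) * partial j \<phi> x \<partial>lborel)"
      by (intro Bochner_Integration.integral_cong refl) (simp add: w1_def w2_def field_simps power2_eq_square)
    finally show ?thesis by simp
  qed
  have "\<nu> * (\<Sum>i\<in>UNIV. \<Sum>j\<in>UNIV. (\<integral>x. partial j (v i) x * partial j (q1 i) x \<partial>lborel) + (\<integral>x. partial j (b i) x * partial j (q2 i) x \<partial>lborel))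
    = (\<integral>x. p x * (\<Sum>i\<in>UNIV. v i x * partial i \<phi> x) \<partial>lborel)
      + (\<Sum>i\<in>UNIV. \<Sum>j\<in>UNIV. (\<integral>x. (v j x * v i x - b j x * b i x) * partial j (q1 i) x \<partial>lborel) + (\<integral>x. (v j x * b i x - b j x * v i x) * partial j (q2 i) x \<partial>lborel))"
    using M1 M2 by (simp add: sum.distrib distrib_left)
  then show ?thesis
    unfolding L Rr F
    using A1 A2 by (simp add: sum.distrib sum_subtractf distrib_left sum_negf flip: sum_distrib_left sum_divide_distrib)
qed

text \<open>Viscous terms by Cauchy-Schwarz, fluxes by products of three functions; the nine index
  pairs give 9 * 16 and 9 * 12, both at most 144.\<close>

lemma energy_le:
  assumes nu: "0 < \<nu>" "\<nu> \<le> 1" and R: "0 \<le> R" "R \<le> 2"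
    and \<phi>: "C1 \<phi>" "cc \<phi>" "supp_in R \<phi>" "\<And>i x. \<bar>partial i \<phi> x\<bar> \<le> 4"
  shows "\<nu> * (\<Sum>i\<in>UNIV. \<Sum>j\<in>UNIV. \<integral>x. \<phi> x * ((partial j (v i) x)\<^sup>2 + (partial j (b i) x)\<^sup>2) \<partial>lborel)
    \<le> 144 * (X R + root 3 (X R) * sqrt (G R)) + \<bar>\<integral>x. p x * (\<Sum>i\<in>UNIV. v i x * partial i \<phi> x) \<partial>lborel\<bar>"
proof -
  have X: "0 \<le> X R" by (rule X_nonneg)
  have cp: "cc (partial j \<phi>)" and sp: "supp_in R (partial j \<phi>)" for j by (intro cc_partial supp_in_partial \<phi>)+
  have S: "\<bar>\<Sum>i\<in>UNIV. \<Sum>j\<in>UNIV. f i j\<bar> \<le> 9 * B" if "\<And>i j. \<bar>f i j\<bar> \<le> B" for f :: "3 \<Rightarrow> 3 \<Rightarrow> real" and B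
  proof -
    have "\<bar>\<Sum>i\<in>UNIV. \<Sum>j\<in>UNIV. f i j\<bar> \<le> (\<Sum>i\<in>(UNIV::3 set). \<Sum>j\<in>(UNIV::3 set). B)"
      by (intro order_trans[OF sum_abs] sum_mono that order_trans[OF sum_abs[of "f _" UNIV]])
    then show ?thesis by simp
  qed
  have T1: "\<bar>\<nu> * (\<integral>x. (v i x * partial j (v i) x + b i x * partial j (b i) x) * partial j \<phi> x \<partial>lborel)\<bar> \<le> 16 * (root 3 (X R) * sqrt (G R))" for i j
  proof -
    have "\<bar>\<integral>x. (v i x * partial j (v i) x + b i x * partial j (b i) x) * partial j \<phi> x \<partial>lborel\<bar>
       \<le> II R (\<lambda>x. 4 * (\<bar>v i x * partial j (v i) x\<bar> + \<bar>b i x * partial j (b i) x\<bar>))"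
    proof (rule integral_le_II)
      show "cc (\<lambda>x. (v i x * partial j (v i) x + b i x * partial j (b i) x) * partial j \<phi> x)"
        by (intro cc_mult_left cp continuous_intros conts)
      show "supp_in R (\<lambda>x. (v i x * partial j (v i) x + b i x * partial j (b i) x) * partial j \<phi> x)"
        using sp by (auto simp: supp_in_def)
      show "\<bar>(v i x * partial j (v i) x + b i x * partial j (b i) x) * partial j \<phi> x\<bar> \<le> 4 * (\<bar>v i x * partial j (v i) x\<bar> + \<bar>b i x * partial j (b i) x\<bar>)" for x
        unfolding abs_mult[of _ "partial j \<phi> x"] mult.commute[of 4] by (intro mult_mono \<phi> abs_triangle_ineq) auto
    qed (intro continuous_intros conts)
    also have "\<dots> = 4 * (II R (\<lambda>x. \<bar>v i x * partial j (v i) x\<bar>) + II R (\<lambda>x. \<bar>b i x * partial j (b i) x\<bar>))"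
      unfolding II_cmult by (subst II_add) (intro continuous_intros conts refl)+
    finally have "\<nu> * \<bar>\<integral>x. (v i x * partial j (v i) x + b i x * partial j (b i) x) * partial j \<phi> x \<partial>lborel\<bar>
       \<le> \<nu> * (4 * (II R (\<lambda>x. \<bar>v i x * partial j (v i) x\<bar>) + II R (\<lambda>x. \<bar>b i x * partial j (b i) x\<bar>)))"
      using nu by (intro mult_left_mono) auto
    also have "\<dots> = 4 * (\<nu> * II R (\<lambda>x. \<bar>v i x * partial j (v i) x\<bar>) + \<nu> * II R (\<lambda>x. \<bar>b i x * partial j (b i) x\<bar>))"
      by (simp add: algebra_simps)
    also have "\<dots> \<le> 4 * (2 * root 3 (X R) * sqrt (G R) + 2 * root 3 (X R) * sqrt (G R))"
      using nu by (intro mult_left_mono add_mono viscous_le(2) R conts II_le_G II_v_le_X II_b_le_X) auto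
    finally show ?thesis using nu by (simp add: abs_mult mult_ac)
  qed
  have T2: "\<bar>\<integral>x. (v j x * ((v i x)\<^sup>2 + (b i x)\<^sup>2) / 2 - b j x * b i x * v i x) * partial j \<phi> x \<partial>lborel\<bar> \<le> 12 * X R" for i j
  proof -
    have "\<bar>\<integral>x. (v j x * ((v i x)\<^sup>2 + (b i x)\<^sup>2) / 2 - b j x * b i x * v i x) * partial j \<phi> x \<partial>lborel\<bar>
       \<le> II R (\<lambda>x. 4 * ((\<bar>v j x\<bar> ^ 3 + \<bar>b j x\<bar> ^ 3) + 2 * (\<bar>v i x\<bar> ^ 3 + \<bar>b i x\<bar> ^ 3)))"
    proof (rule integral_le_II)
      show "cc (\<lambda>x. (v j x * ((v i x)\<^sup>2 + (b i x)\<^sup>2) / 2 - b j x * b i x * v i x) * partial j \<phi> x)"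
        by (intro cc_mult_left cp continuous_intros conts) auto
      show "supp_in R (\<lambda>x. (v j x * ((v i x)\<^sup>2 + (b i x)\<^sup>2) / 2 - b j x * b i x * v i x) * partial j \<phi> x)"
        using sp by (auto simp: supp_in_def)
      fix x
      have a: "\<bar>v j x * (v i x)\<^sup>2\<bar> \<le> \<bar>v j x\<bar> ^ 3 + 2 * \<bar>v i x\<bar> ^ 3" "\<bar>v j x * (b i x)\<^sup>2\<bar> \<le> \<bar>v j x\<bar> ^ 3 + 2 * \<bar>b i x\<bar> ^ 3"
        "\<bar>b j x * b i x * v i x\<bar> \<le> \<bar>b j x\<bar> ^ 3 + \<bar>b i x\<bar> ^ 3 + \<bar>v i x\<bar> ^ 3"
        using abs_prod3_le[of "v j x" "v i x" "v i x"] abs_prod3_le[of "v j x" "b i x" "b i x"] abs_prod3_le[of "b j x" "b i x" "v i x"]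
        by (simp_all add: power2_eq_square mult.assoc)
      have "\<bar>v j x * ((v i x)\<^sup>2 + (b i x)\<^sup>2) / 2 - b j x * b i x * v i x\<bar> \<le> (\<bar>v j x * (v i x)\<^sup>2\<bar> + \<bar>v j x * (b i x)\<^sup>2\<bar>) / 2 + \<bar>b j x * b i x * v i x\<bar>"
      proof -
        have "\<bar>(A + B) / 2 - C\<bar> \<le> (\<bar>A\<bar> + \<bar>B\<bar>) / 2 + \<bar>C\<bar>" for A B C :: real
        proof -
          have "\<bar>(A + B) / 2 - C\<bar> \<le> \<bar>A + B\<bar> / 2 + \<bar>C\<bar>" using abs_triangle_ineq4[of "(A + B) / 2" C] by simp
          also have "\<dots> \<le> (\<bar>A\<bar> + \<bar>B\<bar>) / 2 + \<bar>C\<bar>" by (intro add_right_mono divide_right_mono abs_triangle_ineq) simp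
          finally show ?thesis .
        qed
        then show ?thesis by (simp only: distrib_left)
      qed
      also have "\<dots> \<le> (\<bar>v j x\<bar> ^ 3 + \<bar>b j x\<bar> ^ 3) + 2 * (\<bar>v i x\<bar> ^ 3 + \<bar>b i x\<bar> ^ 3)"
      proof -
        have "(A + B) / 2 + C \<le> (p + s) + 2 * (q + r)"
          if "A \<le> p + 2 * q" "B \<le> p + 2 * r" "C \<le> s + r + q" for A B C p q r s :: real
          using that unfolding add_divide_distrib distrib_left by linarith
        then show ?thesis using a by blast
      qed
      finally have "\<bar>v j x * ((v i x)\<^sup>2 + (b i x)\<^sup>2) / 2 - b j x * b i x * v i x\<bar> * \<bar>partial j \<phi> x\<bar>
         \<le> ((\<bar>v j x\<bar> ^ 3 + \<bar>b j x\<bar> ^ 3) + 2 * (\<bar>v i x\<bar> ^ 3 + \<bar>b i x\<bar> ^ 3)) * 4"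
        by (intro mult_mono \<phi>) auto
      then show "\<bar>(v j x * ((v i x)\<^sup>2 + (b i x)\<^sup>2) / 2 - b j x * b i x * v i x) * partial j \<phi> x\<bar> \<le> 4 * ((\<bar>v j x\<bar> ^ 3 + \<bar>b j x\<bar> ^ 3) + 2 * (\<bar>v i x\<bar> ^ 3 + \<bar>b i x\<bar> ^ 3))"
        unfolding abs_mult by (simp only: mult.commute)
    qed (intro continuous_intros conts)
    also have "\<dots> = 4 * ((II R (\<lambda>x. \<bar>v j x\<bar> ^ 3) + II R (\<lambda>x. \<bar>b j x\<bar> ^ 3)) + 2 * (II R (\<lambda>x. \<bar>v i x\<bar> ^ 3) + II R (\<lambda>x. \<bar>b i x\<bar> ^ 3)))"
      using continuous_cube by (simp add: II_add II_cmult continuous_on_add continuous_on_mult_left)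
    finally show ?thesis using II_le_X[of R j] II_le_X[of R i] unfolding distrib_left by linarith
  qed
  have T2': "\<bar>\<Sum>i\<in>UNIV. \<Sum>j\<in>UNIV. \<integral>x. (v j x * ((v i x)\<^sup>2 + (b i x)\<^sup>2) / 2 - b j x * b i x * v i x) * partial j \<phi> x \<partial>lborel\<bar> \<le> 9 * (12 * X R)"
    by (rule S, rule T2)
  have "\<bar>\<nu> * (\<Sum>i\<in>UNIV. \<Sum>j\<in>UNIV. \<integral>x. (v i x * partial j (v i) x + b i x * partial j (b i) x) * partial j \<phi> x \<partial>lborel)\<bar> \<le> 9 * (16 * (root 3 (X R) * sqrt (G R)))"
    unfolding sum_distrib_left by (rule S[OF T1])
  then show ?thesis unfolding energy_identity[OF \<phi>(1,2)] using T2' X by (simp add: algebra_simps)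
qed

end


text \<open>The explicit formula is exported because lower bounds on smaller balls are read off from
  it; the square makes the function continuously differentiable across the sphere.\<close>

lemma cutoff:
  assumes "0 < r"
  obtains \<phi> :: "real^3 \<Rightarrow> real" where "C1 \<phi>" "cc \<phi>" "supp_in r \<phi>" "\<And>x. 0 \<le> \<phi> x" "\<And>x. \<phi> x \<le> 1"
    "\<And>i x. \<bar>partial i \<phi> x\<bar> \<le> 4 / r" "\<And>x. \<phi> x = (max 0 (1 - x \<bullet> x / r\<^sup>2))\<^sup>2"
proof -
  define Q where "Q t = (max 0 (1 - t / r\<^sup>2))\<^sup>2" for t
  define Q' where "Q' t = 2 * max 0 (1 - t / r\<^sup>2) * (- 1 / r\<^sup>2)" for t
  define \<phi> where "\<phi> x = Q (x \<bullet> x)" for x :: "real^3"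
  have dQ: "(Q has_real_derivative Q' t) (at t)" for t
    unfolding Q_def[abs_def] Q'_def
    by (rule DERIV_chain2[OF DERIV_pos_part_power2])
       (use assms in \<open>auto intro!: derivative_eq_intros simp: divide_simps power2_eq_square power4_eq_xxxx\<close>)
  have cQ: "continuous_on {0..} Q'" unfolding Q'_def[abs_def] by (intro continuous_intros) (use assms in auto)
  have C: "C1 \<phi>" "partial i \<phi> x = 2 * x $ i * Q' (x \<bullet> x)" for i x
    unfolding \<phi>_def[abs_def] using C1_radial[OF dQ cQ] by auto
  have zero: "1 - x \<bullet> x / r\<^sup>2 < 0" if "r < norm x" for x :: "real^3"
  proof -
    have "r\<^sup>2 < (norm x)\<^sup>2" using that assms by (intro power_strict_mono) auto
    then show ?thesis using assms by (simp add: power2_norm_eq_inner)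
  qed
  have supp: "supp_in r \<phi>" unfolding supp_in_def \<phi>_def Q_def
  proof (intro allI impI)
    fix x :: "real^3" assume "r < norm x"
    from zero[OF this] have "max 0 (1 - x \<bullet> x / r\<^sup>2) = 0" by simp
    then show "(max 0 (1 - x \<bullet> x / r\<^sup>2))\<^sup>2 = 0" by simp
  qed
  have le: "max 0 (1 - x \<bullet> x / r\<^sup>2) \<le> 1" for x :: "real^3" by simp
  have bound: "\<bar>partial i \<phi> x\<bar> \<le> 4 / r" for i x
  proof (cases "r < norm x")
    case True
    then show ?thesis using zero[OF True] assms by (simp add: C Q'_def)
  next
    case False
    have "\<bar>x $ i\<bar> \<le> r" using component_le_norm_cart[of x i] False by linarith
    moreover have "\<bar>partial i \<phi> x\<bar> = \<bar>x $ i\<bar> * max 0 (1 - x \<bullet> x / r\<^sup>2) * (4 / r\<^sup>2)"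
      by (simp add: C Q'_def abs_mult)
    ultimately have "\<bar>partial i \<phi> x\<bar> \<le> r * 1 * (4 / r\<^sup>2)"
      using le[of x] assms by (simp only:) (intro mult_right_mono mult_mono, auto)
    then show ?thesis using assms by (simp add: power2_eq_square)
  qed
  have "cc \<phi>" by (rule ccI[OF C1_continuous[OF C(1)] supp])
  then show thesis
    by (intro that[of \<phi>]) (use C(1) supp bound le in \<open>auto simp: \<phi>_def Q_def power_le_one\<close>)
qed

text \<open>The factor 16 undoes the lower bound \<open>t\<^sup>2 / 16\<close> of the cutoff, and
  \<open>16 ^ 9\<close> is what \<open>c ^ 9\<close> contributes besides its power of
  \<open>t\<close>, with \<open>c = 16 / t ^ 4\<close>.\<close>

definition energy_const :: real where "energy_const = 16 * (144 + pressure_const * 16 ^ 9)"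

context mhd
begin

text \<open>As \<open>a\<close> tends to 0, \<open>conv E g\<close> approaches a multiple of
  \<open>g\<close> uniformly, while \<open>pressure_bound\<close> is uniform in \<open>a\<close>.
  The integral of \<open>\<bar>p\<bar>\<close> decides how small \<open>a\<close> must be but leaves
  no trace in the bound.\<close>

lemma pressure_work_le:
  assumes nu: "0 < \<nu>" "\<nu> \<le> 1" and c: "1 \<le> c" and s: "0 < s" "c * s ^ 4 = 1" and R: "r1 + s \<le> R" "0 \<le> r1" "R \<le> 2"
    and \<phi>: "C1 \<phi>" "cc \<phi>" "supp_in r1 \<phi>" "\<And>x. 0 \<le> \<phi> x" "\<And>x. \<phi> x \<le> 1" "\<And>i x. \<bar>partial i \<phi> x\<bar> \<le> 4"
  shows "\<bar>\<integral>x. p x * (\<Sum>i\<in>UNIV. v i x * partial i \<phi> x) \<partial>lborel\<bar> \<le> pressure_const * c ^ 9 * (X R + root 3 (X R) * sqrt (G R))"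
proof (rule field_le_epsilon)
  fix \<eta> :: real assume \<eta>: "\<eta> > 0"
  define g where "g x = (\<Sum>i\<in>UNIV. v i x * partial i \<phi> x)" for x
  have cg: "cc g" unfolding g_def[abs_def] by (intro cc_sum cc_mult_left cc_partial \<phi> conts)
  have sg: "supp_in r1 g" using supp_in_partial[OF \<phi>(3)] by (auto simp: supp_in_def g_def)
  obtain B where B: "B > 0" "\<And>x. \<bar>g x\<bar> \<le> B" using cc_bounded[OF cg] by blast
  define P where "P = II R (\<lambda>x. \<bar>p x\<bar>)"
  have P: "0 \<le> P" unfolding P_def by (intro II_nonneg) auto
  \<comment> \<open>Each of the two errors of the approximate identity is to be at most
    \<open>\<eta> / (2 * (P + 1))\<close>: the first through \<open>e\<close> and the modulus of
    continuity, the second through \<open>m\<close> and the choice of \<open>a\<close>. The 64 below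
    is 2 times 32, since \<open>2 * B * 3 * (16/3) = 32 * B\<close>.\<close>
  define e where "e = \<eta> / (2 * (1622 * c\<^sup>2) * (P + 1))"
  have e: "e > 0" using \<eta> P c by (simp add: e_def)
  obtain d where d: "d > 0" "\<And>x x'. dist x' x < d \<Longrightarrow> \<bar>g x' - g x\<bar> < e"
    using cc_modulus[OF cg e] by blast
  define m where "m = \<eta> * d ^ 5 / (64 * B * (P + 1))"
  have m: "m > 0" using \<eta> d B P by (simp add: m_def)
  define a where "a = min (s / 2) (min 1 m)"
  have a: "0 < a" "a \<le> s / 2" "a \<le> 1" "a \<le> m" using s m by (auto simp: a_def)
  interpret K: mhd_kernel \<nu> v b p c a \<phi>
    by unfold_locales (use c a \<phi> in auto)
  have gK: "K.g = g" by (simp add: K.g_def g_def fun_eq_iff)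
  have "c * (2 * a) ^ 4 \<le> c * s ^ 4" using a c by (intro mult_left_mono power_mono) auto
  then have Ege: "1 \<le> (\<integral>x. K.E x \<partial>lborel)" using s by (intro K.integral_E_ge) simp
  define M where "M = (\<integral>x. K.E x \<partial>lborel)"
  define f where "f x = conv K.E g x - M * g x" for x
  have cE: "cc (conv K.E g)" by (intro cc_conv K.cc_kernel cg)
  have fle: "\<bar>f x\<bar> \<le> \<eta> / (P + 1)" for x
  proof -
    have f1: "\<bar>f x\<bar> \<le> e * (1622 * c\<^sup>2) + 2 * B * (3 * a\<^sup>2 / d ^ 5) * (16/3)"
      unfolding f_def M_def using d(2) e
      by (intro K.E_approximate_identity[OF cg B(2) d(1)]) (auto simp: dist_norm intro: less_imp_le)
    have f2: "e * (1622 * c\<^sup>2) = \<eta> / (2 * (P + 1))"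
    proof -
      have "1622 * c\<^sup>2 \<noteq> 0" using c by simp
      moreover have "\<eta> / (2 * W * (P + 1)) * W = \<eta> / (2 * (P + 1))" if "W \<noteq> 0" for W
        using that by simp
      ultimately show ?thesis unfolding e_def by blast
    qed
    have f3: "2 * B * (3 * a\<^sup>2 / d ^ 5) * (16/3) \<le> \<eta> / (2 * (P + 1))"
    proof -
      have "a\<^sup>2 \<le> m * 1" unfolding power2_eq_square using a by (intro mult_mono) auto
      then have "2 * B * (3 * a\<^sup>2 / d ^ 5) * (16/3) \<le> 2 * B * (3 * m / d ^ 5) * (16/3)"
        using B d by (intro mult_right_mono mult_left_mono divide_right_mono) auto
      also have "\<dots> = \<eta> / (2 * (P + 1))"
      proof -
        have *: "2 * B * (3 * (\<eta> * D / (64 * B * Q)) / D) * (16/3) = \<eta> / (2 * Q)" if "D \<noteq> 0" "Q \<noteq> 0" for D Q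
          using B that by (simp add: field_simps)
        show ?thesis unfolding m_def by (rule *) (use d P in auto)
      qed
      finally show ?thesis .
    qed
    have "\<bar>f x\<bar> \<le> \<eta> / (2 * (P + 1)) + \<eta> / (2 * (P + 1))"
      using f1 f3 unfolding f2 by linarith
    also have "\<dots> = \<eta> / (P + 1)" using P by (simp add: divide_simps)
    finally show ?thesis .
  qed
  have cf: "cc f" unfolding f_def[abs_def] by (intro cc_diff cE cc_cmult cg)
  have sf: "supp_in R f"
  proof -
    have "supp_in (s + r1) (conv K.E g)" by (rule supp_in_conv[OF K.support(3)[OF s] sg])
    moreover have "supp_in (s + r1) g" by (rule supp_in_mono[OF sg]) (use s in auto)
    ultimately have "supp_in (s + r1) f" by (auto simp: supp_in_def f_def)
    then show ?thesis by (rule supp_in_mono) (use R in auto)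
  qed
  have pf: "\<bar>\<integral>x. p x * f x \<partial>lborel\<bar> \<le> \<eta>"
  proof -
    have "\<bar>\<integral>x. p x * f x \<partial>lborel\<bar> \<le> II R (\<lambda>x. \<eta> / (P + 1) * \<bar>p x\<bar>)"
    proof (rule integral_le_II)
      show "cc (\<lambda>x. p x * f x)" by (intro cc_mult_left cf conts)
      show "supp_in R (\<lambda>x. p x * f x)" using sf by (auto simp: supp_in_def)
      show "\<bar>p x * f x\<bar> \<le> \<eta> / (P + 1) * \<bar>p x\<bar>" for x
        unfolding abs_mult mult.commute[of "\<bar>p x\<bar>"] by (intro mult_right_mono fle) auto
    qed (intro continuous_intros conts)
    also have "\<dots> = \<eta> * (P / (P + 1))" unfolding II_cmult P_def[symmetric] by simp
    also have "\<dots> \<le> \<eta>" using \<eta> P by (intro mult_left_le) auto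
    finally show ?thesis .
  qed
  have "(\<integral>x. p x * conv K.E g x \<partial>lborel) = (\<integral>x. M * (p x * g x) + p x * f x \<partial>lborel)"
    by (rule Bochner_Integration.integral_cong) (auto simp: f_def algebra_simps)
  also have "\<dots> = M * (\<integral>x. p x * g x \<partial>lborel) + (\<integral>x. p x * f x \<partial>lborel)"
  proof -
    have "cc (\<lambda>x. M * (p x * g x))" "cc (\<lambda>x. p x * f x)" by (intro cc_mult_left cc_cmult cf cg conts)+
    from Bochner_Integration.integral_add[OF this[THEN cc_integrable]] show ?thesis by simp
  qed
  finally have eq: "M * (\<integral>x. p x * g x \<partial>lborel) = (\<integral>x. p x * conv K.E g x \<partial>lborel) - (\<integral>x. p x * f x \<partial>lborel)" by simp
  \<comment> \<open>Mass at least 1 takes the place of a normalisation of the kernel.\<close>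
  have "\<bar>\<integral>x. p x * g x \<partial>lborel\<bar> \<le> M * \<bar>\<integral>x. p x * g x \<partial>lborel\<bar>"
    using mult_right_mono[OF Ege, of "\<bar>\<integral>x. p x * g x \<partial>lborel\<bar>"] by (simp add: M_def)
  also have "\<dots> = \<bar>M * (\<integral>x. p x * g x \<partial>lborel)\<bar>" using Ege by (simp add: M_def abs_mult)
  also have "\<dots> \<le> \<bar>\<integral>x. p x * conv K.E g x \<partial>lborel\<bar> + \<eta>"
    unfolding eq using pf by linarith
  also have "\<bar>\<integral>x. p x * conv K.E g x \<partial>lborel\<bar> \<le> pressure_const * c ^ 9 * (X R + root 3 (X R) * sqrt (G R))"
    unfolding gK[symmetric] by (rule K.pressure_bound[OF nu s \<phi>(3) R \<phi>(4,5,6)])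
  finally show "\<bar>\<integral>x. p x * (\<Sum>i\<in>UNIV. v i x * partial i \<phi> x) \<partial>lborel\<bar> \<le> pressure_const * c ^ 9 * (X R + root 3 (X R) * sqrt (G R)) + \<eta>"
    by (simp add: g_def)
qed

text \<open>Half of the gap \<open>R - r\<close> is spent on the cutoff and half on the support of
  the kernel. The cutoff is at least \<open>t\<^sup>2 / 16\<close> on the smaller ball and
  \<open>c ^ 9\<close> is of order \<open>t ^ (-36)\<close>, hence the power 38.\<close>

theorem local_energy_inequality:
  assumes nu: "0 < \<nu>" "\<nu> \<le> 1" and r: "1 \<le> r" "r < R" "R \<le> 2"
  shows "G r \<le> energy_const / (R - r) ^ 38 * (X R + root 3 (X R) * sqrt (G R))"
proof -
  define t where "t = R - r"
  define r1 where "r1 = r + t / 2"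
  define s where "s = t / 2"
  define c where "c = 1 / s ^ 4"
  have t: "0 < t" "t \<le> 1" using r by (auto simp: t_def)
  have r1: "1 \<le> r1" "r1 \<le> 2" "r1 + s = R" using r t by (auto simp: r1_def s_def t_def field_simps)
  have s: "0 < s" "s \<le> 1" "c * s ^ 4 = 1" using t by (auto simp: s_def c_def)
  have c: "1 \<le> c" using s by (simp add: c_def power_le_one)
  obtain \<phi> :: "real^3 \<Rightarrow> real" where \<phi>: "C1 \<phi>" "cc \<phi>" "supp_in r1 \<phi>" "\<And>x. 0 \<le> \<phi> x" "\<And>x. \<phi> x \<le> 1"
    "\<And>i x. \<bar>partial i \<phi> x\<bar> \<le> 4 / r1" "\<And>x. \<phi> x = (max 0 (1 - x \<bullet> x / r1\<^sup>2))\<^sup>2"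
    using cutoff[of r1] r1 by auto
  have \<phi>4: "\<bar>partial i \<phi> x\<bar> \<le> 4" for i x
  proof -
    have "4 / r1 \<le> 4" using r1 by (simp add: field_simps)
    then show ?thesis using \<phi>(6)[of i x] by linarith
  qed
  have low: "t\<^sup>2 / 16 \<le> \<phi> x" if "norm x \<le> r" for x
  proof -
    have "x \<bullet> x \<le> r\<^sup>2" using that by (simp add: power2_norm_eq_inner[symmetric] power_mono)
    moreover have "t / 4 * r1\<^sup>2 \<le> r1\<^sup>2 - r\<^sup>2"
    proof -
      have "t / 4 * r1\<^sup>2 \<le> t / 4 * (r1 * 2)" unfolding power2_eq_square using r1 t by (intro mult_left_mono) auto
      also have "\<dots> = t / 2 * r1" by simp
      also have "\<dots> \<le> t / 2 * (r1 + r)" using t r by (intro mult_left_mono) auto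
      also have "\<dots> = r1\<^sup>2 - r\<^sup>2" by (simp add: r1_def power2_eq_square algebra_simps)
      finally show ?thesis .
    qed
    ultimately have "t / 4 * r1\<^sup>2 \<le> r1\<^sup>2 - x \<bullet> x" by linarith
    then have "t / 4 \<le> 1 - x \<bullet> x / r1\<^sup>2" using r1 by (simp add: field_simps)
    then have "(t / 4)\<^sup>2 \<le> (max 0 (1 - x \<bullet> x / r1\<^sup>2))\<^sup>2" using t by (intro power_mono) auto
    then show ?thesis by (simp add: \<phi>(7) power_divide)
  qed
  define Z where "Z = X R + root 3 (X R) * sqrt (G R)"
  have Z: "0 \<le> Z" using X_nonneg[of R] G_nonneg[of R] nu by (auto simp: Z_def intro!: add_nonneg_nonneg mult_nonneg_nonneg)
  have "t\<^sup>2 / 16 * G r \<le> \<nu> * (\<Sum>i\<in>UNIV. \<Sum>j\<in>UNIV. \<integral>x. \<phi> x * ((partial j (v i) x)\<^sup>2 + (partial j (b i) x)\<^sup>2) \<partial>lborel)"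
  proof -
    have "t\<^sup>2 / 16 * (II r (\<lambda>x. (partial j (v i) x)\<^sup>2) + II r (\<lambda>x. (partial j (b i) x)\<^sup>2))
       \<le> (\<integral>x. \<phi> x * ((partial j (v i) x)\<^sup>2 + (partial j (b i) x)\<^sup>2) \<partial>lborel)" for i j
    proof -
      have cv: "continuous_on UNIV (\<lambda>x. (partial j (v i) x)\<^sup>2)" "continuous_on UNIV (\<lambda>x. (partial j (b i) x)\<^sup>2)"
        by (intro continuous_intros conts)+
      have "t\<^sup>2 / 16 * (II r (\<lambda>x. (partial j (v i) x)\<^sup>2) + II r (\<lambda>x. (partial j (b i) x)\<^sup>2))
        = II r (\<lambda>x. t\<^sup>2 / 16 * ((partial j (v i) x)\<^sup>2 + (partial j (b i) x)\<^sup>2))"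
        unfolding II_cmult II_add[OF cv] ..
      also have "\<dots> \<le> II r (\<lambda>x. \<phi> x * ((partial j (v i) x)\<^sup>2 + (partial j (b i) x)\<^sup>2))"
        using low by (intro II_mono mult_right_mono continuous_on_mult continuous_on_add cv cc_continuous[OF \<phi>(2)] continuous_on_const) auto
      also have "\<dots> \<le> II r1 (\<lambda>x. \<phi> x * ((partial j (v i) x)\<^sup>2 + (partial j (b i) x)\<^sup>2))"
        using \<phi>(4) t by (intro II_mono_radius continuous_on_mult continuous_on_add cv cc_continuous[OF \<phi>(2)]) (auto simp: r1_def)
      also have "\<dots> = (\<integral>x. \<phi> x * ((partial j (v i) x)\<^sup>2 + (partial j (b i) x)\<^sup>2) \<partial>lborel)"
        using \<phi>(3) by (intro integral_eq_II[symmetric]) (auto simp: supp_in_def)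
      finally show ?thesis .
    qed
    then have "\<nu> * (\<Sum>i\<in>UNIV. \<Sum>j\<in>UNIV. t\<^sup>2 / 16 * (II r (\<lambda>x. (partial j (v i) x)\<^sup>2) + II r (\<lambda>x. (partial j (b i) x)\<^sup>2)))
       \<le> \<nu> * (\<Sum>i\<in>UNIV. \<Sum>j\<in>UNIV. \<integral>x. \<phi> x * ((partial j (v i) x)\<^sup>2 + (partial j (b i) x)\<^sup>2) \<partial>lborel)"
      using nu by (intro mult_left_mono sum_mono) auto
    then show ?thesis by (simp add: G_def sum_distrib_left mult_ac)
  qed
  also have "\<dots> \<le> 144 * Z + \<bar>\<integral>x. p x * (\<Sum>i\<in>UNIV. v i x * partial i \<phi> x) \<partial>lborel\<bar>"
    unfolding Z_def using nu r r1 s by (intro energy_le \<phi> \<phi>4 supp_in_mono[OF \<phi>(3)]) auto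
  also have "\<bar>\<integral>x. p x * (\<Sum>i\<in>UNIV. v i x * partial i \<phi> x) \<partial>lborel\<bar> \<le> pressure_const * c ^ 9 * Z"
    unfolding Z_def using r r1 by (intro pressure_work_le[OF nu c s(1,3), of r1] \<phi> \<phi>4) auto
  also have "144 * Z + pressure_const * c ^ 9 * Z \<le> (144 + pressure_const * 16 ^ 9) / t ^ 36 * Z"
  proof -
    have "c ^ 9 = 16 ^ 9 / t ^ 36" by (simp add: c_def s_def power_divide flip: power_mult)
    moreover have "144 * 1 \<le> 144 / t ^ 36" using t by (simp add: field_simps power_le_one)
    ultimately have "144 + pressure_const * c ^ 9 \<le> (144 + pressure_const * 16 ^ 9) / t ^ 36" by (simp add: add_divide_distrib)
    from mult_right_mono[OF this Z] show ?thesis by (simp add: distrib_right)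
  qed
  finally have "t\<^sup>2 / 16 * G r \<le> (144 + pressure_const * 16 ^ 9) / t ^ 36 * Z" by simp
  then have "16 / t\<^sup>2 * (t\<^sup>2 / 16 * G r) \<le> 16 / t\<^sup>2 * ((144 + pressure_const * 16 ^ 9) / t ^ 36 * Z)" by (rule mult_left_mono) simp
  then have "G r \<le> 16 / t\<^sup>2 * ((144 + pressure_const * 16 ^ 9) / t ^ 36 * Z)" using t by simp
  also have "\<dots> = energy_const / t ^ 38 * Z" using t by (simp add: energy_const_def flip: power_add)
  finally show ?thesis by (simp add: t_def Z_def)
qed

end

subsection \<open>Interpolation between the gradient and the potential\<close>

text \<open>1152 is the constant in the gradient bound of the cut-off field in
  \<open>cubic_interpolation\<close>; \<open>sobolev6\<close> multiplies three such bounds.\<close>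

definition sobolev_const :: real where "sobolev_const = 4096 * 1152 ^ 3"

lemma powr_le_self: "1 \<le> x \<Longrightarrow> a \<le> 1 \<Longrightarrow> x powr a \<le> (x::real)"
  using powr_mono[of a 1 x] by simp

lemma cube_powr:
  fixes c x :: real
  assumes "0 \<le> c" "0 < x" shows "(c * x ^ 3) powr a = c powr a * x powr (3 * a)"
proof -
  have "x ^ 3 = x powr 3" using assms by simp
  then show ?thesis using assms by (simp add: powr_mult powr_powr del: powr_numeral)
qed

lemma integrable_indicator_mult:
  fixes f :: "'a::euclidean_space \<Rightarrow> real"
  assumes "A \<in> sets borel" "integrable lborel f" shows "integrable lborel (\<lambda>x. indicator A x * f x)"
  using integrable_mult_indicator[of A lborel f] assms by simp

text \<open>Hoelder for \<open>\<bar>F\<bar> powr s\<close>, \<open>\<bar>w\<bar> ^ 3\<close>,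
  \<open>\<bar>w\<bar> ^ 6\<close> and \<open>d\<^sup>2\<close>. The set \<open>A\<close> restricts
  the second and the fourth factor, so that smallness of \<open>ZA\<close> or of \<open>GA\<close>
  is felt.\<close>

lemma interpolation_term:
  fixes F w d :: "real^3 \<Rightarrow> real"
  assumes s: "3 < s" "s \<le> 6" and nu: "0 < \<nu>" and A: "A \<in> sets borel"
    and F: "continuous_on UNIV F" "II r (\<lambda>x. \<bar>F x\<bar> powr s) \<le> C0 * \<nu> ^ 3" "0 < C0"
    and w: "cc w" "supp_in r w" and d: "continuous_on UNIV d"
    and w6: "(\<integral>x. \<bar>w x\<bar> ^ 6 \<partial>lborel) \<le> sobolev_const * (M / \<nu>) ^ 3" "0 < M"
    and ZA: "(\<integral>x. indicator A x * \<bar>w x\<bar> ^ 3 \<partial>lborel) \<le> ZA" "0 < ZA"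
    and DA: "\<nu> * (\<integral>x. indicator A x * (indicator (cball 0 r) x * (d x)\<^sup>2) \<partial>lborel) \<le> GA" "0 < GA"
  shows "(\<integral>x. indicator A x * \<bar>F x * w x * d x\<bar> \<partial>lborel)
    \<le> sobolev_const * C0 powr (1 / s) * ZA powr (2/3 - 2 / s) * M powr (3 / s - 1/2) * sqrt GA"
proof -
  \<comment> \<open>The third exponent is nonnegative by \<open>s \<le> 6\<close>, the second by
    \<open>3 < s\<close>. Besides adding up to 1, they give \<open>w\<close> the total power
    \<open>3 * (2/3 - 2 / s) + 6 * (1 / s - 1/6) = 1\<close>.\<close>
  have p: "0 \<le> 1 / s" "0 \<le> 2/3 - 2 / s" "0 \<le> 1 / s - 1/6" "(0::real) \<le> 1/2"
    "1 / s + (2/3 - 2 / s) + (1 / s - 1/6) + 1/2 = 1"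
    using s by (auto simp: field_simps)
  define f1 where "f1 x = indicator (cball 0 r) x * \<bar>F x\<bar> powr s" for x
  define f2 where "f2 x = indicator A x * \<bar>w x\<bar> ^ 3" for x
  define f3 where "f3 x = \<bar>w x\<bar> ^ 6" for x
  define f4 where "f4 x = indicator A x * (indicator (cball 0 r) x * (d x)\<^sup>2)" for x
  have i1: "integrable lborel f1"
    unfolding f1_def[abs_def] using s by (intro II_integrable continuous_on_powr' continuous_on_rabs F(1) continuous_on_const) auto
  have i2: "integrable lborel f2" unfolding f2_def[abs_def] using w by (intro integrable_indicator_mult A cc_integrable cc_power cc_abs) auto
  have i3: "integrable lborel f3" unfolding f3_def[abs_def] using w by (intro cc_integrable cc_power cc_abs) auto
  have i4: "integrable lborel f4" unfolding f4_def[abs_def] using d by (intro integrable_indicator_mult A II_integrable continuous_on_power)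
  have eq: "indicator A x * \<bar>F x * w x * d x\<bar> = f1 x powr (1 / s) * f2 x powr (2/3 - 2 / s) * f3 x powr (1 / s - 1/6) * f4 x powr (1/2)" for x
  proof (cases "x \<in> A \<and> norm x \<le> r \<and> w x \<noteq> 0")
    case True
    then have w0: "\<bar>w x\<bar> > 0" by simp
    have "f1 x powr (1 / s) = \<bar>F x\<bar>" using True s by (simp add: f1_def powr_powr)
    moreover have "f2 x powr (2/3 - 2 / s) * f3 x powr (1 / s - 1/6) = \<bar>w x\<bar>"
    proof -
      have "f2 x powr (2/3 - 2 / s) * f3 x powr (1 / s - 1/6) = \<bar>w x\<bar> powr (3 * (2/3 - 2 / s) + 6 * (1 / s - 1/6))"
      proof -
        have e: "f2 x = \<bar>w x\<bar> powr 3" "f3 x = \<bar>w x\<bar> powr 6" using True w0 by (simp_all add: f2_def f3_def)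
        show ?thesis unfolding e powr_powr powr_add ..
      qed
      also have "3 * (2/3 - 2 / s) + 6 * (1 / s - 1/6) = 1" by simp
      finally show ?thesis using w0 by simp
    qed
    moreover have "f4 x powr (1/2) = \<bar>d x\<bar>" using True by (simp add: f4_def powr_half_sqrt)
    ultimately show ?thesis using True by (simp add: abs_mult mult.assoc)
  next
    case False
    then have "indicator A x * \<bar>F x * w x * d x\<bar> = (0::real)" "f2 x = 0"
      using w(2) by (auto simp: f2_def supp_in_def indicator_def)
    then show ?thesis by simp
  qed
  have J: "0 < C0 * \<nu> ^ 3" "0 < sobolev_const * (M / \<nu>) ^ 3" "0 < GA / \<nu>" using F nu w6 DA by (auto simp: sobolev_const_def)
  have "(\<integral>x. indicator A x * \<bar>F x * w x * d x\<bar> \<partial>lborel)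
     \<le> (C0 * \<nu> ^ 3) powr (1 / s) * ZA powr (2/3 - 2 / s) * (sobolev_const * (M / \<nu>) ^ 3) powr (1 / s - 1/6) * (GA / \<nu>) powr (1/2)"
    unfolding eq
  proof (rule holder4[OF p _ _ _ _ i1 i2 i3 i4 J(1) ZA(2) J(2,3)])
    show "integral\<^sup>L lborel f1 \<le> C0 * \<nu> ^ 3" using F by (simp add: f1_def[abs_def] II_def)
    show "integral\<^sup>L lborel f2 \<le> ZA" using ZA by (simp add: f2_def[abs_def])
    show "integral\<^sup>L lborel f3 \<le> sobolev_const * (M / \<nu>) ^ 3" using w6 by (simp add: f3_def[abs_def])
    show "integral\<^sup>L lborel f4 \<le> GA / \<nu>" using DA nu by (simp add: f4_def[abs_def] field_simps)
  qed (auto simp: f1_def f2_def f3_def f4_def)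
  also have "\<dots> = sobolev_const powr (1 / s - 1/6) * C0 powr (1 / s) * ZA powr (2/3 - 2 / s) * M powr (3 / s - 1/2) * sqrt GA"
  proof -
    have 1: "(C0 * \<nu> ^ 3) powr (1 / s) = C0 powr (1 / s) * \<nu> powr (3 / s)"
      using cube_powr[of C0 \<nu> "1 / s"] nu F by simp
    have 2: "(sobolev_const * (M / \<nu>) ^ 3) powr (1 / s - 1/6) = sobolev_const powr (1 / s - 1/6) * (M powr (3 / s - 1/2) / \<nu> powr (3 / s - 1/2))"
    proof -
      have "3 * (1 / s - 1/6) = 3 / s - 1/2" by simp
      then show ?thesis using cube_powr[of sobolev_const "M / \<nu>" "1 / s - 1/6"] nu w6 by (simp add: sobolev_const_def powr_divide)
    qed
    have 3: "(GA / \<nu>) powr (1/2) = sqrt GA / \<nu> powr (1/2)"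
      using nu DA by (simp add: powr_divide powr_half_sqrt)
    \<comment> \<open>The potential supplies the power \<open>3 / s\<close> of \<open>\<nu>\<close>,
      while Sobolev and the gradient put \<open>3 / s - 1/2\<close> and \<open>1/2\<close> into the
      denominator. They cancel, so the estimate is independent of the scale.\<close>
    have 4: "\<nu> powr (3 / s) = \<nu> powr (3 / s - 1/2) * \<nu> powr (1/2)" by (simp flip: powr_add)
    show ?thesis unfolding 1 2 3 4 using nu by simp
  qed
  also have "\<dots> \<le> sobolev_const * C0 powr (1 / s) * ZA powr (2/3 - 2 / s) * M powr (3 / s - 1/2) * sqrt GA"
  proof -
    have "sobolev_const powr (1 / s - 1/6) \<le> sobolev_const" using s by (intro powr_le_self) (auto simp: sobolev_const_def field_simps)
    then show ?thesis using DA by (intro mult_right_mono) auto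
  qed
  finally show ?thesis .
qed

text \<open>For the term in which the derivative has fallen on the cutoff. The volume takes the
  remaining exponent, and \<open>\<nu> powr (3 / s)\<close> survives, so this contribution fades as
  the radius grows.\<close>

lemma interpolation_lower_term:
  fixes F w :: "real^3 \<Rightarrow> real"
  assumes s: "3 < s" "s \<le> 6" and nu: "0 < \<nu>" and r: "0 \<le> r" "r \<le> 2"
    and F: "continuous_on UNIV F" "II r (\<lambda>x. \<bar>F x\<bar> powr s) \<le> C0 * \<nu> ^ 3" "0 < C0"
    and w: "cc w" "supp_in r w" and Z: "(\<integral>x. \<bar>w x\<bar> ^ 3 \<partial>lborel) \<le> Z" "0 < Z"
  shows "(\<integral>x. \<bar>F x\<bar> * (w x)\<^sup>2 \<partial>lborel) \<le> 43 * C0 powr (1 / s) * \<nu> powr (3 / s) * Z powr (2/3)"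
proof -
  have p: "0 \<le> 1 / s" "(0::real) \<le> 2/3" "0 \<le> 1/3 - 1 / s" "(0::real) \<le> 0" "1 / s + 2/3 + (1/3 - 1 / s) + 0 = 1"
    using s by (auto simp: field_simps)
  define f1 where "f1 x = indicator (cball 0 r) x * \<bar>F x\<bar> powr s" for x
  define f2 where "f2 x = \<bar>w x\<bar> ^ 3" for x
  define f3 where "f3 x = indicator (cball (0::real^3) r) x * (1::real)" for x
  have i1: "integrable lborel f1"
    unfolding f1_def[abs_def] using s by (intro II_integrable continuous_on_powr' continuous_on_rabs F(1) continuous_on_const) auto
  have i2: "integrable lborel f2" unfolding f2_def[abs_def] using w by (intro cc_integrable cc_power cc_abs) auto
  have i3: "integrable lborel f3" unfolding f3_def[abs_def] by (intro II_integrable continuous_intros)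
  \<comment> \<open>Three factors suffice and the fourth slot gets exponent 0. The value
    \<open>0 powr 0 = 0\<close> is harmless, because \<open>w\<close> vanishes wherever
    \<open>f3\<close> does.\<close>
  have eq: "\<bar>F x\<bar> * (w x)\<^sup>2 = f1 x powr (1 / s) * f2 x powr (2/3) * f3 x powr (1/3 - 1 / s) * f3 x powr 0" for x
  proof (cases "norm x \<le> r \<and> w x \<noteq> 0")
    case True
    then have w0: "\<bar>w x\<bar> > 0" by simp
    have "f1 x powr (1 / s) = \<bar>F x\<bar>" using True s by (simp add: f1_def powr_powr)
    moreover have "f2 x powr (2/3) = (w x)\<^sup>2"
    proof -
      have "f2 x powr (2/3) = (\<bar>w x\<bar> powr 3) powr (2/3)" using w0 by (simp add: f2_def)
      also have "\<dots> = \<bar>w x\<bar> powr 2" unfolding powr_powr by simp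
      also have "\<dots> = \<bar>w x\<bar>\<^sup>2" using powr_realpow[OF w0, of 2] by simp
      finally show ?thesis by simp
    qed
    moreover have "f3 x = 1" using True by (simp add: f3_def)
    ultimately show ?thesis by simp
  next
    case False
    then have "w x = 0" using w(2) by (auto simp: supp_in_def)
    then show ?thesis by (simp add: f2_def)
  qed
  have "(\<integral>x. \<bar>F x\<bar> * (w x)\<^sup>2 \<partial>lborel) \<le> (C0 * \<nu> ^ 3) powr (1 / s) * Z powr (2/3) * 43 powr (1/3 - 1 / s) * 43 powr 0"
    unfolding eq
  proof (rule holder4[OF p _ _ _ _ i1 i2 i3 i3])
    show "integral\<^sup>L lborel f1 \<le> C0 * \<nu> ^ 3" using F by (simp add: f1_def[abs_def] II_def)
    show "integral\<^sup>L lborel f2 \<le> Z" using Z by (simp add: f2_def[abs_def])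
    show "integral\<^sup>L lborel f3 \<le> 43" "integral\<^sup>L lborel f3 \<le> 43"
      using II_one_le[OF r] unfolding f3_def[abs_def] II_def by auto
  qed (use F nu Z in \<open>auto simp: f1_def f2_def f3_def\<close>)
  also have "\<dots> = C0 powr (1 / s) * \<nu> powr (3 / s) * Z powr (2/3) * 43 powr (1/3 - 1 / s)"
  proof -
    have 1: "(C0 * \<nu> ^ 3) powr (1 / s) = C0 powr (1 / s) * \<nu> powr (3 / s)"
      using cube_powr[of C0 \<nu> "1 / s"] nu F by simp
    show ?thesis unfolding 1 by simp
  qed
  also have "\<dots> \<le> C0 powr (1 / s) * \<nu> powr (3 / s) * Z powr (2/3) * 43"
    using s by (intro mult_left_mono powr_le_self) (auto simp: field_simps)
  finally show ?thesis by (simp add: mult_ac)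
qed

text \<open>\<open>u * \<bar>u\<bar>\<close> is the test function whose product with
  \<open>u\<close> is \<open>\<bar>u\<bar> ^ 3\<close>, and it is still continuously differentiable
  where \<open>u\<close> changes sign.\<close>

lemma C1_mult_abs:
  assumes "C1 u"
  shows "C1 (\<lambda>x. u x * \<bar>u x\<bar>)" "partial j (\<lambda>x. u x * \<bar>u x\<bar>) x = 2 * \<bar>u x\<bar> * partial j u x"
proof -
  have c: "continuous_on UNIV (\<lambda>t::real. 2 * \<bar>t\<bar>)" by (intro continuous_intros)
  show "C1 (\<lambda>x. u x * \<bar>u x\<bar>)" "partial j (\<lambda>x. u x * \<bar>u x\<bar>) x = 2 * \<bar>u x\<bar> * partial j u x"
    using C1_chain[OF assms DERIV_mult_abs c] by auto
qed

lemma C1_power3: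
  assumes "C1 w" shows "C1 (\<lambda>x. w x ^ 3)" "partial j (\<lambda>x. w x ^ 3) x = 3 * (w x)\<^sup>2 * partial j w x"
proof -
  have d: "((\<lambda>t. t ^ 3) has_real_derivative 3 * t\<^sup>2) (at t)" for t :: real
    by (auto intro!: derivative_eq_intros)
  have c: "continuous_on UNIV (\<lambda>t::real. 3 * t\<^sup>2)" by (intro continuous_intros)
  show "C1 (\<lambda>x. w x ^ 3)" "partial j (\<lambda>x. w x ^ 3) x = 3 * (w x)\<^sup>2 * partial j w x"
    using C1_chain[OF assms d c] by auto
qed

text \<open>The cubic integral of \<open>u = div F\<close> is integrated by parts onto \<open>F\<close>; the set \<open>A\<close> is used to
  separate a small ball, on which \<open>ZA\<close> is small, from its complement, on which \<open>GA\<close> is small.\<close>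

lemma cubic_interpolation:
  fixes u :: "real^3 \<Rightarrow> real" and F :: "3 \<Rightarrow> real^3 \<Rightarrow> real"
  assumes s: "3 < s" "s \<le> 6" and nu: "0 < \<nu>" "\<nu> \<le> 1" and A: "A \<in> sets borel" and r: "1 \<le> r" "r \<le> 2"
    and u: "C1 u" and F: "\<And>j. C1 (F j)" "\<And>x. (\<Sum>j\<in>UNIV. partial j (F j) x) = u x"
      "\<And>j. II r (\<lambda>x. \<bar>F j x\<bar> powr s) \<le> C0 * \<nu> ^ 3" "0 < C0"
    and \<zeta>: "C1 \<zeta>" "cc \<zeta>" "supp_in r \<zeta>" "\<And>x. 0 \<le> \<zeta> x" "\<And>x. \<zeta> x \<le> 1" "\<And>i x. \<bar>partial i \<zeta> x\<bar> \<le> 4"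
    and Z: "(\<integral>x. \<bar>\<zeta> x * u x\<bar> ^ 3 \<partial>lborel) \<le> Z" "0 < Z"
    and ZA: "(\<integral>x. indicator A x * \<bar>\<zeta> x * u x\<bar> ^ 3 \<partial>lborel) \<le> ZA" "0 < ZA"
    and G: "\<And>j. \<nu> * II r (\<lambda>x. (partial j u x)\<^sup>2) \<le> G" "0 < G"
    and GA: "\<And>j. \<nu> * (\<integral>x. indicator (-A) x * (indicator (cball 0 r) x * (partial j u x)\<^sup>2) \<partial>lborel) \<le> GA" "0 < GA"
  shows "(\<integral>x. \<bar>\<zeta> x * u x\<bar> ^ 3 \<partial>lborel) \<le> 1548 * sobolev_const * C0 powr (1 / s) *
    ((ZA powr (2/3 - 2 / s) * sqrt G + Z powr (2/3 - 2 / s) * sqrt GA) * (G + Z powr (2/3)) powr (3 / s - 1/2)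
      + \<nu> powr (3 / s) * Z powr (2/3))"
proof -
  \<comment> \<open>The product of \<open>q\<close> and \<open>u\<close> is
    \<open>\<bar>z\<bar> ^ 3\<close>. Differentiating \<open>q\<close> against the potential gives
    \<open>2 * \<bar>F j x * w x * partial j u x\<bar>\<close>, with all of the cutoff on
    \<open>w\<close> for Sobolev, and a cutoff term of at most
    \<open>12 * (\<bar>F j x\<bar> * (z x)\<^sup>2)\<close>.\<close>
  define z where "z x = \<zeta> x * u x" for x
  define w where "w x = \<zeta> x ^ 3 * u x" for x
  define q where "q x = \<zeta> x ^ 3 * (u x * \<bar>u x\<bar>)" for x
  define M where "M = G + Z powr (2/3)"
  have M: "0 < M" using G Z by (simp add: M_def add_pos_pos)
  have z: "cc z" "supp_in r z" unfolding z_def[abs_def] using \<zeta> u by (auto simp: supp_in_def intro!: cc_mult_right C1_continuous)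
  have w: "C1 w" "partial j w x = \<zeta> x ^ 3 * partial j u x + 3 * (\<zeta> x)\<^sup>2 * partial j \<zeta> x * u x" for j x
    unfolding w_def[abs_def] using C1_mult[OF C1_power3(1)[OF \<zeta>(1)] u] by (auto simp: C1_power3(2)[OF \<zeta>(1)])
  have wc: "cc w" "supp_in r w" unfolding w_def[abs_def] using \<zeta> u by (auto simp: supp_in_def intro!: cc_mult_right cc_power C1_continuous)
  have q: "C1 q" "partial j q x = \<zeta> x ^ 3 * (2 * \<bar>u x\<bar> * partial j u x) + 3 * (\<zeta> x)\<^sup>2 * partial j \<zeta> x * (u x * \<bar>u x\<bar>)" for j x
    unfolding q_def[abs_def] using C1_mult[OF C1_power3(1)[OF \<zeta>(1)] C1_mult_abs(1)[OF u]]
    by (auto simp: C1_power3(2)[OF \<zeta>(1)] C1_mult_abs(2)[OF u])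
  have qc: "cc q" unfolding q_def[abs_def] using \<zeta> C1_continuous[OF u]
    by (auto intro!: cc_mult_right cc_power continuous_on_mult continuous_on_rabs)
  have wz: "\<bar>w x\<bar> \<le> \<bar>z x\<bar>" for x
  proof -
    have "\<zeta> x ^ 3 \<le> \<zeta> x" using \<zeta>(4,5)[of x] power_decreasing[of 1 3 "\<zeta> x"] by simp
    then show ?thesis using \<zeta>(4)[of x] by (simp add: w_def z_def abs_mult mult_right_mono)
  qed
  have zroot: "root 3 (II r (\<lambda>x. \<bar>z x\<bar> ^ 3)) \<le> Z powr (1/3)"
  proof -
    have "II r (\<lambda>x. \<bar>z x\<bar> ^ 3) = (\<integral>x. \<bar>z x\<bar> ^ 3 \<partial>lborel)"
      using z by (intro integral_eq_II[symmetric]) (auto simp: supp_in_def)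
    also have "\<dots> \<le> Z" using Z by (simp add: z_def)
    finally have "root 3 (II r (\<lambda>x. \<bar>z x\<bar> ^ 3)) \<le> root 3 Z" by simp
    then show ?thesis using Z by (simp add: root_powr_inverse)
  qed
  have z2: "II r (\<lambda>x. (z x)\<^sup>2) \<le> 4 * Z powr (2/3)"
  proof -
    have "II r (\<lambda>x. (z x)\<^sup>2) \<le> 4 * (root 3 (II r (\<lambda>x. \<bar>z x\<bar> ^ 3)))\<^sup>2"
      using r z by (intro II_square_le cc_continuous) auto
    also have "\<dots> \<le> 4 * (Z powr (1/3))\<^sup>2"
      by (intro mult_left_mono power_mono zroot) (auto intro!: real_root_ge_zero II_nonneg)
    also have "(Z powr (1/3))\<^sup>2 = Z powr (2/3)" by (simp add: power2_eq_square flip: powr_add)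
    finally show ?thesis .
  qed
  \<comment> \<open>The square of a sum with second summand \<open>12 * \<bar>z x\<bar>\<close>
    gives 288, and \<open>z2\<close> a factor 4: together 1152. Since \<open>\<nu> \<le> 1\<close>,
    the lower-order term may be divided by \<open>\<nu>\<close> as well, which puts both into
    \<open>M / \<nu>\<close>.\<close>
  have dw: "(\<integral>x. (partial j w x)\<^sup>2 \<partial>lborel) \<le> 1152 * (M / \<nu>)" for j
  proof -
    have "\<bar>\<integral>x. (partial j w x)\<^sup>2 \<partial>lborel\<bar> \<le> II r (\<lambda>x. 2 * (partial j u x)\<^sup>2 + 288 * (z x)\<^sup>2)"
    proof (rule integral_le_II)
      show "cc (\<lambda>x. (partial j w x)\<^sup>2)" by (intro cc_power cc_partial w wc) simp
      show "supp_in r (\<lambda>x. (partial j w x)\<^sup>2)" using supp_in_partial[OF wc(2)] by (auto simp: supp_in_def)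
      show "continuous_on UNIV (\<lambda>x. 2 * (partial j u x)\<^sup>2 + 288 * (z x)\<^sup>2)"
        using u z by (intro continuous_intros C1_partial_continuous) auto
      fix x
      have a: "\<bar>\<zeta> x ^ 3 * partial j u x\<bar> \<le> \<bar>partial j u x\<bar>"
        using \<zeta>(4,5)[of x] by (simp add: abs_mult mult_left_le_one_le power_le_one)
      have b: "\<bar>3 * (\<zeta> x)\<^sup>2 * partial j \<zeta> x * u x\<bar> \<le> 12 * \<bar>z x\<bar>"
      proof -
        have "(\<zeta> x)\<^sup>2 \<le> \<zeta> x" using \<zeta>(4,5)[of x] power_decreasing[of 1 2 "\<zeta> x"] by simp
        then have "(\<zeta> x)\<^sup>2 * \<bar>partial j \<zeta> x\<bar> \<le> \<zeta> x * 4" using \<zeta>(4)[of x] \<zeta>(6)[of j x] by (intro mult_mono) auto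
        from mult_right_mono[OF mult_left_mono[OF this, of 3], of "\<bar>u x\<bar>"] have "3 * ((\<zeta> x)\<^sup>2 * \<bar>partial j \<zeta> x\<bar>) * \<bar>u x\<bar> \<le> 3 * (\<zeta> x * 4) * \<bar>u x\<bar>" by simp
        then show ?thesis using \<zeta>(4)[of x] by (simp add: abs_mult z_def mult_ac)
      qed
      have "\<bar>partial j w x\<bar> \<le> \<bar>partial j u x\<bar> + 12 * \<bar>z x\<bar>"
        unfolding w using a b abs_triangle_ineq[of "\<zeta> x ^ 3 * partial j u x" "3 * (\<zeta> x)\<^sup>2 * partial j \<zeta> x * u x"] by linarith
      then have "\<bar>partial j w x\<bar>\<^sup>2 \<le> (\<bar>partial j u x\<bar> + 12 * \<bar>z x\<bar>)\<^sup>2" by (intro power_mono) auto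
      also have "\<dots> \<le> 2 * \<bar>partial j u x\<bar>\<^sup>2 + 2 * (12 * \<bar>z x\<bar>)\<^sup>2"
      proof -
        have "(m + n)\<^sup>2 \<le> 2 * m\<^sup>2 + 2 * n\<^sup>2" for m n :: real
          using zero_le_power2[of "m - n"] by (simp add: power2_eq_square algebra_simps)
        then show ?thesis .
      qed
      finally show "\<bar>(partial j w x)\<^sup>2\<bar> \<le> 2 * (partial j u x)\<^sup>2 + 288 * (z x)\<^sup>2" by (simp add: power_mult_distrib)
    qed
    also have "\<dots> = 2 * II r (\<lambda>x. (partial j u x)\<^sup>2) + 288 * II r (\<lambda>x. (z x)\<^sup>2)"
      unfolding II_cmult[symmetric] using u z by (intro II_add continuous_intros C1_partial_continuous) auto
    also have "\<dots> \<le> 2 * (G / \<nu>) + 288 * (4 * (Z powr (2/3) / \<nu>))"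
    proof -
      have "II r (\<lambda>x. (partial j u x)\<^sup>2) \<le> G / \<nu>" using G(1)[of j] nu by (simp add: field_simps)
      moreover have "Z powr (2/3) \<le> Z powr (2/3) / \<nu>" using nu by (simp add: field_simps mult_left_le_one_le)
      ultimately show ?thesis using z2 by linarith
    qed
    also have "\<dots> \<le> 1152 * (M / \<nu>)"
    proof -
      have "0 \<le> G / \<nu>" using G nu by simp
      then show ?thesis by (simp add: M_def add_divide_distrib)
    qed
    finally show ?thesis by simp
  qed
  have w6: "(\<integral>x. \<bar>w x\<bar> ^ 6 \<partial>lborel) \<le> sobolev_const * (M / \<nu>) ^ 3"
  proof -
    have "(\<integral>x. \<bar>w x\<bar> ^ 6 \<partial>lborel) \<le> 4096 * ((\<integral>x. (partial 1 w x)\<^sup>2 \<partial>lborel) * (\<integral>x. (partial 2 w x)\<^sup>2 \<partial>lborel) * (\<integral>x. (partial 3 w x)\<^sup>2 \<partial>lborel))"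
      by (rule sobolev6[OF w(1) wc(1)])
    also have "\<dots> \<le> 4096 * ((1152 * (M / \<nu>)) * (1152 * (M / \<nu>)) * (1152 * (M / \<nu>)))"
      using M nu by (intro mult_left_mono mult_mono dw) auto
    also have "\<dots> = sobolev_const * (M / \<nu>) ^ 3" by (simp add: sobolev_const_def power3_eq_cube)
    finally show ?thesis .
  qed
  define a1 where "a1 = sobolev_const * C0 powr (1 / s) * ZA powr (2/3 - 2 / s) * M powr (3 / s - 1/2) * sqrt G"
  define a2 where "a2 = sobolev_const * C0 powr (1 / s) * Z powr (2/3 - 2 / s) * M powr (3 / s - 1/2) * sqrt GA"
  define a3 where "a3 = 43 * C0 powr (1 / s) * \<nu> powr (3 / s) * Z powr (2/3)"
  have Fc: "continuous_on UNIV (F j)" for j using F by (intro C1_continuous)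
  have uc: "continuous_on UNIV (partial j u)" for j using u by (intro C1_partial_continuous)
  have indw: "(\<integral>x. indicator B x * \<bar>w x\<bar> ^ 3 \<partial>lborel) \<le> (\<integral>x. indicator B x * \<bar>z x\<bar> ^ 3 \<partial>lborel)" if B: "B \<in> sets borel" for B
  proof (rule integral_mono)
    have "integrable lborel (\<lambda>x. \<bar>w x\<bar> ^ 3)" "integrable lborel (\<lambda>x. \<bar>z x\<bar> ^ 3)"
      using wc z by (auto intro!: cc_integrable cc_power cc_abs)
    then show "integrable lborel (\<lambda>x. indicator B x * \<bar>w x\<bar> ^ 3)" "integrable lborel (\<lambda>x. indicator B x * \<bar>z x\<bar> ^ 3)"
      using B by (auto intro: integrable_indicator_mult)
    show "indicator B x * \<bar>w x\<bar> ^ 3 \<le> indicator B x * \<bar>z x\<bar> ^ 3" for x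
      using wz[of x] by (intro mult_left_mono power_mono) auto
  qed
  have T1: "(\<integral>x. indicator A x * \<bar>F j x * w x * partial j u x\<bar> \<partial>lborel) \<le> a1" for j
    unfolding a1_def
  proof (rule interpolation_term[OF s nu(1) A Fc F(3,4) wc uc w6 M])
    show "(\<integral>x. indicator A x * \<bar>w x\<bar> ^ 3 \<partial>lborel) \<le> ZA" using indw[OF A] ZA by (simp add: z_def)
    have "(\<integral>x. indicator A x * (indicator (cball 0 r) x * (partial j u x)\<^sup>2) \<partial>lborel) \<le> II r (\<lambda>x. (partial j u x)\<^sup>2)"
      unfolding II_def
    proof (rule integral_mono)
      show i: "integrable lborel (\<lambda>x. indicator (cball 0 r) x * (partial j u x)\<^sup>2)"
        by (intro II_integrable continuous_intros uc)
      then show "integrable lborel (\<lambda>x. indicator A x * (indicator (cball 0 r) x * (partial j u x)\<^sup>2))"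
        using A by (rule integrable_indicator_mult[rotated])
    qed (auto simp: indicator_def)
    then have "\<nu> * (\<integral>x. indicator A x * (indicator (cball 0 r) x * (partial j u x)\<^sup>2) \<partial>lborel) \<le> \<nu> * II r (\<lambda>x. (partial j u x)\<^sup>2)"
      using nu by (intro mult_left_mono) auto
    then show "\<nu> * (\<integral>x. indicator A x * (indicator (cball 0 r) x * (partial j u x)\<^sup>2) \<partial>lborel) \<le> G"
      using G(1)[of j] by linarith
  qed (use ZA G in auto)
  have T2: "(\<integral>x. indicator (-A) x * \<bar>F j x * w x * partial j u x\<bar> \<partial>lborel) \<le> a2" for j
    unfolding a2_def
  proof (rule interpolation_term[OF s nu(1) _ Fc F(3,4) wc uc w6 M])
    have "(\<integral>x. indicator (-A) x * \<bar>w x\<bar> ^ 3 \<partial>lborel) \<le> (\<integral>x. \<bar>z x\<bar> ^ 3 \<partial>lborel)"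
    proof (rule integral_mono)
      have i: "integrable lborel (\<lambda>x. \<bar>w x\<bar> ^ 3)" using wc by (auto intro!: cc_integrable cc_power cc_abs)
      then show "integrable lborel (\<lambda>x. indicator (-A) x * \<bar>w x\<bar> ^ 3)"
        using A by (intro integrable_indicator_mult) auto
      show "integrable lborel (\<lambda>x. \<bar>z x\<bar> ^ 3)" using z by (auto intro!: cc_integrable cc_power cc_abs)
      show "indicator (-A) x * \<bar>w x\<bar> ^ 3 \<le> \<bar>z x\<bar> ^ 3" for x
        using power_mono[OF wz[of x], of 3] by (auto simp: indicator_def)
    qed
    then show "(\<integral>x. indicator (-A) x * \<bar>w x\<bar> ^ 3 \<partial>lborel) \<le> Z" using Z by (simp add: z_def)
    show "\<nu> * (\<integral>x. indicator (-A) x * (indicator (cball 0 r) x * (partial j u x)\<^sup>2) \<partial>lborel) \<le> GA" by (rule GA)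
  qed (use A Z GA in auto)
  have T3: "(\<integral>x. \<bar>F j x\<bar> * (z x)\<^sup>2 \<partial>lborel) \<le> a3" for j
    unfolding a3_def using r Z by (intro interpolation_lower_term[OF s nu(1) _ _ Fc F(3,4) z]) (auto simp: z_def)
  have ccF: "cc (\<lambda>x. \<bar>F j x * w x * partial j u x\<bar>)" "cc (\<lambda>x. \<bar>F j x\<bar> * (z x)\<^sup>2)" for j
  proof -
    show "cc (\<lambda>x. \<bar>F j x * w x * partial j u x\<bar>)"
      by (rule cc_abs[OF cc_mult_right[OF cc_mult_left[OF Fc wc(1)] uc]])
    show "cc (\<lambda>x. \<bar>F j x\<bar> * (z x)\<^sup>2)"
      using z by (intro cc_mult_left cc_power continuous_on_rabs Fc) auto
  qed
  have "(\<integral>x. \<bar>z x\<bar> ^ 3 \<partial>lborel) = (\<integral>x. q x * (\<Sum>j\<in>UNIV. partial j (F j) x) \<partial>lborel)"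
    unfolding F(2)
    by (rule Bochner_Integration.integral_cong)
       (use \<zeta>(4) in \<open>auto simp: q_def z_def abs_mult power_mult_distrib power3_eq_cube\<close>)
  also have "\<dots> = (\<Sum>j\<in>UNIV. \<integral>x. q x * partial j (F j) x \<partial>lborel)"
  proof -
    have "cc (\<lambda>x. q x * partial j (F j) x)" for j by (intro cc_mult_right qc C1_partial_continuous F)
    then show ?thesis by (simp add: sum_distrib_left cc_integrable)
  qed
  also have "\<dots> \<le> (\<Sum>j\<in>(UNIV::3 set). 2 * a1 + 2 * a2 + 12 * a3)"
  proof (rule sum_mono)
    fix j
    have "(\<integral>x. q x * partial j (F j) x \<partial>lborel) = - (\<integral>x. partial j q x * F j x \<partial>lborel)"
      using qc by (intro integral_by_parts q F) auto
    also have "\<dots> \<le> \<bar>\<integral>x. partial j q x * F j x \<partial>lborel\<bar>" by simp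
    also have "\<dots> \<le> (\<integral>x. 2 * \<bar>F j x * w x * partial j u x\<bar> + 12 * (\<bar>F j x\<bar> * (z x)\<^sup>2) \<partial>lborel)"
    proof (rule abs_integral_le)
      show "integrable lborel (\<lambda>x. partial j q x * F j x)"
        by (intro cc_integrable cc_mult_right cc_partial q qc Fc)
      show "integrable lborel (\<lambda>x. 2 * \<bar>F j x * w x * partial j u x\<bar> + 12 * (\<bar>F j x\<bar> * (z x)\<^sup>2))"
        by (intro cc_integrable cc_add cc_cmult ccF)
      fix x
      have a: "\<bar>\<zeta> x ^ 3 * (2 * \<bar>u x\<bar> * partial j u x) * F j x\<bar> = 2 * \<bar>F j x * w x * partial j u x\<bar>"
        using \<zeta>(4)[of x] by (simp add: w_def abs_mult mult_ac)
      have b: "\<bar>3 * (\<zeta> x)\<^sup>2 * partial j \<zeta> x * (u x * \<bar>u x\<bar>) * F j x\<bar> \<le> 12 * (\<bar>F j x\<bar> * (z x)\<^sup>2)"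
      proof -
        have "\<bar>partial j \<zeta> x\<bar> * (3 * (\<zeta> x)\<^sup>2 * (u x)\<^sup>2 * \<bar>F j x\<bar>) \<le> 4 * (3 * (\<zeta> x)\<^sup>2 * (u x)\<^sup>2 * \<bar>F j x\<bar>)"
          by (intro mult_right_mono \<zeta>(6)) auto
        moreover have e: "\<bar>3 * (\<zeta> x)\<^sup>2 * partial j \<zeta> x * (u x * \<bar>u x\<bar>) * F j x\<bar> = \<bar>partial j \<zeta> x\<bar> * (3 * (\<zeta> x)\<^sup>2 * (\<bar>u x\<bar> * \<bar>u x\<bar>) * \<bar>F j x\<bar>)"
          by (simp add: abs_mult mult_ac del: abs_mult_self_eq)
        moreover have e2: "\<bar>u x\<bar> * \<bar>u x\<bar> = (u x)\<^sup>2" by (simp add: power2_eq_square)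
        ultimately show ?thesis unfolding e e2 z_def power_mult_distrib by (simp add: mult_ac)
      qed
      show "\<bar>partial j q x * F j x\<bar> \<le> 2 * \<bar>F j x * w x * partial j u x\<bar> + 12 * (\<bar>F j x\<bar> * (z x)\<^sup>2)"
        unfolding q distrib_right
        by (rule order_trans[OF abs_triangle_ineq add_mono[OF eq_refl[OF a] b]])
    qed
    also have "\<dots> = 2 * (\<integral>x. \<bar>F j x * w x * partial j u x\<bar> \<partial>lborel) + 12 * (\<integral>x. \<bar>F j x\<bar> * (z x)\<^sup>2 \<partial>lborel)"
      using ccF[of j, THEN cc_integrable] by simp
    also have "(\<integral>x. \<bar>F j x * w x * partial j u x\<bar> \<partial>lborel)
        = (\<integral>x. indicator A x * \<bar>F j x * w x * partial j u x\<bar> \<partial>lborel) + (\<integral>x. indicator (-A) x * \<bar>F j x * w x * partial j u x\<bar> \<partial>lborel)"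
    proof -
      have "integrable lborel (\<lambda>x. indicator A x * \<bar>F j x * w x * partial j u x\<bar>)"
        "integrable lborel (\<lambda>x. indicator (-A) x * \<bar>F j x * w x * partial j u x\<bar>)"
        using A ccF(1)[of j, THEN cc_integrable] by (auto intro!: integrable_indicator_mult)
      from Bochner_Integration.integral_add[OF this]
      have "(\<integral>x. indicator A x * \<bar>F j x * w x * partial j u x\<bar> \<partial>lborel) + (\<integral>x. indicator (-A) x * \<bar>F j x * w x * partial j u x\<bar> \<partial>lborel)
        = (\<integral>x. indicator A x * \<bar>F j x * w x * partial j u x\<bar> + indicator (-A) x * \<bar>F j x * w x * partial j u x\<bar> \<partial>lborel)" ..
      also have "\<dots> = (\<integral>x. \<bar>F j x * w x * partial j u x\<bar> \<partial>lborel)"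
        by (rule Bochner_Integration.integral_cong) (auto simp: indicator_def)
      finally show ?thesis ..
    qed
    finally show "(\<integral>x. q x * partial j (F j) x \<partial>lborel) \<le> 2 * a1 + 2 * a2 + 12 * a3"
      unfolding distrib_left using T1[of j] T2[of j] T3[of j] by linarith
  qed
  also have "\<dots> = 6 * (a1 + a2) + 36 * a3" by simp
  \<comment> \<open>1548 = 36 * 43, from three directions, the cutoff factor 12 and the volume
    constant of \<open>a3\<close>.\<close>
  also have "\<dots> \<le> 1548 * (a1 + a2) + 1548 * sobolev_const * C0 powr (1 / s) * (\<nu> powr (3 / s) * Z powr (2/3))"
  proof (rule add_mono)
    have "0 \<le> a1" "0 \<le> a2" using G GA by (auto simp: a1_def a2_def sobolev_const_def)
    then show "6 * (a1 + a2) \<le> 1548 * (a1 + a2)" by simp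
    have "0 \<le> C0 powr (1 / s) * (\<nu> powr (3 / s) * Z powr (2/3))" by simp
    then have "1548 * (C0 powr (1 / s) * (\<nu> powr (3 / s) * Z powr (2/3))) \<le> (1548 * sobolev_const) * (C0 powr (1 / s) * (\<nu> powr (3 / s) * Z powr (2/3)))"
      by (intro mult_right_mono) (auto simp: sobolev_const_def)
    then show "36 * a3 \<le> 1548 * sobolev_const * C0 powr (1 / s) * (\<nu> powr (3 / s) * Z powr (2/3))" by (simp add: a3_def mult_ac)
  qed
  finally show ?thesis
    unfolding z_def[symmetric] M_def[symmetric] by (simp add: a1_def a2_def algebra_simps)
qed

subsection \<open>Uniform gradient bounds\<close>

lemma le_of_sublinear:
  fixes y c g :: real
  assumes "0 < y" "y \<le> c * y powr g" "g < 1"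
  shows "y \<le> c powr (1 / (1 - g))"
proof -
  have "y powr (1 - g) \<le> c"
    using assms by (simp add: powr_diff divide_simps)
  then have "(y powr (1 - g)) powr (1 / (1 - g)) \<le> c powr (1 / (1 - g))"
    using assms by (intro powr_mono2) auto
  then show ?thesis using assms by (simp add: powr_powr)
qed

text \<open>Consider the supremum of \<open>(2 - r) powr N * f r\<close>. Passing to the midpoint
  between \<open>r\<close> and 2 halves the distance to 2, and \<open>N * g = N - 44\<close> makes
  the powers of this distance cancel, so the supremum satisfies a sublinear inequality. The bound
  \<open>M\<close> ensures that it is finite and does not enter the conclusion.\<close>

lemma iteration_bound:
  fixes f :: "real \<Rightarrow> real"
  assumes f: "\<And>r. 1 \<le> r \<Longrightarrow> r \<le> 2 \<Longrightarrow> 1 \<le> f r" "\<And>r. 1 \<le> r \<Longrightarrow> r \<le> 2 \<Longrightarrow> f r \<le> M"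
    and it: "\<And>r r'. 1 \<le> r \<Longrightarrow> r < r' \<Longrightarrow> r' \<le> 2 \<Longrightarrow> f r \<le> D * (1 / (r' - r)) ^ 44 * f r' powr g"
    and g: "0 < g" "g < 1" and D: "0 < D"
  shows "f 1 \<le> (D * 2 powr (44 / (1 - g))) powr (1 / (1 - g))"
proof -
  define N where "N = 44 / (1 - g)"
  have N: "N * g = N - 44" "0 < N" using g by (auto simp: N_def divide_simps)
  define S where "S = (SUP r\<in>{1..<2}. (2 - r) powr N * f r)"
  have bdd: "bdd_above ((\<lambda>r. (2 - r) powr N * f r) ` {1..<2})"
  proof (rule bdd_aboveI2)
    fix r :: real assume r: "r \<in> {1..<2}"
    have "(2 - r) powr N * f r \<le> 1 * M"
      using r N f(1)[of r] f(2)[of r] by (intro mult_mono powr_le1) auto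
    then show "(2 - r) powr N * f r \<le> M" by simp
  qed
  have le: "(2 - r) powr N * f r \<le> S" if "1 \<le> r" "r < 2" for r
    unfolding S_def using that by (intro cSUP_upper bdd) auto
  have f1: "1 \<le> f 1" "f 1 \<le> S" using f(1)[of 1] le[of 1] by auto
  have "S \<le> D * 2 powr N * S powr g"
    unfolding S_def
  proof (rule cSUP_least)
    fix r :: real assume "r \<in> {1..<2}"
    then have r: "1 \<le> r" "r < 2" by auto
    define r' where "r' = (2 + r) / 2"
    define t where "t = 2 - r"
    have r': "1 \<le> r'" "r < r'" "r' < 2" "r' - r = t / 2" "2 - r' = t / 2" "0 < t" using r by (simp_all add: r'_def t_def field_simps)
    have fr': "1 \<le> f r'" using f(1)[of r'] r' by auto
    have "(t / 2) powr N * f r' \<le> S" using le[of r'] r' by simp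
    then have "((t / 2) powr N * f r') powr g \<le> S powr g"
      using r' fr' g by (intro powr_mono2) auto
    then have 1: "(t / 2) powr (N * g) * f r' powr g \<le> S powr g" using fr' by (simp add: powr_mult powr_powr)
    have "f r \<le> D * (1 / (t / 2)) ^ 44 * f r' powr g" using it[of r r'] r r' by simp
    then have 2: "t powr N * f r \<le> t powr N * (D * (1 / (t / 2)) ^ 44 * f r' powr g)" by (intro mult_left_mono) auto
    have 3: "t powr N = 2 powr N * ((t / 2) powr (N * g) * (t / 2) ^ 44)"
    proof -
      have "t powr N = (2 * (t / 2)) powr N" by simp
      also have "\<dots> = 2 powr N * (t / 2) powr N" by (rule powr_mult)
      also have "(t / 2) powr N = (t / 2) powr (N * g + 44)" using N by simp
      also have "\<dots> = (t / 2) powr (N * g) * (t / 2) ^ 44" unfolding powr_add using r' by simp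
      finally show ?thesis .
    qed
    have "t powr N * f r \<le> 2 powr N * ((t / 2) powr (N * g) * (t / 2) ^ 44) * (D * (1 / (t / 2)) ^ 44 * f r' powr g)"
      using 2 unfolding 3[symmetric] .
    also have "2 powr N * ((t / 2) powr (N * g) * (t / 2) ^ 44) * (D * (1 / (t / 2)) ^ 44 * f r' powr g)
        = D * 2 powr N * ((t / 2) powr (N * g) * f r' powr g) * ((t / 2) * (1 / (t / 2))) ^ 44"
      unfolding power_mult_distrib by (simp only: mult_ac)
    also have "(t / 2) * (1 / (t / 2)) = 1" using r' by simp
    also have "D * 2 powr N * ((t / 2) powr (N * g) * f r' powr g) * 1 ^ 44 \<le> D * 2 powr N * S powr g"
      using 1 D by (simp add: mult_left_mono)
    finally show "(2 - r) powr N * f r \<le> D * 2 powr N * (SUP r\<in>{1..<2}. (2 - r) powr N * f r) powr g"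
      by (simp add: t_def S_def)
  qed auto
  then have "S \<le> (D * 2 powr N) powr (1 / (1 - g))"
    using f1 g by (intro le_of_sublinear) auto
  then show ?thesis using f1 by (simp add: N_def)
qed

text \<open>On the smaller ball the cutoff is at least the square of half the gap; cubed, this costs
  the sixth power of the gap.\<close>

lemma II_le_cutoff:
  fixes u \<zeta> :: "real^3 \<Rightarrow> real"
  assumes u: "continuous_on UNIV u" and \<zeta>: "cc \<zeta>" "supp_in r' \<zeta>" "\<And>x. \<zeta> x = (max 0 (1 - x \<bullet> x / r'\<^sup>2))\<^sup>2"
    and r: "0 \<le> r" "r < r'" "r' \<le> 2"
  shows "II r (\<lambda>x. \<bar>u x\<bar> ^ 3) \<le> (2 / (r' - r)) ^ 6 * (\<integral>x. \<bar>\<zeta> x * u x\<bar> ^ 3 \<partial>lborel)"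
proof -
  define t where "t = r' - r"
  have t: "0 < t" using r by (simp add: t_def)
  have low: "(t / 2)\<^sup>2 \<le> \<zeta> x" if "norm x \<le> r" for x
  proof -
    have "t / 2 \<le> 1 - (r / r')\<^sup>2"
    proof -
      have "(r / r')\<^sup>2 \<le> r / r'" using r power_decreasing[of 1 2 "r / r'"] by simp
      moreover have "t / 2 \<le> t / r'" using r t by (intro divide_left_mono) auto
      moreover have "t / r' = 1 - r / r'" using r by (simp add: t_def diff_divide_distrib)
      ultimately show ?thesis by linarith
    qed
    also have "\<dots> \<le> 1 - x \<bullet> x / r'\<^sup>2"
      using that r by (simp add: power_divide divide_right_mono flip: power2_norm_eq_inner)
    also have "\<dots> \<le> max 0 (1 - x \<bullet> x / r'\<^sup>2)" by simp
    finally have m: "t / 2 \<le> max 0 (1 - x \<bullet> x / r'\<^sup>2)" .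
    show ?thesis unfolding \<zeta>(3) by (rule power_mono[OF m]) (use t in simp)
  qed
  have cz: "cc (\<lambda>x. \<zeta> x * u x)" by (intro cc_mult_right \<zeta> u)
  have cu: "continuous_on UNIV (\<lambda>x. \<bar>u x\<bar> ^ 3)" by (intro continuous_on_power continuous_on_rabs u)
  have cz3: "continuous_on UNIV (\<lambda>x. \<bar>\<zeta> x * u x\<bar> ^ 3)" by (intro continuous_on_power continuous_on_rabs cc_continuous cz)
  have "II r (\<lambda>x. \<bar>u x\<bar> ^ 3) \<le> II r (\<lambda>x. (2 / t) ^ 6 * \<bar>\<zeta> x * u x\<bar> ^ 3)"
  proof (rule II_mono)
    fix x :: "real^3" assume x: "norm x \<le> r"
    have z: "0 \<le> \<zeta> x" by (simp add: \<zeta>(3))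
    have "((t / 2)\<^sup>2) ^ 3 \<le> \<zeta> x ^ 3" by (intro power_mono low x) auto
    then have "(2 / t) ^ 6 * ((t / 2) ^ 6 * \<bar>u x\<bar> ^ 3) \<le> (2 / t) ^ 6 * (\<zeta> x ^ 3 * \<bar>u x\<bar> ^ 3)"
      using t by (intro mult_left_mono mult_right_mono) auto
    moreover have "(2 / t) ^ 6 * ((t / 2) ^ 6 * \<bar>u x\<bar> ^ 3) = \<bar>u x\<bar> ^ 3" using t by (simp add: power_divide)
    ultimately show "\<bar>u x\<bar> ^ 3 \<le> (2 / t) ^ 6 * \<bar>\<zeta> x * u x\<bar> ^ 3" using z by (simp add: abs_mult power_mult_distrib)
  qed (intro continuous_on_mult_left cu cz3)+
  also have "\<dots> = (2 / t) ^ 6 * II r (\<lambda>x. \<bar>\<zeta> x * u x\<bar> ^ 3)" by (rule II_cmult)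
  also have "\<dots> \<le> (2 / t) ^ 6 * II r' (\<lambda>x. \<bar>\<zeta> x * u x\<bar> ^ 3)"
    using r t by (intro mult_left_mono II_mono_radius cz3) auto
  also have "II r' (\<lambda>x. \<bar>\<zeta> x * u x\<bar> ^ 3) = (\<integral>x. \<bar>\<zeta> x * u x\<bar> ^ 3 \<partial>lborel)"
    using \<zeta>(2) by (intro integral_eq_II[symmetric]) (auto simp: supp_in_def)
  finally show ?thesis by (simp add: t_def)
qed

text \<open>The sum serves both cases of \<open>cubic_bound\<close>: a term linear in the
  interpolation constant if the cubic integral is below the gradient bound, and the power from
  \<open>le_of_sublinear\<close> otherwise. 7740 is 5 times 1548.\<close>

definition cubic_const :: "real \<Rightarrow> real \<Rightarrow> real" where
  "cubic_const s C0 = 1 + 7740 * sobolev_const * C0 powr (1 / s) + (7740 * sobolev_const * C0 powr (1 / s)) powr (1 / (1/3 - 1 / s))"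

lemma cubic_const_ge: "1 \<le> cubic_const s C0" by (simp add: cubic_const_def sobolev_const_def)

text \<open>Interpolation with \<open>A = UNIV\<close> and with all data replaced by the maximum
  \<open>y\<close> of \<open>G\<close> and \<open>Z\<close>. As the total exponent
  \<open>2/3 + 1 / s\<close> is below 1, \<open>Z\<close> is absorbed when it is the larger.\<close>

lemma cubic_bound:
  fixes u :: "real^3 \<Rightarrow> real" and F :: "3 \<Rightarrow> real^3 \<Rightarrow> real"
  assumes s: "3 < s" "s \<le> 6" and nu: "0 < \<nu>" "\<nu> \<le> 1" and r: "1 \<le> r" "r \<le> 2"
    and u: "C1 u" and F: "\<And>j. C1 (F j)" "\<And>x. (\<Sum>j\<in>UNIV. partial j (F j) x) = u x"
      "\<And>j. II r (\<lambda>x. \<bar>F j x\<bar> powr s) \<le> C0 * \<nu> ^ 3" "0 < C0"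
    and \<zeta>: "C1 \<zeta>" "cc \<zeta>" "supp_in r \<zeta>" "\<And>x. 0 \<le> \<zeta> x" "\<And>x. \<zeta> x \<le> 1" "\<And>i x. \<bar>partial i \<zeta> x\<bar> \<le> 4"
    and G: "\<And>j. \<nu> * II r (\<lambda>x. (partial j u x)\<^sup>2) \<le> G" "1 \<le> G"
  shows "(\<integral>x. \<bar>\<zeta> x * u x\<bar> ^ 3 \<partial>lborel) \<le> cubic_const s C0 * G powr (2/3 + 1 / s)"
proof -
  define Z where "Z = (\<integral>x. \<bar>\<zeta> x * u x\<bar> ^ 3 \<partial>lborel)"
  define y where "y = max G Z"
  define c where "c = 1548 * sobolev_const * C0 powr (1 / s)"
  define g where "g = 2/3 + 1 / s"
  have y: "1 \<le> y" "G \<le> y" "Z \<le> y" using G by (auto simp: y_def)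
  have c: "0 < c" using F by (simp add: c_def sobolev_const_def)
  have e: "0 \<le> 3 / s - 1/2" "3 / s - 1/2 \<le> 1" "g < 1" "0 < g" using s by (simp_all add: field_simps g_def)
  have yg: "1 \<le> y powr g" using y e by (intro ge_one_powr_ge_zero) auto
  have "Z \<le> c * ((y powr (2/3 - 2 / s) * sqrt y + y powr (2/3 - 2 / s) * sqrt y) * (y + y powr (2/3)) powr (3 / s - 1/2)
      + \<nu> powr (3 / s) * y powr (2/3))"
    unfolding Z_def c_def
  proof (rule cubic_interpolation[OF s nu _ r u F \<zeta>])
    show "\<nu> * II r (\<lambda>x. (partial j u x)\<^sup>2) \<le> y" for j using G(1)[of j] y by linarith
    show "\<nu> * (\<integral>x. indicator (- UNIV) x * (indicator (cball 0 r) x * (partial j u x)\<^sup>2) \<partial>lborel) \<le> y" for j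
      using y by simp
  qed (use y in \<open>auto simp: Z_def\<close>)
  also have "\<dots> \<le> c * ((y powr (2/3 - 2 / s) * sqrt y + y powr (2/3 - 2 / s) * sqrt y) * (2 * y powr (3 / s - 1/2)) + 1 * y powr g)"
  proof (intro mult_left_mono add_mono mult_mono)
    have "(y + y powr (2/3)) powr (3 / s - 1/2) \<le> (2 * y) powr (3 / s - 1/2)"
      using y e powr_le_self[of y "2/3"] by (intro powr_mono2) auto
    also have "\<dots> = 2 powr (3 / s - 1/2) * y powr (3 / s - 1/2)" by (rule powr_mult)
    also have "\<dots> \<le> 2 * y powr (3 / s - 1/2)" using e by (intro mult_right_mono powr_le_self) auto
    finally show "(y + y powr (2/3)) powr (3 / s - 1/2) \<le> 2 * y powr (3 / s - 1/2)" .
    show "\<nu> powr (3 / s) \<le> 1" using nu s by (intro powr_le1) auto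
    show "y powr (2/3) \<le> y powr g" using y s by (intro powr_mono) (auto simp: g_def)
  qed (use c y in auto)
  \<comment> \<open>5 = 2 * 2 + 1: two equal interpolation terms with a factor 2 each, and the
    cutoff term.\<close>
  also have "\<dots> = 5 * c * y powr g"
  proof -
    have "y powr (2/3 - 2 / s) * sqrt y * y powr (3 / s - 1/2) = y powr (2/3 - 2 / s + 1/2 + (3 / s - 1/2))"
      unfolding powr_add using y by (simp add: powr_half_sqrt)
    also have "2/3 - 2 / s + 1/2 + (3 / s - 1/2) = g" by (simp add: g_def diff_divide_distrib[symmetric])
    finally show ?thesis by (simp add: algebra_simps)
  qed
  finally have Zy: "Z \<le> 5 * c * y powr g" .
  have Gg: "1 \<le> G powr g" using G e by (intro ge_one_powr_ge_zero) auto
  have e2: "1 - g = 1/3 - 1 / s" by (simp add: g_def)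
  have "Z \<le> (1 + 5 * c + (5 * c) powr (1 / (1 - g))) * G powr g"
  proof (cases "Z \<le> G")
    case True
    then have "y = G" by (simp add: y_def)
    with Zy have "Z \<le> 5 * c * G powr g" by simp
    also have "\<dots> \<le> (1 + 5 * c + (5 * c) powr (1 / (1 - g))) * G powr g" using Gg by (intro mult_right_mono) auto
    finally show ?thesis .
  next
    case False
    then have "y = Z" "0 < Z" using G by (auto simp: y_def)
    with Zy have "Z \<le> (5 * c) powr (1 / (1 - g))" using e by (intro le_of_sublinear) auto
    also have "\<dots> \<le> (1 + 5 * c + (5 * c) powr (1 / (1 - g))) * 1" using c by simp
    also have "\<dots> \<le> (1 + 5 * c + (5 * c) powr (1 / (1 - g))) * G powr g" using Gg c by (intro mult_left_mono) auto
    finally show ?thesis .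
  qed
  then show ?thesis unfolding e2 by (simp add: Z_def g_def c_def cubic_const_def mult.assoc)
qed

lemma energy_const_ge: "1 \<le> energy_const"
proof -
  have "0 \<le> pressure_const" by (simp add: pressure_const_def hessian_const_def)
  then show ?thesis by (simp add: energy_const_def)
qed

text \<open>\<open>2 ^ 39\<close> joins \<open>2 ^ 38\<close> from halving the gap in the energy
  inequality with a factor 2 for two summands of the same bound; \<open>6 * 4 ^ 6\<close> counts six
  components and the cutoff loss over the other half of the gap.\<close>

definition step_const :: "real \<Rightarrow> real \<Rightarrow> real" where
  "step_const s C0 = 2 ^ 39 * energy_const * (6 * 4 ^ 6 * cubic_const s C0)"

text \<open>The outcome of \<open>iteration_bound\<close> for the exponent
  \<open>2/3 + 1 / s\<close>, whose complement to 1 is \<open>1/3 - 1 / s\<close>.\<close>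

definition gradient_const :: "real \<Rightarrow> real \<Rightarrow> real" where
  "gradient_const s C0 = (step_const s C0 * 2 powr (44 / (1/3 - 1 / s))) powr (1 / (1/3 - 1 / s))"

text \<open>With the Dirichlet integral at most \<open>g\<close>, \<open>Z\<close> is the a priori
  size of the cubic integral and \<open>m\<close> the Sobolev factor of
  \<open>cubic_interpolation\<close>; the last sum majorises the coefficients of the three
  quantities that become small.\<close>

definition decay_const :: "real \<Rightarrow> real \<Rightarrow> real \<Rightarrow> real" where
  "decay_const s C0 g = (let Z = cubic_const s C0 * g powr (2/3 + 1 / s); m = (g + Z powr (2/3)) powr (3 / s - 1/2)
    in 1548 * sobolev_const * C0 powr (1 / s) * (sqrt g * m + Z powr (2/3 - 2 / s) * m + Z powr (2/3)))"

lemma (in mhd) G_mono: "0 \<le> \<nu> \<Longrightarrow> r \<le> r' \<Longrightarrow> G r \<le> G r'"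
  unfolding G_def
  by (intro mult_left_mono sum_mono add_mono II_mono_radius continuous_on_power C1_partial_continuous C1_v C1_b) auto

text \<open>The bound \<open>C0 * \<nu> ^ 3\<close> is what the growth rate \<open>r powr (1/3 - 1/s)\<close> of the mean oscillation becomes after rescaling.\<close>

locale mhd_potential = mhd +
  fixes F H :: "3 \<Rightarrow> 3 \<Rightarrow> real^3 \<Rightarrow> real" and s C0 :: real
  assumes nu: "0 < \<nu>" "\<nu> \<le> 1" and s: "3 < s" "s \<le> 6" and C0: "0 < C0"
    and C1_F: "C1 (F i j)" and div_F: "(\<Sum>j\<in>UNIV. partial j (F i j) x) = v i x"
    and F_le: "II 2 (\<lambda>x. \<bar>F i j x\<bar> powr s) \<le> C0 * \<nu> ^ 3"
    and C1_H: "C1 (H i j)" and div_H: "(\<Sum>j\<in>UNIV. partial j (H i j) x) = b i x"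
    and H_le: "II 2 (\<lambda>x. \<bar>H i j x\<bar> powr s) \<le> C0 * \<nu> ^ 3"
begin

lemma F_le': "r \<le> 2 \<Longrightarrow> II r (\<lambda>x. \<bar>F i j x\<bar> powr s) \<le> C0 * \<nu> ^ 3"
  and H_le': "r \<le> 2 \<Longrightarrow> II r (\<lambda>x. \<bar>H i j x\<bar> powr s) \<le> C0 * \<nu> ^ 3"
proof -
  have c: "continuous_on UNIV (\<lambda>x. \<bar>f x\<bar> powr s)" if "C1 f" for f :: "real^3 \<Rightarrow> real"
    using s by (intro continuous_on_powr' continuous_on_rabs continuous_on_const C1_continuous that) auto
  assume r: "r \<le> 2"
  show "II r (\<lambda>x. \<bar>F i j x\<bar> powr s) \<le> C0 * \<nu> ^ 3"
    by (rule order_trans[OF II_mono_radius[OF c[OF C1_F] _ r] F_le]) simp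
  show "II r (\<lambda>x. \<bar>H i j x\<bar> powr s) \<le> C0 * \<nu> ^ 3"
    by (rule order_trans[OF II_mono_radius[OF c[OF C1_H] _ r] H_le]) simp
qed

lemma X_le_sum: assumes "\<And>i. II r (\<lambda>x. \<bar>v i x\<bar> ^ 3) \<le> B" "\<And>i. II r (\<lambda>x. \<bar>b i x\<bar> ^ 3) \<le> B" shows "X r \<le> 6 * B"
proof -
  have "X r \<le> (\<Sum>i\<in>(UNIV::3 set). B + B)" unfolding X_def by (intro sum_mono add_mono assms)
  then show ?thesis by simp
qed

lemma X_le_G:
  assumes r: "1 \<le> r" "r < r'" "r' \<le> 2" and G: "G r' \<le> g" "1 \<le> g"
  shows "X r \<le> 6 * ((2 / (r' - r)) ^ 6 * (cubic_const s C0 * g powr (2/3 + 1 / s)))"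
proof -
  have r0: "0 < r'" using r by simp
  obtain \<zeta> :: "real^3 \<Rightarrow> real" where \<zeta>: "C1 \<zeta>" "cc \<zeta>" "supp_in r' \<zeta>" "\<And>x. 0 \<le> \<zeta> x" "\<And>x. \<zeta> x \<le> 1"
    "\<And>i x. \<bar>partial i \<zeta> x\<bar> \<le> 4 / r'" "\<And>x. \<zeta> x = (max 0 (1 - x \<bullet> x / r'\<^sup>2))\<^sup>2"
    using cutoff[OF r0] by blast
  have \<zeta>4: "\<bar>partial i \<zeta> x\<bar> \<le> 4" for i x
  proof -
    have "4 / r' \<le> 4" using r by (simp add: field_simps)
    then show ?thesis using \<zeta>(6)[of i x] by linarith
  qed
  have r': "1 \<le> r'" "0 \<le> r" using r by auto
  show ?thesis
  proof (rule X_le_sum)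
    fix i
    show "II r (\<lambda>x. \<bar>v i x\<bar> ^ 3) \<le> (2 / (r' - r)) ^ 6 * (cubic_const s C0 * g powr (2/3 + 1 / s))"
      using r by (intro order_trans[OF II_le_cutoff[OF C1_continuous[OF C1_v] \<zeta>(2,3,7) r'(2) r(2,3)]] mult_left_mono
          less_imp_le[OF nu(1)] cubic_bound[where \<nu> = \<nu> and F = "F i" and r = r'] s nu r' C1_v C1_F div_F F_le' C0 \<zeta> \<zeta>4 G order_trans[OF II_le_G(1) G(1)]) auto
    show "II r (\<lambda>x. \<bar>b i x\<bar> ^ 3) \<le> (2 / (r' - r)) ^ 6 * (cubic_const s C0 * g powr (2/3 + 1 / s))"
      using r by (intro order_trans[OF II_le_cutoff[OF C1_continuous[OF C1_b] \<zeta>(2,3,7) r'(2) r(2,3)]] mult_left_mono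
          less_imp_le[OF nu(1)] cubic_bound[where \<nu> = \<nu> and F = "H i" and r = r'] s nu r' C1_b C1_H div_H H_le' C0 \<zeta> \<zeta>4 G order_trans[OF II_le_G(2) G(1)]) auto
  qed
qed

text \<open>The energy inequality between \<open>r\<close> and the midpoint loses the power 38 of
  the gap, the cubic bound between the midpoint and \<open>r'\<close> the power 6. The mixed term
  has exponent \<open>(2/3 + 1 / s) / 3 + 1/2\<close>, which is at most \<open>2/3 + 1 / s\<close>
  because \<open>s \<le> 12\<close>; the maximum with 1 lets the larger power dominate.\<close>

lemma gradient_step:
  assumes r: "1 \<le> r" "r < r'" "r' \<le> 2"
  shows "max 1 (G r) \<le> step_const s C0 * (1 / (r' - r)) ^ 44 * max 1 (G r') powr (2/3 + 1 / s)"
proof -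
  define g where "g = max 1 (G r')"
  define q where "q = 1 / (r' - r)"
  define P where "P = g powr (2/3 + 1 / s)"
  define \<rho> where "\<rho> = (r + r') / 2"
  define W where "W = 6 * 4 ^ 6 * cubic_const s C0 * q ^ 6"
  have \<rho>: "1 \<le> \<rho>" "r < \<rho>" "\<rho> < r'" "\<rho> \<le> 2" "\<rho> - r = (r' - r) / 2" "r' - \<rho> = (r' - r) / 2"
    using r by (simp_all add: \<rho>_def field_simps)
  have q: "1 \<le> q" "q > 0" using r by (auto simp: q_def)
  have g: "1 \<le> g" "G r' \<le> g" by (auto simp: g_def)
  have P: "1 \<le> P" unfolding P_def using g s by (intro ge_one_powr_ge_zero) auto
  have W: "1 \<le> W"
  proof -
    have "1 * 1 \<le> cubic_const s C0 * q ^ 6" using q cubic_const_ge[of s C0] by (intro mult_mono one_le_power) auto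
    then show ?thesis by (simp add: W_def)
  qed
  have X: "X \<rho> \<le> W * P"
    using X_le_G[of \<rho> r' g] \<rho> r g by (simp add: W_def P_def q_def power_divide mult_ac)
  have "root 3 (X \<rho>) * sqrt (G \<rho>) \<le> W * P"
  proof -
    have "root 3 (X \<rho>) \<le> root 3 (W * P)" using X by simp
    also have "\<dots> = root 3 W * root 3 P" by (rule real_root_mult)
    also have "\<dots> \<le> W * root 3 P"
      using W P real_root_le_iff[of 3 W "W ^ 3"] self_le_power[of W 3] real_root_power_cancel[of 3 W]
      by (intro mult_right_mono) auto
    also have "root 3 P = g powr ((2/3 + 1 / s) / 3)"
      using P g by (simp add: root_powr_inverse P_def powr_powr)
    finally have 1: "root 3 (X \<rho>) \<le> W * g powr ((2/3 + 1 / s) / 3)" .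
    have "G \<rho> \<le> g" using G_mono[of \<rho> r'] nu \<rho> g by linarith
    then have 2: "sqrt (G \<rho>) \<le> g powr (1/2)" using g by (simp add: powr_half_sqrt)
    have "root 3 (X \<rho>) * sqrt (G \<rho>) \<le> (W * g powr ((2/3 + 1 / s) / 3)) * g powr (1/2)"
      using 1 2 W nu by (intro mult_mono) (auto intro: G_nonneg)
    also have "\<dots> = W * g powr ((2/3 + 1 / s) / 3 + 1/2)" by (simp add: powr_add)
    also have "\<dots> \<le> W * P" unfolding P_def using W g s
      by (intro mult_left_mono powr_mono) (auto simp: field_simps)
    finally show ?thesis .
  qed
  with X have XG: "X \<rho> + root 3 (X \<rho>) * sqrt (G \<rho>) \<le> 2 * (W * P)" by linarith
  have "G r \<le> energy_const / (\<rho> - r) ^ 38 * (X \<rho> + root 3 (X \<rho>) * sqrt (G \<rho>))"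
    using \<rho> r by (intro local_energy_inequality nu) auto
  also have "\<dots> \<le> energy_const / (\<rho> - r) ^ 38 * (2 * (W * P))"
    using \<rho> energy_const_ge by (intro mult_left_mono XG) auto
  also have "energy_const / (\<rho> - r) ^ 38 = energy_const * 2 ^ 38 * q ^ 38"
    unfolding \<rho>(5) by (simp add: q_def power_divide)
  also have "energy_const * 2 ^ 38 * q ^ 38 * (2 * (W * P)) = step_const s C0 * q ^ 44 * P"
  proof -
    have "q ^ 44 = q ^ 38 * q ^ 6" by (simp flip: power_add)
    then show ?thesis by (simp add: step_const_def W_def)
  qed
  finally have G: "G r \<le> step_const s C0 * q ^ 44 * P" .
  have "1 * 1 * 1 \<le> step_const s C0 * q ^ 44 * P"
  proof -
    have "1 * 1 \<le> energy_const * cubic_const s C0" using energy_const_ge cubic_const_ge[of s C0] by (intro mult_mono) auto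
    then have "1 \<le> step_const s C0" by (simp add: step_const_def)
    then show ?thesis using q P by (intro mult_mono one_le_power) auto
  qed
  with G show ?thesis by (simp add: q_def P_def g_def)
qed

text \<open>The constant contains neither \<open>\<nu>\<close> nor the fields. Finiteness of
  \<open>G 2\<close> supplies the a priori bound with which the iteration starts.\<close>

lemma gradient_bound: "G 1 \<le> gradient_const s C0"
proof -
  have e: "1 - (2/3 + 1 / s) = 1/3 - 1 / s" by simp
  have "max 1 (G 1) \<le> (step_const s C0 * 2 powr (44 / (1 - (2/3 + 1 / s)))) powr (1 / (1 - (2/3 + 1 / s)))"
  proof (rule iteration_bound[where f = "\<lambda>r. max 1 (G r)" and M = "max 1 (G 2)"])
    show "max 1 (G r) \<le> max 1 (G 2)" if "r \<le> 2" for r using G_mono[OF _ that] nu by auto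
    show "0 < step_const s C0" using energy_const_ge cubic_const_ge[of s C0] by (simp add: step_const_def)
  qed (use s gradient_step in \<open>auto simp: field_simps\<close>)
  then show ?thesis unfolding e gradient_const_def by simp
qed

text \<open>After the crude bound \<open>Z\<close> for the cubic integral,
  \<open>cubic_interpolation\<close> is applied with \<open>A\<close> as separating set: the cubic
  integral is small on \<open>A\<close>, the gradient off \<open>A\<close>, and the cutoff term
  carries a power of \<open>\<nu>\<close>. The factor 4096 is the cutoff loss \<open>4 ^ 6\<close>
  between the radii 3/2 and 2.\<close>

lemma cubic_decay_scalar:
  fixes u :: "real^3 \<Rightarrow> real" and f :: "3 \<Rightarrow> real^3 \<Rightarrow> real"
  assumes A: "A \<in> sets borel" and u: "C1 u" and f: "\<And>j. C1 (f j)" "\<And>x. (\<Sum>j\<in>UNIV. partial j (f j) x) = u x"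
      "\<And>j. II 2 (\<lambda>x. \<bar>f j x\<bar> powr s) \<le> C0 * \<nu> ^ 3"
    and ZA: "(\<integral>x. indicator A x * (indicator (cball 0 2) x * \<bar>u x\<bar> ^ 3) \<partial>lborel) \<le> ZA" "0 < ZA"
    and g: "\<And>j. \<nu> * II 2 (\<lambda>x. (partial j u x)\<^sup>2) \<le> g" "1 \<le> g"
    and GA: "\<And>j. \<nu> * (\<integral>x. indicator (-A) x * (indicator (cball 0 2) x * (partial j u x)\<^sup>2) \<partial>lborel) \<le> GA" "0 < GA"
  shows "II (3/2) (\<lambda>x. \<bar>u x\<bar> ^ 3) \<le> 4096 * (decay_const s C0 g * (ZA powr (2/3 - 2 / s) + sqrt GA + \<nu> powr (3 / s)))"
proof -
  obtain \<zeta> :: "real^3 \<Rightarrow> real" where \<zeta>: "C1 \<zeta>" "cc \<zeta>" "supp_in 2 \<zeta>" "\<And>x. 0 \<le> \<zeta> x" "\<And>x. \<zeta> x \<le> 1"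
    "\<And>i x. \<bar>partial i \<zeta> x\<bar> \<le> 4 / 2" "\<And>x. \<zeta> x = (max 0 (1 - x \<bullet> x / 2\<^sup>2))\<^sup>2"
    by (rule cutoff[of 2]) simp_all
  have \<zeta>4: "\<bar>partial i \<zeta> x\<bar> \<le> 4" for i x using \<zeta>(6)[of i x] by linarith
  define Z where "Z = cubic_const s C0 * g powr (2/3 + 1 / s)"
  define m where "m = (g + Z powr (2/3)) powr (3 / s - 1/2)"
  define c where "c = 1548 * sobolev_const * C0 powr (1 / s)"
  have c: "0 \<le> c" by (simp add: c_def sobolev_const_def)
  have Z0: "0 < Z" using cubic_const_ge[of s C0] g by (simp add: Z_def)
  have Z: "(\<integral>x. \<bar>\<zeta> x * u x\<bar> ^ 3 \<partial>lborel) \<le> Z"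
    unfolding Z_def by (rule cubic_bound[OF s nu _ _ u f C0 \<zeta>(1-5) \<zeta>4 g]) auto
  have cu: "continuous_on UNIV u" by (rule C1_continuous[OF u])
  have ZA': "(\<integral>x. indicator A x * \<bar>\<zeta> x * u x\<bar> ^ 3 \<partial>lborel) \<le> ZA"
  proof (rule order_trans[OF integral_mono ZA(1)])
    show "integrable lborel (\<lambda>x. indicator A x * \<bar>\<zeta> x * u x\<bar> ^ 3)"
      by (intro integrable_indicator_mult A cc_integrable cc_power cc_abs cc_mult_right \<zeta> cu) simp
    show "integrable lborel (\<lambda>x. indicator A x * (indicator (cball 0 2) x * \<bar>u x\<bar> ^ 3))"
      by (rule integrable_indicator_mult[OF A]) (intro II_integrable continuous_on_power continuous_on_rabs cu)
    show "indicator A x * \<bar>\<zeta> x * u x\<bar> ^ 3 \<le> indicator A x * (indicator (cball 0 2) x * \<bar>u x\<bar> ^ 3)" for x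
    proof (cases "norm x \<le> 2")
      case True
      have "\<bar>\<zeta> x * u x\<bar> \<le> \<bar>u x\<bar>" using \<zeta>(4,5)[of x] by (simp add: abs_mult mult_left_le_one_le)
      then show ?thesis using True by (auto simp: indicator_def intro: power_mono)
    next
      case False
      then show ?thesis using \<zeta>(3) by (simp add: supp_in_def)
    qed
  qed
  have "II (3/2) (\<lambda>x. \<bar>u x\<bar> ^ 3) \<le> (2 / (2 - 3/2)) ^ 6 * (\<integral>x. \<bar>\<zeta> x * u x\<bar> ^ 3 \<partial>lborel)"
    by (rule II_le_cutoff[OF cu \<zeta>(2,3,7)]) auto
  also have "\<dots> = 4096 * (\<integral>x. \<bar>\<zeta> x * u x\<bar> ^ 3 \<partial>lborel)" by (simp add: power_divide)
  also have "\<dots> \<le> 4096 * (c * ((ZA powr (2/3 - 2 / s) * sqrt g + Z powr (2/3 - 2 / s) * sqrt GA) * m + \<nu> powr (3 / s) * Z powr (2/3)))"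
    unfolding m_def c_def using g
    by (intro mult_left_mono cubic_interpolation[OF s nu A _ _ u f C0 \<zeta>(1-5) \<zeta>4 Z Z0 ZA' ZA(2) g(1) _ GA]) auto
  also have "\<dots> \<le> 4096 * (c * ((sqrt g * m + Z powr (2/3 - 2 / s) * m + Z powr (2/3)) * (ZA powr (2/3 - 2 / s) + sqrt GA + \<nu> powr (3 / s))))"
  proof (intro mult_left_mono c)
    have *: "(z * a + b * e) * m + n * d \<le> (a * m + b * m + d) * (z + e + n)"
      if "0 \<le> z" "0 \<le> a" "0 \<le> b" "0 \<le> e" "0 \<le> m" "0 \<le> n" "0 \<le> d" for z a b e m n d :: real
    proof -
      have "(a * m + b * m + d) * (z + e + n) = (z * a + b * e) * m + n * d + (a * m * e + a * m * n + b * m * z + b * m * n + d * z + d * e)"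
        by (simp add: algebra_simps)
      moreover have "0 \<le> a * m * e + a * m * n + b * m * z + b * m * n + d * z + d * e" using that by simp
      ultimately show ?thesis by linarith
    qed
    show "(ZA powr (2/3 - 2 / s) * sqrt g + Z powr (2/3 - 2 / s) * sqrt GA) * m + \<nu> powr (3 / s) * Z powr (2/3)
      \<le> (sqrt g * m + Z powr (2/3 - 2 / s) * m + Z powr (2/3)) * (ZA powr (2/3 - 2 / s) + sqrt GA + \<nu> powr (3 / s))"
      by (rule *) (use g GA in \<open>auto simp: m_def\<close>)
  qed simp
  finally show ?thesis by (simp add: decay_const_def Z_def m_def c_def Let_def mult.assoc)
qed

end

subsection \<open>Scaling\<close>

text \<open>\<open>smooth\<close> asks for differentiability of every iterated partial, so
  continuity of the partials comes from differentiability one order higher. Components are bounded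
  linear and commute with \<open>partial\<close>, which brings vector and matrix fields down to
  scalar functions.\<close>

lemma smooth_linear_image:
  fixes f :: "real^'n::finite \<Rightarrow> 'b::real_normed_vector" and L :: "'b \<Rightarrow> real"
  assumes f: "smooth f" and L: "bounded_linear L"
  shows "C1 (\<lambda>x. L (pderivs js f x))" "partial j (\<lambda>x. L (pderivs js f x)) = (\<lambda>x. L (pderivs (j # js) f x))"
proof -
  have diff: "(\<lambda>x. L (pderivs js f x)) differentiable (at x)" for js x
    using f bounded_linear.has_derivative[OF L] unfolding smooth_def differentiable_def by blast
  have p: "partial j (\<lambda>x. L (pderivs js f x)) = (\<lambda>x. L (pderivs (j # js) f x))" for j
  proof
    fix x
    have "(pderivs js f has_derivative frechet_derivative (pderivs js f) (at x)) (at x)"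
      using f frechet_derivative_works by (auto simp: smooth_def)
    from bounded_linear.has_derivative[OF L this] show "partial j (\<lambda>x. L (pderivs js f x)) x = L (pderivs (j # js) f x)"
      by (subst partial_eq) (auto simp: partial_def)
  qed
  show "C1 (\<lambda>x. L (pderivs js f x))"
    unfolding C1_def p
    using diff differentiable_imp_continuous_on[unfolded differentiable_on_def, of UNIV] by blast
  show "partial j (\<lambda>x. L (pderivs js f x)) = (\<lambda>x. L (pderivs (j # js) f x))" by (rule p)
qed

lemma C1_dilation:
  fixes f :: "real^'n::finite \<Rightarrow> real"
  assumes "C1 f"
  shows "C1 (\<lambda>x. f (m *\<^sub>R x))" "partial j (\<lambda>x. f (m *\<^sub>R x)) = (\<lambda>x. m * partial j f (m *\<^sub>R x))"
proof -
  have *: "((\<lambda>x. f (m *\<^sub>R x)) has_derivative (\<lambda>v. \<Sum>j\<in>UNIV. v $ j * (m * partial j f (m *\<^sub>R x)))) (at x)" for x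
  proof -
    have "((\<lambda>x. m *\<^sub>R x) has_derivative (\<lambda>v. m *\<^sub>R v)) (at x)" by (auto intro!: derivative_eq_intros)
    from has_derivative_compose[OF this C1_has_derivative[OF assms]] show ?thesis by (simp add: mult_ac)
  qed
  have c: "continuous_on UNIV (\<lambda>x. m * partial j f (m *\<^sub>R x))" for j
    by (intro continuous_on_mult_left continuous_on_compose2[OF C1_partial_continuous[OF assms]] continuous_on_scaleR continuous_on_const continuous_on_id) auto
  show "C1 (\<lambda>x. f (m *\<^sub>R x))" "partial j (\<lambda>x. f (m *\<^sub>R x)) = (\<lambda>x. m * partial j f (m *\<^sub>R x))"
    using C1I_partial[OF * c] by auto
qed

lemma C1_scaled:
  fixes f :: "real^'n::finite \<Rightarrow> real"
  assumes "C1 f"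
  shows "C1 (\<lambda>x. c * f (m *\<^sub>R x))" "partial j (\<lambda>x. c * f (m *\<^sub>R x)) = (\<lambda>x. (c * m) * partial j f (m *\<^sub>R x))"
  using C1_cmult[OF C1_dilation(1)[OF assms]] by (auto simp: C1_dilation(2)[OF assms] fun_eq_iff)

lemma II_dilation:
  assumes m: "0 < m" and f: "continuous_on UNIV f"
  shows "II r (\<lambda>x. f (m *\<^sub>R x)) = II (m * r) f / m ^ 3"
proof -
  have b: "(\<lambda>x. indicator (cball 0 (m * r)) x * f x) \<in> borel_measurable borel"
    using borel_measurable_continuous_onI[OF f] by (intro borel_measurable_times borel_measurable_indicator) auto
  have "II (m * r) f = (\<integral>x. indicator (cball 0 (m * r)) x * f x \<partial>density (distr lborel borel (\<lambda>x. 0 + m *\<^sub>R x)) (\<lambda>_. ennreal (\<bar>m\<bar> ^ DIM(real^3))))"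
    unfolding II_def using lborel_affine[of m "0::real^3"] m by simp
  also have "\<dots> = (\<integral>x. m ^ 3 * (indicator (cball 0 (m * r)) (m *\<^sub>R x) * f (m *\<^sub>R x)) \<partial>lborel)"
    using b m by (subst integral_density) (auto simp: integral_distr)
  also have "\<dots> = m ^ 3 * II r (\<lambda>x. f (m *\<^sub>R x))"
    unfolding II_def using m by (simp add: indicator_def)
  finally show ?thesis using m by simp
qed

text \<open>Vanishing almost everywhere on a ball extends to every point of it, because the zero set
  of a continuous function is closed.\<close>

lemma II_eq_0_imp:
  assumes f: "continuous_on UNIV f" "\<And>x. 0 \<le> f x" and 0: "\<And>r. II r f = 0"
  shows "f x = 0"
proof -
  define r where "r = norm x + 1"
  have "AE y in lborel. indicator (cball 0 r) y * f y = 0"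
    using 0[of r] f(2) unfolding II_def by (subst (asm) integral_nonneg_eq_0_iff_AE) (auto intro: II_integrable f)
  then have "AE y \<in> ball 0 r in lborel. y \<in> {y. f y = 0}"
    by eventually_elim (simp add: indicator_def split: if_splits)
  then have 1: "AE y \<in> ball 0 r in lebesgue. y \<in> {y. f y = 0}" by (rule AE_completion)
  have 2: "closed {y. f y = 0}" using continuous_closed_preimage_constant[OF f(1) closed_UNIV, of 0] by simp
  have "x \<in> {y. f y = 0}"
    by (rule mem_closed_if_AE_lebesgue_open[OF open_ball 2 1]) (simp add: r_def)
  then show ?thesis by simp
qed

lemma C1_constant:
  assumes "C1 f" "\<And>j x. partial j f x = 0" shows "f x = f 0"
proof -
  have "(f has_derivative (\<lambda>_. 0)) (at y)" for y using C1_has_derivative[OF assms(1), of y] assms(2) by simp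
  then show ?thesis using has_derivative_zero_constant[of UNIV f] by auto
qed

text \<open>Undoes the root and the normalisation in \<open>osc_avg\<close> and dominates a matrix
  entry by the norm. The strict inequality of the radii fits the closed ball of \<open>II\<close>
  into the open ball of \<open>osc_avg\<close>.\<close>

lemma oscillation_le:
  fixes \<Phi> :: "real^3 \<Rightarrow> real^3^3"
  assumes c: "continuous_on UNIV \<Phi>" and s: "0 < s" and r: "0 < r" "r' < r" and K: "osc_avg s r \<Phi> \<le> K"
  shows "II r' (\<lambda>x. \<bar>\<Phi> x $ i $ j - mean_val (ball 0 r) \<Phi> $ i $ j\<bar> powr s) \<le> 4/3 * pi * r ^ 3 * K powr s"
proof -
  define M where "M = mean_val (ball 0 r) \<Phi>"
  define h where "h x = norm (\<Phi> x - M) powr s" for x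
  have ch: "continuous_on UNIV h"
    unfolding h_def[abs_def] using s by (intro continuous_on_powr' continuous_on_norm continuous_on_diff c continuous_on_const) auto
  have "set_integrable lborel (cball 0 r) h"
    using II_integrable[OF ch, of r] by (simp add: set_integrable_def)
  then have i: "set_integrable lborel (ball 0 r) h" by (rule set_integrable_subset) auto
  have ib: "integral (ball 0 r) h = (\<integral>x. indicator (ball 0 r) x * h x \<partial>lborel)"
    using set_borel_integral_eq_integral(2)[OF i] by (simp add: set_lebesgue_integral_def)
  have "II r' (\<lambda>x. \<bar>\<Phi> x $ i $ j - M $ i $ j\<bar> powr s) \<le> II r' h"
  proof (rule II_mono[OF _ ch])
    show "continuous_on UNIV (\<lambda>x. \<bar>\<Phi> x $ i $ j - M $ i $ j\<bar> powr s)"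
      using s by (intro continuous_on_powr' continuous_on_rabs continuous_on_diff continuous_on_component c continuous_on_const) auto
    fix x
    have "\<bar>(\<Phi> x - M) $ i $ j\<bar> \<le> norm (\<Phi> x - M)"
      by (rule order_trans[OF component_le_norm_cart Finite_Cartesian_Product.norm_nth_le])
    then show "\<bar>\<Phi> x $ i $ j - M $ i $ j\<bar> powr s \<le> h x" unfolding h_def using s by (intro powr_mono2) auto
  qed
  also have "II r' h \<le> integral (ball 0 r) h"
    unfolding ib II_def
  proof (rule integral_mono)
    show "integrable lborel (\<lambda>x. indicator (cball 0 r') x * h x)" by (rule II_integrable[OF ch])
    show "integrable lborel (\<lambda>x. indicator (ball 0 r) x * h x)" using i by (simp add: set_integrable_def)
    show "indicator (cball 0 r') x * h x \<le> indicator (ball 0 r) x * h x" for x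
      using r by (auto simp: indicator_def h_def)
  qed
  also have "\<dots> \<le> 4/3 * pi * r ^ 3 * K powr s"
  proof -
    define V where "V = measure lebesgue (ball (0::real^3) r)"
    have V: "V = 4/3 * pi * r ^ 3" using r by (simp add: V_def content_ball unit_ball_vol_3)
    have V0: "0 < V" using r unfolding V by simp
    have n: "0 \<le> integral (ball 0 r) h" by (intro integral_nonneg set_borel_integral_eq_integral(1) i) (simp add: h_def)
    have "((1 / V * integral (ball 0 r) h) powr (1 / s)) powr s \<le> K powr s"
      using K s unfolding osc_avg_def V_def M_def h_def[abs_def] by (intro powr_mono2) auto
    then have "1 / V * integral (ball 0 r) h \<le> K powr s" using s n V0 by (simp add: powr_powr)
    then show ?thesis unfolding V[symmetric] using V0 by (simp add: field_simps)
  qed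
  finally show ?thesis by (simp add: M_def)
qed

lemma II_cball_indicator:
  assumes f: "continuous_on UNIV f" and r: "r \<le> 2"
  shows "(\<integral>x. indicator (cball 0 r) x * (indicator (cball 0 2) x * f x) \<partial>lborel) = II r f"
    "(\<integral>x. indicator (- cball 0 r) x * (indicator (cball 0 2) x * f x) \<partial>lborel) = II 2 f - II r f"
proof -
  show "(\<integral>x. indicator (cball 0 r) x * (indicator (cball 0 2) x * f x) \<partial>lborel) = II r f"
    unfolding II_def by (rule Bochner_Integration.integral_cong) (use r in \<open>auto simp: indicator_def\<close>)
  have "II 2 f - II r f = (\<integral>x. indicator (cball 0 2) x * f x - indicator (cball 0 r) x * f x \<partial>lborel)"
    unfolding II_def by (rule Bochner_Integration.integral_diff[symmetric]) (intro II_integrable f)+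
  also have "\<dots> = (\<integral>x. indicator (- cball 0 r) x * (indicator (cball 0 2) x * f x) \<partial>lborel)"
    by (rule Bochner_Integration.integral_cong) (use r in \<open>auto simp: indicator_def\<close>)
  finally show "(\<integral>x. indicator (- cball 0 r) x * (indicator (cball 0 2) x * f x) \<partial>lborel) = II 2 f - II r f" ..
qed

lemma le_0_of_tendsto_at_right:
  fixes f :: "real \<Rightarrow> real"
  assumes "(f \<longlongrightarrow> 0) (at_right 0)" "\<And>e. 0 < e \<Longrightarrow> a \<le> f e" shows "a \<le> 0"
  using assms(1)
  by (rule tendsto_lowerbound[OF _ eventually_mono[OF eventually_at_right_less]]) (simp_all add: assms(2))

text \<open>Here \<open>l ^ 3\<close> is the radius: in the variable \<open>x / l ^ 3\<close> the fields scale by \<open>l\<^sup>2\<close>, the pressure by \<open>l ^ 4\<close>,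
  the potentials by \<open>1 / l\<close>, and the viscosity becomes \<open>1 / l\<close>. Cubes avoid fractional powers.\<close>

locale mhd_global = mhd 1 u b p for u b :: "3 \<Rightarrow> real^3 \<Rightarrow> real" and p +
  fixes \<Phi> \<Psi> :: "3 \<Rightarrow> 3 \<Rightarrow> real^3 \<Rightarrow> real" and s C0 :: real
  assumes s: "3 < s" "s \<le> 6" and C0: "0 < C0"
    and C1_\<Phi>: "C1 (\<Phi> i j)" and div_\<Phi>: "(\<Sum>j\<in>UNIV. partial j (\<Phi> i j) x) = u i x"
    and osc_\<Phi>: "1 \<le> l \<Longrightarrow> \<exists>M. II (2 * l ^ 3) (\<lambda>x. \<bar>\<Phi> i j x - M\<bar> powr s) \<le> C0 * l powr (s + 6)"
    and C1_\<Psi>: "C1 (\<Psi> i j)" and div_\<Psi>: "(\<Sum>j\<in>UNIV. partial j (\<Psi> i j) x) = b i x"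
    and osc_\<Psi>: "1 \<le> l \<Longrightarrow> \<exists>M. II (2 * l ^ 3) (\<lambda>x. \<bar>\<Psi> i j x - M\<bar> powr s) \<le> C0 * l powr (s + 6)"
begin

text \<open>Subtracting constants from the entries changes no divergence. In powers of
  \<open>l\<close>, \<open>- s\<close> from the factor \<open>1 / l\<close>, \<open>- 9\<close> from
  the change of variables and \<open>s + 6\<close> from the oscillation leave \<open>- 3\<close>:
  the cube of the new viscosity.\<close>

lemma scaled_potential:
  fixes f :: "3 \<Rightarrow> 3 \<Rightarrow> real^3 \<Rightarrow> real"
  assumes f: "\<And>i j. C1 (f i j)" "\<And>i x. (\<Sum>j\<in>UNIV. partial j (f i j) x) = w i x"
    and osc: "\<And>i j. \<exists>M. II (2 * l ^ 3) (\<lambda>x. \<bar>f i j x - M\<bar> powr s) \<le> C0 * l powr (s + 6)" and l: "1 \<le> l"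
  shows "\<exists>F. \<forall>i j. C1 (F i j) \<and> (\<forall>x. (\<Sum>j\<in>UNIV. partial j (F i j) x) = l\<^sup>2 * w i (l ^ 3 *\<^sub>R x))
    \<and> II 2 (\<lambda>x. \<bar>F i j x\<bar> powr s) \<le> C0 * (1 / l) ^ 3"
proof -
  obtain M where M: "\<And>i j. II (2 * l ^ 3) (\<lambda>x. \<bar>f i j x - M i j\<bar> powr s) \<le> C0 * l powr (s + 6)"
    using osc by metis
  define F where "F i j x = (1 / l) * (f i j (l ^ 3 *\<^sub>R x) - M i j)" for i j x
  have d: "C1 (\<lambda>x. f i j x - M i j)" "partial j (\<lambda>x. f i j x - M i j) = partial j (f i j)" for i j
    using C1_diff[OF f(1) C1_const(1)] by (auto simp: C1_const(2) fun_eq_iff)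
  have F: "C1 (F i j)" "partial j (F i j) = (\<lambda>x. l\<^sup>2 * partial j (f i j) (l ^ 3 *\<^sub>R x))" for i j
    unfolding F_def[abs_def] using C1_scaled[OF d(1), where c = "1 / l" and m = "l ^ 3"] l
    by (auto simp: d(2) power2_eq_square power3_eq_cube)
  have "II 2 (\<lambda>x. \<bar>F i j x\<bar> powr s) \<le> C0 * (1 / l) ^ 3" for i j
  proof -
    have c: "continuous_on UNIV (\<lambda>x. \<bar>f i j x - M i j\<bar> powr s)"
      using s by (intro continuous_on_powr' continuous_on_rabs C1_continuous[OF d(1)] continuous_on_const) auto
    have "II 2 (\<lambda>x. \<bar>F i j x\<bar> powr s) = (1 / l) powr s * II 2 (\<lambda>x. \<bar>f i j (l ^ 3 *\<^sub>R x) - M i j\<bar> powr s)"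
      unfolding II_cmult[symmetric] using l by (simp add: F_def abs_mult powr_mult powr_divide)
    also have "\<dots> = (1 / l) powr s * (II (l ^ 3 * 2) (\<lambda>x. \<bar>f i j x - M i j\<bar> powr s) / (l ^ 3) ^ 3)"
      using l by (subst II_dilation[OF _ c]) auto
    also have "\<dots> \<le> (1 / l) powr s * (C0 * l powr (s + 6) / (l ^ 3) ^ 3)"
      using M[of i j] l by (intro mult_left_mono divide_right_mono) (auto simp: mult.commute)
    also have "\<dots> = C0 * (1 / l) ^ 3"
    proof -
      have "l powr 6 = l ^ 6" using l by simp
      moreover have "(l ^ 3) ^ 3 = l ^ 6 * l ^ 3" by (simp flip: power_mult power_add)
      moreover have "a \<noteq> 0 \<Longrightarrow> 1 / a * (C0 * (a * y) / (y * d)) = C0 * (1 / d)" if "y \<noteq> 0" for a d y :: real using that by simp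
      from this[of "l ^ 6" "l powr s" "l ^ 3"] have "1 / l powr s * (C0 * (l powr s * l ^ 6) / (l ^ 6 * l ^ 3)) = C0 * (1 / l ^ 3)" using l by simp
      ultimately show ?thesis using l by (simp only: powr_add powr_divide power_divide powr_one_eq_one power_one)
    qed
    finally show ?thesis .
  qed
  then show ?thesis using F f(2) by (intro exI[of _ F]) (simp add: sum_distrib_left[symmetric])
qed

text \<open>Every term acquires the same factor \<open>l ^ 7\<close>, in exponents: viscous - 1 + 2
  + 6, convective 2 + 2 + 3, pressure 4 + 3. Each derivative costs \<open>l ^ 3\<close>.\<close>

lemma scaled:
  assumes l: "1 \<le> l"
  obtains F H where "mhd_potential (1 / l) (\<lambda>i x. l\<^sup>2 * u i (l ^ 3 *\<^sub>R x)) (\<lambda>i x. l\<^sup>2 * b i (l ^ 3 *\<^sub>R x)) (\<lambda>x. l ^ 4 * p (l ^ 3 *\<^sub>R x)) F H s C0"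
proof -
  obtain F where F: "\<And>i j. C1 (F i j)" "\<And>i x. (\<Sum>j\<in>UNIV. partial j (F i j) x) = l\<^sup>2 * u i (l ^ 3 *\<^sub>R x)"
    "\<And>i j. II 2 (\<lambda>x. \<bar>F i j x\<bar> powr s) \<le> C0 * (1 / l) ^ 3"
    using scaled_potential[where w = u, OF C1_\<Phi> div_\<Phi> osc_\<Phi>[OF l] l] by blast
  obtain H where H: "\<And>i j. C1 (H i j)" "\<And>i x. (\<Sum>j\<in>UNIV. partial j (H i j) x) = l\<^sup>2 * b i (l ^ 3 *\<^sub>R x)"
    "\<And>i j. II 2 (\<lambda>x. \<bar>H i j x\<bar> powr s) \<le> C0 * (1 / l) ^ 3"
    using scaled_potential[where w = b, OF C1_\<Psi> div_\<Psi> osc_\<Psi>[OF l] l] by blast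
  have l0: "0 < l" using l by simp
  have e1: "(1 / l) * (l\<^sup>2 * l ^ 3 * l ^ 3 * y) = l ^ 7 * y" "l ^ 4 * l ^ 3 * y = l ^ 7 * y"
      "l\<^sup>2 * a * (l\<^sup>2 * l ^ 3 * y) = l ^ 7 * (a * y)" for a y
    using l0 by (simp_all add: field_simps flip: power_add) (simp add: eval_nat_numeral)
  have "mhd_potential (1 / l) (\<lambda>i x. l\<^sup>2 * u i (l ^ 3 *\<^sub>R x)) (\<lambda>i x. l\<^sup>2 * b i (l ^ 3 *\<^sub>R x)) (\<lambda>x. l ^ 4 * p (l ^ 3 *\<^sub>R x)) F H s C0"
  proof unfold_locales
    show "C1 (\<lambda>x. l\<^sup>2 * u i (l ^ 3 *\<^sub>R x))" "C1 (\<lambda>x. l\<^sup>2 * b i (l ^ 3 *\<^sub>R x))" "C1 (\<lambda>x. l ^ 4 * p (l ^ 3 *\<^sub>R x))" for i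
      by (intro C1_scaled C1_v C1_b C1_p)+
    show "C1 (partial j (\<lambda>x. l\<^sup>2 * u i (l ^ 3 *\<^sub>R x)))" "C1 (partial j (\<lambda>x. l\<^sup>2 * b i (l ^ 3 *\<^sub>R x)))" for i j
      unfolding C1_scaled(2)[OF C1_v] C1_scaled(2)[OF C1_b] by (intro C1_scaled C2_v C2_b)+
    show "(\<Sum>i\<in>UNIV. partial i (\<lambda>x. l\<^sup>2 * u i (l ^ 3 *\<^sub>R x)) x) = 0" "(\<Sum>i\<in>UNIV. partial i (\<lambda>x. l\<^sup>2 * b i (l ^ 3 *\<^sub>R x)) x) = 0" for x
      unfolding C1_scaled(2)[OF C1_v] C1_scaled(2)[OF C1_b] by (simp_all only: sum_distrib_left[symmetric] div_v div_b mult_zero_right)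
    fix i x
    show "1 / l * (\<Sum>j\<in>UNIV. partial j (partial j (\<lambda>x. l\<^sup>2 * u i (l ^ 3 *\<^sub>R x))) x) =
      (\<Sum>j\<in>UNIV. l\<^sup>2 * u j (l ^ 3 *\<^sub>R x) * partial j (\<lambda>x. l\<^sup>2 * u i (l ^ 3 *\<^sub>R x)) x) + partial i (\<lambda>x. l ^ 4 * p (l ^ 3 *\<^sub>R x)) x -
      (\<Sum>j\<in>UNIV. l\<^sup>2 * b j (l ^ 3 *\<^sub>R x) * partial j (\<lambda>x. l\<^sup>2 * b i (l ^ 3 *\<^sub>R x)) x)"
      unfolding C1_scaled(2)[OF C1_v] C1_scaled(2)[OF C1_b] C1_scaled(2)[OF C1_p] C1_scaled(2)[OF C2_v] sum_distrib_left[of "1 / l"] e1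
        sum_distrib_left[symmetric] distrib_left[symmetric] right_diff_distrib[symmetric]
      using momentum[of i "l ^ 3 *\<^sub>R x"] by simp
    show "1 / l * (\<Sum>j\<in>UNIV. partial j (partial j (\<lambda>x. l\<^sup>2 * b i (l ^ 3 *\<^sub>R x))) x) =
      (\<Sum>j\<in>UNIV. l\<^sup>2 * u j (l ^ 3 *\<^sub>R x) * partial j (\<lambda>x. l\<^sup>2 * b i (l ^ 3 *\<^sub>R x)) x) -
      (\<Sum>j\<in>UNIV. l\<^sup>2 * b j (l ^ 3 *\<^sub>R x) * partial j (\<lambda>x. l\<^sup>2 * u i (l ^ 3 *\<^sub>R x)) x)"
      unfolding C1_scaled(2)[OF C1_v] C1_scaled(2)[OF C1_b] C1_scaled(2)[OF C2_b] sum_distrib_left[of "1 / l"] e1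
        sum_distrib_left[symmetric] right_diff_distrib[symmetric]
      using induction[of i "l ^ 3 *\<^sub>R x"] by simp
  qed (use l s C0 F H in auto)
  then show thesis by (rule that)
qed

text \<open>In powers of \<open>l\<close> the Dirichlet integral with its viscosity is invariant, -
  1 + 10 - 9 = 0, whereas the cubic integral is divided by the radius, 6 - 9 = - 3.\<close>

lemma II_scaled:
  assumes f: "C1 f" and l: "1 \<le> l"
  shows "1 / l * II r (\<lambda>x. (partial j (\<lambda>x. l\<^sup>2 * f (l ^ 3 *\<^sub>R x)) x)\<^sup>2) = II (l ^ 3 * r) (\<lambda>x. (partial j f x)\<^sup>2)"
    "II r (\<lambda>x. \<bar>l\<^sup>2 * f (l ^ 3 *\<^sub>R x)\<bar> ^ 3) = II (l ^ 3 * r) (\<lambda>x. \<bar>f x\<bar> ^ 3) / l ^ 3"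
proof -
  have c: "continuous_on UNIV (\<lambda>x. (partial j f x)\<^sup>2)" "continuous_on UNIV (\<lambda>x. \<bar>f x\<bar> ^ 3)"
    by (intro continuous_on_power continuous_on_rabs C1_partial_continuous C1_continuous f)+
  have l0: "0 < l ^ 3" "0 < l" using l by auto
  have "1 / l * II r (\<lambda>x. (partial j (\<lambda>x. l\<^sup>2 * f (l ^ 3 *\<^sub>R x)) x)\<^sup>2) = 1 / l * ((l\<^sup>2 * l ^ 3)\<^sup>2 * (II (l ^ 3 * r) (\<lambda>x. (partial j f x)\<^sup>2) / (l ^ 3) ^ 3))"
    unfolding C1_scaled(2)[OF f] power_mult_distrib[of "l\<^sup>2 * l ^ 3"] II_cmult
    by (subst II_dilation[OF l0(1) c(1)]) simp
  also have "\<dots> = II (l ^ 3 * r) (\<lambda>x. (partial j f x)\<^sup>2)"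
  proof -
    have "(l\<^sup>2 * l ^ 3)\<^sup>2 = l * (l ^ 3) ^ 3" by (simp flip: power_mult power_add power_Suc)
    then show ?thesis using l0 by simp
  qed
  finally show "1 / l * II r (\<lambda>x. (partial j (\<lambda>x. l\<^sup>2 * f (l ^ 3 *\<^sub>R x)) x)\<^sup>2) = II (l ^ 3 * r) (\<lambda>x. (partial j f x)\<^sup>2)" .
  have "II r (\<lambda>x. \<bar>l\<^sup>2 * f (l ^ 3 *\<^sub>R x)\<bar> ^ 3) = (l\<^sup>2) ^ 3 * (II (l ^ 3 * r) (\<lambda>x. \<bar>f x\<bar> ^ 3) / (l ^ 3) ^ 3)"
    unfolding abs_mult abs_power2 power_mult_distrib II_cmult by (subst II_dilation[OF l0(1) c(2)]) simp
  also have "\<dots> = II (l ^ 3 * r) (\<lambda>x. \<bar>f x\<bar> ^ 3) / l ^ 3"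
  proof -
    have e: "(l ^ 3) ^ 3 = (l\<^sup>2) ^ 3 * l ^ 3" by (simp flip: power_mult power_add)
    have "a \<noteq> 0 \<Longrightarrow> a * (y / (a * d)) = y / d" for a d y :: real by simp
    moreover have "(l\<^sup>2) ^ 3 \<noteq> 0" using l0 by simp
    ultimately show ?thesis unfolding e by blast
  qed
  finally show "II r (\<lambda>x. \<bar>l\<^sup>2 * f (l ^ 3 *\<^sub>R x)\<bar> ^ 3) = II (l ^ 3 * r) (\<lambda>x. \<bar>f x\<bar> ^ 3) / l ^ 3" .
qed

text \<open>With \<open>l = root 3 r\<close> the ball of radius \<open>r\<close> becomes the unit
  ball. Invariance of the Dirichlet integral turns the scale-free \<open>gradient_bound\<close> into
  a bound for every radius, so the total Dirichlet integral is finite.\<close>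

lemma G_bounded: "G r \<le> max 1 (gradient_const s C0)"
proof -
  have *: "G r \<le> gradient_const s C0" if "1 \<le> r" for r
  proof -
    have l: "1 \<le> root 3 r" "root 3 r ^ 3 = r" using that by auto
    obtain F H where "mhd_potential (1 / root 3 r) (\<lambda>i x. (root 3 r)\<^sup>2 * u i (root 3 r ^ 3 *\<^sub>R x)) (\<lambda>i x. (root 3 r)\<^sup>2 * b i (root 3 r ^ 3 *\<^sub>R x))
        (\<lambda>x. root 3 r ^ 4 * p (root 3 r ^ 3 *\<^sub>R x)) F H s C0"
      by (rule scaled[OF l(1)])
    then interpret S: mhd_potential "1 / root 3 r" "\<lambda>i x. (root 3 r)\<^sup>2 * u i (root 3 r ^ 3 *\<^sub>R x)" "\<lambda>i x. (root 3 r)\<^sup>2 * b i (root 3 r ^ 3 *\<^sub>R x)"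
        "\<lambda>x. root 3 r ^ 4 * p (root 3 r ^ 3 *\<^sub>R x)" F H s C0 .
    have "S.G 1 = G r"
      unfolding S.G_def G_def sum_distrib_left distrib_left II_scaled(1)[OF C1_v l(1)] II_scaled(1)[OF C1_b l(1)] unfolding l by simp
    then show ?thesis using S.gradient_bound by simp
  qed
  show ?thesis
  proof (cases "1 \<le> r")
    case True then show ?thesis using *[OF True] by simp
  next
    case False then show ?thesis using G_mono[of r 1] *[of 1] by simp
  qed
qed

text \<open>All increments between two radii are nonnegative, so each is at most their sum; this
  hands the smallness of the tail of \<open>G\<close> to single components.\<close>

lemma II_diff_le_G_diff:
  assumes r: "r \<le> r'"
  shows "II r' (\<lambda>x. (partial j (u i) x)\<^sup>2) - II r (\<lambda>x. (partial j (u i) x)\<^sup>2) \<le> G r' - G r"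
    "II r' (\<lambda>x. (partial j (b i) x)\<^sup>2) - II r (\<lambda>x. (partial j (b i) x)\<^sup>2) \<le> G r' - G r"
proof -
  define du where "du i j = II r' (\<lambda>x. (partial j (u i) x)\<^sup>2) - II r (\<lambda>x. (partial j (u i) x)\<^sup>2)" for i j
  define db where "db i j = II r' (\<lambda>x. (partial j (b i) x)\<^sup>2) - II r (\<lambda>x. (partial j (b i) x)\<^sup>2)" for i j
  have nn: "0 \<le> du i j" "0 \<le> db i j" for i j
    unfolding du_def db_def diff_ge_0_iff_ge
    by (intro II_mono_radius continuous_on_power C1_partial_continuous C1_v C1_b r zero_le_power2)+
  have "G r' - G r = (\<Sum>i\<in>UNIV. \<Sum>j\<in>UNIV. du i j + db i j)"
    unfolding G_def by (simp add: du_def db_def sum_subtractf[symmetric] algebra_simps)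
  moreover have "du i j + db i j \<le> (\<Sum>j\<in>UNIV. du i j + db i j)"
    by (rule member_le_sum) (auto simp: nn add_nonneg_nonneg)
  moreover have "(\<Sum>j\<in>UNIV. du i j + db i j) \<le> (\<Sum>i\<in>UNIV. \<Sum>j\<in>UNIV. du i j + db i j)"
    by (rule member_le_sum) (auto simp: nn add_nonneg_nonneg intro!: sum_nonneg)
  ultimately have "du i j + db i j \<le> G r' - G r" by linarith
  then show "II r' (\<lambda>x. (partial j (u i) x)\<^sup>2) - II r (\<lambda>x. (partial j (u i) x)\<^sup>2) \<le> G r' - G r"
    "II r' (\<lambda>x. (partial j (b i) x)\<^sup>2) - II r (\<lambda>x. (partial j (b i) x)\<^sup>2) \<le> G r' - G r"
    using nn[of i j] unfolding du_def db_def by linarith+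
qed

definition "g = max 1 (gradient_const s C0)"
text \<open>Right-hand side of \<open>cubic_decay_scalar\<close> when its three small quantities
  \<open>ZA\<close>, \<open>GA\<close> and \<open>\<nu>\<close> are all replaced by
  \<open>\<epsilon>\<close>.\<close>

definition "err \<epsilon> = 4096 * (decay_const s C0 g * (\<epsilon> powr (2/3 - 2 / s) + sqrt \<epsilon> + \<epsilon> powr (3 / s)))"

lemma decay_const_nonneg: "0 \<le> decay_const s C0 g"
  by (simp add: decay_const_def Let_def sobolev_const_def g_def)

text \<open>The Dirichlet integral is finite, so all but \<open>\<epsilon>\<close> of it lies in some ball of radius \<open>r0\<close>; this ball shrinks to
  the origin in the rescaled variables, where the cubic integral over it is negligible.\<close>

lemma decay:
  assumes e: "0 < \<epsilon>"
  obtains L where "\<And>l. L \<le> l \<Longrightarrow> 1 \<le> l"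
    "\<And>l i. L \<le> l \<Longrightarrow> II (3/2) (\<lambda>x. \<bar>l\<^sup>2 * u i (l ^ 3 *\<^sub>R x)\<bar> ^ 3) \<le> err \<epsilon>"
    "\<And>l i. L \<le> l \<Longrightarrow> II (3/2) (\<lambda>x. \<bar>l\<^sup>2 * b i (l ^ 3 *\<^sub>R x)\<bar> ^ 3) \<le> err \<epsilon>"
    "\<And>l. L \<le> l \<Longrightarrow> G (l ^ 3) \<le> energy_const * 2 ^ 38 * (6 * err \<epsilon> + root 3 (6 * err \<epsilon>) * sqrt g)"
proof -
  have g1: "1 \<le> g" and Gg: "G r \<le> g" for r using G_bounded by (auto simp: g_def)
  obtain r0 where r0: "0 \<le> r0" "\<And>r. G r \<le> G r0 + \<epsilon>"
  proof -
    have bdd: "bdd_above (range G)" using Gg by (intro bdd_aboveI2)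
    then obtain r1 where r1: "(SUP r. G r) - \<epsilon> < G r1"
      using less_cSUP_iff[of UNIV G "(SUP r. G r) - \<epsilon>"] e by auto
    have "G r \<le> G (max 0 r1) + \<epsilon>" for r
      using cSUP_upper[OF UNIV_I bdd, of r] r1 G_mono[of r1 "max 0 r1"] by simp
    then show thesis by (intro that[of "max 0 r1"]) auto
  qed
  \<comment> \<open>The summands ensure in turn that \<open>1 \<le> l\<close>, that the shrunken
    ball stays within radius 2, that the new viscosity is at most \<open>\<epsilon>\<close>, and
    that so is the rescaled cubic integral over the shrunken ball.\<close>
  define L where "L = 1 + r0 + 1 / \<epsilon> + X r0 / \<epsilon>"
  have X0: "0 \<le> X r0" by (rule X_nonneg)
  show thesis
  proof (rule that[of L])
    fix l assume Ll: "L \<le> l"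
    have pos: "0 \<le> 1 / \<epsilon>" "0 \<le> X r0 / \<epsilon>" using e X0 by auto
    then show l1: "1 \<le> l" using Ll r0(1) unfolding L_def by linarith
    have l3: "l \<le> l ^ 3" using l1 by (intro self_le_power) auto
    have "r0 \<le> l" "1 / \<epsilon> \<le> l" "X r0 / \<epsilon> \<le> l" using Ll pos r0(1) unfolding L_def by linarith+
    then have le: "r0 / l ^ 3 \<le> 2" "1 / l \<le> \<epsilon>" "X r0 / l ^ 3 \<le> \<epsilon>"
    proof -
      assume a: "r0 \<le> l" "1 / \<epsilon> \<le> l" "X r0 / \<epsilon> \<le> l"
      have "X r0 \<le> \<epsilon> * l" using a(3) e by (simp add: field_simps)
      also have "\<dots> \<le> \<epsilon> * l ^ 3" using l3 e by simp
      finally show "X r0 / l ^ 3 \<le> \<epsilon>" using l1 by (simp add: field_simps)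
      show "1 / l \<le> \<epsilon>" using a(2) e l1 by (simp add: field_simps)
      have "r0 \<le> 2 * l ^ 3" using a(1) l3 l1 by linarith
      then show "r0 / l ^ 3 \<le> 2" using l1 by (simp add: field_simps)
    qed
    have r0l: "l ^ 3 * (r0 / l ^ 3) = r0" "r0 \<le> l ^ 3 * 2" using l1 le(1) by (auto simp: field_simps)
    obtain F H where "mhd_potential (1 / l) (\<lambda>i x. l\<^sup>2 * u i (l ^ 3 *\<^sub>R x)) (\<lambda>i x. l\<^sup>2 * b i (l ^ 3 *\<^sub>R x))
        (\<lambda>x. l ^ 4 * p (l ^ 3 *\<^sub>R x)) F H s C0"
      by (rule scaled[OF l1])
    then interpret S: mhd_potential "1 / l" "\<lambda>i x. l\<^sup>2 * u i (l ^ 3 *\<^sub>R x)" "\<lambda>i x. l\<^sup>2 * b i (l ^ 3 *\<^sub>R x)"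
        "\<lambda>x. l ^ 4 * p (l ^ 3 *\<^sub>R x)" F H s C0 .
    have SG: "S.G r = G (l ^ 3 * r)" for r
      unfolding S.G_def G_def sum_distrib_left distrib_left II_scaled(1)[OF C1_v l1] II_scaled(1)[OF C1_b l1] by simp
    define A where "A = cball (0::real^3) (r0 / l ^ 3)"
    \<comment> \<open>Common to velocity and magnetic field: \<open>w\<close> is one component and
      \<open>f\<close> the matching row of the rescaled potential.\<close>
    have step: "II (3/2) (\<lambda>x. \<bar>l\<^sup>2 * w (l ^ 3 *\<^sub>R x)\<bar> ^ 3) \<le> err \<epsilon>"
      if w: "C1 w" and f: "\<And>j. C1 (f j)" "\<And>x. (\<Sum>j\<in>UNIV. partial j (f j) x) = l\<^sup>2 * w (l ^ 3 *\<^sub>R x)"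
        "\<And>j. II 2 (\<lambda>x. \<bar>f j x\<bar> powr s) \<le> C0 * (1 / l) ^ 3" and wX: "II r0 (\<lambda>x. \<bar>w x\<bar> ^ 3) \<le> X r0"
        and wG: "\<And>j. II (l ^ 3 * 2) (\<lambda>x. (partial j w x)\<^sup>2) \<le> G (l ^ 3 * 2)"
        and wd: "\<And>j. II (l ^ 3 * 2) (\<lambda>x. (partial j w x)\<^sup>2) - II r0 (\<lambda>x. (partial j w x)\<^sup>2) \<le> G (l ^ 3 * 2) - G r0" for w f
    proof -
      define v where "v x = l\<^sup>2 * w (l ^ 3 *\<^sub>R x)" for x
      have v: "C1 v" unfolding v_def[abs_def] by (rule C1_scaled(1)[OF w])
      note sc = II_scaled[OF w l1, folded v_def]
      have c: "continuous_on UNIV (\<lambda>x. \<bar>v x\<bar> ^ 3)" "continuous_on UNIV (\<lambda>x. (partial j v x)\<^sup>2)" for j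
        by (intro continuous_on_power continuous_on_rabs C1_partial_continuous C1_continuous v)+
      have "II (3/2) (\<lambda>x. \<bar>v x\<bar> ^ 3) \<le> 4096 * (decay_const s C0 g * (\<epsilon> powr (2/3 - 2 / s) + sqrt \<epsilon> + (1 / l) powr (3 / s)))"
      proof (rule S.cubic_decay_scalar[of A v f])
        have "II r0 (\<lambda>x. \<bar>w x\<bar> ^ 3) / l ^ 3 \<le> X r0 / l ^ 3" using wX l1 by (intro divide_right_mono) auto
        then show "(\<integral>x. indicator A x * (indicator (cball 0 2) x * \<bar>v x\<bar> ^ 3) \<partial>lborel) \<le> \<epsilon>"
          unfolding A_def II_cball_indicator(1)[OF c(1) le(1)] sc r0l using le(3) by linarith
        show "1 / l * II 2 (\<lambda>x. (partial j v x)\<^sup>2) \<le> g" for j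
          unfolding sc using wG[of j] Gg[of "l ^ 3 * 2"] by linarith
        show "1 / l * (\<integral>x. indicator (- A) x * (indicator (cball 0 2) x * (partial j v x)\<^sup>2) \<partial>lborel) \<le> \<epsilon>" for j
          unfolding A_def II_cball_indicator(2)[OF c(2) le(1)] right_diff_distrib sc r0l using wd[of j] r0(2)[of "l ^ 3 * 2"] by linarith
      qed (use v f e g1 in \<open>auto simp: A_def v_def\<close>)
      also have "\<dots> \<le> err \<epsilon>"
        unfolding err_def using decay_const_nonneg le(2) l1 s by (intro mult_left_mono add_left_mono powr_mono2) auto
      finally show ?thesis by (simp add: v_def[abs_def])
    qed
    have stepv: "II (3/2) (\<lambda>x. \<bar>l\<^sup>2 * u i (l ^ 3 *\<^sub>R x)\<bar> ^ 3) \<le> err \<epsilon>" for i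
      by (rule step[of "u i" "F i"])
        (use C1_v S.C1_F S.div_F S.F_le II_v_le_X II_le_G(1) II_diff_le_G_diff(1)[OF r0l(2)] in auto)
    have stepb: "II (3/2) (\<lambda>x. \<bar>l\<^sup>2 * b i (l ^ 3 *\<^sub>R x)\<bar> ^ 3) \<le> err \<epsilon>" for i
      by (rule step[of "b i" "H i"])
        (use C1_b S.C1_H S.div_H S.H_le II_b_le_X II_le_G(2) II_diff_le_G_diff(2)[OF r0l(2)] in auto)
    show "II (3/2) (\<lambda>x. \<bar>l\<^sup>2 * u i (l ^ 3 *\<^sub>R x)\<bar> ^ 3) \<le> err \<epsilon>" "II (3/2) (\<lambda>x. \<bar>l\<^sup>2 * b i (l ^ 3 *\<^sub>R x)\<bar> ^ 3) \<le> err \<epsilon>" for i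
      by (rule stepv stepb)+
    have SX: "S.X (3/2) \<le> 6 * err \<epsilon>" by (rule S.X_le_sum[OF stepv stepb])
    \<comment> \<open>The energy inequality between the rescaled radii 1 and 3/2 converts smallness
      of the cubic integral into smallness of the Dirichlet integral over the ball of radius
      \<open>l ^ 3\<close>.\<close>
    have "G (l ^ 3) = S.G 1" by (simp add: SG)
    also have "\<dots> \<le> energy_const / (3/2 - 1) ^ 38 * (S.X (3/2) + root 3 (S.X (3/2)) * sqrt (S.G (3/2)))"
      by (rule S.local_energy_inequality) (use S.nu in auto)
    also have "\<dots> \<le> energy_const / (3/2 - 1) ^ 38 * (6 * err \<epsilon> + root 3 (6 * err \<epsilon>) * sqrt g)"
    proof (intro mult_left_mono add_mono mult_mono SX)
      show "root 3 (S.X (3/2)) \<le> root 3 (6 * err \<epsilon>)" using SX by simp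
      show "sqrt (S.G (3/2)) \<le> sqrt g" using Gg by (simp add: SG)
      show "0 \<le> root 3 (6 * err \<epsilon>)" using SX S.X_nonneg[of "3/2"] by (intro real_root_ge_zero) linarith
      show "0 \<le> sqrt (S.G (3/2))" using S.G_nonneg S.nu by simp
    qed (use energy_const_ge in auto)
    also have "energy_const / (3/2 - 1) ^ 38 = energy_const * 2 ^ 38" by (simp add: power_divide)
    finally show "G (l ^ 3) \<le> energy_const * 2 ^ 38 * (6 * err \<epsilon> + root 3 (6 * err \<epsilon>) * sqrt g)" .
  qed
qed

lemma err_tendsto_0: "(err \<longlongrightarrow> 0) (at_right 0)"
proof -
  have id: "((\<lambda>\<epsilon>::real. \<epsilon>) \<longlongrightarrow> 0) (at_right 0)" by (rule tendsto_ident_at)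
  have nn: "\<forall>\<^sub>F \<epsilon>::real in at_right 0. 0 \<le> \<epsilon>"
    by (rule eventually_mono[OF eventually_at_right_less]) simp
  have "((\<lambda>\<epsilon>::real. \<epsilon> powr a) \<longlongrightarrow> 0) (at_right 0)" if "0 < a" for a
    by (rule tendsto_zero_powrI[OF id tendsto_const nn that])
  moreover have "0 < 2/3 - 2 / s" "0 < 3 / s" using s by (auto simp: field_simps)
  ultimately have "(err \<longlongrightarrow> 4096 * (decay_const s C0 g * (0 + sqrt 0 + 0))) (at_right 0)"
    unfolding err_def[abs_def] by (intro tendsto_intros id) auto
  then show ?thesis by simp
qed

theorem vanishing: "u i x = 0" "b i x = 0"
proof -
  have lim: "((\<lambda>\<epsilon>. energy_const * 2 ^ 38 * (6 * err \<epsilon> + root 3 (6 * err \<epsilon>) * sqrt g)) \<longlongrightarrow> energy_const * 2 ^ 38 * (6 * 0 + root 3 (6 * 0) * sqrt g)) (at_right 0)"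
    by (intro tendsto_intros err_tendsto_0)
  \<comment> \<open>\<open>G\<close> is monotone, so a bound at arbitrarily large radii
    \<open>l ^ 3\<close> holds at every radius.\<close>
  have G0: "G r \<le> 0" for r
  proof (rule le_0_of_tendsto_at_right)
    show "((\<lambda>\<epsilon>. energy_const * 2 ^ 38 * (6 * err \<epsilon> + root 3 (6 * err \<epsilon>) * sqrt g)) \<longlongrightarrow> 0) (at_right 0)" using lim by simp
    fix \<epsilon> :: real assume "0 < \<epsilon>"
    then obtain L where L: "\<And>l. L \<le> l \<Longrightarrow> 1 \<le> l"
      "\<And>l. L \<le> l \<Longrightarrow> G (l ^ 3) \<le> energy_const * 2 ^ 38 * (6 * err \<epsilon> + root 3 (6 * err \<epsilon>) * sqrt g)"
      using decay by metis
    define l where "l = max L r"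
    have l: "L \<le> l" "1 \<le> l" "r \<le> l" using L(1)[of l] by (auto simp: l_def)
    have "l \<le> l ^ 3" using l by (intro self_le_power) auto
    then show "G r \<le> energy_const * 2 ^ 38 * (6 * err \<epsilon> + root 3 (6 * err \<epsilon>) * sqrt g)"
      using G_mono[of r "l ^ 3"] L(2)[OF l(1)] l by simp
  qed
  have p0: "partial j (u i) x = 0" "partial j (b i) x = 0" for i j x
  proof -
    have c: "continuous_on UNIV (\<lambda>x. (partial j (u i) x)\<^sup>2)" "continuous_on UNIV (\<lambda>x. (partial j (b i) x)\<^sup>2)"
      by (intro continuous_on_power C1_partial_continuous C1_v C1_b)+
    have "II r (\<lambda>x. (partial j (u i) x)\<^sup>2) = 0" "II r (\<lambda>x. (partial j (b i) x)\<^sup>2) = 0" for r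
      using II_le_G(1)[of r j i] II_le_G(2)[of r j i] G0[of r] II_nonneg[of "\<lambda>x. (partial j (u i) x)\<^sup>2" r] II_nonneg[of "\<lambda>x. (partial j (b i) x)\<^sup>2" r] by auto
    from II_eq_0_imp[OF c(1) _ this(1)] II_eq_0_imp[OF c(2) _ this(2)]
    show "partial j (u i) x = 0" "partial j (b i) x = 0" by auto
  qed
  \<comment> \<open>A constant field is amplified by \<open>l\<^sup>2\<close>, so its rescaled cubic
    integral stays above \<open>\<bar>w 0\<bar> ^ 3\<close> and cannot tend to 0 unless the constant
    is 0.\<close>
  have const: "w x = 0" if w: "C1 w" "\<And>j x. partial j w x = 0"
    and dec: "\<And>\<epsilon>. 0 < \<epsilon> \<Longrightarrow> \<exists>l\<ge>1. II (3/2) (\<lambda>x. \<bar>l\<^sup>2 * w (l ^ 3 *\<^sub>R x)\<bar> ^ 3) \<le> err \<epsilon>" for w x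
  proof -
    have wc: "w x = w 0" for x by (rule C1_constant[OF w])
    have "\<bar>w 0\<bar> ^ 3 \<le> 0"
    proof (rule le_0_of_tendsto_at_right[OF err_tendsto_0])
      fix \<epsilon> :: real assume "0 < \<epsilon>"
      then obtain l where l: "1 \<le> l" "II (3/2) (\<lambda>x. \<bar>l\<^sup>2 * w (l ^ 3 *\<^sub>R x)\<bar> ^ 3) \<le> err \<epsilon>" using dec by blast
      have "II (3/2) (\<lambda>x. \<bar>l\<^sup>2 * w (l ^ 3 *\<^sub>R x)\<bar> ^ 3) = \<bar>l\<^sup>2 * w 0\<bar> ^ 3 * (4/3 * pi * (3/2) ^ 3)"
        unfolding wc[of "_ *\<^sub>R _"] by (rule II_const) simp
      moreover have "\<bar>w 0\<bar> ^ 3 * 1 \<le> \<bar>l\<^sup>2 * w 0\<bar> ^ 3 * (4/3 * pi * (3/2) ^ 3)"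
      proof (rule mult_mono)
        have "1 * \<bar>w 0\<bar> \<le> l\<^sup>2 * \<bar>w 0\<bar>" using l by (intro mult_right_mono one_le_power) auto
        then show "\<bar>w 0\<bar> ^ 3 \<le> \<bar>l\<^sup>2 * w 0\<bar> ^ 3" by (intro power_mono) (auto simp: abs_mult)
        show "(1::real) \<le> 4/3 * pi * (3/2) ^ 3" using pi_gt3 by (simp add: power_divide)
      qed auto
      ultimately show "\<bar>w 0\<bar> ^ 3 \<le> err \<epsilon>" using l(2) by linarith
    qed
    then show ?thesis using wc[of x] zero_le_power[of "\<bar>w 0\<bar>" 3] by (simp add: power_le_zero_eq)
  qed
  have "\<exists>l\<ge>1. II (3/2) (\<lambda>x. \<bar>l\<^sup>2 * u i (l ^ 3 *\<^sub>R x)\<bar> ^ 3) \<le> err \<epsilon>"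
    "\<exists>l\<ge>1. II (3/2) (\<lambda>x. \<bar>l\<^sup>2 * b i (l ^ 3 *\<^sub>R x)\<bar> ^ 3) \<le> err \<epsilon>" if "0 < \<epsilon>" for \<epsilon>
    using that
  proof -
    obtain L where L: "\<And>l. L \<le> l \<Longrightarrow> 1 \<le> l"
      "\<And>l i. L \<le> l \<Longrightarrow> II (3/2) (\<lambda>x. \<bar>l\<^sup>2 * u i (l ^ 3 *\<^sub>R x)\<bar> ^ 3) \<le> err \<epsilon>"
      "\<And>l i. L \<le> l \<Longrightarrow> II (3/2) (\<lambda>x. \<bar>l\<^sup>2 * b i (l ^ 3 *\<^sub>R x)\<bar> ^ 3) \<le> err \<epsilon>"
      by (rule decay[OF \<open>0 < \<epsilon>\<close>]) blast
    show "\<exists>l\<ge>1. II (3/2) (\<lambda>x. \<bar>l\<^sup>2 * u i (l ^ 3 *\<^sub>R x)\<bar> ^ 3) \<le> err \<epsilon>"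
      "\<exists>l\<ge>1. II (3/2) (\<lambda>x. \<bar>l\<^sup>2 * b i (l ^ 3 *\<^sub>R x)\<bar> ^ 3) \<le> err \<epsilon>"
      using L[OF order_refl] by blast+
  qed
  then show "u i x = 0" "b i x = 0" using const[OF C1_v p0(1)] const[OF C1_b p0(2)] by blast+
qed

end

text \<open>The radius \<open>3 * l ^ 3\<close> exceeds 1, and its ball strictly contains that of
  radius \<open>2 * l ^ 3\<close>. The volume gives \<open>l ^ 9\<close> and the oscillation
  \<open>l powr (s - 3)\<close>; 36 is 4/3 times 27.\<close>

lemma oscillation_scaled:
  fixes \<Phi> :: "real^3 \<Rightarrow> real^3^3"
  assumes c: "continuous_on UNIV \<Phi>" and s: "3 < s" and C: "0 < C" and l: "1 \<le> l"
    and osc: "\<And>r. 1 < r \<Longrightarrow> osc_avg s r \<Phi> \<le> C * r powr (1/3 - 1 / s)"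
  shows "\<exists>M. II (2 * l ^ 3) (\<lambda>x. \<bar>\<Phi> x $ i $ j - M\<bar> powr s) \<le> 36 * pi * C powr s * 3 powr (s / 3 - 1) * l powr (s + 6)"
proof -
  define r where "r = 3 * l ^ 3"
  have l3: "1 \<le> l ^ 3" using l by (rule one_le_power)
  then have r: "1 < r" "0 < r" "2 * l ^ 3 < r" unfolding r_def by linarith+
  have "II (2 * l ^ 3) (\<lambda>x. \<bar>\<Phi> x $ i $ j - mean_val (ball 0 r) \<Phi> $ i $ j\<bar> powr s) \<le> 4/3 * pi * r ^ 3 * (C * r powr (1/3 - 1 / s)) powr s"
    using s by (intro oscillation_le[OF c _ r(2,3) osc[OF r(1)]]) simp
  also have "(C * r powr (1/3 - 1 / s)) powr s = C powr s * r powr (s / 3 - 1)"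
  proof -
    have "(1/3 - 1 / s) * s = s / 3 - 1" using s by (simp add: field_simps)
    then show ?thesis by (simp add: powr_mult powr_powr)
  qed
  also have "r powr (s / 3 - 1) = 3 powr (s / 3 - 1) * l powr (s - 3)"
  proof -
    have "l ^ 3 = l powr 3" using l by simp
    then have "(l ^ 3) powr (s / 3 - 1) = l powr (3 * (s / 3 - 1))" by (simp only: powr_powr)
    also have "3 * (s / 3 - 1) = s - 3" by simp
    finally show ?thesis by (simp add: r_def powr_mult)
  qed
  also have "4/3 * pi * r ^ 3 * (C powr s * (3 powr (s / 3 - 1) * l powr (s - 3))) = 36 * pi * C powr s * 3 powr (s / 3 - 1) * (l powr (s - 3) * l ^ 9)"
    by (simp add: r_def power_mult_distrib flip: power_mult)
  also have "l powr (s - 3) * l ^ 9 = l powr (s + 6)"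
  proof -
    have "l ^ 9 = l powr 9" using l by simp
    then show ?thesis by (simp only: powr_add[symmetric]) (simp add: add.commute)
  qed
  finally show ?thesis by blast
qed

theorem theorem1p1:
  fixes u B :: "real^3 \<Rightarrow> real^3" and P :: "real^3 \<Rightarrow> real"
    and \<Phi> \<Psi> :: "real^3 \<Rightarrow> real^3^3" and s C :: real
  assumes "smooth u" and "smooth B" and "smooth P"
    and "\<And>x. - laplacian u x + advect u u x = - grad P x + advect B B x"
    and "\<And>x. - laplacian B x + advect u B x = advect B u x"
    and "\<And>x. div_vec u x = 0" and "\<And>x. div_vec B x = 0"
    and "smooth \<Phi>" and "smooth \<Psi>"
    and "\<And>x. div_mat \<Phi> x = u x" and "\<And>x. div_mat \<Psi> x = B x"
    and "3 < s" and "s \<le> 6" and "C > 0"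
    and "\<And>r. r > 1 \<Longrightarrow> osc_avg s r \<Phi> + osc_avg s r \<Psi> \<le> C * r powr (1/3 - 1/s)"
  shows "(\<forall>x. u x = 0) \<and> (\<forall>x. B x = 0)"
proof -
  have bl: "bounded_linear (\<lambda>v::real^3. v $ i)" for i by (rule bounded_linear_vec_nth)
  have bl2: "bounded_linear (\<lambda>M::real^3^3. M $ i $ j)" for i j
    using bounded_linear_compose[OF bounded_linear_vec_nth bounded_linear_vec_nth] .
  have comp: "C1 (\<lambda>x. w x $ i)" "partial j (\<lambda>x. w x $ i) = (\<lambda>x. partial j w x $ i)"
    "C1 (\<lambda>x. partial j w x $ i)" "partial k (\<lambda>x. partial j w x $ i) = (\<lambda>x. partial k (partial j w) x $ i)"
    if "smooth w" for w :: "real^3 \<Rightarrow> real^3" and i j k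
    using smooth_linear_image[OF that bl[of i], where js = "[]"] smooth_linear_image[OF that bl[of i], where js = "[j]"] by auto
  have matrix: "C1 (\<lambda>x. W x $ i $ j)" "continuous_on UNIV W" if "smooth W" for W :: "real^3 \<Rightarrow> real^3^3" and i j
  proof -
    show "C1 (\<lambda>x. W x $ i $ j)" using smooth_linear_image(1)[OF that bl2[of i j], where js = "[]"] by simp
    have "W differentiable (at x)" for x using that[unfolded smooth_def, rule_format, of "[]"] by simp
    then show "continuous_on UNIV W" by (simp add: differentiable_imp_continuous_on differentiable_on_def)
  qed
  have osc_nonneg: "0 \<le> osc_avg s r W" for r and W :: "real^3 \<Rightarrow> real^3^3" by (simp add: osc_avg_def)
  have osc: "osc_avg s r \<Phi> \<le> C * r powr (1/3 - 1/s)" "osc_avg s r \<Psi> \<le> C * r powr (1/3 - 1/s)" if "1 < r" for r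
    using assms(15)[OF that] osc_nonneg[of r \<Phi>] osc_nonneg[of r \<Psi>] by linarith+
  \<comment> \<open>The system is read component by component with viscosity 1; the constant is the
    one delivered by \<open>oscillation_scaled\<close>.\<close>
  interpret mhd_global "\<lambda>i x. u x $ i" "\<lambda>i x. B x $ i" P "\<lambda>i j x. \<Phi> x $ i $ j" "\<lambda>i j x. \<Psi> x $ i $ j" s
    "36 * pi * C powr s * 3 powr (s / 3 - 1)"
  proof unfold_locales
    fix i j :: 3 and x
    show "C1 (\<lambda>x. u x $ i)" "C1 (\<lambda>x. B x $ i)" "C1 (partial j (\<lambda>x. u x $ i))" "C1 (partial j (\<lambda>x. B x $ i))"
      using comp[OF assms(1)] comp[OF assms(2)] by auto
    show "C1 P" using smooth_linear_image(1)[OF assms(3) bounded_linear_ident, where js = "[]"] by simp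
    show "(\<Sum>i\<in>UNIV. partial i (\<lambda>x. u x $ i) x) = 0" "(\<Sum>i\<in>UNIV. partial i (\<lambda>x. B x $ i) x) = 0"
      using assms(6)[of x] assms(7)[of x] by (simp_all add: div_vec_def)
    show "1 * (\<Sum>j\<in>UNIV. partial j (partial j (\<lambda>x. u x $ i)) x) =
      (\<Sum>j\<in>UNIV. u x $ j * partial j (\<lambda>x. u x $ i) x) + partial i P x - (\<Sum>j\<in>UNIV. B x $ j * partial j (\<lambda>x. B x $ i) x)"
      using arg_cong[OF assms(4)[of x], of "\<lambda>v. v $ i"]
      by (simp add: comp[OF assms(1)] comp[OF assms(2)] laplacian_def advect_def grad_def algebra_simps)
    show "1 * (\<Sum>j\<in>UNIV. partial j (partial j (\<lambda>x. B x $ i)) x) =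
      (\<Sum>j\<in>UNIV. u x $ j * partial j (\<lambda>x. B x $ i) x) - (\<Sum>j\<in>UNIV. B x $ j * partial j (\<lambda>x. u x $ i) x)"
      using arg_cong[OF assms(5)[of x], of "\<lambda>v. v $ i"]
      by (simp add: comp[OF assms(1)] comp[OF assms(2)] laplacian_def advect_def algebra_simps)
    show "C1 (\<lambda>x. \<Phi> x $ i $ j)" "C1 (\<lambda>x. \<Psi> x $ i $ j)" by (intro matrix assms)+
    show "(\<Sum>j\<in>UNIV. partial j (\<lambda>x. \<Phi> x $ i $ j) x) = u x $ i" "(\<Sum>j\<in>UNIV. partial j (\<lambda>x. \<Psi> x $ i $ j) x) = B x $ i"
      using assms(10,11)[of x, symmetric] by (simp_all add: div_mat_def)
    fix l :: real assume "1 \<le> l"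
    then show "\<exists>M. II (2 * l ^ 3) (\<lambda>x. \<bar>\<Phi> x $ i $ j - M\<bar> powr s) \<le> 36 * pi * C powr s * 3 powr (s / 3 - 1) * l powr (s + 6)"
      "\<exists>M. II (2 * l ^ 3) (\<lambda>x. \<bar>\<Psi> x $ i $ j - M\<bar> powr s) \<le> 36 * pi * C powr s * 3 powr (s / 3 - 1) * l powr (s + 6)"
      using assms(12,14) osc by (intro oscillation_scaled matrix assms; simp)+
  qed (use assms(12,13,14) in auto)
  show ?thesis using vanishing by (simp add: vec_eq_iff)
qed

end
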